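(* Let $Z=(Z^+,Z^-)$ be a planar piecewise vector field with switching set $\Sigma=\{y=0\}$, with $Z^\pm$ analytic, satisfying hypothesis (H1) stated in the context, and such that the origin is an invisible fold-fold singularity of order $(2k^+,2k^-)$. Let $Z_b(x,y)=Z^+(x-b,y)$ for $y>0$ and $Z_b(x,y)=Z^-(x,y)$ for $y<0$, $b\in\mathbb{R}$, and let $\mu\in\{-1,1\}$ be the sign associated with $Z$. Then the position $x(b)$ and the period $\mathcal{T}(b)$ of the crossing limit cycle of $Z_b$ that unfolds from the pseudo-Hopf bifurcation (i.e. the crossing limit cycle bifurcating from the origin, which exists for $\mu b>0$ small) satisfy $$x(b)\sim \xi_0|b|^{\frac{1}{2n}},\qquad \mathcal{T}(b)\sim T_0|b|^{\frac{1}{2n}}$$ as $b\to0$ with $\mu b>0$, for some $\xi_0>0$, $T_0>0$ and $n\in\mathbb{N}$ (positive integer).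
   Context: Setting. Let $\Sigma=\{(x,y)\in\mathbb{R}^2: y=0\}$ and $\Sigma^\pm=\{(x,y)\in\mathbb{R}^2:\pm y\geqslant 0\}$. Consider $Z(x,y)=Z^+(x,y)$ if $y>0$ and $Z(x,y)=Z^-(x,y)$ if $y<0$, where $Z^\pm=(P^\pm,Q^\pm)$. Let $\psi^\pm(t;x,y)$ be the solution of $Z^\pm$ with $\psi^\pm(0;x,y)=(x,y)$. Hypothesis (H1): there are $x_0>0$ and continuous functions $\tau^\pm:(0,x_0)\to\mathbb{R}$ such that for every $x\in(0,x_0)$: (i) $\psi^\pm(\tau^\pm(x);x,0)\in\Sigma$; (ii) $\tau^+(x)\tau^-(x)<0$; (iii) $\psi^\pm(t;x,0)\in\Sigma^\pm\setminus\Sigma$ for every $t$ in the open interval bounded by $0$ and $\tau^\pm(x)$; (iv) $\varphi^\pm(x)<0$, where $(\varphi^\pm(x),0):=\psi^\pm(\tau^\pm(x);x,0)$; (v) $\varphi^+(x)\neq\varphi^-(x)$; (vi) $\varphi^\pm$ extend continuously to $x=0$ with $\varphi^\pm(0)=0$. Signs: $\delta=1$ if $\tau^+(x)<0<\tau^-(x)$ and $\delta=-1$ if $\tau^-(x)<0<\tau^+(x)$ (independent of $x\in(0,x_0)$). Let $\sigma=\operatorname{sign}\bigl(\delta(\varphi^+(x)-\varphi^-(x))\bigr)\in\{-1,1\}$ (independent of $x\in(0,x_0)$) and $\mu=-\sigma\delta$. Invisible fold-fold singularity of order $(2k^+,2k^-)$, $k^\pm\geqslant1$: the origin is an invisible contact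 of multiplicity $2k^\pm$ between $Z^\pm$ and $\Sigma$, i.e. $P^\pm(0,0)\neq0$ and $Q^\pm(x,0)=c^\pm x^{2k^\pm-1}+O(x^{2k^\pm})$ with $P^+(0,0)c^+<0$ and $P^-(0,0)c^->0$. Terminology: a crossing limit cycle of $Z_b$ is an isolated periodic orbit obtained by concatenating an orbit arc of $Z^+(x-b,y)$ in $\Sigma^+$ and an orbit arc of $Z^-$ in $\Sigma^-$, crossing $\Sigma$ without sliding. Its position is the number $x(b)>0$ such that it passes through $(x(b),0)$. The notation $f(b)\sim g(b)$ means $f(b)/g(b)\to1$. *)

theory Defs
  imports "HOL-Analysis.Analysis" "HOL-Library.Landau_Symbols"
begin

unbundle asymp_equiv_syntax

type_synonym vfield = "real \<times> real \<Rightarrow> real \<times> real"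

definition real_analytic2 :: "(real \<times> real \<Rightarrow> real) \<Rightarrow> bool" where
  "real_analytic2 f \<longleftrightarrow> (\<forall>x\<^sub>0 y\<^sub>0. \<exists>c :: nat \<times> nat \<Rightarrow> real. \<exists>r>0. \<forall>x y.
     \<bar>x - x\<^sub>0\<bar> < r \<and> \<bar>y - y\<^sub>0\<bar> < r \<longrightarrow>
     ((\<lambda>(i, j). c (i, j) * (x - x\<^sub>0) ^ i * (y - y\<^sub>0) ^ j) has_sum f (x, y)) UNIV)"

definition analytic_vfield :: "vfield \<Rightarrow> bool" where
  "analytic_vfield F \<longleftrightarrow> real_analytic2 (\<lambda>p. fst (F p)) \<and> real_analytic2 (\<lambda>p. snd (F p))"

definition solution_on :: "vfield \<Rightarrow> (real \<Rightarrow> real \<times> real) \<Rightarrow> real set \<Rightarrow> bool" where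
  "solution_on F \<gamma> I \<longleftrightarrow> (\<forall>t\<in>I. (\<gamma> has_vector_derivative F (\<gamma> t)) (at t within I))"

text \<open>Solutions need not be complete: \<open>flow F t p\<close> is meaningful only for
  \<open>t \<in> flow_dom F p\<close>, an interval containing 0. For locally Lipschitz \<open>F\<close>
  the value does not depend on the choice of \<open>\<gamma>\<close>.\<close>

definition flow_dom :: "vfield \<Rightarrow> real \<times> real \<Rightarrow> real set" where
  "flow_dom F p = {t. \<exists>\<gamma>. \<gamma> 0 = p \<and> solution_on F \<gamma> (closed_segment 0 t)}"

definition flow :: "vfield \<Rightarrow> real \<Rightarrow> real \<times> real \<Rightarrow> real \<times> real" where
  "flow F t p = (THE q. \<exists>\<gamma>. \<gamma> 0 = p \<and> solution_on F \<gamma> (closed_segment 0 t) \<and> \<gamma> t = q)"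

text \<open>The sign \<open>s\<close> is \<open>1\<close> for the upper half plane and \<open>-1\<close> for the lower one; the
  return time \<open>t\<close> may be negative.\<close>

definition half_return_time :: "real \<Rightarrow> vfield \<Rightarrow> real \<Rightarrow> real \<Rightarrow> bool" where
  "half_return_time s F x t \<longleftrightarrow>
     t \<in> flow_dom F (x, 0) \<and> snd (flow F t (x, 0)) = 0 \<and>
     (\<forall>u\<in>open_segment 0 t. s * snd (flow F u (x, 0)) > 0)"

definition half_return_map :: "vfield \<Rightarrow> (real \<Rightarrow> real) \<Rightarrow> real \<Rightarrow> real" where
  "half_return_map F \<tau> x = fst (flow F (\<tau> x) (x, 0))"

definition hypothesis_H1 ::
  "vfield \<Rightarrow> vfield \<Rightarrow> real \<Rightarrow> (real \<Rightarrow> real) \<Rightarrow> (real \<Rightarrow> real) \<Rightarrow> bool" where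
  "hypothesis_H1 Zp Zm x\<^sub>0 \<tau>p \<tau>m \<longleftrightarrow>
     x\<^sub>0 > 0 \<and> continuous_on {0<..<x\<^sub>0} \<tau>p \<and> continuous_on {0<..<x\<^sub>0} \<tau>m \<and>
     (\<forall>x\<in>{0<..<x\<^sub>0}.
        half_return_time 1 Zp x (\<tau>p x) \<and> half_return_time (-1) Zm x (\<tau>m x) \<and>
        \<tau>p x * \<tau>m x < 0 \<and>
        half_return_map Zp \<tau>p x < 0 \<and> half_return_map Zm \<tau>m x < 0 \<and>
        half_return_map Zp \<tau>p x \<noteq> half_return_map Zm \<tau>m x) \<and>
     (half_return_map Zp \<tau>p \<longlongrightarrow> 0) (at_right 0) \<and>
     (half_return_map Zm \<tau>m \<longlongrightarrow> 0) (at_right 0)"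

text \<open>Under \<open>hypothesis_H1\<close> the following signs do not depend on the point \<open>x\<close> of
  \<open>{0<..<x\<^sub>0}\<close> at which they are evaluated.\<close>

definition delta_sign :: "(real \<Rightarrow> real) \<Rightarrow> (real \<Rightarrow> real) \<Rightarrow> real \<Rightarrow> real" where
  "delta_sign \<tau>p \<tau>m x = (if \<tau>p x < 0 \<and> 0 < \<tau>m x then 1 else -1)"

definition sigma_sign ::
  "vfield \<Rightarrow> vfield \<Rightarrow> (real \<Rightarrow> real) \<Rightarrow> (real \<Rightarrow> real) \<Rightarrow> real \<Rightarrow> real" where
  "sigma_sign Zp Zm \<tau>p \<tau>m x =
     sgn (delta_sign \<tau>p \<tau>m x * (half_return_map Zp \<tau>p x - half_return_map Zm \<tau>m x))"

definition mu_sign ::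
  "vfield \<Rightarrow> vfield \<Rightarrow> (real \<Rightarrow> real) \<Rightarrow> (real \<Rightarrow> real) \<Rightarrow> real \<Rightarrow> real" where
  "mu_sign Zp Zm \<tau>p \<tau>m x = - sigma_sign Zp Zm \<tau>p \<tau>m x * delta_sign \<tau>p \<tau>m x"

text \<open>Contact of multiplicity \<open>2 k\<close> with the line \<open>y = 0\<close> at the origin, invisible for a
  field living on the half plane \<open>s * y \<ge> 0\<close>.\<close>

definition invisible_contact :: "real \<Rightarrow> nat \<Rightarrow> vfield \<Rightarrow> bool" where
  "invisible_contact s k F \<longleftrightarrow> fst (F (0, 0)) \<noteq> 0 \<and>
     (\<exists>c. s * (fst (F (0, 0)) * c) < 0 \<and>
          (\<lambda>x. snd (F (x, 0)) - c * x ^ (2 * k - 1)) \<in> O[at 0](\<lambda>x. x ^ (2 * k)))"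

definition invisible_fold_fold :: "nat \<Rightarrow> nat \<Rightarrow> vfield \<Rightarrow> vfield \<Rightarrow> bool" where
  "invisible_fold_fold kp km Zp Zm \<longleftrightarrow>
     kp \<ge> 1 \<and> km \<ge> 1 \<and> invisible_contact 1 kp Zp \<and> invisible_contact (-1) km Zm"

definition hshift :: "real \<Rightarrow> vfield \<Rightarrow> vfield" where
  "hshift b F = (\<lambda>(x, y). F (x - b, y))"

text \<open>Trajectories of the piecewise field (\<open>Fp\<close> above, \<open>Fm\<close> below \<open>y = 0\<close>) that meet the
  switching line only at crossing points, i.e. where both fields point transversally to the
  same side. At such a point only the one-sided derivatives are prescribed.\<close>

definition crossing_trajectory :: "vfield \<Rightarrow> vfield \<Rightarrow> (real \<Rightarrow> real \<times> real) \<Rightarrow> bool" where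
  "crossing_trajectory Fp Fm \<gamma> \<longleftrightarrow> (\<forall>t.
     (snd (\<gamma> t) > 0 \<longrightarrow> (\<gamma> has_vector_derivative Fp (\<gamma> t)) (at t)) \<and>
     (snd (\<gamma> t) < 0 \<longrightarrow> (\<gamma> has_vector_derivative Fm (\<gamma> t)) (at t)) \<and>
     (snd (\<gamma> t) = 0 \<longrightarrow>
        snd (Fp (\<gamma> t)) > 0 \<and> snd (Fm (\<gamma> t)) > 0 \<and>
          (\<gamma> has_vector_derivative Fm (\<gamma> t)) (at_left t) \<and>
          (\<gamma> has_vector_derivative Fp (\<gamma> t)) (at_right t) \<or>
        snd (Fp (\<gamma> t)) < 0 \<and> snd (Fm (\<gamma> t)) < 0 \<and>
          (\<gamma> has_vector_derivative Fp (\<gamma> t)) (at_left t) \<and>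
          (\<gamma> has_vector_derivative Fm (\<gamma> t)) (at_right t)))"

text \<open>\<open>T\<close> is the minimal period; in particular \<open>\<gamma>\<close> is not constant.\<close>

definition periodic_trajectory ::
  "vfield \<Rightarrow> vfield \<Rightarrow> (real \<Rightarrow> real \<times> real) \<Rightarrow> real \<Rightarrow> bool" where
  "periodic_trajectory Fp Fm \<gamma> T \<longleftrightarrow> crossing_trajectory Fp Fm \<gamma> \<and> T > 0 \<and>
     (\<forall>t. \<gamma> (t + T) = \<gamma> t) \<and> (\<forall>S. 0 < S \<and> S < T \<longrightarrow> (\<exists>t. \<gamma> (t + S) \<noteq> \<gamma> t))"

text \<open>One period consists of a single arc in \<open>y \<ge> 0\<close> over \<open>{a..m}\<close> followed by a single arc
  in \<open>y \<le> 0\<close> over \<open>{m..a + T}\<close>; both endpoints then lie on \<open>y = 0\<close>. Isolation is among all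
  periodic trajectories, whatever their number of arcs.\<close>

definition crossing_limit_cycle ::
  "vfield \<Rightarrow> vfield \<Rightarrow> (real \<times> real) set \<Rightarrow> real \<Rightarrow> bool" where
  "crossing_limit_cycle Fp Fm C T \<longleftrightarrow>
     (\<exists>\<gamma>. periodic_trajectory Fp Fm \<gamma> T \<and> C = range \<gamma> \<and>
        (\<exists>a m. a < m \<and> m < a + T \<and>
           (\<forall>t\<in>{a..m}. snd (\<gamma> t) \<ge> 0) \<and> (\<forall>t\<in>{m..a + T}. snd (\<gamma> t) \<le> 0))) \<and>
     (\<exists>U. open U \<and> C \<subseteq> U \<and>
        (\<forall>\<gamma>' T'. periodic_trajectory Fp Fm \<gamma>' T' \<and> range \<gamma>' \<subseteq> U \<longrightarrow> range \<gamma>' = C))"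

definition cycle_position :: "(real \<times> real) set \<Rightarrow> real \<Rightarrow> bool" where
  "cycle_position C x \<longleftrightarrow> {u. 0 < u \<and> (u, 0) \<in> C} = {x}"

abbreviation unfolding_filter :: "real \<Rightarrow> real filter" where
  "unfolding_filter \<mu> \<equiv> at 0 within {b. \<mu> * b > 0}"

text \<open>\<open>C b\<close>, of period \<open>T b\<close>, is the crossing limit cycle bifurcating from the origin: the
  only crossing limit cycle of the perturbed field inside a fixed neighbourhood \<open>V\<close> of the
  origin, shrinking to the origin as \<open>b\<close> tends to 0.\<close>

definition unfolding_cycle ::
  "vfield \<Rightarrow> vfield \<Rightarrow> real \<Rightarrow> (real \<Rightarrow> (real \<times> real) set) \<Rightarrow> (real \<Rightarrow> real) \<Rightarrow> bool" where
  "unfolding_cycle Zp Zm \<mu> C T \<longleftrightarrow>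
     (\<exists>V. open V \<and> (0, 0) \<in> V \<and>
        (\<forall>\<^sub>F b in unfolding_filter \<mu>.
           crossing_limit_cycle (hshift b Zp) Zm (C b) (T b) \<and> C b \<subseteq> V \<and>
           (\<forall>C' T'. crossing_limit_cycle (hshift b Zp) Zm C' T' \<and> C' \<subseteq> V \<longrightarrow> C' = C b))) \<and>
     (\<forall>W. open W \<and> (0, 0) \<in> W \<longrightarrow> (\<forall>\<^sub>F b in unfolding_filter \<mu>. C b \<subseteq> W))"

end

(* In a neighbourhood of the origin the orbits of each field are graphs of solutions of
   dy/dx = Q/P. The height over x = 0 of the graph through (x, 0) is an analytic function of x
   (Picard iteration in the complex domain), of the form kappa * sigma(x)^(2 k) with
   sigma'(0) = 1; hence the half-return map phi satisfies sigma(phi x) = - sigma(x), and the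
   half-return time is asymptotic to 2 x / |P(0)|.

   A cycle of Z_b through (v, 0) and (u, 0), u < 0 < v, is a solution of
   sigma_m(u) = - sigma_m(v), sigma_p(v - b) + sigma_p(u - b) = 0. With p = sigma_m(v) the second
   equation at b = 0 becomes an even analytic function of p, equivalent to a * p^(2 n), and the
   perturbation adds - 2 b + o(b); so for mu b > 0 there is exactly one small solution, and
   v^(2 n) is asymptotic to 2 |b| / |a|. Uniqueness among all periodic trajectories follows since
   the largest point v > 0 of such a trajectory on y = 0 is a fixed point of the return map. *)

theory Submission
  imports Defs "HOL-Complex_Analysis.Complex_Analysis"
begin

section \<open>Dependence of solutions on data\<close>

text \<open>Two orbits that meet the line near the contact are the same graph exactly when they have
  the same height over 0. This replaces the time-parametrised flow by a scalar equation whose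
  dependence on the initial abscissa is holomorphic, and it turns each half-return map into a
  reflection in a suitable coordinate.

  Analyticity is what makes the exponent exist: the unperturbed displacement does not vanish for
  \<open>p > 0\<close>, so as an analytic germ it has finite order, and exchanging the two crossing
  points makes that order even. The perturbed equation cannot be solved for \<open>p\<close> by an
  implicit function theorem at \<open>p = 0\<close>, where the derivative in \<open>p\<close>
  vanishes to order \<open>2 * n - 1\<close>. Existence therefore comes from a sign change, and
  uniqueness from playing the growth of the unperturbed part against a Lipschitz bound, proportional
  to \<open>\<bar>b\<bar>\<close>, for the perturbation.\<close>

lemma gronwall:
  fixes e e' :: "real \<Rightarrow> real"
  assumes e: "\<And>t. t \<in> {0..c} \<Longrightarrow> (e has_real_derivative e' t) (at t within {0..c})"
    and le: "\<And>t. t \<in> {0..c} \<Longrightarrow> e' t \<le> B * e t + K"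
    and K: "K \<ge> 0" and B: "B \<ge> 0" and u: "u \<in> {0..c}"
  shows "e u \<le> (e 0 + K * u) * exp (B * u)"
proof (cases "u = 0")
  case False
  then have u0: "0 < u" using u by auto
  \<comment> \<open>The factor \<open>exp (- B * t) \<le> 1\<close> for \<open>t \<ge> 0\<close>
    leaves only the drift \<open>K\<close>, so \<open>f\<close> does not increase. The resulting
    constant is not sharp, but it needs no division by \<open>B\<close>, which may be 0.\<close>
  define f where "f t = e t * exp (- B * t) - K * t" for t
  have "(f has_derivative (\<lambda>h. (e' x * exp (- B * x) + e x * (- B * exp (- B * x)) - K) * h))
      (at x within {0..u})" if x: "0 \<le> x" "x \<le> u" for x
  proof -
    have "(e has_real_derivative e' x) (at x within {0..u})"
      using DERIV_subset[OF e[of x], of "{0..u}"] x u by auto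
    then have "(f has_real_derivative (e' x * exp (- B * x) + e x * (- B * exp (- B * x)) - K))
        (at x within {0..u})"
      unfolding f_def by (auto intro!: derivative_eq_intros)
    then show ?thesis by (simp add: has_field_derivative_def)
  qed
  from mvt_simple[OF u0 this] obtain x where x: "x \<in> {0<..<u}" and
    eq: "f u - f 0 = (e' x * exp (- B * x) + e x * (- B * exp (- B * x)) - K) * (u - 0)" by auto
  have xc: "x \<in> {0..c}" using x u by auto
  have "(e' x - B * e x) * exp (- B * x) \<le> K * exp (- B * x)"
    using le[OF xc] by (intro mult_right_mono) auto
  also have "\<dots> \<le> K * 1" using K B x by (intro mult_left_mono) auto
  finally have "e' x * exp (- B * x) + e x * (- B * exp (- B * x)) - K \<le> 0"
    by (simp add: algebra_simps)
  then have "f u \<le> f 0" using eq u0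
    by (metis diff_0_right diff_le_0_iff_le less_imp_le mult_nonpos_nonneg)
  then have "e u * exp (- B * u) \<le> e 0 + K * u" by (simp add: f_def)
  then have "e u * exp (- B * u) * exp (B * u) \<le> (e 0 + K * u) * exp (B * u)"
    by (intro mult_right_mono) auto
  then show ?thesis by (simp add: mult.assoc flip: exp_add)
qed auto

text \<open>The constant \<open>L\<close> may have any sign here; this is why absolute values appear
  when it is passed to the library notion \<open>lipschitz_on\<close>.\<close>

definition locally_lipschitz :: "('a::metric_space \<Rightarrow> 'b::metric_space) \<Rightarrow> bool" where
  "locally_lipschitz F \<longleftrightarrow>
     (\<forall>p. \<exists>r>0. \<exists>L. \<forall>q\<in>ball p r. \<forall>q'\<in>ball p r. dist (F q) (F q') \<le> L * dist q q')"

lemma locally_lipschitz_continuous: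
  assumes "locally_lipschitz F"
  shows "continuous_on S F"
proof -
  have "isCont F p" for p
  proof -
    obtain r L where r: "r > 0" and L: "\<And>q q'. q \<in> ball p r \<Longrightarrow> q' \<in> ball p r \<Longrightarrow> dist (F q) (F q') \<le> L * dist q q'"
      using assms unfolding locally_lipschitz_def by metis
    have "\<bar>L\<bar>-lipschitz_on (ball p r) F"
    proof (rule lipschitz_onI)
      fix q q' assume "q \<in> ball p r" "q' \<in> ball p r"
      then show "dist (F q) (F q') \<le> \<bar>L\<bar> * dist q q'"
        using L[of q q'] by (meson abs_ge_self mult_right_mono order_trans zero_le_dist)
    qed auto
    then have "continuous_on (ball p r) F" by (rule lipschitz_on_continuous_on)
    then show ?thesis using r by (auto simp: continuous_on_eq_continuous_at)
  qed
  then show ?thesis by (simp add: continuous_at_imp_continuous_on)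
qed

lemma locally_lipschitz_compact:
  fixes F :: "'a::metric_space \<Rightarrow> 'b::metric_space"
  assumes F: "locally_lipschitz F" and X: "compact X"
  obtains L where "L \<ge> 0" "\<And>p q. p \<in> X \<Longrightarrow> q \<in> X \<Longrightarrow> dist (F p) (F q) \<le> L * dist p q"
proof -
  \<comment> \<open>The one-point time set turns the autonomous field into an instance of the
    time-dependent notion, for which a constant on a whole compact set is known; pairs that are far
    apart are covered too.\<close>
  have "local_lipschitz {0::real} X (\<lambda>_. F)"
  proof (rule local_lipschitzI)
    fix t :: real and p assume "t \<in> {0}" "p \<in> X"
    obtain r L where r: "r > 0" and L: "\<And>q q'. q \<in> ball p r \<Longrightarrow> q' \<in> ball p r \<Longrightarrow> dist (F q) (F q') \<le> L * dist q q'"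
      using F unfolding locally_lipschitz_def by metis
    have "\<bar>L\<bar>-lipschitz_on (cball p (r/2) \<inter> X) F"
    proof (rule lipschitz_onI)
      fix q q' assume "q \<in> cball p (r/2) \<inter> X" "q' \<in> cball p (r/2) \<inter> X"
      then show "dist (F q) (F q') \<le> \<bar>L\<bar> * dist q q'"
        using L[of q q'] r mult_right_mono[OF abs_ge_self[of L], of "dist q q'"] by auto
    qed auto
    then show "\<exists>u>0. \<exists>L. \<forall>t\<in>cball t u \<inter> {0}. L-lipschitz_on (cball p u \<inter> X) F"
      using r by (intro exI[of _ "r/2"]) auto
  qed
  then obtain L where L: "L-lipschitz_on X F"
    by (rule local_lipschitz_compact_implies_lipschitz[OF _ X compact_sing[of 0]]) auto
  show ?thesis using that[of L] lipschitz_onD[OF L] lipschitz_on_nonneg[OF L] by auto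
qed

text \<open>The field is Lipschitz only on compact sets, so the Gronwall estimate is available only
  while \<open>\<beta>\<close> stays in a tube around \<open>\<alpha>\<close>; a first exit time
  from the tube removes the circularity. The speed factors \<open>a\<close> and \<open>b\<close> let
  solutions of different durations be compared on the common interval \<open>{0..1}\<close>, which
  is needed because return times vary with the initial point.\<close>

lemma solution_dependence:
  fixes F :: "'a::euclidean_space \<Rightarrow> 'a" and \<alpha> :: "real \<Rightarrow> 'a"
  assumes F: "locally_lipschitz F"
    and \<alpha>: "\<And>t. t \<in> {0..1} \<Longrightarrow> (\<alpha> has_vector_derivative a *\<^sub>R F (\<alpha> t)) (at t within {0..1})"
    and \<epsilon>: "\<epsilon> > 0"
  obtains \<eta> where "\<eta> > 0"
    "\<And>\<beta> b t. (\<And>t. t \<in> {0..1} \<Longrightarrow> (\<beta> has_vector_derivative b *\<^sub>R F (\<beta> t)) (at t within {0..1})) \<Longrightarrow>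
       \<bar>b - a\<bar> < \<eta> \<Longrightarrow> dist (\<beta> 0) (\<alpha> 0) < \<eta> \<Longrightarrow> t \<in> {0..1} \<Longrightarrow> dist (\<beta> t) (\<alpha> t) < \<epsilon>"
proof -
  have conta: "continuous_on {0..1} \<alpha>"
    using \<alpha> by (meson continuous_on_eq_continuous_within has_vector_derivative_continuous)
  define N where "N = (\<lambda>(t, v). \<alpha> t + v) ` ({0..1} \<times> cball 0 \<epsilon>)"
  have N: "compact N" unfolding N_def
    by (intro compact_continuous_image compact_Times)
       (auto intro!: continuous_intros continuous_on_compose2[OF conta] simp: case_prod_beta)
  obtain L where L0: "L \<ge> 0" and L: "\<And>p q. p \<in> N \<Longrightarrow> q \<in> N \<Longrightarrow> dist (F p) (F q) \<le> L * dist p q"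
    using locally_lipschitz_compact[OF F N] by blast
  have inN: "q \<in> N" if "t \<in> {0..1}" "dist q (\<alpha> t) \<le> \<epsilon>" for t q
    unfolding N_def using that
    by (intro image_eqI[of _ _ "(t, q - \<alpha> t)"]) (auto simp: dist_norm norm_minus_commute)
  have "compact (F ` N)" using N locally_lipschitz_continuous[OF F] compact_continuous_image by blast
  then obtain M where M: "\<And>p. p \<in> N \<Longrightarrow> norm (F p) \<le> M"
    by (meson bounded_iff compact_imp_bounded imageI)
  have "\<alpha> 0 \<in> N" using inN[of 0 "\<alpha> 0"] \<epsilon> by simp
  then have M0: "M \<ge> 0" using M[of "\<alpha> 0"] norm_ge_zero[of "F (\<alpha> 0)"] by linarith
  \<comment> \<open>\<open>\<bar>b\<bar> \<le> \<bar>a\<bar> + 1\<close> because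
    \<open>\<eta> \<le> 1\<close>; the final \<open>+ 1\<close> absorbs the square of the distance
    produced by splitting the mixed term, \<open>2 * x * y \<le> x^2 + y^2\<close>.\<close>
  define B where "B = 2 * (\<bar>a\<bar> + 1) * L + 1"
  have B: "B \<ge> 0" using L0 by (auto simp: B_def)
  define C where "C = (1 + M\<^sup>2) * exp B"
  have C: "C > 0" by (auto simp: C_def intro!: mult_pos_pos add_pos_nonneg)
  \<comment> \<open>Over a unit of time the squared distance grows to at most
    \<open>\<eta>^2 * C\<close>; the \<open>+ 1\<close> under the root makes this strictly less than
    \<open>\<epsilon>^2\<close>.\<close>
  define \<eta> where "\<eta> = min 1 (\<epsilon> / sqrt (C + 1))"
  have \<eta>: "\<eta> > 0" using \<epsilon> C by (auto simp: \<eta>_def)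
  have \<eta>1: "\<eta> \<le> 1" by (auto simp: \<eta>_def)
  have "\<eta>\<^sup>2 \<le> (\<epsilon> / sqrt (C + 1))\<^sup>2" using \<eta> by (intro power_mono) (auto simp: \<eta>_def)
  also have "\<dots> = \<epsilon>\<^sup>2 / (C + 1)" using C by (simp add: power_divide)
  finally have "\<eta>\<^sup>2 * (C + 1) \<le> \<epsilon>\<^sup>2" using C by (simp add: field_simps)
  moreover have "\<eta>\<^sup>2 > 0" using \<eta> by simp
  ultimately have \<eta>C: "\<eta>\<^sup>2 * C < \<epsilon>\<^sup>2" unfolding distrib_left mult_1_right by linarith
  show ?thesis
  proof (rule that[OF \<eta>])
    fix \<beta> b t
    assume \<beta>: "\<And>t. t \<in> {0..1} \<Longrightarrow> (\<beta> has_vector_derivative b *\<^sub>R F (\<beta> t)) (at t within {0..1})"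
      and ba: "\<bar>b - a\<bar> < \<eta>" and d0: "dist (\<beta> 0) (\<alpha> 0) < \<eta>" and t: "t \<in> {0..1::real}"
    have contb: "continuous_on {0..1} \<beta>"
      using \<beta> by (meson continuous_on_eq_continuous_within has_vector_derivative_continuous)
    define e where "e t = (\<beta> t - \<alpha> t) \<bullet> (\<beta> t - \<alpha> t)" for t
    define e' where "e' t = 2 * ((\<beta> t - \<alpha> t) \<bullet> (b *\<^sub>R F (\<beta> t) - a *\<^sub>R F (\<alpha> t)))" for t
    have e: "(e has_real_derivative e' t) (at t within {0..1})" if t: "t \<in> {0..1}" for t
    proof -
      have "((\<lambda>t. \<beta> t - \<alpha> t) has_derivative (\<lambda>h. h *\<^sub>R (b *\<^sub>R F (\<beta> t) - a *\<^sub>R F (\<alpha> t)))) (at t within {0..1})"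
        using has_vector_derivative_diff[OF \<beta>[OF t] \<alpha>[OF t]] by (simp add: has_vector_derivative_def)
      from has_derivative_inner[OF this this]
      show ?thesis unfolding e_def e'_def has_field_derivative_def
        by (rule has_derivative_eq_rhs) (auto simp: fun_eq_iff inner_commute algebra_simps)
    qed
    have conte: "continuous_on {0..1} e"
      using e by (meson continuous_on_eq_continuous_within DERIV_continuous)
    have bd: "e u < \<epsilon>\<^sup>2" if u: "u \<in> {0..1}" and near: "\<And>v. v \<in> {0..u} \<Longrightarrow> dist (\<beta> v) (\<alpha> v) \<le> \<epsilon>" for u
    proof -
      have "e u \<le> (e 0 + (\<eta> * M)\<^sup>2 * u) * exp (B * u)"
      proof (rule gronwall[of u e e'])
        fix v assume v: "v \<in> {0..u}"
        then have v1: "v \<in> {0..1}" using u by auto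
        show "(e has_real_derivative e' v) (at v within {0..u})"
          by (rule DERIV_subset[OF e[OF v1]]) (use u in auto)
        have Nb: "\<beta> v \<in> N" "\<alpha> v \<in> N" using inN[OF v1] near[OF v] \<epsilon> by auto
        let ?n = "norm (\<beta> v - \<alpha> v)"
        have "b *\<^sub>R F (\<beta> v) - a *\<^sub>R F (\<alpha> v) = b *\<^sub>R (F (\<beta> v) - F (\<alpha> v)) + (b - a) *\<^sub>R F (\<alpha> v)"
          by (simp add: algebra_simps)
        then have "norm (b *\<^sub>R F (\<beta> v) - a *\<^sub>R F (\<alpha> v)) \<le> norm (b *\<^sub>R (F (\<beta> v) - F (\<alpha> v))) + norm ((b - a) *\<^sub>R F (\<alpha> v))"
          by (metis norm_triangle_ineq)
        also have "\<dots> \<le> (\<bar>a\<bar> + 1) * (L * ?n) + \<eta> * M"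
          using L[OF Nb] ba \<eta>1 M[OF Nb(2)] M0 L0
          by (auto intro!: add_mono mult_mono simp: dist_norm)
        finally have n: "norm (b *\<^sub>R F (\<beta> v) - a *\<^sub>R F (\<alpha> v)) \<le> (\<bar>a\<bar> + 1) * (L * ?n) + \<eta> * M" .
        have "e' v \<le> 2 * (?n * norm (b *\<^sub>R F (\<beta> v) - a *\<^sub>R F (\<alpha> v)))"
          unfolding e'_def using norm_cauchy_schwarz by auto
        also have "\<dots> \<le> 2 * (?n * ((\<bar>a\<bar> + 1) * (L * ?n) + \<eta> * M))"
          using n by (intro mult_left_mono) auto
        also have "\<dots> = 2 * (\<bar>a\<bar> + 1) * L * ?n\<^sup>2 + 2 * ?n * (\<eta> * M)"
          by (simp add: algebra_simps power2_eq_square)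
        also have "\<dots> \<le> 2 * (\<bar>a\<bar> + 1) * L * ?n\<^sup>2 + (?n\<^sup>2 + (\<eta> * M)\<^sup>2)"
          using sum_squares_bound[of ?n "\<eta> * M"] by simp
        also have "\<dots> = B * e v + (\<eta> * M)\<^sup>2"
          by (simp add: B_def e_def power2_norm_eq_inner algebra_simps)
        finally show "e' v \<le> B * e v + (\<eta> * M)\<^sup>2" .
      qed (use B u in auto)
      also have "\<dots> \<le> (\<eta>\<^sup>2 + (\<eta> * M)\<^sup>2 * 1) * exp (B * 1)"
      proof (intro mult_mono add_mono)
        have "e 0 = (dist (\<beta> 0) (\<alpha> 0))\<^sup>2" by (simp add: e_def dist_norm power2_norm_eq_inner)
        also have "\<dots> \<le> \<eta>\<^sup>2" using d0 by (intro power_mono) auto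
        finally show "e 0 \<le> \<eta>\<^sup>2" .
      qed (use u B in \<open>auto intro!: mult_left_le add_nonneg_nonneg\<close>)
      also have "\<dots> = \<eta>\<^sup>2 * C" by (simp add: C_def algebra_simps power_mult_distrib)
      also note \<eta>C
      finally show ?thesis .
    qed
    have ed: "e v = (dist (\<beta> v) (\<alpha> v))\<^sup>2" for v by (simp add: e_def dist_norm power2_norm_eq_inner)
    show "dist (\<beta> t) (\<alpha> t) < \<epsilon>"
    proof (rule ccontr)
      assume "\<not> dist (\<beta> t) (\<alpha> t) < \<epsilon>"
      \<comment> \<open>The least element is the first time at which the distance reaches
        \<open>\<epsilon>\<close>. Up to it the estimate \<open>bd\<close> applies, and at that time
        it gives a distance strictly less than \<open>\<epsilon>\<close>.\<close>
      define Bd where "Bd = {v \<in> {0..1}. \<epsilon> \<le> dist (\<beta> v) (\<alpha> v)}"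
      have "closed Bd" unfolding Bd_def
        by (intro continuous_on_closed_Collect_le continuous_intros conta contb)
      moreover have "{0..1} \<inter> Bd = Bd" by (auto simp: Bd_def)
      ultimately have cBd: "compact Bd" using compact_Int_closed[OF compact_Icc, of Bd 0 1] by simp
      have "t \<in> Bd" using t \<open>\<not> dist (\<beta> t) (\<alpha> t) < \<epsilon>\<close> by (auto simp: Bd_def)
      then obtain u where u: "u \<in> Bd" and umin: "\<And>v. v \<in> Bd \<Longrightarrow> u \<le> v"
        using compact_attains_inf[OF cBd] by auto
      have lt: "dist (\<beta> v) (\<alpha> v) < \<epsilon>" if "v \<in> {0..<u}" for v
        using umin[of v] that u by (force simp: Bd_def)
      have "u \<noteq> 0" using u d0 ba
      proof -
        have "dist (\<beta> 0) (\<alpha> 0) < \<epsilon>"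
        proof -
          have "\<eta> \<le> \<epsilon>"
          proof -
            have "C \<ge> 0" using C by auto
            then have "1 \<le> sqrt (C + 1)" by auto
            then have "\<epsilon> / sqrt (C + 1) \<le> \<epsilon>" using \<epsilon> by (simp add: divide_le_eq)
            then show ?thesis by (auto simp: \<eta>_def)
          qed
          then show ?thesis using d0 by simp
        qed
        then show ?thesis using u by (auto simp: Bd_def)
      qed
      then have u0: "0 < u" "u \<le> 1" using u by (auto simp: Bd_def)
      have "dist (\<beta> u) (\<alpha> u) \<le> \<epsilon>"
      proof -
        have "continuous_on {0..u} (\<lambda>v. dist (\<beta> v) (\<alpha> v))"
          using u0 by (intro continuous_intros continuous_on_subset[OF conta] continuous_on_subset[OF contb]) auto
        then have "closed {v \<in> {0..u}. dist (\<beta> v) (\<alpha> v) \<le> \<epsilon>}"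
          by (intro continuous_on_closed_Collect_le continuous_on_const closed_atLeastAtMost)
        then have "closure {0..<u} \<subseteq> {v \<in> {0..u}. dist (\<beta> v) (\<alpha> v) \<le> \<epsilon>}"
          by (rule closure_minimal[rotated]) (use lt in \<open>force\<close>)
        moreover have "u \<in> closure {0..<u}" using u0 by auto
        ultimately show ?thesis by blast
      qed
      then have "e u < \<epsilon>\<^sup>2" using lt u0
        by (intro bd) (auto simp: less_eq_real_def)
      moreover have "\<epsilon>\<^sup>2 \<le> (dist (\<beta> u) (\<alpha> u))\<^sup>2" using u \<epsilon> by (intro power_mono) (auto simp: Bd_def)
      ultimately show False unfolding ed by simp
    qed
  qed
qed

text \<open>Equal speeds and equal initial points satisfy the smallness conditions of
  \<open>solution_dependence\<close> for every \<open>\<eta>\<close>, so no positive distance can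
  occur.\<close>

lemma solution_unique:
  fixes F :: "'a::euclidean_space \<Rightarrow> 'a"
  assumes F: "locally_lipschitz F"
    and "\<And>t. t \<in> {0..1} \<Longrightarrow> (\<alpha> has_vector_derivative a *\<^sub>R F (\<alpha> t)) (at t within {0..1})"
    and "\<And>t. t \<in> {0..1} \<Longrightarrow> (\<beta> has_vector_derivative a *\<^sub>R F (\<beta> t)) (at t within {0..1})"
    and "\<alpha> 0 = \<beta> 0" "t \<in> {0..1}"
  shows "\<alpha> t = \<beta> t"
proof (rule ccontr)
  assume ne: "\<alpha> t \<noteq> \<beta> t"
  then have "dist (\<beta> t) (\<alpha> t) > 0" by simp
  from solution_dependence[OF F assms(2) this] obtain \<eta> where "\<eta> > 0"
    "\<And>\<gamma> b t'. (\<And>t. t \<in> {0..1} \<Longrightarrow> (\<gamma> has_vector_derivative b *\<^sub>R F (\<gamma> t)) (at t within {0..1})) \<Longrightarrow>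
       \<bar>b - a\<bar> < \<eta> \<Longrightarrow> dist (\<gamma> 0) (\<alpha> 0) < \<eta> \<Longrightarrow> t' \<in> {0..1} \<Longrightarrow> dist (\<gamma> t') (\<alpha> t') < dist (\<beta> t) (\<alpha> t)"
    by metis
  from this(2)[of \<beta> a t] assms(3) \<open>\<eta> > 0\<close> assms(4,5) show False by auto
qed

section \<open>Complexification of analytic vector fields\<close>

text \<open>Cauchy's inequality on discs of radius \<open>r / 4\<close> about the points of the half
  disc bounds \<open>deriv f\<close> by \<open>4 * M / r\<close>; these discs stay in
  \<open>ball 0 r\<close>.\<close>

lemma holomorphic_lipschitz:
  fixes f :: "complex \<Rightarrow> complex"
  assumes f: "f holomorphic_on ball 0 r" and r: "r > 0"
    and M: "\<And>z. z \<in> ball 0 r \<Longrightarrow> norm (f z) \<le> M"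
    and z: "z \<in> cball 0 (r/2)" and w: "w \<in> cball 0 (r/2)"
  shows "norm (f z - f w) \<le> 4 * M / r * norm (z - w)"
proof (rule field_differentiable_bound[of "cball 0 (r/2)" f "deriv f"])
  fix u :: complex assume u: "u \<in> cball 0 (r/2)"
  have sub: "cball u (r/4) \<subseteq> ball 0 r"
  proof
    fix v assume "v \<in> cball u (r/4)"
    then have "norm (u - v) \<le> r/4" by (simp add: dist_norm)
    then have "norm v \<le> norm u + r/4" using norm_triangle_ineq4[of u "u - v"] by simp
    then show "v \<in> ball 0 r" using u r by simp
  qed
  have "u \<in> ball 0 r" using u r by simp
  then show "(f has_field_derivative deriv f u) (at u within cball 0 (r/2))"
    using f by (meson at_within_open centre_in_ball has_field_derivative_at_within holomorphic_derivI open_ball)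
  have "norm ((deriv ^^ 1) f u) \<le> fact 1 * M / (r/4) ^ 1"
  proof (rule Cauchy_inequality)
    show "f holomorphic_on ball u (r/4)"
      using f sub ball_subset_cball holomorphic_on_subset by blast
    show "continuous_on (cball u (r/4)) f"
      using f sub holomorphic_on_imp_continuous_on continuous_on_subset by blast
    fix x assume "norm (u - x) = r/4"
    then have "x \<in> cball u (r/4)" by (simp add: dist_norm)
    then show "norm (f x) \<le> M" using M sub by blast
  qed (use r in auto)
  then show "norm (deriv f u) \<le> 4 * M / r" by (simp add: mult.commute)
qed (use z w in auto)

text \<open>Holomorphy on a bidisc is only ever needed after composition with holomorphic curves, so
  this serves as its definition.\<close>

definition holomorphic2 :: "(complex \<times> complex \<Rightarrow> complex) \<Rightarrow> real \<Rightarrow> bool" where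
  "holomorphic2 f r \<longleftrightarrow> r > 0 \<and> continuous_on (cball 0 r \<times> cball 0 r) f \<and>
     (\<forall>A a b. open A \<and> a holomorphic_on A \<and> b holomorphic_on A \<and> a ` A \<subseteq> ball 0 r \<and> b ` A \<subseteq> ball 0 r \<longrightarrow>
        (\<lambda>z. f (a z, b z)) holomorphic_on A)"

lemma holomorphic2_mono:
  assumes "holomorphic2 f r" "0 < s" "s \<le> r"
  shows "holomorphic2 f s"
  unfolding holomorphic2_def
proof (intro conjI allI impI)
  show "continuous_on (cball 0 s \<times> cball 0 s) f"
    using assms unfolding holomorphic2_def
    by (elim conjE continuous_on_subset) auto
  fix A a b
  assume *: "open A \<and> a holomorphic_on A \<and> b holomorphic_on A \<and> a ` A \<subseteq> ball 0 s \<and> b ` A \<subseteq> ball 0 s"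
  moreover have "ball (0::complex) s \<subseteq> ball 0 r" using assms by auto
  ultimately show "(\<lambda>z. f (a z, b z)) holomorphic_on A"
    using assms(1) unfolding holomorphic2_def by (meson order_trans)
qed (use assms in auto)

text \<open>Convergence at the corner \<open>(r, r)\<close> of a square half as large as the domain
  gives a summable majorant, since unconditional summability of reals is absolute. The M-test then
  works for complex arguments, along the filter of finite index sets, so that the pairs need not be
  enumerated. Composition with holomorphic curves is a locally uniform limit of polynomials in these
  curves.\<close>

lemma real_analytic2_complexify:
  assumes "real_analytic2 f"
  obtains r fc where "holomorphic2 fc r"
    "\<And>x y. \<bar>x\<bar> \<le> r \<Longrightarrow> \<bar>y\<bar> \<le> r \<Longrightarrow> fc (of_real x, of_real y) = of_real (f (x\<^sub>0 + x, y\<^sub>0 + y))"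
proof -
  obtain c :: "nat \<times> nat \<Rightarrow> real" and r0 where r0: "r0 > 0" and
    c: "\<And>x y. \<bar>x - x\<^sub>0\<bar> < r0 \<Longrightarrow> \<bar>y - y\<^sub>0\<bar> < r0 \<Longrightarrow>
      ((\<lambda>(i, j). c (i, j) * (x - x\<^sub>0) ^ i * (y - y\<^sub>0) ^ j) has_sum f (x, y)) UNIV"
    using assms[unfolded real_analytic2_def, rule_format, of x\<^sub>0 y\<^sub>0] by blast
  define r where "r = r0 / 2"
  have r: "r > 0" using r0 by (simp add: r_def)
  define t :: "nat \<times> nat \<Rightarrow> complex \<times> complex \<Rightarrow> complex"
    where "t p q = of_real (c p) * fst q ^ fst p * snd q ^ snd p" for p q
  define M where "M p = norm (c p * r ^ fst p * r ^ snd p)" for p :: "nat \<times> nat"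
  have "(\<lambda>p. c p * r ^ fst p * r ^ snd p) summable_on UNIV"
    using has_sum_imp_summable[OF c[of "x\<^sub>0 + r" "y\<^sub>0 + r"]] r r0
    by (simp add: r_def case_prod_unfold)
  then have M: "M summable_on UNIV"
    unfolding M_def by (rule summable_on_iff_abs_summable_on_real[THEN iffD1])
  define fc where "fc q = (\<Sum>\<^sub>\<infinity>p\<in>UNIV. t p q)" for q
  let ?Y = "cball (0::complex) r \<times> cball (0::complex) r"
  have ul: "uniform_limit ?Y (\<lambda>X q. \<Sum>p\<in>X. t p q) fc (finite_subsets_at_top UNIV)"
    unfolding fc_def
  proof (rule Weierstrass_m_test_general[OF _ M])
    fix p q assume "q \<in> ?Y"
    then have "norm (fst q) \<le> r" "norm (snd q) \<le> r" by auto
    then show "norm (t p q) \<le> M p"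
      unfolding t_def M_def using r by (simp add: norm_mult norm_power power_mono mult_mono abs_mult)
  qed
  have contt: "continuous_on S (\<lambda>q. \<Sum>p\<in>X. t p q)" for S X
    unfolding t_def by (intro continuous_intros)
  have cont: "continuous_on ?Y fc"
    by (rule uniform_limit_theorem[OF _ ul]) (auto intro!: always_eventually contt)
  have hol: "(\<lambda>z. fc (a z, b z)) holomorphic_on A"
    if A: "open A" and a: "a holomorphic_on A" and b: "b holomorphic_on A"
      and ar: "a ` A \<subseteq> ball 0 r" and br: "b ` A \<subseteq> ball 0 r" for A a b
  proof -
    have "\<exists>d>0. (\<lambda>z. fc (a z, b z)) holomorphic_on ball z d" if z: "z \<in> A" for z
    proof -
      obtain d where d: "d > 0" "cball z d \<subseteq> A" using A z open_contains_cball by blast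
      have "uniform_limit (cball z d) (\<lambda>X z. \<Sum>p\<in>X. t p (a z, b z)) (\<lambda>z. fc (a z, b z)) (finite_subsets_at_top UNIV)"
        by (rule uniform_limit_compose'[OF ul]) (use ar br d in \<open>auto simp: image_subset_iff less_imp_le subset_iff\<close>)
      moreover have "(\<lambda>z. \<Sum>p\<in>X. t p (a z, b z)) holomorphic_on A" for X
        unfolding t_def fst_conv snd_conv by (intro holomorphic_intros a b)
      then have "continuous_on (cball z d) (\<lambda>z. \<Sum>p\<in>X. t p (a z, b z)) \<and>
          (\<lambda>z. \<Sum>p\<in>X. t p (a z, b z)) holomorphic_on ball z d" for X
        using d by (meson ball_subset_cball continuous_on_subset holomorphic_on_imp_continuous_on
            holomorphic_on_subset order_trans)
      then have ev: "\<forall>\<^sub>F X in finite_subsets_at_top UNIV. continuous_on (cball z d) (\<lambda>z. \<Sum>p\<in>X. t p (a z, b z)) \<and>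
          (\<lambda>z. \<Sum>p\<in>X. t p (a z, b z)) holomorphic_on ball z d" by simp
      ultimately have "(\<lambda>z. fc (a z, b z)) holomorphic_on ball z d"
        using holomorphic_uniform_limit[OF ev _ finite_subsets_at_top_neq_bot] by blast
      then show ?thesis using d by auto
    qed
    then have "(\<lambda>z. fc (a z, b z)) analytic_on A" by (simp add: analytic_on_def)
    then show ?thesis by (rule analytic_imp_holomorphic)
  qed
  show ?thesis
  proof (rule that)
    show "holomorphic2 fc r" using r cont hol by (auto simp: holomorphic2_def)
    fix x y :: real assume xy: "\<bar>x\<bar> \<le> r" "\<bar>y\<bar> \<le> r"
    have "((\<lambda>p. c p * x ^ fst p * y ^ snd p) has_sum f (x\<^sub>0 + x, y\<^sub>0 + y)) UNIV"
      using c[of "x\<^sub>0 + x" "y\<^sub>0 + y"] xy r0 by (simp add: r_def case_prod_unfold)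
    then have "((\<lambda>p. complex_of_real (c p * x ^ fst p * y ^ snd p)) has_sum of_real (f (x\<^sub>0 + x, y\<^sub>0 + y))) UNIV"
      by (rule has_sum_of_real)
    then show "fc (of_real x, of_real y) = of_real (f (x\<^sub>0 + x, y\<^sub>0 + y))"
      unfolding fc_def t_def by (simp add: infsumI)
  qed
qed

text \<open>One variable is moved at a time, the other being frozen as a constant curve; the two
  one-variable Cauchy bounds add up.\<close>

lemma holomorphic2_lipschitz:
  assumes f: "holomorphic2 f r"
  obtains L where "L \<ge> 0"
    "\<And>z z' w w'. z \<in> cball 0 (r/4) \<Longrightarrow> z' \<in> cball 0 (r/4) \<Longrightarrow> w \<in> cball 0 (r/4) \<Longrightarrow> w' \<in> cball 0 (r/4) \<Longrightarrow>
       norm (f (z, w) - f (z', w')) \<le> L * (norm (z - z') + norm (w - w'))"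
proof -
  have r: "r > 0" and cont: "continuous_on (cball 0 r \<times> cball 0 r) f"
    and hol: "\<And>A a b. open A \<Longrightarrow> a holomorphic_on A \<Longrightarrow> b holomorphic_on A \<Longrightarrow> a ` A \<subseteq> ball 0 r \<Longrightarrow> b ` A \<subseteq> ball 0 r \<Longrightarrow>
        (\<lambda>z. f (a z, b z)) holomorphic_on A"
    using f by (auto simp: holomorphic2_def)
  have "compact (f ` (cball 0 r \<times> cball 0 r))"
    by (intro compact_continuous_image cont compact_Times compact_cball)
  then have "bounded (f ` (cball 0 r \<times> cball 0 r))" by (rule compact_imp_bounded)
  then obtain M where M': "\<forall>v \<in> f ` (cball 0 r \<times> cball 0 r). norm v \<le> M"
    unfolding bounded_iff by blast
  have M: "norm (f (z, w)) \<le> M" if "z \<in> cball 0 r" "w \<in> cball 0 r" for z w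
    by (rule bspec[OF M']) (use that in blast)
  have M0: "M \<ge> 0" using order_trans[OF norm_ge_zero M[of 0 0]] r by simp
  show ?thesis
  proof (rule that[of "4 * M / (r/2)"])
    show "0 \<le> 4 * M / (r/2)" using M0 r by simp
    fix z z' w w' :: complex
    assume *: "z \<in> cball 0 (r/4)" "z' \<in> cball 0 (r/4)" "w \<in> cball 0 (r/4)" "w' \<in> cball 0 (r/4)"
    have 1: "norm (f (z, w) - f (z', w)) \<le> 4 * M / (r/2) * norm (z - z')"
    proof (rule holomorphic_lipschitz[of "\<lambda>z. f (z, w)"])
      show "(\<lambda>z. f (z, w)) holomorphic_on ball 0 (r/2)"
        by (rule hol[of _ "\<lambda>z. z" "\<lambda>_. w"]) (use * r in auto)
    qed (use * r in \<open>auto intro!: M\<close>)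
    have 2: "norm (f (z', w) - f (z', w')) \<le> 4 * M / (r/2) * norm (w - w')"
    proof (rule holomorphic_lipschitz[of "\<lambda>w. f (z', w)"])
      show "(\<lambda>w. f (z', w)) holomorphic_on ball 0 (r/2)"
        by (rule hol[of _ "\<lambda>_. z'" "\<lambda>z. z"]) (use * r in auto)
    qed (use * r in \<open>auto intro!: M\<close>)
    have "norm (f (z, w) - f (z', w')) \<le> norm (f (z, w) - f (z', w)) + norm (f (z', w) - f (z', w'))"
      using norm_triangle_ineq[of "f (z, w) - f (z', w)" "f (z', w) - f (z', w')"] by simp
    then show "norm (f (z, w) - f (z', w')) \<le> 4 * M / (r/2) * (norm (z - z') + norm (w - w'))"
      using 1 2 unfolding distrib_left by linarith
  qed
qed

lemma real_analytic2_lipschitz: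
  assumes "real_analytic2 f"
  obtains r L where "r > 0" "\<And>q q'. q \<in> ball p r \<Longrightarrow> q' \<in> ball p r \<Longrightarrow> dist (f q) (f q') \<le> L * dist q q'"
proof -
  obtain r fc where fc: "holomorphic2 fc r" and
    eq: "\<And>x y. \<bar>x\<bar> \<le> r \<Longrightarrow> \<bar>y\<bar> \<le> r \<Longrightarrow> fc (of_real x, of_real y) = of_real (f (fst p + x, snd p + y))"
    using real_analytic2_complexify[OF assms] by blast
  have r: "r > 0" using fc by (simp add: holomorphic2_def)
  obtain L where L0: "L \<ge> 0" and L: "\<And>z z' w w'. z \<in> cball 0 (r/4) \<Longrightarrow> z' \<in> cball 0 (r/4) \<Longrightarrow> w \<in> cball 0 (r/4) \<Longrightarrow> w' \<in> cball 0 (r/4) \<Longrightarrow>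
       norm (fc (z, w) - fc (z', w')) \<le> L * (norm (z - z') + norm (w - w'))"
    using holomorphic2_lipschitz[OF fc] by blast
  show ?thesis
  proof (rule that[of "r/4" "2 * L"])
    fix q q' assume q: "q \<in> ball p (r/4)" "q' \<in> ball p (r/4)"
    have b: "\<bar>fst s - fst p\<bar> \<le> r/4" "\<bar>snd s - snd p\<bar> \<le> r/4" if "s \<in> ball p (r/4)" for s
      using that dist_fst_le[of p s] dist_snd_le[of p s] by (auto simp: dist_real_def abs_minus_commute)
    have e: "fc (of_real (fst s - fst p), of_real (snd s - snd p)) = of_real (f s)" if "s \<in> ball p (r/4)" for s
      using eq[of "fst s - fst p" "snd s - snd p"] b[OF that] r by auto
    have "dist (f q) (f q') = norm (complex_of_real (f q) - of_real (f q'))"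
      by (simp add: dist_real_def flip: of_real_diff)
    also have "\<dots> \<le> L * (norm (complex_of_real (fst q - fst p) - of_real (fst q' - fst p)) +
        norm (complex_of_real (snd q - snd p) - of_real (snd q' - snd p)))"
      unfolding e[OF q(1), symmetric] e[OF q(2), symmetric]
      by (intro L) (use b[OF q(1)] b[OF q(2)] in \<open>simp_all flip: of_real_diff\<close>)
    also have "\<dots> = L * (\<bar>fst q - fst q'\<bar> + \<bar>snd q - snd q'\<bar>)"
      by (simp flip: of_real_diff)
    also have "\<dots> \<le> L * (dist q q' + dist q q')"
      using L0 dist_fst_le[of q q'] dist_snd_le[of q q'] by (intro mult_left_mono) (auto simp: dist_real_def)
    finally show "dist (f q) (f q') \<le> 2 * L * dist q q'" by simp
  qed (use r in auto)
qed

section \<open>Holomorphic dependence of the graph equation on a parameter\<close>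

text \<open>Induction over the cells, each of which contributes at most \<open>e / N\<close>. The
  error depends on \<open>f\<close> only through its modulus of continuity, hence is uniform over an
  equicontinuous family.\<close>

lemma riemann_sum_error:
  fixes f :: "real \<Rightarrow> complex"
  assumes f: "continuous_on {0..1} f" and N: "N > 0"
    and e: "\<And>u v. u \<in> {0..1} \<Longrightarrow> v \<in> {0..1} \<Longrightarrow> \<bar>u - v\<bar> \<le> 1 / real N \<Longrightarrow> norm (f u - f v) \<le> e"
    and m: "m \<le> N"
  shows "norm (integral {0..real m / real N} f - (\<Sum>k<m. f (real k / real N) / of_nat N)) \<le> real m / real N * e"
  using m
proof (induction m)
  case (Suc m)
  let ?a = "real m / real N" and ?b = "real (Suc m) / real N"
  have ab: "0 \<le> ?a" "?a \<le> ?b" "?b \<le> 1" "?b - ?a = 1 / real N"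
    using Suc.prems N by (auto simp: field_simps)
  have int: "f integrable_on {0..?b}"
    by (rule integrable_continuous_real) (use ab in \<open>auto intro: continuous_on_subset[OF f]\<close>)
  have cab: "continuous_on {?a..?b} f" by (rule continuous_on_subset[OF f]) (use ab in auto)
  have "integral {0..?b} f = integral {0..?a} f + integral {?a..?b} f"
    using Henstock_Kurzweil_Integration.integral_combine[OF ab(1,2) int] by simp
  moreover have "integral {?a..?b} (\<lambda>u. f u - f ?a) = integral {?a..?b} f - integral {?a..?b} (\<lambda>u. f ?a)"
    by (rule Henstock_Kurzweil_Integration.integral_diff) (use cab in \<open>auto intro: integrable_continuous_real\<close>)
  moreover have "integral {?a..?b} (\<lambda>u. f ?a) = f ?a / of_nat N"
    using ab by (simp add: scaleR_conv_of_real)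
  ultimately have eq: "integral {0..?b} f - (\<Sum>k<Suc m. f (real k / real N) / of_nat N)
      = (integral {0..?a} f - (\<Sum>k<m. f (real k / real N) / of_nat N)) + integral {?a..?b} (\<lambda>u. f u - f ?a)"
    by simp
  have "norm (integral {?a..?b} (\<lambda>u. f u - f ?a)) \<le> e * (?b - ?a)"
  proof (rule integral_bound)
    show "continuous_on {?a..?b} (\<lambda>u. f u - f ?a)" by (intro continuous_intros cab)
    fix t assume t: "t \<in> {?a..?b}"
    show "norm (f t - f ?a) \<le> e"
    proof (rule e)
      show "t \<in> {0..1}" using ab t by (meson atLeastAtMost_iff order_trans)
      show "?a \<in> {0..1}" using ab by (meson atLeastAtMost_iff order_trans)
      show "\<bar>t - ?a\<bar> \<le> 1 / real N" unfolding ab(4)[symmetric] using t by auto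
    qed
  qed (rule ab)
  then have 1: "norm (integral {?a..?b} (\<lambda>u. f u - f ?a)) \<le> 1 / real N * e"
    unfolding ab(4) by (simp add: mult.commute)
  have "norm (integral {0..?b} f - (\<Sum>k<Suc m. f (real k / real N) / of_nat N)) \<le> ?a * e + 1 / real N * e"
    unfolding eq by (rule norm_triangle_le[OF add_mono[OF _ 1]]) (use Suc in auto)
  then show ?case by (simp add: add_divide_distrib distrib_right)
qed simp

text \<open>Riemann sums are holomorphic in \<open>z\<close>, and by the uniform continuity of
  \<open>F\<close> they converge uniformly; this avoids differentiating under the integral
  sign.\<close>

lemma holomorphic_integral_parameter:
  fixes F :: "real \<times> complex \<Rightarrow> complex"
  assumes cont: "continuous_on ({0..1} \<times> cball 0 R) F"
    and hol: "\<And>u. u \<in> {0..1} \<Longrightarrow> (\<lambda>z. F (u, z)) holomorphic_on ball 0 R"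
  shows "(\<lambda>z. integral {0..1} (\<lambda>u. F (u, z))) holomorphic_on ball 0 R"
proof -
  define S where "S n z = (\<Sum>k<Suc n. F (real k / real (Suc n), z) / of_nat (Suc n))" for n z
  have mem: "real k / real (Suc n) \<in> {0..1}" if "k < Suc n" for k n using that by auto
  have "uniform_limit (cball 0 R) S (\<lambda>z. integral {0..1} (\<lambda>u. F (u, z))) sequentially"
  proof (rule uniform_limitI)
    fix \<epsilon> :: real assume \<epsilon>: "\<epsilon> > 0"
    have "uniformly_continuous_on ({0..1} \<times> cball 0 R) F"
      by (intro compact_uniformly_continuous cont compact_Times compact_Icc compact_cball)
    then obtain d where d: "d > 0" and
      F: "\<And>p q. p \<in> {0..1} \<times> cball 0 R \<Longrightarrow> q \<in> {0..1} \<times> cball 0 R \<Longrightarrow> dist q p < d \<Longrightarrow> dist (F q) (F p) < \<epsilon> / 2"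
      unfolding uniformly_continuous_on_def using half_gt_zero[OF \<epsilon>] by metis
    show "\<forall>\<^sub>F n in sequentially. \<forall>z\<in>cball 0 R. dist (S n z) (integral {0..1} (\<lambda>u. F (u, z))) < \<epsilon>"
    proof -
      obtain n0 where n0: "1 / real (Suc n0) < d" using d by (meson nat_approx_posE)
      show ?thesis unfolding eventually_sequentially
      proof (intro exI[of _ n0] allI impI ballI)
        fix n z assume n: "n0 \<le> n" and z: "z \<in> cball (0::complex) R"
        have nd: "1 / real (Suc n) < d"
          using n n0 frac_le[of 1 1 "real (Suc n0)" "real (Suc n)"] by simp
        have "norm (integral {0..real (Suc n) / real (Suc n)} (\<lambda>u. F (u, z)) - (\<Sum>k<Suc n. F (real k / real (Suc n), z) / of_nat (Suc n)))
            \<le> real (Suc n) / real (Suc n) * (\<epsilon> / 2)"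
        proof (rule riemann_sum_error)
          show "continuous_on {0..1} (\<lambda>u. F (u, z))"
            by (rule continuous_on_compose2[OF cont]) (use z in \<open>auto intro!: continuous_intros\<close>)
          fix u v :: real assume "u \<in> {0..1}" "v \<in> {0..1}" "\<bar>u - v\<bar> \<le> 1 / real (Suc n)"
          then show "norm (F (u, z) - F (v, z)) \<le> \<epsilon> / 2"
            using F[of "(v, z)" "(u, z)"] z nd by (auto simp: dist_Pair_Pair dist_norm)
        qed auto
        then have "norm (integral {0..1} (\<lambda>u. F (u, z)) - S n z) \<le> \<epsilon> / 2"
          by (simp add: S_def del: of_nat_Suc)
        then show "dist (S n z) (integral {0..1} (\<lambda>u. F (u, z))) < \<epsilon>"
          using \<epsilon> by (simp add: dist_norm norm_minus_commute)
      qed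
    qed
  qed
  moreover have "continuous_on (cball 0 R) (S n)" for n
    unfolding S_def using mem
    by (intro continuous_intros continuous_on_compose2[OF cont]) (auto intro!: continuous_intros simp del: of_nat_Suc)
  moreover have "S n holomorphic_on ball 0 R" for n
    unfolding S_def using mem by (intro holomorphic_intros hol) auto
  ultimately show ?thesis
    using holomorphic_uniform_limit[of 0 R S sequentially] trivial_limit_sequentially by fastforce
qed

lemma integral_in_Reals:
  fixes f :: "real \<Rightarrow> complex"
  assumes "continuous_on {a..b} f" "\<And>t. t \<in> {a..b} \<Longrightarrow> f t \<in> \<real>"
  shows "integral {a..b} f \<in> \<real>"
proof -
  have "f integrable_on {a..b}" using assms(1) by (rule integrable_continuous_real)
  from integral_linear[OF this bounded_linear_Im]
  have "Im (integral {a..b} f) = integral {a..b} (\<lambda>t. Im (f t))" by (simp add: o_def)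
  also have "\<dots> = integral {a..b} (\<lambda>t. 0)"
    by (rule integral_cong) (use assms(2) in \<open>auto simp: complex_is_Real_iff\<close>)
  finally show ?thesis by (simp add: complex_is_Real_iff)
qed

text \<open>\<open>W (t, z)\<close> is the value at the point \<open>(1 - t) * z\<close> of the solution that vanishes at \<open>z\<close>. The
  range \<open>t \<le> 3\<close> reaches \<open>-2 * z\<close>, beyond the second zero near \<open>- z\<close>.\<close>

lemma complex_ode_holomorphic_parameter:
  fixes g :: "complex \<times> complex \<Rightarrow> complex"
  assumes g: "holomorphic2 g r"
    and L: "\<And>z w w'. z \<in> cball 0 r \<Longrightarrow> w \<in> cball 0 r \<Longrightarrow> w' \<in> cball 0 r \<Longrightarrow> norm (g (z, w) - g (z, w')) \<le> L * norm (w - w')"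
    and M: "\<And>z w. z \<in> cball 0 r \<Longrightarrow> w \<in> cball 0 r \<Longrightarrow> norm (g (z, w)) \<le> M"
    and real: "\<And>x y. \<bar>x\<bar> \<le> r \<Longrightarrow> \<bar>y\<bar> \<le> r \<Longrightarrow> g (of_real x, of_real y) \<in> \<real>"
    and L0: "L \<ge> 0" and M0: "M \<ge> 0"
  obtains R W where "R > 0" "2 * R \<le> r"
    "continuous_on ({0..3} \<times> cball 0 R) W"
    "\<And>t. t \<in> {0..3} \<Longrightarrow> (\<lambda>z. W (t, z)) holomorphic_on ball 0 R"
    "\<And>t z. t \<in> {0..3} \<Longrightarrow> z \<in> cball 0 R \<Longrightarrow> norm (W (t, z)) \<le> r / 2"
    "\<And>t x. t \<in> {0..3} \<Longrightarrow> \<bar>x\<bar> \<le> R \<Longrightarrow> W (t, of_real x) \<in> \<real>"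
    "\<And>t z. t \<in> {0..3} \<Longrightarrow> z \<in> cball 0 R \<Longrightarrow>
       W (t, z) = - (z * of_real t) * integral {0..1} (\<lambda>u. g ((1 - of_real (t * u)) * z, W (t * u, z)))"
proof -
  have r: "r > 0" and contg: "continuous_on (cball 0 r \<times> cball 0 r) g"
    and holg: "\<And>A a b. open A \<Longrightarrow> a holomorphic_on A \<Longrightarrow> b holomorphic_on A \<Longrightarrow> a ` A \<subseteq> ball 0 r \<Longrightarrow> b ` A \<subseteq> ball 0 r \<Longrightarrow>
        (\<lambda>z. g (a z, b z)) holomorphic_on A"
    using g by (auto simp: holomorphic2_def)
  \<comment> \<open>The three entries secure, in order: the points \<open>(1 - t) * z\<close> stay
    in the disc of radius \<open>r\<close>; the integral operator maps into functions bounded by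
    \<open>r / 2\<close>; it contracts by the factor \<open>1 / 2\<close>. Each 6 is twice the
    length 3 of the range of \<open>t\<close>.\<close>
  define R where "R = min (r / 4) (min (r / (6 * (M + 1))) (1 / (6 * (L + 1))))"
  have R: "R > 0" using r L0 M0 by (simp add: R_def)
  have R2: "2 * R < r" using r by (simp add: R_def min_def)
  have "R \<le> r / (6 * (M + 1))" by (simp add: R_def)
  then have "R * (6 * (M + 1)) \<le> r" using M0 by (simp add: pos_le_divide_eq)
  then have RM: "R * 3 * M \<le> r / 2" using R by (simp add: algebra_simps)
  have "R \<le> 1 / (6 * (L + 1))" by (simp add: R_def)
  then have "R * (6 * (L + 1)) \<le> 1" using L0 by (simp add: pos_le_divide_eq)
  then have RL: "R * 3 * L \<le> 1 / 2" using R by (simp add: algebra_simps)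
  define K where "K = {0..3::real} \<times> cball (0::complex) R"
  \<comment> \<open>The integral along the path from \<open>z\<close> to \<open>(1 - t) * z\<close>
    is rescaled to \<open>{0..1}\<close>, so that the domain of integration does not depend on the
    parameter.\<close>
  define I where "I f p u = g ((1 - of_real (fst p * u)) * snd p, f (fst p * u, snd p))" for f p u
  define \<Phi> where "\<Phi> f p = - (snd p * of_real (fst p)) * integral {0..1} (I f p)" for f p
  \<comment> \<open>These properties survive both \<open>\<Phi>\<close> and uniform limits. Reality
    on the real axis is carried along so that the limit restricts to a real solution.\<close>
  define good where "good f \<longleftrightarrow> continuous_on K f \<and> (\<forall>p\<in>K. norm (f p) \<le> r / 2) \<and>
     (\<forall>t\<in>{0..3}. (\<lambda>z. f (t, z)) holomorphic_on ball 0 R) \<and> (\<forall>t\<in>{0..3}. \<forall>x. \<bar>x\<bar> \<le> R \<longrightarrow> f (t, of_real x) \<in> \<real>)"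
    for f :: "real \<times> complex \<Rightarrow> complex"
  have tu: "t * u \<in> {0..3}" "norm ((1 - complex_of_real (t * u)) * z) \<le> 2 * norm z"
    if "t \<in> {0..3}" "u \<in> {0..1}" for t u z
  proof -
    have "t * u \<le> 3 * 1" using that by (intro mult_mono) auto
    then show 1: "t * u \<in> {0..3}" using that by auto
    have "norm (1 - complex_of_real (t * u)) = \<bar>1 - t * u\<bar>"
      by (metis norm_of_real of_real_1 of_real_diff)
    also have "\<dots> \<le> 2" using 1 by auto
    finally show "norm ((1 - complex_of_real (t * u)) * z) \<le> 2 * norm z"
      unfolding norm_mult by (rule mult_right_mono) auto
  qed
  have arg: "(1 - complex_of_real (t * u)) * z \<in> ball 0 r" if "t \<in> {0..3}" "u \<in> {0..1}" "z \<in> cball 0 R" for t u z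
    using tu(2)[OF that(1,2), of z] that(3) R2 by auto
  have contI: "continuous_on (K \<times> {0..1}) (\<lambda>(p, u). I f p u)" if "good f" for f
  proof -
    have f: "continuous_on K f" "\<And>p. p \<in> K \<Longrightarrow> norm (f p) \<le> r / 2" using that by (auto simp: good_def)
    show ?thesis unfolding I_def case_prod_unfold
    proof (rule continuous_on_compose2[OF contg])
      show "continuous_on (K \<times> {0..1}) (\<lambda>x. ((1 - complex_of_real (fst (fst x) * snd x)) * snd (fst x), f (fst (fst x) * snd x, snd (fst x))))"
        by (intro continuous_intros continuous_on_compose2[OF f(1)])
           (use tu(1) in \<open>auto simp: K_def\<close>)
      show "(\<lambda>x. ((1 - complex_of_real (fst (fst x) * snd x)) * snd (fst x), f (fst (fst x) * snd x, snd (fst x)))) ` (K \<times> {0..1})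
          \<subseteq> cball 0 r \<times> cball 0 r"
      proof clarsimp
        fix t z and u :: real assume *: "(t, z) \<in> K" "0 \<le> u" "u \<le> 1"
        then have "(1 - complex_of_real (t * u)) * z \<in> ball 0 r" by (intro arg) (auto simp: K_def)
        moreover have "(t * u, z) \<in> K" using * tu(1)[of t u] by (auto simp: K_def)
        then have "norm (f (t * u, z)) \<le> r / 2" by (rule f(2))
        ultimately show "cmod ((1 - complex_of_real t * complex_of_real u) * z) \<le> r \<and> cmod (f (t * u, z)) \<le> r"
          using r by simp
      qed
    qed
  qed
  have contI1: "continuous_on {0..1} (I f p)" if "good f" "p \<in> K" for f p
  proof -
    have "continuous_on {0..1} (\<lambda>u. (\<lambda>(p, u). I f p u) (p, u))"
      by (rule continuous_on_compose2[OF contI[OF that(1)]]) (use that(2) in \<open>auto intro!: continuous_intros\<close>)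
    then show ?thesis by simp
  qed
  have normI: "norm (I f p u) \<le> M" if "good f" "p \<in> K" "u \<in> {0..1}" for f p u
    unfolding I_def
  proof (rule M)
    show "(1 - complex_of_real (fst p * u)) * snd p \<in> cball 0 r"
      using arg[of "fst p" u "snd p"] that by (auto simp: K_def)
    have "(fst p * u, snd p) \<in> K" using that tu(1)[of "fst p" u] by (auto simp: K_def)
    then have "norm (f (fst p * u, snd p)) \<le> r / 2" using that(1) by (auto simp: good_def)
    then show "f (fst p * u, snd p) \<in> cball 0 r" using r by simp
  qed
  have fac: "norm (- (snd p * complex_of_real (fst p)) * J) \<le> R * 3 * B"
    if "p \<in> K" "norm J \<le> B" for p J B
  proof -
    have "norm (- (snd p * complex_of_real (fst p)) * J) = norm (snd p) * \<bar>fst p\<bar> * norm J"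
      by (simp add: norm_mult)
    also have "\<dots> \<le> R * 3 * B"
      using that R norm_ge_zero[of J] by (intro mult_mono) (auto simp: K_def)
    finally show ?thesis .
  qed
  have good\<Phi>: "good (\<Phi> f)" if f: "good f" for f
    unfolding good_def
  proof (intro conjI ballI allI impI)
    show "continuous_on K (\<Phi> f)"
      unfolding \<Phi>_def using integral_continuous_on_param[of K 0 1 "I f"] contI[OF f]
      by (auto intro!: continuous_intros)
    fix p assume p: "p \<in> K"
    have "norm (integral {0..1} (I f p)) \<le> M * (1 - 0)"
      by (rule integral_bound) (use normI[OF f p] contI1[OF f p] in auto)
    then have "norm (integral {0..1} (I f p)) \<le> M" by simp
    from fac[OF p this] RM show "norm (\<Phi> f p) \<le> r / 2" unfolding \<Phi>_def by linarith
  next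
    fix t :: real assume t: "t \<in> {0..3}"
    have "(\<lambda>z. integral {0..1} (\<lambda>u. (\<lambda>(u, z). I f (t, z) u) (u, z))) holomorphic_on ball 0 R"
    proof (rule holomorphic_integral_parameter)
      show "continuous_on ({0..1} \<times> cball 0 R) (\<lambda>(u, z). I f (t, z) u)"
      proof -
        have "continuous_on ({0..1} \<times> cball 0 R) (\<lambda>x. (\<lambda>(p, u). I f p u) ((t, snd x), fst x))"
          by (rule continuous_on_compose2[OF contI[OF f]]) (use t in \<open>auto intro!: continuous_intros simp: K_def\<close>)
        then show ?thesis by (simp add: case_prod_unfold)
      qed
      fix u :: real assume u: "u \<in> {0..1}"
      have "(\<lambda>z. f (t * u, z)) holomorphic_on ball 0 R" using f tu(1)[OF t u] by (auto simp: good_def)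
      moreover have "f (t * u, z) \<in> ball 0 r" if "z \<in> ball 0 R" for z
      proof -
        have "(t * u, z) \<in> K" using that tu(1)[OF t u] by (auto simp: K_def)
        then have "norm (f (t * u, z)) \<le> r / 2" using f by (auto simp: good_def)
        then show ?thesis using r by simp
      qed
      ultimately have "(\<lambda>z. g ((1 - complex_of_real (t * u)) * z, f (t * u, z))) holomorphic_on ball 0 R"
        using arg[OF t u] by (intro holg) (auto intro!: holomorphic_intros simp: image_subset_iff)
      then show "(\<lambda>z. (\<lambda>(u, z). I f (t, z) u) (u, z)) holomorphic_on ball 0 R" by (simp add: I_def)
    qed
    then have "(\<lambda>z. integral {0..1} (I f (t, z))) holomorphic_on ball 0 R" by simp
    then show "(\<lambda>z. \<Phi> f (t, z)) holomorphic_on ball 0 R"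
      unfolding \<Phi>_def fst_conv snd_conv by (intro holomorphic_intros)
    fix x :: real assume x: "\<bar>x\<bar> \<le> R"
    have tx: "(t, of_real x) \<in> K" using t x by (simp add: K_def)
    have "I f (t, of_real x) u \<in> \<real>" if u: "u \<in> {0..1}" for u
    proof -
      have "f (t * u, of_real x) \<in> \<real>" using f tu(1)[OF t u] x by (auto simp: good_def)
      then obtain y where y: "f (t * u, of_real x) = of_real y" by (auto elim: Reals_cases)
      have "(t * u, of_real x) \<in> K" using tx tu(1)[OF t u] by (auto simp: K_def)
      then have "norm (f (t * u, of_real x)) \<le> r / 2" using f by (auto simp: good_def)
      then have "\<bar>y\<bar> \<le> r" using y r by simp
      moreover have "norm ((1 - complex_of_real (t * u)) * of_real x) \<le> r"
        using arg[OF t u, of "of_real x"] x by simp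
      then have "\<bar>(1 - t * u) * x\<bar> \<le> r"
        by (metis norm_of_real of_real_1 of_real_diff of_real_mult)
      ultimately show ?thesis using real[of "(1 - t * u) * x" y] by (simp add: I_def y)
    qed
    then have "integral {0..1} (I f (t, of_real x)) \<in> \<real>"
      by (intro integral_in_Reals contI1 f tx)
    then show "\<Phi> f (t, of_real x) \<in> \<real>" unfolding \<Phi>_def by (auto intro!: Reals_mult)
  qed
  \<comment> \<open>Here \<open>e\<close> is any uniform bound for the distance, so the estimate
    yields both the geometric convergence of the iterates and the continuity of
    \<open>\<Phi>\<close> that identifies the limit as a fixed point.\<close>
  have contr: "norm (\<Phi> f p - \<Phi> h p) \<le> e / 2"
    if f: "good f" and h: "good h" and e: "\<And>p. p \<in> K \<Longrightarrow> norm (f p - h p) \<le> e" and p: "p \<in> K" for f h e p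
  proof -
    have e0: "e \<ge> 0" using order_trans[OF norm_ge_zero e[OF p]] .
    have "integral {0..1} (I f p) - integral {0..1} (I h p) = integral {0..1} (\<lambda>u. I f p u - I h p u)"
      by (rule Henstock_Kurzweil_Integration.integral_diff[symmetric])
         (auto intro!: integrable_continuous_real contI1 f h p)
    moreover have "norm (integral {0..1} (\<lambda>u. I f p u - I h p u)) \<le> (L * e) * (1 - 0)"
    proof (rule integral_bound)
      show "continuous_on {0..1} (\<lambda>u. I f p u - I h p u)" by (intro continuous_intros contI1 f h p)
      fix u :: real assume u: "u \<in> {0..1}"
      have pu: "(fst p * u, snd p) \<in> K" using p tu(1)[of "fst p" u] u by (auto simp: K_def)
      have "norm (f (fst p * u, snd p)) \<le> r / 2" "norm (h (fst p * u, snd p)) \<le> r / 2"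
        using f h pu by (auto simp: good_def)
      then have "norm (I f p u - I h p u) \<le> L * norm (f (fst p * u, snd p) - h (fst p * u, snd p))"
        unfolding I_def using arg[of "fst p" u "snd p"] u p r by (intro L) (auto simp: K_def)
      also have "\<dots> \<le> L * e" using e[OF pu] L0 by (rule mult_left_mono)
      finally show "norm (I f p u - I h p u) \<le> L * e" .
    qed simp
    ultimately have "norm (integral {0..1} (I f p) - integral {0..1} (I h p)) \<le> L * e" by simp
    from fac[OF p this] have "norm (\<Phi> f p - \<Phi> h p) \<le> (R * 3 * L) * e"
      unfolding \<Phi>_def by (simp add: right_diff_distrib mult.assoc)
    also have "\<dots> \<le> 1 / 2 * e" using RL e0 by (rule mult_right_mono)
    finally show ?thesis by simp
  qed
  define w where "w n = (\<Phi> ^^ n) (\<lambda>_. 0)" for n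
  have w_Suc: "w (Suc n) = \<Phi> (w n)" for n by (simp add: w_def)
  have goodw: "good (w n)" for n
  proof (induction n)
    case 0 show ?case using r by (simp add: w_def good_def)
  qed (simp add: w_Suc good\<Phi>)
  have diff: "norm (w (Suc n) p - w n p) \<le> (r / 2) * (1 / 2) ^ n" if "p \<in> K" for n p
    using that
  proof (induction n arbitrary: p)
    case 0
    then show ?case using goodw[of 1] by (auto simp: good_def w_def)
  next
    case (Suc n)
    from contr[OF goodw goodw Suc.IH Suc.prems] show ?case by (simp add: w_Suc)
  qed
  \<comment> \<open>The iterates start at 0, so the partial sums telescope to them; successive
    differences decay like \<open>(1 / 2) ^ n\<close>, and the M-test gives uniform convergence on
    \<open>K\<close>.\<close>
  define W where "W p = (\<Sum>n. w (Suc n) p - w n p)" for p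
  have "uniform_limit K (\<lambda>n p. \<Sum>i<n. w (Suc i) p - w i p) W sequentially"
    unfolding W_def by (rule Weierstrass_m_test[OF diff]) (auto intro!: summable_mult summable_geometric)
  moreover have "(\<Sum>i<n. w (Suc i) p - w i p) = w n p" for n p
    by (subst sum_lessThan_telescope) (simp add: w_def)
  ultimately have ul: "uniform_limit K w W sequentially" by simp
  have lim: "(\<lambda>n. w n p) \<longlonglongrightarrow> W p" if "p \<in> K" for p
    by (rule tendsto_uniform_limitI[OF ul that])
  have goodW: "good W"
    unfolding good_def
  proof (intro conjI ballI allI impI)
    show "continuous_on K W"
      by (rule uniform_limit_theorem[OF _ ul]) (use goodw in \<open>auto simp: good_def\<close>)
    show "norm (W p) \<le> r / 2" if "p \<in> K" for p
      by (rule Lim_norm_ubound[OF _ lim[OF that]]) (use goodw that in \<open>auto simp: good_def\<close>)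
    fix t :: real assume t: "t \<in> {0..3}"
    have ult: "uniform_limit (cball 0 R) (\<lambda>n z. w n (t, z)) (\<lambda>z. W (t, z)) sequentially"
      by (rule uniform_limit_compose'[OF ul]) (use t in \<open>auto simp: K_def\<close>)
    have "continuous_on (cball 0 R) (\<lambda>z. w n (t, z)) \<and> (\<lambda>z. w n (t, z)) holomorphic_on ball 0 R" for n
    proof
      show "continuous_on (cball 0 R) (\<lambda>z. w n (t, z))"
      proof (rule continuous_on_compose2[of K "w n"])
        show "continuous_on K (w n)" using goodw[of n] unfolding good_def by blast
      qed (use t in \<open>auto intro!: continuous_intros simp: K_def\<close>)
      show "(\<lambda>z. w n (t, z)) holomorphic_on ball 0 R" using goodw[of n] t unfolding good_def by blast
    qed
    then have ev: "\<forall>\<^sub>F n in sequentially. continuous_on (cball 0 R) (\<lambda>z. w n (t, z)) \<and> (\<lambda>z. w n (t, z)) holomorphic_on ball 0 R"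
      by simp
    show "(\<lambda>z. W (t, z)) holomorphic_on ball 0 R"
      using holomorphic_uniform_limit[OF ev ult trivial_limit_sequentially] by blast
    fix x :: real assume x: "\<bar>x\<bar> \<le> R"
    have "closed (\<real> :: complex set)" by (rule closed_complex_Reals)
    moreover have "(t, of_real x) \<in> K" using t x by (simp add: K_def)
    moreover have "w n (t, of_real x) \<in> \<real>" for n using goodw[of n] t x unfolding good_def by blast
    ultimately show "W (t, of_real x) \<in> \<real>"
      using closed_sequentially[OF _ _ lim] by blast
  qed
  have fixpt: "W p = \<Phi> W p" if p: "p \<in> K" for p
  proof -
    have "(\<lambda>n. \<Phi> (w n) p) \<longlonglongrightarrow> \<Phi> W p"
    proof (rule tendstoI)
      fix e :: real assume e: "e > 0"
      from uniform_limitD[OF ul e] show "\<forall>\<^sub>F n in sequentially. dist (\<Phi> (w n) p) (\<Phi> W p) < e"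
      proof eventually_elim
        case (elim n)
        have "norm (\<Phi> (w n) p - \<Phi> W p) \<le> e / 2"
          by (rule contr[OF goodw goodW _ p]) (use elim in \<open>auto simp: dist_norm less_imp_le\<close>)
        then show ?case using e by (simp add: dist_norm)
      qed
    qed
    moreover have "(\<lambda>n. \<Phi> (w n) p) \<longlonglongrightarrow> W p"
      using LIMSEQ_Suc[OF lim[OF p]] by (simp add: w_Suc)
    ultimately show ?thesis using LIMSEQ_unique by blast
  qed
  show ?thesis
  proof (rule that[of R W])
    show "2 * R \<le> r" using R2 by simp
    show "continuous_on ({0..3} \<times> cball 0 R) W" using goodW by (simp add: good_def K_def)
    fix t :: real assume t: "t \<in> {0..3}"
    show "(\<lambda>z. W (t, z)) holomorphic_on ball 0 R" using goodW t by (auto simp: good_def)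
    show "W (t, of_real x) \<in> \<real>" if "\<bar>x\<bar> \<le> R" for x using goodW t that by (auto simp: good_def)
    fix z assume z: "z \<in> cball (0::complex) R"
    then have tz: "(t, z) \<in> K" using t by (simp add: K_def)
    then show "norm (W (t, z)) \<le> r / 2" using goodW by (auto simp: good_def)
    have "integral {0..1} (I W (t, z)) = integral {0..1} (\<lambda>u. g ((1 - of_real (t * u)) * z, W (t * u, z)))"
      by (simp add: I_def[abs_def])
    then show "W (t, z) = - (z * of_real t) * integral {0..1} (\<lambda>u. g ((1 - of_real (t * u)) * z, W (t * u, z)))"
      using fixpt[OF tz] unfolding \<Phi>_def by simp
  qed (rule R)
qed

section \<open>The slope field of the orbits, their graphs and the order of contact\<close>

lemma holomorphic2_compose:
  assumes f: "holomorphic2 f r" and ab: "open A" "a holomorphic_on A" "b holomorphic_on A"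
    "a ` A \<subseteq> ball 0 r" "b ` A \<subseteq> ball 0 r"
  shows "(\<lambda>z. f (a z, b z)) holomorphic_on A"
proof -
  have "\<And>A a b. open A \<Longrightarrow> a holomorphic_on A \<Longrightarrow> b holomorphic_on A \<Longrightarrow> a ` A \<subseteq> ball 0 r \<Longrightarrow> b ` A \<subseteq> ball 0 r \<Longrightarrow>
      (\<lambda>z. f (a z, b z)) holomorphic_on A"
    using f by (auto simp: holomorphic2_def)
  from this[OF ab] show ?thesis .
qed

lemma holomorphic2_divide:
  assumes "holomorphic2 f r" "holomorphic2 g r" "\<And>z w. z \<in> cball 0 r \<Longrightarrow> w \<in> cball 0 r \<Longrightarrow> g (z, w) \<noteq> 0"
  shows "holomorphic2 (\<lambda>p. f p / g p) r"
  unfolding holomorphic2_def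
proof (intro conjI allI impI)
  show "continuous_on (cball 0 r \<times> cball 0 r) (\<lambda>p. f p / g p)"
    using assms by (intro continuous_intros) (auto simp: holomorphic2_def)
  fix A a b
  assume *: "open A \<and> a holomorphic_on A \<and> b holomorphic_on A \<and> a ` A \<subseteq> ball 0 r \<and> b ` A \<subseteq> ball 0 r"
  have "g (a z, b z) \<noteq> 0" if "z \<in> A" for z
  proof (rule assms(3))
    have "a z \<in> ball 0 r" "b z \<in> ball 0 r" using * that by blast+
    then show "a z \<in> cball 0 r" "b z \<in> cball 0 r" by auto
  qed
  moreover have "(\<lambda>z. f (a z, b z)) holomorphic_on A" "(\<lambda>z. g (a z, b z)) holomorphic_on A"
    using * by (auto intro: holomorphic2_compose[OF assms(1)] holomorphic2_compose[OF assms(2)])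
  ultimately show "(\<lambda>z. f (a z, b z) / g (a z, b z)) holomorphic_on A"
    by (intro holomorphic_intros)
qed (use assms in \<open>auto simp: holomorphic2_def\<close>)

text \<open>Multiplying the field by a time direction \<open>d\<close> leaves this quotient
  unchanged, so one family of graphs serves forward and backward orbits. It is meaningful only where
  the first component does not vanish.\<close>

definition slope :: "vfield \<Rightarrow> real \<Rightarrow> real \<Rightarrow> real" where
  "slope F x y = snd (F (x, y)) / fst (F (x, y))"

lemma slope_complexify:
  assumes F: "analytic_vfield F" and P0: "fst (F (0, 0)) \<noteq> 0"
  obtains \<rho> L M g where "\<rho> > 0" "L \<ge> 0" "M \<ge> 0"
    "\<And>x y. \<bar>x\<bar> \<le> \<rho> \<Longrightarrow> \<bar>y\<bar> \<le> \<rho> \<Longrightarrow> fst (F (0, 0)) * fst (F (x, y)) > 0"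
    "holomorphic2 g \<rho>"
    "\<And>z w w'. z \<in> cball 0 \<rho> \<Longrightarrow> w \<in> cball 0 \<rho> \<Longrightarrow> w' \<in> cball 0 \<rho> \<Longrightarrow> norm (g (z, w) - g (z, w')) \<le> L * norm (w - w')"
    "\<And>z w. z \<in> cball 0 \<rho> \<Longrightarrow> w \<in> cball 0 \<rho> \<Longrightarrow> norm (g (z, w)) \<le> M"
    "\<And>x y. \<bar>x\<bar> \<le> \<rho> \<Longrightarrow> \<bar>y\<bar> \<le> \<rho> \<Longrightarrow> g (of_real x, of_real y) = of_real (slope F x y)"
proof -
  have "real_analytic2 (\<lambda>p. fst (F p))" "real_analytic2 (\<lambda>p. snd (F p))"
    using F by (auto simp: analytic_vfield_def)
  then obtain r1 pc r2 qc where pc: "holomorphic2 pc r1" and qc: "holomorphic2 qc r2" and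
    pr: "\<And>x y. \<bar>x\<bar> \<le> r1 \<Longrightarrow> \<bar>y\<bar> \<le> r1 \<Longrightarrow> pc (of_real x, of_real y) = of_real (fst (F (0 + x, 0 + y)))" and
    qr: "\<And>x y. \<bar>x\<bar> \<le> r2 \<Longrightarrow> \<bar>y\<bar> \<le> r2 \<Longrightarrow> qc (of_real x, of_real y) = of_real (snd (F (0 + x, 0 + y)))"
    using real_analytic2_complexify[of "\<lambda>p. fst (F p)" 0 0] real_analytic2_complexify[of "\<lambda>p. snd (F p)" 0 0]
    by metis
  obtain K where K0: "K \<ge> 0" and K: "\<And>z z' w w'. z \<in> cball 0 (r1/4) \<Longrightarrow> z' \<in> cball 0 (r1/4) \<Longrightarrow> w \<in> cball 0 (r1/4) \<Longrightarrow> w' \<in> cball 0 (r1/4) \<Longrightarrow>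
       norm (pc (z, w) - pc (z', w')) \<le> K * (norm (z - z') + norm (w - w'))"
    using holomorphic2_lipschitz[OF pc] by blast
  have r: "r1 > 0" "r2 > 0" using pc qc by (auto simp: holomorphic2_def)
  define P where "P = fst (F (0, 0))"
  \<comment> \<open>On the bidisc of radius \<open>s\<close> the extension of the first component
    differs from \<open>P\<close> by less than \<open>\<bar>P\<bar>\<close>: it has no zero there,
    and at real points it keeps the sign of \<open>P\<close>.\<close>
  define s where "s = min (min (r1 / 4) r2) (\<bar>P\<bar> / (4 * (K + 1)))"
  have s: "s > 0" "s \<le> r1 / 4" "s \<le> r2" using r K0 P0 unfolding s_def P_def by (simp, linarith+)
  have "s \<le> \<bar>P\<bar> / (4 * (K + 1))" by (simp add: s_def)
  then have "s * (4 * (K + 1)) \<le> \<bar>P\<bar>" using K0 by (simp add: pos_le_divide_eq)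
  then have sK: "K * (s + s) < \<bar>P\<bar>" using s K0 by (simp add: algebra_simps)
  have pc0: "pc (0, 0) = of_real P" using pr[of 0 0] r by (simp add: P_def)
  have near: "norm (pc (z, w) - of_real P) < \<bar>P\<bar>" if "z \<in> cball 0 s" "w \<in> cball 0 s" for z w
  proof -
    have "norm (pc (z, w) - pc (0, 0)) \<le> K * (norm (z - 0) + norm (w - 0))"
      by (rule K) (use that s r in auto)
    also have "\<dots> \<le> K * (s + s)" using that K0 by (intro mult_left_mono add_mono) auto
    also note sK
    finally show ?thesis by (simp add: pc0)
  qed
  have nz: "pc (z, w) \<noteq> 0" if "z \<in> cball 0 s" "w \<in> cball 0 s" for z w
    using near[OF that] by auto
  define g where "g p = qc p / pc p" for p
  have g: "holomorphic2 g s"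
    unfolding g_def using r s
    by (intro holomorphic2_divide nz holomorphic2_mono[OF qc] holomorphic2_mono[OF pc]) auto
  obtain L where L0: "L \<ge> 0" and L: "\<And>z z' w w'. z \<in> cball 0 (s/4) \<Longrightarrow> z' \<in> cball 0 (s/4) \<Longrightarrow> w \<in> cball 0 (s/4) \<Longrightarrow> w' \<in> cball 0 (s/4) \<Longrightarrow>
       norm (g (z, w) - g (z', w')) \<le> L * (norm (z - z') + norm (w - w'))"
    using holomorphic2_lipschitz[OF g] by blast
  show ?thesis
  proof (rule that[of "s/4" L "norm (g (0, 0)) + L * s" g])
    show "0 \<le> norm (g (0, 0)) + L * s" using L0 s by auto
    show "holomorphic2 g (s/4)" by (rule holomorphic2_mono[OF g]) (use s in auto)
    show "fst (F (0, 0)) * fst (F (x, y)) > 0" if "\<bar>x\<bar> \<le> s/4" "\<bar>y\<bar> \<le> s/4" for x y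
    proof -
      have "norm (pc (of_real x, of_real y) - of_real P) < \<bar>P\<bar>"
        by (rule near) (use that s in auto)
      moreover have "pc (of_real x, of_real y) = of_real (fst (F (x, y)))"
        using pr[of x y] that s by simp
      ultimately have "norm (complex_of_real (fst (F (x, y)) - P)) < \<bar>P\<bar>" by simp
      then have "\<bar>fst (F (x, y)) - P\<bar> < \<bar>P\<bar>" unfolding norm_of_real .
      then have "P * fst (F (x, y)) > 0"
        by (cases "P > 0") (auto simp: zero_less_mult_iff abs_if split: if_splits)
      then show ?thesis by (simp add: P_def)
    qed
    fix z w w' assume *: "z \<in> cball (0::complex) (s/4)" "w \<in> cball (0::complex) (s/4)"
    show "norm (g (z, w) - g (z, w')) \<le> L * norm (w - w')" if "w' \<in> cball 0 (s/4)"
      using L[of z z w w'] * that by simp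
    have "norm (g (z, w) - g (0, 0)) \<le> L * (norm (z - 0) + norm (w - 0))"
      using * s by (intro L) auto
    also have "\<dots> \<le> L * s" using * L0 norm_ge_zero[of z] norm_ge_zero[of w]
      by (intro mult_left_mono) (simp_all del: norm_ge_zero)
    finally have "norm (g (z, w) - g (0, 0)) \<le> L * s" .
    then show "norm (g (z, w)) \<le> norm (g (0, 0)) + L * s"
      using norm_triangle_ineq2[of "g (z, w)" "g (0, 0)"] by linarith
  next
    fix x y :: real assume "\<bar>x\<bar> \<le> s/4" "\<bar>y\<bar> \<le> s/4"
    then show "g (of_real x, of_real y) = of_real (slope F x y)"
      using pr[of x y] qr[of x y] s by (simp add: g_def slope_def)
  qed (use s L0 in auto)
qed

text \<open>\<open>Y x\<close> is the graph of the orbit through \<open>(x, 0)\<close>, and \<open>h\<close> extends its height over 0.\<close>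

lemma local_graphs:
  assumes F: "analytic_vfield F" and P0: "fst (F (0, 0)) \<noteq> 0"
  obtains R \<rho> L M h Y where "R > 0" "2 * R \<le> \<rho>" "L \<ge> 0" "M \<ge> 0"
    "\<And>x y. \<bar>x\<bar> \<le> \<rho> \<Longrightarrow> \<bar>y\<bar> \<le> \<rho> \<Longrightarrow> fst (F (0, 0)) * fst (F (x, y)) > 0"
    "\<And>x y y'. \<bar>x\<bar> \<le> \<rho> \<Longrightarrow> \<bar>y\<bar> \<le> \<rho> \<Longrightarrow> \<bar>y'\<bar> \<le> \<rho> \<Longrightarrow> \<bar>slope F x y - slope F x y'\<bar> \<le> L * \<bar>y - y'\<bar>"
    "h holomorphic_on ball 0 R"
    "\<And>x. \<bar>x\<bar> < R \<Longrightarrow> h (of_real x) = of_real (Y x 0)"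
    "\<And>x. \<bar>x\<bar> < R \<Longrightarrow> Y x x = 0"
    "\<And>x \<xi>. \<bar>x\<bar> < R \<Longrightarrow> x \<noteq> 0 \<Longrightarrow> \<xi> \<in> closed_segment x (-2*x) \<Longrightarrow>
       (Y x has_real_derivative slope F \<xi> (Y x \<xi>)) (at \<xi> within closed_segment x (-2*x))"
    "\<And>x \<xi>. \<bar>x\<bar> < R \<Longrightarrow> x \<noteq> 0 \<Longrightarrow> \<xi> \<in> closed_segment x (-2*x) \<Longrightarrow> \<bar>Y x \<xi>\<bar> \<le> \<rho> / 2"
    "\<And>x \<xi>. \<bar>x\<bar> < R \<Longrightarrow> x \<noteq> 0 \<Longrightarrow> \<xi> \<in> closed_segment x (-2*x) \<Longrightarrow> \<bar>Y x \<xi>\<bar> \<le> 3 * M * \<bar>x\<bar>"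
proof -
  obtain \<rho> L M g where \<rho>: "\<rho> > 0" and L0: "L \<ge> 0" and M0: "M \<ge> 0" and
    pos: "\<And>x y. \<bar>x\<bar> \<le> \<rho> \<Longrightarrow> \<bar>y\<bar> \<le> \<rho> \<Longrightarrow> fst (F (0, 0)) * fst (F (x, y)) > 0" and
    g: "holomorphic2 g \<rho>" and
    L: "\<And>z w w'. z \<in> cball 0 \<rho> \<Longrightarrow> w \<in> cball 0 \<rho> \<Longrightarrow> w' \<in> cball 0 \<rho> \<Longrightarrow> norm (g (z, w) - g (z, w')) \<le> L * norm (w - w')" and
    M: "\<And>z w. z \<in> cball 0 \<rho> \<Longrightarrow> w \<in> cball 0 \<rho> \<Longrightarrow> norm (g (z, w)) \<le> M" and
    gr: "\<And>x y. \<bar>x\<bar> \<le> \<rho> \<Longrightarrow> \<bar>y\<bar> \<le> \<rho> \<Longrightarrow> g (of_real x, of_real y) = of_real (slope F x y)"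
    using slope_complexify[OF F P0] by blast
  have greal: "\<And>x y. \<bar>x\<bar> \<le> \<rho> \<Longrightarrow> \<bar>y\<bar> \<le> \<rho> \<Longrightarrow> g (of_real x, of_real y) \<in> \<real>"
    using gr by simp
  obtain R W where R: "R > 0" "2 * R \<le> \<rho>" and
    contW: "continuous_on ({0..3} \<times> cball 0 R) W" and
    holW: "\<And>t. t \<in> {0..3} \<Longrightarrow> (\<lambda>z. W (t, z)) holomorphic_on ball 0 R" and
    bW: "\<And>t z. t \<in> {0..3} \<Longrightarrow> z \<in> cball 0 R \<Longrightarrow> norm (W (t, z)) \<le> \<rho> / 2" and
    rW: "\<And>t x. t \<in> {0..3} \<Longrightarrow> \<bar>x\<bar> \<le> R \<Longrightarrow> W (t, of_real x) \<in> \<real>" and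
    eqW: "\<And>t z. t \<in> {0..3} \<Longrightarrow> z \<in> cball 0 R \<Longrightarrow>
       W (t, z) = - (z * of_real t) * integral {0..1} (\<lambda>u. g ((1 - of_real (t * u)) * z, W (t * u, z)))"
    using complex_ode_holomorphic_parameter[OF g L M greal L0 M0] by blast
  have contg: "continuous_on (cball 0 \<rho> \<times> cball 0 \<rho>) g" using g by (simp add: holomorphic2_def)
  \<comment> \<open>\<open>t = 1 - \<xi> / x\<close> inverts \<open>\<xi> = (1 - t) * x\<close>. For
    \<open>x = 0\<close> division by zero yields \<open>t = 1\<close>, and
    \<open>W (1, 0) = 0\<close> because of the factor \<open>z\<close> in the integral equation; the
    claims at \<open>x = 0\<close> rest on this.\<close>
  define Y where "Y x \<xi> = Re (W (1 - \<xi> / x, of_real x))" for x \<xi> :: real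
  have Wr: "W (t, of_real x) = of_real (Re (W (t, of_real x)))" if "t \<in> {0..3}" "\<bar>x\<bar> \<le> R" for t x
    using rW[OF that] by (simp add: complex_is_Real_iff complex_eq_iff)
  have ode: "(Y x has_real_derivative slope F \<xi> (Y x \<xi>)) (at \<xi> within closed_segment x (-2*x))
      \<and> \<bar>Y x \<xi>\<bar> \<le> \<rho> / 2 \<and> \<bar>Y x \<xi>\<bar> \<le> 3 * M * \<bar>x\<bar>"
    if x: "\<bar>x\<bar> < R" "x \<noteq> 0" and \<xi>: "\<xi> \<in> closed_segment x (-2*x)" for x \<xi>
  proof -
    have xR: "complex_of_real x \<in> cball 0 R" using x by simp
    define V where "V t = W (t, of_real x)" for t
    define G where "G t = g (of_real ((1 - t) * x), V t)" for t
    have Vr: "V t = of_real (Re (V t))" "norm (V t) \<le> \<rho> / 2" if "t \<in> {0..3}" for t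
      using Wr[OF that, of x] bW[OF that xR] x by (auto simp: V_def)
    have arg: "\<bar>(1 - t) * x\<bar> \<le> \<rho>" if "t \<in> {0..3}" for t
    proof -
      have "\<bar>(1 - t) * x\<bar> \<le> 2 * R" unfolding abs_mult using that x by (intro mult_mono) auto
      then show ?thesis using R by simp
    qed
    have contV: "continuous_on {0..3} V"
      unfolding V_def by (rule continuous_on_compose2[OF contW]) (use x in \<open>auto intro!: continuous_intros\<close>)
    have contG: "continuous_on {0..3} G"
      unfolding G_def
    proof (rule continuous_on_compose2[OF contg])
      show "continuous_on {0..3} (\<lambda>t. (complex_of_real ((1 - t) * x), V t))"
        by (intro continuous_intros contV)
      show "(\<lambda>t. (complex_of_real ((1 - t) * x), V t)) ` {0..3} \<subseteq> cball 0 \<rho> \<times> cball 0 \<rho>"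
      proof (clarsimp simp del: of_real_mult of_real_diff)
        fix t :: real assume "0 \<le> t" "t \<le> 3"
        then show "\<bar>(1 - t) * x\<bar> \<le> \<rho> \<and> norm (V t) \<le> \<rho>" using arg[of t] Vr(2)[of t] \<rho> by auto
      qed
    qed
    \<comment> \<open>Undoing the rescaling gives an integral with variable upper end, to which the
      fundamental theorem of calculus applies.\<close>
    have Veq: "V t = - of_real x * integral {0..t} G" if t: "t \<in> {0..3}" for t
    proof (cases "t = 0")
      case False
      then have t0: "t > 0" using t by auto
      have "continuous_on {0..t} G" using contG by (rule continuous_on_subset) (use t in auto)
      then have "(G has_integral integral {0..t} G) {0..t}"
        by (intro integrable_integral integrable_continuous_real)
      from has_integral_stretch_real[OF this, of t]
      have "((\<lambda>u. G (t * u)) has_integral (1 / \<bar>t\<bar>) *\<^sub>R integral {0..t} G) ((\<lambda>x. x / t) ` {0..t})"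
        using t0 by simp
      moreover have "(\<lambda>x. x / t) ` {0..t} = {0..1}" using t0 by (simp add: image_divide_atLeastAtMost)
      ultimately have "integral {0..1} (\<lambda>u. G (t * u)) = (1 / t) *\<^sub>R integral {0..t} G"
        using t0 by (simp add: integral_unique)
      moreover have "V t = - (of_real x * of_real t) * integral {0..1} (\<lambda>u. G (t * u))"
        unfolding V_def G_def using eqW[OF t xR] by simp
      ultimately show ?thesis using t0 by (simp add: scaleR_conv_of_real)
    qed (use eqW[OF t xR] in \<open>simp add: V_def\<close>)
    define t where "t = 1 - \<xi> / x"

    have seg: "1 - \<eta> / x \<in> {0..3}" if "\<eta> \<in> closed_segment x (-2*x)" for \<eta>
    proof -
      from that obtain u where u: "0 \<le> u" "u \<le> 1" "\<eta> = (1 - u) *\<^sub>R x + u *\<^sub>R (-2*x)"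
        unfolding closed_segment_def by blast
      then have "\<eta> = (1 - 3 * u) * x" by (simp add: algebra_simps)
      then have "1 - \<eta> / x = 3 * u" using x by simp
      then show ?thesis using u by auto
    qed
    have t: "t \<in> {0..3}" using seg[OF \<xi>] by (simp add: t_def)
    have \<xi>t: "(1 - t) * x = \<xi>" using x by (simp add: t_def)
    have Yt: "Y x \<xi> = Re (V t)" by (simp add: Y_def V_def t_def)
    have "((\<lambda>t. integral {0..t} G) has_vector_derivative G t) (at t within {0..3})"
      by (rule integral_has_vector_derivative[OF contG t])
    from has_vector_derivative_mult_right[OF this, of "- of_real x"]
    have "(V has_vector_derivative - of_real x * G t) (at t within {0..3})"
      by (rule has_vector_derivative_transform[OF t, rotated]) (simp add: Veq)
    then have dV: "(V has_vector_derivative - of_real x * G t) (at (1 - \<xi> / x) within (\<lambda>\<eta>. 1 - \<eta> / x) ` closed_segment x (-2*x))"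
      unfolding t_def[symmetric] by (rule has_vector_derivative_within_subset) (use seg in auto)
    have "((\<lambda>\<eta>. 1 - \<eta> / x) has_vector_derivative - (1 / x)) (at \<xi> within closed_segment x (-2*x))"
      using x by (auto simp flip: has_real_derivative_iff_has_vector_derivative intro!: derivative_eq_intros)
    from vector_diff_chain_within[OF this dV]
    have "((\<lambda>\<eta>. V (1 - \<eta> / x)) has_vector_derivative G t) (at \<xi> within closed_segment x (-2*x))"
      using x by (simp add: o_def scaleR_conv_of_real)
    then have "((\<lambda>\<eta>. Re (V (1 - \<eta> / x))) has_vector_derivative Re (G t)) (at \<xi> within closed_segment x (-2*x))"
      by (rule bounded_linear.has_vector_derivative[OF bounded_linear_Re])
    moreover have "Re (G t) = slope F \<xi> (Y x \<xi>)"
    proof -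
      have "G t = g (of_real \<xi>, of_real (Y x \<xi>))"
        unfolding G_def \<xi>t Yt using Vr(1)[OF t] by simp
      also have "\<dots> = of_real (slope F \<xi> (Y x \<xi>))"
        using arg[OF t] Vr[OF t] \<rho> unfolding \<xi>t Yt by (intro gr) (auto intro: order_trans[OF abs_Re_le_cmod])
      finally show ?thesis by simp
    qed
    ultimately have "(Y x has_real_derivative slope F \<xi> (Y x \<xi>)) (at \<xi> within closed_segment x (-2*x))"
      by (simp add: Y_def[abs_def] V_def has_real_derivative_iff_has_vector_derivative)
    moreover have "\<bar>Y x \<xi>\<bar> \<le> \<rho> / 2" unfolding Yt using Vr(2)[OF t] abs_Re_le_cmod[of "V t"] by linarith
    moreover have "norm (V t) \<le> 3 * M * \<bar>x\<bar>"
    proof -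
      have "norm (integral {0..t} G) \<le> M * (t - 0)"
      proof (rule integral_bound)
        show "continuous_on {0..t} G" using contG by (rule continuous_on_subset) (use t in auto)
        fix \<sigma> assume "\<sigma> \<in> {0..t}"
        then have \<sigma>: "\<sigma> \<in> {0..3}" using t by auto
        have "norm (complex_of_real ((1 - \<sigma>) * x)) \<le> \<rho>" unfolding norm_of_real using arg[OF \<sigma>] .
        then show "norm (G \<sigma>) \<le> M"
          unfolding G_def using Vr(2)[OF \<sigma>] \<rho> by (intro M) auto
      qed (use t in auto)
      also have "\<dots> \<le> M * 3" using t M0 by (intro mult_left_mono) auto
      finally have "norm (integral {0..t} G) \<le> 3 * M" by simp
      then have "\<bar>x\<bar> * norm (integral {0..t} G) \<le> \<bar>x\<bar> * (3 * M)" by (intro mult_left_mono) auto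
      then show ?thesis unfolding Veq[OF t] by (simp add: norm_mult mult.commute)
    qed
    then have "\<bar>Y x \<xi>\<bar> \<le> 3 * M * \<bar>x\<bar>" unfolding Yt using abs_Re_le_cmod[of "V t"] by linarith
    ultimately show ?thesis by blast
  qed
  show ?thesis
  \<comment> \<open>The parameter value \<open>t = 1\<close> belongs to the abscissa
    \<open>(1 - 1) * z = 0\<close>, so \<open>W (1, z)\<close> is the height over 0.\<close>
  proof (rule that[of R \<rho> L M "\<lambda>z. W (1, z)" Y])
    show "\<bar>slope F x y - slope F x y'\<bar> \<le> L * \<bar>y - y'\<bar>" if "\<bar>x\<bar> \<le> \<rho>" "\<bar>y\<bar> \<le> \<rho>" "\<bar>y'\<bar> \<le> \<rho>" for x y y'
      using L[of "of_real x" "of_real y" "of_real y'"] that gr[of x y] gr[of x y'] by (simp flip: of_real_diff)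
    show "W (1, of_real x) = of_real (Y x 0)" if "\<bar>x\<bar> < R" for x
      using Wr[of 1 x] that by (simp add: Y_def)
    show "Y x x = 0" if "\<bar>x\<bar> < R" for x
      using eqW[of 0 "of_real x"] eqW[of 1 0] R that by (cases "x = 0") (simp_all add: Y_def)
    show "(\<lambda>z. W (1, z)) holomorphic_on ball 0 R" by (rule holW) auto
  qed (use R L0 M0 pos ode in auto)
qed

lemma analytic_vfield_lipschitz:
  assumes "analytic_vfield F"
  shows "locally_lipschitz F"
  unfolding locally_lipschitz_def
proof
  fix p
  have F: "real_analytic2 (\<lambda>p. fst (F p))" "real_analytic2 (\<lambda>p. snd (F p))"
    using assms by (auto simp: analytic_vfield_def)
  obtain r1 L1 where 1: "r1 > 0" "\<And>q q'. q \<in> ball p r1 \<Longrightarrow> q' \<in> ball p r1 \<Longrightarrow> dist (fst (F q)) (fst (F q')) \<le> L1 * dist q q'"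
    using real_analytic2_lipschitz[OF F(1), where p = p] by blast
  obtain r2 L2 where 2: "r2 > 0" "\<And>q q'. q \<in> ball p r2 \<Longrightarrow> q' \<in> ball p r2 \<Longrightarrow> dist (snd (F q)) (snd (F q')) \<le> L2 * dist q q'"
    using real_analytic2_lipschitz[OF F(2), where p = p] by blast
  have "\<forall>q\<in>ball p (min r1 r2). \<forall>q'\<in>ball p (min r1 r2). dist (F q) (F q') \<le> (L1 + L2) * dist q q'"
  proof (intro ballI)
    fix q q' assume q: "q \<in> ball p (min r1 r2)" "q' \<in> ball p (min r1 r2)"
    have "dist (F q) (F q') = sqrt ((dist (fst (F q)) (fst (F q')))\<^sup>2 + (dist (snd (F q)) (snd (F q')))\<^sup>2)"
      by (simp add: dist_prod_def)
    also have "\<dots> \<le> dist (fst (F q)) (fst (F q')) + dist (snd (F q)) (snd (F q'))"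
      by (rule sqrt_sum_squares_le_sum) auto
    also have "\<dots> \<le> L1 * dist q q' + L2 * dist q q'"
      using 1(2)[of q q'] 2(2)[of q q'] q by (intro add_mono) auto
    finally show "dist (F q) (F q') \<le> (L1 + L2) * dist q q'" by (simp add: distrib_right)
  qed
  then show "\<exists>r>0. \<exists>L. \<forall>q\<in>ball p r. \<forall>q'\<in>ball p r. dist (F q) (F q') \<le> L * dist q q'"
    using 1(1) 2(1) by (meson min_less_iff_conj)
qed

text \<open>The order condition says nothing at \<open>x = 0\<close> itself, since its filter is
  punctured; the value there follows from the continuity of \<open>F\<close>.\<close>

lemma slope_asymptotics:
  assumes F: "analytic_vfield F" and P0: "fst (F (0, 0)) \<noteq> 0" and k: "k \<ge> 1"
    and c: "(\<lambda>x. snd (F (x, 0)) - c * x ^ (2 * k - 1)) \<in> O[at 0](\<lambda>x. x ^ (2 * k))"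
  shows "((\<lambda>x. slope F x 0 / x ^ (2 * k - 1)) \<longlongrightarrow> c / fst (F (0, 0))) (at 0)" and "slope F 0 0 = 0"
proof -
  have "continuous_on UNIV F" by (rule locally_lipschitz_continuous[OF analytic_vfield_lipschitz[OF F]])
  then have "continuous_on UNIV (\<lambda>x. F (x, 0))"
    by (rule continuous_on_compose2) (auto intro!: continuous_intros)
  then have "((\<lambda>x. F (x, 0)) \<longlongrightarrow> F (0, 0)) (at 0)"
    by (simp add: continuous_on_eq_continuous_at isCont_def)
  then have cont: "((\<lambda>x. fst (F (x, 0))) \<longlongrightarrow> fst (F (0, 0))) (at 0)"
    "((\<lambda>x. snd (F (x, 0))) \<longlongrightarrow> snd (F (0, 0))) (at 0)"
    by (auto intro!: tendsto_intros)
  obtain B where B: "\<forall>\<^sub>F x in at 0. norm (snd (F (x, 0)) - c * x ^ (2 * k - 1)) \<le> B * norm (x ^ (2 * k))"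
    using landau_o.bigE[OF c] by blast
  have "((\<lambda>x. (snd (F (x, 0)) - c * x ^ (2 * k - 1)) / x ^ (2 * k - 1)) \<longlongrightarrow> 0) (at 0)"
  proof (rule Lim_null_comparison)
    show "\<forall>\<^sub>F x in at 0. norm ((snd (F (x, 0)) - c * x ^ (2 * k - 1)) / x ^ (2 * k - 1)) \<le> B * \<bar>x\<bar>"
      using B eventually_neq_at_within[of 0 0]
    proof eventually_elim
      case (elim x)
      have "x ^ (2 * k) = x * x ^ (2 * k - 1)" using k by (cases k) auto
      then have "norm (snd (F (x, 0)) - c * x ^ (2 * k - 1)) \<le> B * \<bar>x\<bar> * \<bar>x ^ (2 * k - 1)\<bar>"
        using elim by (simp add: abs_mult mult.assoc)
      then show ?case using elim by (simp add: norm_divide pos_divide_le_eq)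
    qed
    show "((\<lambda>x. B * \<bar>x\<bar>) \<longlongrightarrow> 0) (at 0)" by (auto intro!: tendsto_eq_intros)
  qed
  then have "((\<lambda>x. (snd (F (x, 0)) - c * x ^ (2 * k - 1)) / x ^ (2 * k - 1) + c) \<longlongrightarrow> 0 + c) (at 0)"
    by (intro tendsto_intros)
  then have "((\<lambda>x. (snd (F (x, 0)) - c * x ^ (2 * k - 1)) / x ^ (2 * k - 1) + c) \<longlongrightarrow> c) (at 0)"
    by simp
  then have 1: "((\<lambda>x. snd (F (x, 0)) / x ^ (2 * k - 1)) \<longlongrightarrow> c) (at 0)"
  proof (rule Lim_transform_eventually)
    show "\<forall>\<^sub>F x in at 0. (snd (F (x, 0)) - c * x ^ (2 * k - 1)) / x ^ (2 * k - 1) + c = snd (F (x, 0)) / x ^ (2 * k - 1)"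
      using eventually_neq_at_within[of "0::real" 0 UNIV] by eventually_elim (simp add: diff_divide_distrib)
  qed
  from tendsto_divide[OF 1 cont(1) P0] show lim: "((\<lambda>x. slope F x 0 / x ^ (2 * k - 1)) \<longlongrightarrow> c / fst (F (0, 0))) (at 0)"
    by (simp add: slope_def divide_divide_eq_left mult.commute)
  have "((\<lambda>x. snd (F (x, 0)) / x ^ (2 * k - 1) * x ^ (2 * k - 1)) \<longlongrightarrow> c * 0 ^ (2 * k - 1)) (at 0)"
    by (intro tendsto_intros 1)
  then have "((\<lambda>x. snd (F (x, 0)) / x ^ (2 * k - 1) * x ^ (2 * k - 1)) \<longlongrightarrow> 0) (at 0)"
    using k by (simp add: power_0_left)
  then have "((\<lambda>x. snd (F (x, 0))) \<longlongrightarrow> 0) (at 0)"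
  proof (rule Lim_transform_eventually)
    show "\<forall>\<^sub>F x in at 0. snd (F (x, 0)) / x ^ (2 * k - 1) * x ^ (2 * k - 1) = snd (F (x, 0))"
      using eventually_neq_at_within[of "0::real" 0 UNIV] by eventually_elim simp
  qed
  with cont(2) have "snd (F (0, 0)) = 0"
    by (metis LIM_unique)
  then show "slope F 0 0 = 0" by (simp add: slope_def)
qed

text \<open>To leading order the slope along the graph is \<open>c * \<xi> ^ (2 * k - 1)\<close>,
  whose integral from \<open>x\<close> to 0 is \<open>- c * x ^ (2 * k) / (2 * k)\<close>. The
  dependence of the slope on the height costs at most \<open>L * \<bar>Y\<bar>\<close>, which is
  itself of order \<open>x ^ (2 * k)\<close> and is integrated over a length
  \<open>\<bar>x\<bar>\<close>, hence negligible.\<close>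

lemma graph_asymptotics:
  fixes f :: "real \<Rightarrow> real \<Rightarrow> real"
  assumes R: "R > 0" and L0: "L \<ge> 0" and k: "k \<ge> 1"
    and lip: "\<And>x y. \<bar>x\<bar> < R \<Longrightarrow> \<bar>y\<bar> \<le> \<rho> \<Longrightarrow> \<bar>f x y - f x 0\<bar> \<le> L * \<bar>y\<bar>"
    and Yx: "\<And>x. \<bar>x\<bar> < R \<Longrightarrow> Y x x = 0"
    and dY: "\<And>x \<xi>. \<bar>x\<bar> < R \<Longrightarrow> x \<noteq> 0 \<Longrightarrow> \<xi> \<in> closed_segment x 0 \<Longrightarrow>
       (Y x has_real_derivative f \<xi> (Y x \<xi>)) (at \<xi> within closed_segment x 0)"
    and bY: "\<And>x \<xi>. \<bar>x\<bar> < R \<Longrightarrow> x \<noteq> 0 \<Longrightarrow> \<xi> \<in> closed_segment x 0 \<Longrightarrow> \<bar>Y x \<xi>\<bar> \<le> \<rho>"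
    and c: "((\<lambda>x. f x 0 / x ^ (2 * k - 1)) \<longlongrightarrow> c) (at 0)" and f0: "f 0 0 = 0"
  shows "((\<lambda>x. Y x 0 / x ^ (2 * k)) \<longlongrightarrow> - c / (2 * k)) (at 0)"
proof (rule tendstoI)
  fix \<epsilon>' :: real assume \<epsilon>': "\<epsilon>' > 0"
  define \<epsilon> where "\<epsilon> = \<epsilon>' / 3"
  have \<epsilon>: "\<epsilon> > 0" using \<epsilon>' by (simp add: \<epsilon>_def)
  obtain d where d: "d > 0" and c': "\<And>x. x \<noteq> 0 \<Longrightarrow> dist x 0 < d \<Longrightarrow> dist (f x 0 / x ^ (2 * k - 1)) c < \<epsilon>"
    using tendstoD[OF c \<epsilon>] unfolding eventually_at by blast
  define C where "C = \<bar>c\<bar> + \<epsilon>"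
  have C: "C > 0" using \<epsilon> by (simp add: C_def add_nonneg_pos)
  \<comment> \<open>The last two entries give \<open>L * \<bar>x\<bar> \<le> 1 / 2\<close>, which
    lets the maximal height \<open>A\<close> be bounded although it occurs on both sides, and
    \<open>2 * L * C * \<bar>x\<bar> \<le> \<epsilon>\<close>, which makes the effect of a nonzero
    height as small as the error in the slope.\<close>
  define s where "s = Min {d, R, 1 / (2 * (L + 1)), \<epsilon> / (2 * (L + 1) * C)}"
  have s: "s > 0" using d R L0 \<epsilon> C by (simp add: s_def)
  show "\<forall>\<^sub>F x in at 0. dist (Y x 0 / x ^ (2 * k)) (- c / (2 * k)) < \<epsilon>'"
    unfolding eventually_at
  proof (intro exI[of _ s] conjI ballI impI s)
    fix x :: real assume "x \<noteq> 0 \<and> dist x 0 < s"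
    then have x: "x \<noteq> 0" "\<bar>x\<bar> < d" "\<bar>x\<bar> < R" "\<bar>x\<bar> < 1 / (2 * (L + 1))" "\<bar>x\<bar> < \<epsilon> / (2 * (L + 1) * C)"
      by (auto simp: s_def)
    have xL: "L * \<bar>x\<bar> \<le> 1 / 2"
      using x(4) L0 by (simp add: field_simps)
    have xLC: "2 * L * C * \<bar>x\<bar> \<le> \<epsilon>"
    proof -
      have "\<bar>x\<bar> * (2 * (L + 1) * C) < \<epsilon>" using x(5) L0 C by (simp add: pos_less_divide_eq)
      moreover have "2 * L * C * \<bar>x\<bar> \<le> \<bar>x\<bar> * (2 * (L + 1) * C)"
        using C by (simp add: algebra_simps)
      ultimately show ?thesis by simp
    qed
    define S where "S = closed_segment x 0"
    have S: "\<bar>\<xi>\<bar> \<le> \<bar>x\<bar>" if "\<xi> \<in> S" for \<xi>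
      using that unfolding S_def closed_segment_eq_real_ivl by (auto split: if_splits)
    have xS: "x \<in> S" "0 \<in> S" by (auto simp: S_def)
    have slope: "\<bar>f \<xi> 0 - c * \<xi> ^ (2 * k - 1)\<bar> \<le> \<epsilon> * \<bar>x\<bar> ^ (2 * k - 1)" if \<xi>: "\<xi> \<in> S" for \<xi>
    proof (cases "\<xi> = 0")
      case True
      then show ?thesis using f0 k \<epsilon> by (simp add: power_0_left)
    next
      case False
      have "dist (f \<xi> 0 / \<xi> ^ (2 * k - 1)) c < \<epsilon>" using S[OF \<xi>] x False by (intro c') auto
      then have "\<bar>f \<xi> 0 / \<xi> ^ (2 * k - 1) - c\<bar> * \<bar>\<xi> ^ (2 * k - 1)\<bar> \<le> \<epsilon> * \<bar>\<xi> ^ (2 * k - 1)\<bar>"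
        by (intro mult_right_mono) (auto simp: dist_real_def)
      also have "\<bar>f \<xi> 0 / \<xi> ^ (2 * k - 1) - c\<bar> * \<bar>\<xi> ^ (2 * k - 1)\<bar> = \<bar>f \<xi> 0 - c * \<xi> ^ (2 * k - 1)\<bar>"
        using False by (simp add: left_diff_distrib flip: abs_mult)
      also have "\<bar>\<xi> ^ (2 * k - 1)\<bar> \<le> \<bar>x\<bar> ^ (2 * k - 1)" unfolding power_abs
        by (intro power_mono S \<xi>) auto
      finally show ?thesis using \<epsilon> by (simp add: mult_left_mono)
    qed
    have cS: "convex S" "compact S" by (simp_all add: S_def)
    have dYS: "(Y x has_real_derivative f \<xi> (Y x \<xi>)) (at \<xi> within S)" if "\<xi> \<in> S" for \<xi>
      using dY[of x \<xi>] x that by (simp add: S_def)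
    have "continuous_on S (\<lambda>\<xi>. \<bar>Y x \<xi>\<bar>)"
      using DERIV_continuous_on[of S "Y x", OF dYS] by (rule continuous_on_rabs)
    then obtain \<xi>0 where \<xi>0: "\<xi>0 \<in> S" and max: "\<And>\<xi>. \<xi> \<in> S \<Longrightarrow> \<bar>Y x \<xi>\<bar> \<le> \<bar>Y x \<xi>0\<bar>"
      using continuous_attains_sup[OF cS(2)] xS by blast
    define A where "A = \<bar>Y x \<xi>0\<bar>"
    have dist: "\<bar>f \<xi> (Y x \<xi>) - f \<xi> 0\<bar> \<le> L * A" if "\<xi> \<in> S" for \<xi>
    proof -
      have "\<bar>f \<xi> (Y x \<xi>) - f \<xi> 0\<bar> \<le> L * \<bar>Y x \<xi>\<bar>"
        using lip[of \<xi> "Y x \<xi>"] S[OF that] x bY[of x \<xi>] that by (simp add: S_def)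
      also have "\<dots> \<le> L * A" unfolding A_def by (intro mult_left_mono max that L0)
      finally show ?thesis .
    qed
    have pw: "\<bar>x\<bar> ^ (2 * k - 1) * \<bar>x\<bar> = \<bar>x\<bar> ^ (2 * k)" using k by (cases k) auto
    have "norm (Y x \<xi>0 - Y x x) \<le> (C * \<bar>x\<bar> ^ (2 * k - 1) + L * A) * norm (\<xi>0 - x)"
    proof (rule field_differentiable_bound[OF cS(1) dYS _ \<xi>0 xS(1)])
      fix \<xi> assume \<xi>: "\<xi> \<in> S"
      have "\<bar>c * \<xi> ^ (2 * k - 1)\<bar> \<le> \<bar>c\<bar> * \<bar>x\<bar> ^ (2 * k - 1)"
        unfolding abs_mult power_abs by (intro mult_left_mono power_mono S \<xi>) auto
      then show "norm (f \<xi> (Y x \<xi>)) \<le> C * \<bar>x\<bar> ^ (2 * k - 1) + L * A"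
        using slope[OF \<xi>] dist[OF \<xi>] unfolding C_def distrib_right real_norm_def by linarith
    qed
    also have "\<dots> \<le> (C * \<bar>x\<bar> ^ (2 * k - 1) + L * A) * \<bar>x\<bar>"
    proof (rule mult_left_mono)
      show "norm (\<xi>0 - x) \<le> \<bar>x\<bar>"
        using \<xi>0 unfolding S_def closed_segment_eq_real_ivl by (auto split: if_splits)
      show "0 \<le> C * \<bar>x\<bar> ^ (2 * k - 1) + L * A" using C L0 by (auto simp: A_def)
    qed
    finally have "A \<le> C * \<bar>x\<bar> ^ (2 * k) + (L * \<bar>x\<bar>) * A"
      using Yx[of x] x pw by (simp add: A_def algebra_simps)
    moreover have "(L * \<bar>x\<bar>) * A \<le> 1 / 2 * A" using xL by (rule mult_right_mono) (simp add: A_def)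
    ultimately have A: "A \<le> 2 * C * \<bar>x\<bar> ^ (2 * k)" by simp
    \<comment> \<open>Deviation from the antiderivative of the leading slope; \<open>D 0\<close> is
      the height sought, and \<open>D x\<close> is explicit because the graph vanishes at
      \<open>x\<close>.\<close>
    define D where "D \<xi> = Y x \<xi> - c * \<xi> ^ (2 * k) / (2 * k)" for \<xi>
    have "norm (D 0 - D x) \<le> (L * A + \<epsilon> * \<bar>x\<bar> ^ (2 * k - 1)) * norm (0 - x)"
    proof (rule field_differentiable_bound[OF cS(1) _ _ xS(2,1)])
      fix \<xi> assume \<xi>: "\<xi> \<in> S"
      show "(D has_real_derivative f \<xi> (Y x \<xi>) - c * \<xi> ^ (2 * k - 1)) (at \<xi> within S)"
        unfolding D_def using k by (auto intro!: derivative_eq_intros dYS[OF \<xi>])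
      show "norm (f \<xi> (Y x \<xi>) - c * \<xi> ^ (2 * k - 1)) \<le> L * A + \<epsilon> * \<bar>x\<bar> ^ (2 * k - 1)"
        using slope[OF \<xi>] dist[OF \<xi>] by simp
    qed
    also have "\<dots> = (L * \<bar>x\<bar>) * A + \<epsilon> * \<bar>x\<bar> ^ (2 * k)" using pw by (simp add: algebra_simps)
    also have "\<dots> \<le> (L * \<bar>x\<bar>) * (2 * C * \<bar>x\<bar> ^ (2 * k)) + \<epsilon> * \<bar>x\<bar> ^ (2 * k)"
      using A L0 by (intro add_right_mono mult_left_mono) auto
    also have "\<dots> = (2 * L * C * \<bar>x\<bar> + \<epsilon>) * \<bar>x\<bar> ^ (2 * k)" by (simp add: algebra_simps)
    also have "\<dots> \<le> (\<epsilon> + \<epsilon>) * \<bar>x\<bar> ^ (2 * k)"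
      using xLC by (intro mult_right_mono) auto
    finally have *: "\<bar>D 0 - D x\<bar> \<le> 2 * \<epsilon> * \<bar>x\<bar> ^ (2 * k)" by simp
    have "D 0 - D x = Y x 0 + c * x ^ (2 * k) / (2 * k)"
      using Yx[of x] x k by (simp add: D_def)
    also have "\<dots> = (Y x 0 / x ^ (2 * k) - (- c / (2 * k))) * x ^ (2 * k)"
      using x by (simp add: distrib_right)
    finally have "\<bar>Y x 0 / x ^ (2 * k) - (- c / (2 * k))\<bar> * \<bar>x\<bar> ^ (2 * k) \<le> 2 * \<epsilon> * \<bar>x\<bar> ^ (2 * k)"
      using * by (simp add: abs_mult power_abs)
    then have "\<bar>Y x 0 / x ^ (2 * k) - (- c / (2 * k))\<bar> \<le> 2 * \<epsilon>" using x by simp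
    then show "dist (Y x 0 / x ^ (2 * k)) (- c / (2 * k)) < \<epsilon>'"
      using \<epsilon> by (simp add: dist_real_def \<epsilon>_def)
  qed
qed

section \<open>Analytic germs on the real line\<close>

text \<open>A real germ is a real-analytic local diffeomorphism of the line that is tangent to the
  identity at 0, given by its holomorphic extension.\<close>

definition real_germ :: "(complex \<Rightarrow> complex) \<Rightarrow> real \<Rightarrow> bool" where
  "real_germ \<sigma> r \<longleftrightarrow> r > 0 \<and> \<sigma> holomorphic_on ball 0 r \<and> \<sigma> 0 = 0 \<and> deriv \<sigma> 0 = 1 \<and>
     (\<forall>x. \<bar>x\<bar> < r \<longrightarrow> \<sigma> (of_real x) \<in> \<real>) \<and> (\<forall>z\<in>ball 0 r. norm (deriv \<sigma> z - 1) \<le> 1 / 4)"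

definition on_real :: "(complex \<Rightarrow> complex) \<Rightarrow> real \<Rightarrow> real" where
  "on_real \<sigma> x = Re (\<sigma> (of_real x))"

lemma real_germ_mono: "real_germ \<sigma> r \<Longrightarrow> 0 < s \<Longrightarrow> s \<le> r \<Longrightarrow> real_germ \<sigma> s"
  unfolding real_germ_def by (auto elim!: holomorphic_on_subset)

lemma real_germ_shrink:
  assumes "\<sigma> holomorphic_on ball 0 r" "r > 0" "\<sigma> 0 = 0" "deriv \<sigma> 0 = 1"
    "\<And>x. \<bar>x\<bar> < r \<Longrightarrow> \<sigma> (of_real x) \<in> \<real>"
  obtains s where "0 < s" "s \<le> r" "real_germ \<sigma> s"
proof -
  have "deriv \<sigma> holomorphic_on ball 0 r" using assms(1) by (simp add: holomorphic_deriv)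
  then have "isCont (deriv \<sigma>) 0"
    using assms(2) by (metis at_within_open centre_in_ball continuous_on_eq_continuous_within holomorphic_on_imp_continuous_on open_ball)
  then have "\<forall>\<^sub>F z in nhds 0. dist (deriv \<sigma> z) (deriv \<sigma> 0) < 1 / 4"
    unfolding isCont_def tendsto_at_iff_tendsto_nhds by (rule tendstoD) simp
  then obtain d where d: "d > 0" "\<And>z. dist z 0 < d \<Longrightarrow> dist (deriv \<sigma> z) (deriv \<sigma> 0) < 1 / 4"
    unfolding eventually_nhds_metric by blast
  show ?thesis
  proof (rule that[of "min d r"])
    show "real_germ \<sigma> (min d r)"
      unfolding real_germ_def
    proof (intro conjI ballI)
      show "\<sigma> holomorphic_on ball 0 (min d r)" by (rule holomorphic_on_subset[OF assms(1)]) auto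
      fix z :: complex assume "z \<in> ball 0 (min d r)"
      then show "norm (deriv \<sigma> z - 1) \<le> 1 / 4" using d(2)[of z] assms(4) by (simp add: dist_norm)
    qed (use assms d in auto)
  qed (use assms d in auto)
qed

lemma real_germ_of_real:
  assumes "real_germ \<sigma> r" "\<bar>x\<bar> < r"
  shows "\<sigma> (of_real x) = of_real (on_real \<sigma> x)"
proof -
  have "\<sigma> (of_real x) \<in> \<real>" using assms by (auto simp: real_germ_def)
  then show ?thesis by (simp add: on_real_def complex_is_Real_iff complex_eq_iff)
qed

lemma on_real_has_derivative:
  assumes "f holomorphic_on ball 0 r" "\<bar>x\<bar> < r"
  shows "(on_real f has_real_derivative on_real (deriv f) x) (at x within S)"
proof -
  have "(f has_field_derivative deriv f (of_real x)) (at (of_real x))"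
    using assms by (intro holomorphic_derivI[of f "ball 0 r"]) auto
  then have "((\<lambda>x. f (of_real x)) has_vector_derivative deriv f (of_real x)) (at x)"
    by (rule has_vector_derivative_real_field)
  then have "((\<lambda>x. Re (f (of_real x))) has_vector_derivative Re (deriv f (of_real x))) (at x)"
    by (rule bounded_linear.has_vector_derivative[OF bounded_linear_Re])
  then show ?thesis
    unfolding on_real_def has_real_derivative_iff_has_vector_derivative
    by (rule has_vector_derivative_at_within)
qed

lemma real_germ_has_derivative:
  assumes "real_germ \<sigma> r" "\<bar>x\<bar> < r"
  shows "(on_real \<sigma> has_real_derivative on_real (deriv \<sigma>) x) (at x within S)"
  using assms by (intro on_real_has_derivative) (auto simp: real_germ_def)

lemma real_germ_0 [simp]: "real_germ \<sigma> r \<Longrightarrow> on_real \<sigma> 0 = 0"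
  by (simp add: real_germ_def on_real_def)

text \<open>\<open>\<sigma>\<close> minus the identity is \<open>1 / 4\<close>-Lipschitz; the
  factors \<open>3 / 4\<close> and \<open>5 / 4\<close> in the estimates on germs originate
  here.\<close>

lemma real_germ_diff:
  assumes "real_germ \<sigma> r" "\<bar>x\<bar> < r" "\<bar>y\<bar> < r"
  shows "\<bar>(on_real \<sigma> x - on_real \<sigma> y) - (x - y)\<bar> \<le> 1 / 4 * \<bar>x - y\<bar>"
proof -
  have "norm ((on_real \<sigma> x - x) - (on_real \<sigma> y - y)) \<le> 1 / 4 * norm (x - y)"
  proof (rule field_differentiable_bound[of "{-r<..<r}"])
    fix z assume z: "z \<in> {-r<..<r}"
    then have "\<bar>z\<bar> < r" by auto
    from real_germ_has_derivative[OF assms(1) this]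
    show "((\<lambda>x. on_real \<sigma> x - x) has_real_derivative on_real (deriv \<sigma>) z - 1) (at z within {-r<..<r})"
      by (auto intro!: derivative_eq_intros)
    have "norm (deriv \<sigma> (of_real z) - 1) \<le> 1 / 4" using assms(1) z by (auto simp: real_germ_def)
    then show "norm (on_real (deriv \<sigma>) z - 1) \<le> 1 / 4"
      using abs_Re_le_cmod[of "deriv \<sigma> (of_real z) - 1"] by (simp add: on_real_def)
  qed (use assms in auto)
  then show ?thesis by (simp add: algebra_simps)
qed

lemma real_germ_bounds:
  assumes "real_germ \<sigma> r" "\<bar>x\<bar> < r"
  shows "\<bar>on_real \<sigma> x\<bar> \<le> 5 / 4 * \<bar>x\<bar>" "3 / 4 * \<bar>x\<bar> \<le> \<bar>on_real \<sigma> x\<bar>"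
proof -
  have "\<bar>on_real \<sigma> x - x\<bar> \<le> 1 / 4 * \<bar>x\<bar>"
    using real_germ_diff[OF assms, of 0] real_germ_0[OF assms(1)] assms by simp
  then show "\<bar>on_real \<sigma> x\<bar> \<le> 5 / 4 * \<bar>x\<bar>" "3 / 4 * \<bar>x\<bar> \<le> \<bar>on_real \<sigma> x\<bar>" by - linarith+
qed

lemma real_germ_mono_bounds:
  assumes "real_germ \<sigma> r" "\<bar>x\<bar> < r" "\<bar>y\<bar> < r" "x \<le> y"
  shows "3 / 4 * (y - x) \<le> on_real \<sigma> y - on_real \<sigma> x" "on_real \<sigma> y - on_real \<sigma> x \<le> 5 / 4 * (y - x)"
proof -
  have "\<bar>y - x\<bar> = y - x" using assms by simp
  then have "\<bar>(on_real \<sigma> y - on_real \<sigma> x) - (y - x)\<bar> \<le> 1 / 4 * (y - x)"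
    using real_germ_diff[OF assms(1,3,2)] by simp
  then show "3 / 4 * (y - x) \<le> on_real \<sigma> y - on_real \<sigma> x" "on_real \<sigma> y - on_real \<sigma> x \<le> 5 / 4 * (y - x)"
    unfolding abs_le_iff right_diff_distrib by - linarith+
qed

lemma real_germ_less_iff:
  assumes "real_germ \<sigma> r" "\<bar>x\<bar> < r" "\<bar>y\<bar> < r"
  shows "on_real \<sigma> x < on_real \<sigma> y \<longleftrightarrow> x < y"
proof -
  have less: "on_real \<sigma> x < on_real \<sigma> y" if "x < y" "\<bar>x\<bar> < r" "\<bar>y\<bar> < r" for x y
    using real_germ_mono_bounds(1)[OF assms(1) that(2,3)] that by simp
  show ?thesis using less[of x y] less[of y x] assms by (metis linorder_less_linear order_less_asym)
qed

lemma real_germ_eq_iff: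
  assumes "real_germ \<sigma> r" "\<bar>x\<bar> < r" "\<bar>y\<bar> < r"
  shows "on_real \<sigma> x = on_real \<sigma> y \<longleftrightarrow> x = y"
  using real_germ_less_iff[OF assms] real_germ_less_iff[OF assms(1,3,2)] by (metis linorder_less_linear order_less_irrefl)

lemma real_germ_continuous: "real_germ \<sigma> r \<Longrightarrow> S \<subseteq> {-r<..<r} \<Longrightarrow> continuous_on S (on_real \<sigma>)"
  by (intro DERIV_continuous_on[OF real_germ_has_derivative]) (auto simp: subset_iff abs_less_iff)

lemma real_germ_solve:
  assumes \<sigma>: "real_germ \<sigma> r" and x: "\<bar>x\<bar> < r / 2" and y: "\<bar>y\<bar> \<le> 5 / 4 * \<bar>x\<bar>"
  obtains u where "\<bar>u\<bar> \<le> 2 * \<bar>x\<bar>" "on_real \<sigma> u = y"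
proof -
  have r: "r > 0" using \<sigma> by (simp add: real_germ_def)
  have "on_real \<sigma> (- (2 * \<bar>x\<bar>)) \<le> - (3/2) * \<bar>x\<bar>" "3/2 * \<bar>x\<bar> \<le> on_real \<sigma> (2 * \<bar>x\<bar>)"
  proof -
    have a: "\<bar>2 * \<bar>x\<bar>\<bar> < r" "\<bar>- (2 * \<bar>x\<bar>)\<bar> < r" "\<bar>0::real\<bar> < r" using x r by auto
    show "on_real \<sigma> (- (2 * \<bar>x\<bar>)) \<le> - (3/2) * \<bar>x\<bar>" "3/2 * \<bar>x\<bar> \<le> on_real \<sigma> (2 * \<bar>x\<bar>)"
      using real_germ_mono_bounds[OF \<sigma> a(3,1)] real_germ_mono_bounds[OF \<sigma> a(2,3)] real_germ_0[OF \<sigma>] by simp_all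
  qed
  then have "\<exists>u. - (2 * \<bar>x\<bar>) \<le> u \<and> u \<le> 2 * \<bar>x\<bar> \<and> on_real \<sigma> u = y"
    using y x by (intro IVT' real_germ_continuous[OF \<sigma>]) auto
  then obtain u where "- (2 * \<bar>x\<bar>) \<le> u" "u \<le> 2 * \<bar>x\<bar>" "on_real \<sigma> u = y" by blast
  then show ?thesis by (intro that[of u]) auto
qed

lemma real_germ_asymp:
  assumes "real_germ \<sigma> r"
  shows "((\<lambda>x. on_real \<sigma> x / x) \<longlongrightarrow> 1) (at 0)"
proof -
  have "(on_real \<sigma> has_real_derivative on_real (deriv \<sigma>) 0) (at 0)"
    using assms by (intro real_germ_has_derivative) (auto simp: real_germ_def)
  then show ?thesis using assms
    by (simp add: has_field_derivative_iff) (simp add: on_real_def real_germ_def)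
qed

text \<open>A nonconstant \<open>h\<close> factors as \<open>z ^ n * g z\<close> with
  \<open>g 0 \<noteq> 0\<close>; the real limit forces \<open>n = m\<close> and
  \<open>g 0 = \<kappa>\<close>, and an \<open>m\<close>-th root of \<open>g / \<kappa>\<close> near
  1 supplies the germ.\<close>

lemma holomorphic_root:
  fixes y :: "real \<Rightarrow> real"
  assumes R: "R > 0" and h: "h holomorphic_on ball 0 R" and hy: "\<And>x. \<bar>x\<bar> < R \<Longrightarrow> h (of_real x) = of_real (y x)"
    and lim: "((\<lambda>x. y x / x ^ m) \<longlongrightarrow> \<kappa>) (at 0)" and \<kappa>: "\<kappa> \<noteq> 0" and m: "m \<ge> 1"
  obtains r \<sigma> where "0 < r" "r \<le> R" "real_germ \<sigma> r" "\<And>x. \<bar>x\<bar> < r \<Longrightarrow> y x = \<kappa> * on_real \<sigma> x ^ m"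
proof -
  have lim0: "((\<lambda>x. y x / x ^ m * x ^ j) \<longlongrightarrow> 0) (at 0)" if "j > 0" for j
  proof -
    have "((\<lambda>x. y x / x ^ m * x ^ j) \<longlongrightarrow> \<kappa> * 0 ^ j) (at 0)" by (intro tendsto_intros lim)
    then show ?thesis using that by (simp add: power_0_left)
  qed
  have conth: "isCont h 0"
    using h R by (metis at_within_open centre_in_ball continuous_on_eq_continuous_within holomorphic_on_imp_continuous_on open_ball)
  have ev: "\<forall>\<^sub>F x in at (0::real). x \<noteq> 0 \<and> \<bar>x\<bar> < e" if "e > 0" for e
    unfolding eventually_at using that by (intro exI[of _ e]) auto
  have ty: "(y \<longlongrightarrow> 0) (at 0)"
  proof (rule Lim_transform_eventually[OF lim0])
    show "\<forall>\<^sub>F x in at 0. y x / x ^ m * x ^ m = y x" using ev[OF R] by eventually_elim simp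
  qed (use m in simp)
  have of_real_at: "filterlim (of_real :: real \<Rightarrow> complex) (at 0) (at 0)"
    by (rule filterlim_atI) (auto intro!: tendsto_eq_intros simp: eventually_at_filter)
  have along: "((\<lambda>x. f (of_real x)) \<longlongrightarrow> f 0) (at (0::real))" if "isCont f 0" for f :: "complex \<Rightarrow> complex"
    using filterlim_compose[OF that[unfolded isCont_def] of_real_at] .
  have "((\<lambda>x. complex_of_real (y x)) \<longlongrightarrow> h 0) (at 0)"
    by (rule Lim_transform_eventually[OF along[OF conth]]) (use ev[OF R] hy in \<open>auto elim!: eventually_mono\<close>)
  moreover have "((\<lambda>x. complex_of_real (y x)) \<longlongrightarrow> of_real 0) (at 0)" by (intro tendsto_intros ty)
  ultimately have h0: "h 0 = 0" using LIM_unique by fastforce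
  have ynz: "\<forall>\<^sub>F x in at 0. y x \<noteq> 0"
    using tendsto_imp_eventually_ne[OF lim \<kappa>] by eventually_elim auto
  have nc: "\<not> h constant_on ball 0 R"
  proof
    assume "h constant_on ball 0 R"
    then have "h z = 0" if "z \<in> ball 0 R" for z using h0 R that by (auto simp: constant_on_def)
    then have "y x = 0" if "\<bar>x\<bar> < R" for x using hy[OF that] that by simp
    then show False
      using eventually_happens'[OF _ eventually_conj[OF ynz ev[OF R]]] by (auto simp: trivial_limit_at)
  qed
  obtain g s n where n: "0 < n" and s: "0 < s" "ball (0::complex) s \<subseteq> ball 0 R" and g: "g holomorphic_on ball 0 s"
    and hg: "\<And>w. w \<in> ball 0 s \<Longrightarrow> h w = (w - 0) ^ n * g w" and gnz: "\<And>w. w \<in> ball 0 s \<Longrightarrow> g w \<noteq> 0"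
    by (rule holomorphic_factor_zero_nonconstant[OF h open_ball connected_ball centre_in_ball[THEN iffD2, OF R] h0 nc]) (rule that)
  have sR: "s \<le> R" using s(2) s(1) by (simp add: ball_subset_ball_iff)
  have contg: "isCont g 0"
    using g s by (metis at_within_open centre_in_ball continuous_on_eq_continuous_within holomorphic_on_imp_continuous_on open_ball)
  have yg: "of_real (y x) = of_real x ^ n * g (of_real x)" if "\<bar>x\<bar> < s" for x
    using hg[of "of_real x"] hy[of x] that sR by simp
  \<comment> \<open>Along the reals, a smaller \<open>n\<close> would force \<open>g 0 = 0\<close>
    and a larger one \<open>\<kappa> = 0\<close>.\<close>
  have "m = n"
  proof (rule ccontr)
    assume "m \<noteq> n"
    then consider "n < m" | "m < n" by linarith
    then show False
    proof cases
      case 1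
      have "((\<lambda>x. complex_of_real (y x / x ^ m * x ^ (m - n))) \<longlongrightarrow> of_real 0) (at 0)"
        using 1 by (intro tendsto_intros lim0) auto
      moreover have "((\<lambda>x. complex_of_real (y x / x ^ m * x ^ (m - n))) \<longlongrightarrow> g 0) (at 0)"
      proof (rule Lim_transform_eventually[OF along[OF contg]])
        show "\<forall>\<^sub>F x in at 0. g (complex_of_real x) = complex_of_real (y x / x ^ m * x ^ (m - n))"
          using ev[OF s(1)]
        proof eventually_elim
          case (elim x)
          have "x ^ m = x ^ n * x ^ (m - n)" using 1 by (simp flip: power_add)
          then have "y x / x ^ m * x ^ (m - n) = y x / x ^ n" using elim by simp
          then show ?case using elim yg[of x] by simp
        qed
      qed
      ultimately have "g 0 = of_real 0" using LIM_unique by blast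
      then show False using gnz[of 0] s by simp
    next
      case 2
      have "((\<lambda>x. of_real x ^ (n - m) * g (of_real x)) \<longlongrightarrow> of_real 0 ^ (n - m) * g 0) (at (0::real))"
        by (intro tendsto_intros along contg)
      then have "((\<lambda>x. of_real x ^ (n - m) * g (of_real x)) \<longlongrightarrow> 0) (at (0::real))"
        using 2 by (simp add: power_0_left)
      moreover have "((\<lambda>x. of_real x ^ (n - m) * g (of_real x)) \<longlongrightarrow> complex_of_real \<kappa>) (at (0::real))"
      proof (rule Lim_transform_eventually[OF tendsto_of_real[OF lim]])
        show "\<forall>\<^sub>F x in at 0. complex_of_real (y x / x ^ m) = of_real x ^ (n - m) * g (of_real x)"
          using ev[OF s(1)]
        proof eventually_elim
          case (elim x)
          have "x ^ n = x ^ m * x ^ (n - m)" using 2 by (simp flip: power_add)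
          then have "complex_of_real x ^ n = of_real x ^ m * of_real x ^ (n - m)"
            by (metis of_real_mult of_real_power)
          then show ?case using elim yg[of x] by simp
        qed
      qed
      ultimately have "complex_of_real \<kappa> = 0" using LIM_unique by blast
      then show False using \<kappa> by simp
    qed
  qed
  have g0: "g 0 = of_real \<kappa>"
  proof -
    have "((\<lambda>x. g (of_real x)) \<longlongrightarrow> complex_of_real \<kappa>) (at (0::real))"
    proof (rule Lim_transform_eventually[OF tendsto_of_real[OF lim]])
      show "\<forall>\<^sub>F x in at 0. complex_of_real (y x / x ^ m) = g (of_real x)"
        using ev[OF s(1)] by eventually_elim (use yg \<open>m = n\<close> in auto)
    qed
    then show ?thesis using along[OF contg] LIM_unique by blast
  qed
  \<comment> \<open>Dividing by \<open>\<kappa>\<close> first makes the value at 0 equal to 1, so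
    that the principal logarithm is available, and keeps the root real even if
    \<open>\<kappa> < 0\<close>.\<close>
  define e where "e z = g z / of_real \<kappa>" for z
  have "isCont e 0" unfolding e_def by (intro continuous_intros contg) (use \<kappa> in auto)
  moreover have e0: "e 0 = 1" using g0 \<kappa> by (simp add: e_def)
  ultimately have "\<forall>\<^sub>F z in nhds 0. dist (e z) 1 < 1"
    using tendstoD[of e "e 0" "nhds 0" 1] unfolding isCont_def tendsto_at_iff_tendsto_nhds by simp
  then obtain d where d: "d > 0" "\<And>z. dist z 0 < d \<Longrightarrow> dist (e z) 1 < 1"
    unfolding eventually_nhds_metric by blast
  define t where "t = min s d"
  have t: "t > 0" "t \<le> s" using s d by (auto simp: t_def)
  have Re_e: "Re (e z) > 0" if "z \<in> ball 0 t" for z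
  proof -
    have "norm (1 - e z) < 1" using d(2)[of z] that by (simp add: t_def dist_norm norm_minus_commute)
    then have "Re (1 - e z) < 1" using complex_Re_le_cmod[of "1 - e z"] by linarith
    then show ?thesis by simp
  qed
  have enz: "e z \<noteq> 0" if "z \<in> ball 0 t" for z using Re_e[OF that] by auto
  have hole: "e holomorphic_on ball 0 t" unfolding e_def
    using t \<kappa> by (intro holomorphic_intros holomorphic_on_subset[OF g]) auto
  define q where "q z = exp (Ln (e z) / of_nat m)" for z
  have holq: "q holomorphic_on ball 0 t" unfolding q_def
    using Re_e m by (intro holomorphic_intros hole) (force simp: complex_nonpos_Reals_iff)+
  have qm: "q z ^ m = e z" if "z \<in> ball 0 t" for z
    using enz[OF that] m by (simp add: q_def exp_of_nat_mult[symmetric])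
  define \<sigma> where "\<sigma> z = z * q z" for z
  have \<sigma>0: "\<sigma> 0 = 0" by (simp add: \<sigma>_def)
  have hol\<sigma>: "\<sigma> holomorphic_on ball 0 t" unfolding \<sigma>_def by (intro holomorphic_intros holq)
  have q0: "q 0 = 1" by (simp add: q_def e0)
  have "(q has_field_derivative deriv q 0) (at 0)"
    using holq t by (intro holomorphic_derivI[of q "ball 0 t"]) auto
  then have "(\<sigma> has_field_derivative 1) (at 0)"
    unfolding \<sigma>_def using q0 by (auto intro!: derivative_eq_intros)
  then have d\<sigma>: "deriv \<sigma> 0 = 1" by (rule DERIV_imp_deriv)
  have real\<sigma>: "\<sigma> (of_real x) \<in> \<real>" if "\<bar>x\<bar> < t" for x
  proof -
    have "e (of_real x) \<in> \<real>"
    proof (cases "x = 0")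
      case False
      then have "e (of_real x) = of_real (y x / (x ^ n * \<kappa>))"
        using yg[of x] that t by (simp add: e_def)
      then show ?thesis by simp
    qed (simp add: e0)
    then obtain v where v: "e (of_real x) = of_real v" by (auto elim: Reals_cases)
    then have "v > 0" using Re_e[of "of_real x"] that by simp
    then have "Ln (e (of_real x)) = of_real (ln v)" by (simp add: v Ln_of_real)
    then have "Ln (e (of_real x)) / of_nat m = of_real (ln v / real m)" by simp
    then have "q (of_real x) = of_real (exp (ln v / real m))"
      unfolding q_def by (simp only: exp_of_real)
    then show ?thesis by (simp add: \<sigma>_def)
  qed
  obtain r where r: "0 < r" "r \<le> t" "real_germ \<sigma> r"
    using real_germ_shrink[OF hol\<sigma> t(1) \<sigma>0 d\<sigma> real\<sigma>] by blast
  show ?thesis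
  proof (rule that[OF r(1) _ r(3)])
    show "r \<le> R" using r t sR by simp
    fix x :: real assume x: "\<bar>x\<bar> < r"
    have "complex_of_real (y x) = of_real x ^ m * (of_real \<kappa> * e (of_real x))"
      using yg[of x] x r t \<kappa> \<open>m = n\<close> by (simp add: e_def)
    also have "\<dots> = of_real \<kappa> * \<sigma> (of_real x) ^ m"
      using qm[of "of_real x"] x r by (simp add: \<sigma>_def power_mult_distrib)
    also have "\<dots> = of_real (\<kappa> * on_real \<sigma> x ^ m)"
      using real_germ_of_real[OF r(3) x] by simp
    finally show "y x = \<kappa> * on_real \<sigma> x ^ m" using of_real_eq_iff by blast
  qed
qed

section \<open>Arcs and half-return maps near the contact\<close>

text \<open>The direction of time is part of \<open>G\<close>, so that all arcs run over
  \<open>{0..l}\<close> and forward and backward returns are one notion.\<close>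

definition half_arc :: "real \<Rightarrow> vfield \<Rightarrow> real \<Rightarrow> (real \<Rightarrow> real \<times> real) \<Rightarrow> bool" where
  "half_arc s G l \<alpha> \<longleftrightarrow> l > 0 \<and> solution_on G \<alpha> {0..l} \<and> snd (\<alpha> 0) = 0 \<and> snd (\<alpha> l) = 0 \<and>
     (\<forall>u\<in>{0<..<l}. s * snd (\<alpha> u) > 0)"

lemma half_arc_components:
  assumes "half_arc s G l \<alpha>" "u \<in> {0..l}"
  shows "((\<lambda>u. fst (\<alpha> u)) has_real_derivative fst (G (\<alpha> u))) (at u within {0..l})"
    and "((\<lambda>u. snd (\<alpha> u)) has_real_derivative snd (G (\<alpha> u))) (at u within {0..l})"
proof -
  have "(\<alpha> has_vector_derivative G (\<alpha> u)) (at u within {0..l})"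
    using assms by (auto simp: half_arc_def solution_on_def)
  from bounded_linear.has_vector_derivative[OF bounded_linear_fst this]
    bounded_linear.has_vector_derivative[OF bounded_linear_snd this]
  show "((\<lambda>u. fst (\<alpha> u)) has_real_derivative fst (G (\<alpha> u))) (at u within {0..l})"
    "((\<lambda>u. snd (\<alpha> u)) has_real_derivative snd (G (\<alpha> u))) (at u within {0..l})"
    by (simp_all add: has_real_derivative_iff_has_vector_derivative)
qed

lemma half_arc_continuous: "half_arc s G l \<alpha> \<Longrightarrow> continuous_on {0..l} \<alpha>"
  unfolding half_arc_def solution_on_def
  by (meson continuous_on_eq_continuous_within has_vector_derivative_continuous)

text \<open>A derivative of the wrong sign would carry the arc out of its half plane at once.
  Together with the sign of the normal component this determines the direction of time in which an
  arc can start.\<close>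

lemma half_arc_start_derivative:
  assumes "half_arc s G l \<alpha>"
  shows "s * snd (G (\<alpha> 0)) \<ge> 0"
proof (rule ccontr)
  assume "\<not> s * snd (G (\<alpha> 0)) \<ge> 0"
  moreover have l: "l > 0" using assms by (simp add: half_arc_def)
  then have "((\<lambda>u. s * snd (\<alpha> u)) has_real_derivative s * snd (G (\<alpha> 0))) (at 0 within {0..l})"
    by (intro DERIV_cmult half_arc_components(2)[OF assms]) auto
  ultimately obtain d where d: "d > 0" "\<And>h. 0 < h \<Longrightarrow> 0 + h \<in> {0..l} \<Longrightarrow> h < d \<Longrightarrow> s * snd (\<alpha> (0 + h)) < s * snd (\<alpha> 0)"
    using has_real_derivative_neg_dec_right[of "\<lambda>u. s * snd (\<alpha> u)" "s * snd (G (\<alpha> 0))" 0 "{0..l}"] by auto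
  define h where "h = min (l / 2) (d / 2)"
  have "0 < h" "h < l" "h < d" using d l by (auto simp: h_def)
  then have "s * snd (\<alpha> h) < 0" using d(2)[of h] assms by (auto simp: half_arc_def)
  moreover have "s * snd (\<alpha> h) > 0" using assms \<open>0 < h\<close> \<open>h < l\<close> by (auto simp: half_arc_def)
  ultimately show False by simp
qed

text \<open>Gronwall for the squared difference along the affine path from \<open>c\<close> to
  \<open>e\<close>; parametrising the path handles \<open>e < c\<close> and \<open>c < e\<close>
  alike.\<close>

lemma graph_unique:
  fixes f :: "real \<Rightarrow> real \<Rightarrow> real"
  assumes y1: "\<And>\<xi>. \<xi> \<in> {a..b} \<Longrightarrow> (y1 has_real_derivative f \<xi> (y1 \<xi>)) (at \<xi> within {a..b})"
    and y2: "\<And>\<xi>. \<xi> \<in> {a..b} \<Longrightarrow> (y2 has_real_derivative f \<xi> (y2 \<xi>)) (at \<xi> within {a..b})"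
    and L: "\<And>\<xi>. \<xi> \<in> {a..b} \<Longrightarrow> \<bar>f \<xi> (y1 \<xi>) - f \<xi> (y2 \<xi>)\<bar> \<le> L * \<bar>y1 \<xi> - y2 \<xi>\<bar>"
    and L0: "L \<ge> 0" and c: "c \<in> {a..b}" "y1 c = y2 c" and e: "e \<in> {a..b}"
  shows "y1 e = y2 e"
proof -
  define p where "p t = c + t * (e - c)" for t
  have p: "p t \<in> {a..b}" if "t \<in> {0..1}" for t
  proof -
    have "p t = (1 - t) *\<^sub>R c + t *\<^sub>R e" by (simp add: p_def algebra_simps)
    then show ?thesis using convexD_alt[OF convex_real_interval(5) c(1) e, of t] that by auto
  qed
  define D where "D t = y1 (p t) - y2 (p t)" for t
  define D' where "D' t = (f (p t) (y1 (p t)) - f (p t) (y2 (p t))) * (e - c)" for t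
  have dD: "(D has_real_derivative D' t) (at t within {0..1})" if t: "t \<in> {0..1}" for t
  proof -
    have dp: "(p has_real_derivative (e - c)) (at t within {0..1})"
      unfolding p_def by (auto intro!: derivative_eq_intros)
    have "((y1 \<circ> p) has_real_derivative f (p t) (y1 (p t)) * (e - c)) (at t within {0..1})"
      by (rule DERIV_image_chain[OF _ dp]) (rule DERIV_subset[OF y1[OF p[OF t]]], use p in auto)
    moreover have "((y2 \<circ> p) has_real_derivative f (p t) (y2 (p t)) * (e - c)) (at t within {0..1})"
      by (rule DERIV_image_chain[OF _ dp]) (rule DERIV_subset[OF y2[OF p[OF t]]], use p in auto)
    ultimately show ?thesis unfolding D_def D'_def left_diff_distrib
      by (intro DERIV_diff) (auto simp: o_def)
  qed
  have "(D 1)\<^sup>2 \<le> ((D 0)\<^sup>2 + 0 * 1) * exp ((2 * L * \<bar>e - c\<bar>) * 1)"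
  proof (rule gronwall[where c = 1 and e' = "\<lambda>t. 2 * D t * D' t" and e = "\<lambda>t. (D t)\<^sup>2"])
    fix t :: real assume t: "t \<in> {0..1}"
    show "((\<lambda>t. (D t)\<^sup>2) has_real_derivative 2 * D t * D' t) (at t within {0..1})"
      by (auto intro!: derivative_eq_intros dD[OF t])
    have "\<bar>D' t\<bar> \<le> (L * \<bar>D t\<bar>) * \<bar>e - c\<bar>"
      unfolding D'_def D_def abs_mult by (intro mult_right_mono L p t) auto
    then have "2 * \<bar>D t\<bar> * \<bar>D' t\<bar> \<le> 2 * \<bar>D t\<bar> * ((L * \<bar>D t\<bar>) * \<bar>e - c\<bar>)"
      by (intro mult_left_mono) auto
    moreover have "2 * D t * D' t \<le> 2 * \<bar>D t\<bar> * \<bar>D' t\<bar>"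
      by (metis abs_ge_self abs_mult abs_numeral)
    ultimately show "2 * D t * D' t \<le> 2 * L * \<bar>e - c\<bar> * (D t)\<^sup>2 + 0"
      by (simp add: power2_eq_square mult_ac)
  qed (use L0 in auto)
  then show ?thesis using c by (simp add: D_def p_def)
qed

lemma strictly_decreasing:
  fixes f :: "real \<Rightarrow> real"
  assumes "\<And>x. x \<in> {a..b} \<Longrightarrow> (f has_real_derivative f' x) (at x within {a..b})"
    and "\<And>x. x \<in> {a..b} \<Longrightarrow> f' x < 0" and "a < b"
  shows "f b < f a"
proof -
  have "\<exists>x\<in>{a<..<b}. f b - f a = f' x * (b - a)"
    by (rule mvt_simple[OF assms(3)]) (use assms(1) in \<open>auto simp: has_field_derivative_def\<close>)
  then obtain x where "x \<in> {a<..<b}" "f b - f a = f' x * (b - a)" by blast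
  moreover have "f' x * (b - a) < 0" using assms(2)[of x] assms(3) calculation(1) by (intro mult_neg_pos) auto
  ultimately show ?thesis by simp
qed

text \<open>Bootstrapping on the first exit time from the box: inside the box the distance from the
  solution to the graph satisfies a Gronwall estimate.\<close>

lemma half_arc_on_graph:
  assumes arc: "half_arc s (\<lambda>p. d *\<^sub>R F p) l \<alpha>" and \<alpha>0: "\<alpha> 0 = (x, 0)" and d: "d \<in> {-1, 1}"
    and cont: "continuous_on UNIV F" and L0: "L \<ge> 0"
    and P: "\<And>u v. \<bar>u\<bar> \<le> \<rho> \<Longrightarrow> \<bar>v\<bar> \<le> \<rho> \<Longrightarrow> d * fst (F (u, v)) < 0"
    and L: "\<And>u v v'. \<bar>u\<bar> \<le> \<rho> \<Longrightarrow> \<bar>v\<bar> \<le> \<rho> \<Longrightarrow> \<bar>v'\<bar> \<le> \<rho> \<Longrightarrow> \<bar>slope F u v - slope F u v'\<bar> \<le> L * \<bar>v - v'\<bar>"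
    and x: "x < \<rho>" "- \<rho> < \<psi>" "\<psi> < x"
    and y: "\<And>\<xi>. \<xi> \<in> {\<psi>..x} \<Longrightarrow> (y has_real_derivative slope F \<xi> (y \<xi>)) (at \<xi> within {\<psi>..x})"
    and bnd: "\<And>\<xi>. \<xi> \<in> {\<psi>..x} \<Longrightarrow> \<bar>y \<xi>\<bar> < \<rho>"
    and yz: "y x = 0" "y \<psi> = 0" "\<And>\<xi>. \<xi> \<in> {\<psi><..<x} \<Longrightarrow> y \<xi> \<noteq> 0"
  shows "fst (\<alpha> l) = \<psi>" and "\<And>u. u \<in> {0..l} \<Longrightarrow> fst (\<alpha> u) \<in> {\<psi>..x} \<and> snd (\<alpha> u) = y (fst (\<alpha> u))"
proof -
  have l: "l > 0" using arc by (simp add: half_arc_def)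
  define X where "X u = fst (\<alpha> u)" for u
  define V where "V u = snd (\<alpha> u)" for u
  have X0: "X 0 = x" "V 0 = 0" using \<alpha>0 by (auto simp: X_def V_def)
  have dX: "(X has_real_derivative d * fst (F (X u, V u))) (at u within {0..l})"
    and dV: "(V has_real_derivative d * snd (F (X u, V u))) (at u within {0..l})" if "u \<in> {0..l}" for u
    using half_arc_components[OF arc that] by (auto simp: X_def[abs_def] V_def[abs_def])
  have cX: "continuous_on {0..l} X" "continuous_on {0..l} V"
    using DERIV_continuous_on[of "{0..l}" X, OF dX] DERIV_continuous_on[of "{0..l}" V, OF dV] by auto
  have "compact ((\<lambda>p. fst (F p)) ` (cball 0 \<rho> \<times> cball 0 \<rho>))"
    by (intro compact_continuous_image compact_Times compact_cball continuous_intros)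
       (rule continuous_on_subset[OF cont], simp)
  then obtain B where B: "\<forall>v\<in>(\<lambda>p. fst (F p)) ` (cball 0 \<rho> \<times> cball 0 \<rho>). norm v \<le> B"
    using compact_imp_bounded bounded_iff by blast
  have B: "\<bar>fst (F (u, v))\<bar> \<le> B" if "\<bar>u\<bar> \<le> \<rho>" "\<bar>v\<bar> \<le> \<rho>" for u v
    using B that by force
  have B0: "B \<ge> 0" using order_trans[OF abs_ge_zero B[of x 0]] x by simp
  have down: "X u \<le> x" "0 < u \<Longrightarrow> X u < x"
    if u: "u \<in> {0..l}" and box: "\<And>v. v \<in> {0..u} \<Longrightarrow> \<bar>X v\<bar> \<le> \<rho> \<and> \<bar>V v\<bar> \<le> \<rho>" for u
  proof -
    show *: "X u < x" if "0 < u"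
    proof -
      have "X u < X 0"
      proof (rule strictly_decreasing[where f = X and a = 0 and b = u and f' = "\<lambda>u. d * fst (F (X u, V u))"])
        fix v assume v: "v \<in> {0..u}"
        show "(X has_real_derivative d * fst (F (X v, V v))) (at v within {0..u})"
          by (rule DERIV_subset[OF dX]) (use u v in auto)
        show "d * fst (F (X v, V v)) < 0" using box[OF v] by (intro P) auto
      qed (rule that)
      then show ?thesis by (simp add: X0)
    qed
    show "X u \<le> x" using * u X0 by (cases "u = 0") auto
  qed
  have ride: "V u = y (X u)"
    if u: "u \<in> {0..l}" and box: "\<And>v. v \<in> {0..u} \<Longrightarrow> \<bar>X v\<bar> \<le> \<rho> \<and> \<bar>V v\<bar> \<le> \<rho> \<and> X v \<in> {\<psi>..x}" for u
  proof -
    define D where "D v = V v - y (X v)" for v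
    \<comment> \<open>The second component of \<open>F\<close> is the slope times the first, so the
      error is driven only by the difference of the slopes at the heights \<open>V v\<close> and
      \<open>y (X v)\<close>, which is Lipschitz in the error itself.\<close>
    define D' where "D' v = d * fst (F (X v, V v)) * (slope F (X v) (V v) - slope F (X v) (y (X v)))" for v
    have dD: "(D has_real_derivative D' v) (at v within {0..u})" if v: "v \<in> {0..u}" for v
    proof -
      have v': "v \<in> {0..l}" and sub: "{0..u} \<subseteq> {0..l}" using u v by auto
      have Pn: "fst (F (X v, V v)) \<noteq> 0" using P[of "X v" "V v"] box[OF v] by auto
      have "((y \<circ> X) has_real_derivative slope F (X v) (y (X v)) * (d * fst (F (X v, V v)))) (at v within {0..u})"
      proof (rule DERIV_image_chain)
        show "(X has_real_derivative d * fst (F (X v, V v))) (at v within {0..u})"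
          by (rule DERIV_subset[OF dX[OF v'] sub])
        show "(y has_real_derivative slope F (X v) (y (X v))) (at (X v) within X ` {0..u})"
          by (rule DERIV_subset[OF y]) (use box v in auto)
      qed
      from DERIV_diff[OF DERIV_subset[OF dV[OF v'] sub] this]
      have "(D has_real_derivative d * snd (F (X v, V v)) - slope F (X v) (y (X v)) * (d * fst (F (X v, V v)))) (at v within {0..u})"
        by (simp add: D_def[abs_def] o_def)
      moreover have "snd (F (X v, V v)) = slope F (X v) (V v) * fst (F (X v, V v))"
        using Pn by (simp add: slope_def)
      ultimately show ?thesis by (simp add: D'_def algebra_simps)
    qed
    have "(D u)\<^sup>2 \<le> ((D 0)\<^sup>2 + 0 * u) * exp ((2 * B * L) * u)"
    proof (rule gronwall[where c = u and e' = "\<lambda>t. 2 * D t * D' t" and e = "\<lambda>t. (D t)\<^sup>2"])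
      fix v assume v: "v \<in> {0..u}"
      show "((\<lambda>t. (D t)\<^sup>2) has_real_derivative 2 * D v * D' v) (at v within {0..u})"
        by (auto intro!: derivative_eq_intros dD[OF v])
      have bv: "\<bar>X v\<bar> \<le> \<rho>" "\<bar>V v\<bar> \<le> \<rho>" "X v \<in> {\<psi>..x}" using box[OF v] by auto
      have "\<bar>D' v\<bar> = \<bar>fst (F (X v, V v))\<bar> * \<bar>slope F (X v) (V v) - slope F (X v) (y (X v))\<bar>"
        using d by (auto simp: D'_def abs_mult)
      also have "\<dots> \<le> B * (L * \<bar>D v\<bar>)"
        unfolding D_def using bv bnd[of "X v"] B0 by (intro mult_mono B L) auto
      finally have "2 * \<bar>D v\<bar> * \<bar>D' v\<bar> \<le> 2 * \<bar>D v\<bar> * (B * (L * \<bar>D v\<bar>))"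
        by (intro mult_left_mono) auto
      moreover have "2 * D v * D' v \<le> 2 * \<bar>D v\<bar> * \<bar>D' v\<bar>"
        by (metis abs_ge_self abs_mult abs_numeral)
      ultimately show "2 * D v * D' v \<le> 2 * B * L * (D v)\<^sup>2 + 0"
        by (simp add: power2_eq_square mult_ac)
    qed (use u L0 B0 in auto)
    then show ?thesis using X0 yz by (simp add: D_def)
  qed
  \<comment> \<open>Exit means reaching the abscissa \<open>\<psi>\<close> or the boundary of the
    box. Before it the arc moves strictly to the left and has the height of the graph, which stays
    below \<open>\<rho>\<close>, so the first exit can only be at \<open>\<psi>\<close>.\<close>
  define Out where "Out = {u \<in> {0..l}. X u \<le> \<psi>} \<union> {u \<in> {0..l}. \<rho> \<le> X u} \<union> {u \<in> {0..l}. \<rho> \<le> \<bar>V u\<bar>}"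
  have "closed Out" unfolding Out_def
    by (intro closed_Un continuous_on_closed_Collect_le continuous_on_const continuous_intros cX closed_atLeastAtMost)
  moreover have sub: "Out \<subseteq> {0..l}" by (auto simp: Out_def)
  ultimately have cOut: "compact Out"
    using compact_Int_closed[OF compact_Icc, of Out 0 l] by (simp add: Int_absorb1)
  have inside: "\<bar>X u\<bar> < \<rho> \<and> \<bar>V u\<bar> < \<rho> \<and> \<psi> < X u" if "u \<in> {0..l}" "u \<notin> Out" for u
    using that x unfolding Out_def by (auto simp: not_le abs_less_iff)
  \<comment> \<open>Without an exit the arc would end on the line at an abscissa strictly between
    \<open>\<psi>\<close> and \<open>x\<close>, where the graph has no zero.\<close>
  have "Out \<noteq> {}"
  proof
    assume "Out = {}"
    then have box: "\<bar>X v\<bar> \<le> \<rho> \<and> \<bar>V v\<bar> \<le> \<rho>" "\<psi> < X v" if "v \<in> {0..l}" for v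
      using inside[OF that] by auto
    have Xl: "X v \<le> x" if "v \<in> {0..l}" for v
      by (rule down(1)[OF that]) (use box that in auto)
    have "V l = y (X l)" by (rule ride) (use box Xl l in \<open>auto simp: less_imp_le\<close>)
    moreover have "X l < x" by (rule down(2)) (use box l in auto)
    moreover have "V l = 0" using arc by (simp add: half_arc_def V_def)
    ultimately show False using yz(3)[of "X l"] box(2)[of l] l by auto
  qed
  then obtain u0 where u0: "u0 \<in> Out" and umin: "\<And>u. u \<in> Out \<Longrightarrow> u0 \<le> u"
    using compact_attains_inf[OF cOut] by auto
  have u0l: "u0 \<in> {0..l}" using u0 sub by auto
  have "\<bar>V 0\<bar> < \<rho>" "\<psi> < X 0" "X 0 < \<rho>" using X0 x by auto
  then have "0 \<notin> Out" by (auto simp: Out_def)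
  then have u0pos: "u0 > 0" using u0 u0l by (cases "u0 = 0") auto
  have lt: "\<bar>X v\<bar> < \<rho> \<and> \<bar>V v\<bar> < \<rho> \<and> \<psi> < X v" if "v \<in> {0..<u0}" for v
    by (rule inside) (use that u0l umin[of v] in auto)
  have le: "\<bar>X v\<bar> \<le> \<rho>" "\<bar>V v\<bar> \<le> \<rho>" "\<psi> \<le> X v" if "v \<in> {0..u0}" for v
  proof -
    let ?S = "{v \<in> {0..u0}. \<bar>X v\<bar> \<le> \<rho>} \<inter> {v \<in> {0..u0}. \<bar>V v\<bar> \<le> \<rho>} \<inter> {v \<in> {0..u0}. \<psi> \<le> X v}"
    have "continuous_on {0..u0} X" "continuous_on {0..u0} V"
      using u0l by (auto intro: continuous_on_subset[OF cX(1)] continuous_on_subset[OF cX(2)])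
    then have "closed ?S"
      by (intro closed_Int continuous_on_closed_Collect_le continuous_on_const continuous_intros closed_atLeastAtMost)
    then have "closure {0..<u0} \<subseteq> ?S"
      by (rule closure_minimal[rotated]) (use lt in \<open>auto simp: less_imp_le\<close>)
    then have "v \<in> ?S" using that u0pos by auto
    then show "\<bar>X v\<bar> \<le> \<rho>" "\<bar>V v\<bar> \<le> \<rho>" "\<psi> \<le> X v" by auto
  qed
  have Xx: "X v \<le> x" if "v \<in> {0..u0}" for v
    by (rule down(1)) (use le that u0l in auto)
  have on: "V v = y (X v)" if "v \<in> {0..u0}" for v
    by (rule ride) (use le Xx that u0l in auto)
  have "\<bar>V u0\<bar> < \<rho>" using on[of u0] bnd[of "X u0"] le(3)[of u0] Xx[of u0] u0pos by auto
  moreover have "X u0 < \<rho>" using Xx[of u0] u0pos x by auto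
  ultimately have "X u0 \<le> \<psi>" using u0 by (auto simp: Out_def)
  then have X\<psi>: "X u0 = \<psi>" using le(3)[of u0] u0pos by auto
  then have "V u0 = 0" using on[of u0] u0pos yz by auto
  \<comment> \<open>An arc meets the line only at its ends, and \<open>u0 > 0\<close>.\<close>
  then have "u0 = l" using arc u0pos u0l unfolding half_arc_def V_def by force
  then show "fst (\<alpha> l) = \<psi>" "\<And>u. u \<in> {0..l} \<Longrightarrow> fst (\<alpha> u) \<in> {\<psi>..x} \<and> snd (\<alpha> u) = y (fst (\<alpha> u))"
    using X\<psi> on le(3) Xx by (auto simp: X_def V_def)
qed

lemma closed_segment_real:
  fixes x :: real
  shows "x > 0 \<Longrightarrow> closed_segment x (-2*x) = {-2*x..x}"
  by (auto simp: closed_segment_eq_real_ivl)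

text \<open>Graphs that agree at one abscissa coincide, so the graph of \<open>x\<close> vanishes at
  \<open>\<xi>\<close> exactly when the graphs of \<open>x\<close> and \<open>\<xi>\<close> have the
  same height over 0, that is when the values of \<open>\<sigma>\<close> at both points have equal
  \<open>2 * k\<close>-th powers. Besides \<open>x\<close> itself only the reflected point remains,
  with no zero in between, and \<open>half_arc_on_graph\<close> transfers this to actual
  arcs.\<close>

lemma half_return_local:
  assumes F: "analytic_vfield F" and contact: "invisible_contact s k F" and k: "k \<ge> 1" and s: "s \<in> {-1, 1}"
  obtains r \<sigma> K where "real_germ \<sigma> r" "K \<ge> 0"
    "\<And>x. 0 < \<bar>x\<bar> \<Longrightarrow> \<bar>x\<bar> < r \<Longrightarrow> s * fst (F (0, 0)) * (snd (F (x, 0)) * x) < 0"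
    "\<And>x y. \<bar>x\<bar> < r \<Longrightarrow> \<bar>y\<bar> < r \<Longrightarrow> fst (F (0, 0)) * fst (F (x, y)) > 0"
    "\<And>x d l \<alpha>. 0 < x \<Longrightarrow> x < r \<Longrightarrow> d \<in> {-1, 1} \<Longrightarrow> half_arc s (\<lambda>p. d *\<^sub>R F p) l \<alpha> \<Longrightarrow> \<alpha> 0 = (x, 0) \<Longrightarrow>
       d * fst (F (0, 0)) < 0 \<and> fst (\<alpha> l) < 0 \<and> - (2 * x) \<le> fst (\<alpha> l) \<and> on_real \<sigma> (fst (\<alpha> l)) = - on_real \<sigma> x \<and>
       (\<forall>u\<in>{0..l}. \<bar>fst (\<alpha> u)\<bar> \<le> 2 * x \<and> \<bar>snd (\<alpha> u)\<bar> \<le> K * x)"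
proof -
  define P where "P = fst (F (0, 0))"
  have P0: "P \<noteq> 0" and "\<exists>c. s * (P * c) < 0 \<and> (\<lambda>x. snd (F (x, 0)) - c * x ^ (2 * k - 1)) \<in> O[at 0](\<lambda>x. x ^ (2 * k))"
    using contact by (auto simp: invisible_contact_def P_def)
  then obtain c where c: "s * (P * c) < 0" "(\<lambda>x. snd (F (x, 0)) - c * x ^ (2 * k - 1)) \<in> O[at 0](\<lambda>x. x ^ (2 * k))"
    by blast
  define c1 where "c1 = c / P"
  have sc1: "s * c1 < 0"
  proof -
    have "s * c1 = s * (P * c) / P\<^sup>2" using P0 by (simp add: c1_def power2_eq_square field_simps)
    then show ?thesis using c(1) P0 by (simp add: divide_neg_pos)
  qed
  have slope_lim: "((\<lambda>x. slope F x 0 / x ^ (2 * k - 1)) \<longlongrightarrow> c1) (at 0)" and slope0: "slope F 0 0 = 0"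
    using slope_asymptotics[OF F _ k c(2)] P0 by (simp_all add: c1_def P_def)
  have cont: "continuous_on UNIV F" by (rule locally_lipschitz_continuous[OF analytic_vfield_lipschitz[OF F]])
  obtain R \<rho> L M h Y where R: "R > 0" and R\<rho>: "2 * R \<le> \<rho>" and L0: "L \<ge> 0" and M0: "M \<ge> 0" and
    pos: "\<And>x y. \<bar>x\<bar> \<le> \<rho> \<Longrightarrow> \<bar>y\<bar> \<le> \<rho> \<Longrightarrow> P * fst (F (x, y)) > 0" and
    L: "\<And>x y y'. \<bar>x\<bar> \<le> \<rho> \<Longrightarrow> \<bar>y\<bar> \<le> \<rho> \<Longrightarrow> \<bar>y'\<bar> \<le> \<rho> \<Longrightarrow> \<bar>slope F x y - slope F x y'\<bar> \<le> L * \<bar>y - y'\<bar>" and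
    h: "h holomorphic_on ball 0 R" and
    hY: "\<And>x. \<bar>x\<bar> < R \<Longrightarrow> h (of_real x) = of_real (Y x 0)" and
    Yx: "\<And>x. \<bar>x\<bar> < R \<Longrightarrow> Y x x = 0" and
    dY: "\<And>x \<xi>. \<bar>x\<bar> < R \<Longrightarrow> x \<noteq> 0 \<Longrightarrow> \<xi> \<in> closed_segment x (-2*x) \<Longrightarrow>
       (Y x has_real_derivative slope F \<xi> (Y x \<xi>)) (at \<xi> within closed_segment x (-2*x))" and
    bY: "\<And>x \<xi>. \<bar>x\<bar> < R \<Longrightarrow> x \<noteq> 0 \<Longrightarrow> \<xi> \<in> closed_segment x (-2*x) \<Longrightarrow> \<bar>Y x \<xi>\<bar> \<le> \<rho> / 2" and
    bY': "\<And>x \<xi>. \<bar>x\<bar> < R \<Longrightarrow> x \<noteq> 0 \<Longrightarrow> \<xi> \<in> closed_segment x (-2*x) \<Longrightarrow> \<bar>Y x \<xi>\<bar> \<le> 3 * M * \<bar>x\<bar>"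
    using local_graphs[OF F P0[unfolded P_def]] unfolding P_def by blast
  have \<rho>: "\<rho> > 0" using R R\<rho> by simp
  have seg: "closed_segment x 0 \<subseteq> closed_segment x (-2*x)" for x :: real
    by (auto simp: closed_segment_eq_real_ivl)
  define \<kappa> where "\<kappa> = - c1 / (2 * k)"
  have \<kappa>: "\<kappa> \<noteq> 0" using sc1 k by (auto simp: \<kappa>_def)
  have lim: "((\<lambda>x. Y x 0 / x ^ (2 * k)) \<longlongrightarrow> \<kappa>) (at 0)"
    unfolding \<kappa>_def
  proof (rule graph_asymptotics[where f = "slope F" and R = R and L = L and \<rho> = \<rho>, OF R L0 k _ Yx _ _ slope_lim slope0])
    fix x y :: real assume "\<bar>x\<bar> < R" "\<bar>y\<bar> \<le> \<rho>"
    then show "\<bar>slope F x y - slope F x 0\<bar> \<le> L * \<bar>y\<bar>" using L[of x y 0] R\<rho> R by simp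
  next
    fix x \<xi> :: real assume x: "\<bar>x\<bar> < R" "x \<noteq> 0" and \<xi>: "\<xi> \<in> closed_segment x 0"
    then have \<xi>': "\<xi> \<in> closed_segment x (-2*x)" using seg by blast
    show "(Y x has_real_derivative slope F \<xi> (Y x \<xi>)) (at \<xi> within closed_segment x 0)"
      by (rule DERIV_subset[OF dY[OF x \<xi>'] seg])
    show "\<bar>Y x \<xi>\<bar> \<le> \<rho>" using bY[OF x \<xi>'] \<rho> by linarith
  qed
  obtain r0 \<sigma> where r0: "0 < r0" "r0 \<le> R" and germ: "real_germ \<sigma> r0" and
    Y\<sigma>: "\<And>x. \<bar>x\<bar> < r0 \<Longrightarrow> Y x 0 = \<kappa> * on_real \<sigma> x ^ (2 * k)"
    using holomorphic_root[OF R h hY lim \<kappa>] k by (metis One_nat_def le_Suc_eq mult_le_mono numeral_2_eq_2 one_le_mult_iff)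
  have "\<forall>\<^sub>F x in at 0. dist (slope F x 0 / x ^ (2 * k - 1)) c1 < \<bar>c1\<bar>"
    by (rule tendstoD[OF slope_lim]) (use sc1 in auto)
  then obtain e where e: "e > 0" and e': "\<And>x. x \<noteq> 0 \<Longrightarrow> \<bar>x\<bar> < e \<Longrightarrow> \<bar>slope F x 0 / x ^ (2 * k - 1) - c1\<bar> < \<bar>c1\<bar>"
    unfolding eventually_at by (auto simp: dist_real_def)
  \<comment> \<open>\<open>r0 / 4\<close> leaves room for abscissae down to \<open>- 2 * x\<close>
    inside the domain of the germ; below \<open>e\<close> the slope on the line has the sign of
    \<open>c1 * x\<close>.\<close>
  define r where "r = min (r0 / 4) e"
  have r: "r > 0" "r \<le> r0 / 4" "r \<le> e" using r0 e by (auto simp: r_def)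
  have rR: "4 * r \<le> R" "8 * r \<le> \<rho>" using r r0 R\<rho> by auto
  have sQ: "s * P * (snd (F (x, 0)) * x) < 0" if x: "0 < \<bar>x\<bar>" "\<bar>x\<bar> < r" for x
  proof -
    define q where "q = slope F x 0 / x ^ (2 * k - 1)"
    have "\<bar>q - c1\<bar> < \<bar>c1\<bar>" unfolding q_def using x r by (intro e') auto
    then have sq: "s * q < 0" using sc1 s by (auto simp: abs_if split: if_splits)
    have PF: "P * fst (F (x, 0)) > 0" using pos[of x 0] x rR r by auto
    have Q: "snd (F (x, 0)) = slope F x 0 * fst (F (x, 0))" using PF by (auto simp: slope_def)
    have S: "slope F x 0 = q * x ^ (2 * k - 1)" using x by (simp add: q_def)
    have "x ^ (2 * k - 1) * x = x ^ (2 * k)" using k by (cases k) auto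
    also have "x ^ (2 * k) = (x ^ k)\<^sup>2" by (simp add: power_mult mult.commute)
    finally have X: "x ^ (2 * k - 1) * x = (x ^ k)\<^sup>2" .
    have "s * P * (snd (F (x, 0)) * x) = (s * q) * (P * fst (F (x, 0))) * (x ^ (2 * k - 1) * x)"
      unfolding Q S by simp
    then have eq: "s * P * (snd (F (x, 0)) * x) = (s * q) * (P * fst (F (x, 0))) * (x ^ k)\<^sup>2" unfolding X .
    have "(x ^ k)\<^sup>2 > 0" using x by simp
    then show ?thesis unfolding eq using PF sq by (metis mult_neg_pos)
  qed
  have main: "d * P < 0 \<and> fst (\<alpha> l) < 0 \<and> - (2 * x) \<le> fst (\<alpha> l) \<and> on_real \<sigma> (fst (\<alpha> l)) = - on_real \<sigma> x \<and>
       (\<forall>u\<in>{0..l}. \<bar>fst (\<alpha> u)\<bar> \<le> 2 * x \<and> \<bar>snd (\<alpha> u)\<bar> \<le> (3 * M) * x)"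
    if x: "0 < x" "x < r" and d: "d \<in> {-1, 1}" and arc: "half_arc s (\<lambda>p. d *\<^sub>R F p) l \<alpha>" and \<alpha>0: "\<alpha> 0 = (x, 0)" for x d l \<alpha>
  proof -
    \<comment> \<open>The arc must start into its half plane, while \<open>sQ\<close> fixes the sign
      of the normal component at \<open>x > 0\<close>; comparing the two determines
      \<open>d\<close>.\<close>
    have "s * (d * snd (F (x, 0))) \<ge> 0" using half_arc_start_derivative[OF arc] \<alpha>0 by simp
    moreover have sq: "s * P * (snd (F (x, 0)) * x) < 0" by (rule sQ) (use x in auto)
    then have "s * P * snd (F (x, 0)) < 0" using x by (simp add: mult_less_0_iff zero_less_mult_iff)
    ultimately have dP: "d * P < 0"
      using s d P0 by (auto simp: mult_less_0_iff zero_le_mult_iff)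
    have sx: "\<bar>x\<bar> < r0 / 2" "\<bar>x\<bar> < r0" "\<bar>x\<bar> < R" using x r r0 by auto
    obtain \<psi> where \<psi>: "\<bar>\<psi>\<bar> \<le> 2 * \<bar>x\<bar>" "on_real \<sigma> \<psi> = - on_real \<sigma> x"
      using real_germ_solve[OF germ sx(1), of "- on_real \<sigma> x"] real_germ_bounds(1)[OF germ sx(2)] by auto
    have \<sigma>x: "on_real \<sigma> x > 0"
      using real_germ_less_iff[OF germ _ sx(2), of 0] real_germ_0[OF germ] x r0 by simp
    have \<psi>r: "\<bar>\<psi>\<bar> < r0" "\<bar>\<psi>\<bar> < R" "\<bar>\<psi>\<bar> < \<rho>" using \<psi>(1) x r r0 R\<rho> R by auto
    have \<psi>0: "\<psi> < 0"
      using real_germ_less_iff[OF germ \<psi>r(1), of 0] real_germ_0[OF germ] \<sigma>x \<psi>(2) r0 by simp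
    have \<psi>x: "{\<psi>..x} \<subseteq> {-2*x..x}" using \<psi>(1) x by auto
    define y where "y = Y x"
    have dy: "(y has_real_derivative slope F \<xi> (y \<xi>)) (at \<xi> within {-2*x..x})"
      and by1: "\<bar>y \<xi>\<bar> \<le> \<rho> / 2" and by2: "\<bar>y \<xi>\<bar> \<le> 3 * M * x" if "\<xi> \<in> {-2*x..x}" for \<xi>
      using dY[OF sx(3), of \<xi>] bY[OF sx(3), of \<xi>] bY'[OF sx(3), of \<xi>] that x
      unfolding closed_segment_real[OF x(1)] y_def by simp_all
    have y0: "y 0 = \<kappa> * on_real \<sigma> x ^ (2 * k)" using Y\<sigma>[OF sx(2)] by (simp add: y_def)
    \<comment> \<open>Only the segment between \<open>\<xi>\<close> and 0 is used: both graphs are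
      defined there, and uniqueness runs from \<open>\<xi>\<close> to 0 as well as back.\<close>
    have compare: "y p = Y \<xi> p \<longleftrightarrow> y q = Y \<xi> q"
      if \<xi>: "\<xi> \<in> {-2*x..x}" "\<xi> \<noteq> 0" "\<bar>\<xi>\<bar> < R" and pq: "p \<in> closed_segment \<xi> 0" "q \<in> closed_segment \<xi> 0" for \<xi> p q
    proof -
      have *: "y q = Y \<xi> q" if eq: "y p = Y \<xi> p" and p: "p \<in> closed_segment \<xi> 0" and q: "q \<in> closed_segment \<xi> 0" for p q
      proof -
        define a b where "a = min \<xi> 0" and "b = max \<xi> 0"
        have ab: "closed_segment \<xi> 0 = {a..b}" by (auto simp: closed_segment_eq_real_ivl a_def b_def)
        have sub: "{a..b} \<subseteq> {-2*x..x}" using \<xi> x by (auto simp: a_def b_def)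
        have sub': "{a..b} \<subseteq> closed_segment \<xi> (-2*\<xi>)" using seg[of \<xi>] ab by simp
        show ?thesis
        proof (rule graph_unique[where f = "slope F" and a = a and b = b and L = L and c = p and e = q and ?y1.0 = y and ?y2.0 = "Y \<xi>"])
          fix \<eta> assume \<eta>: "\<eta> \<in> {a..b}"
          show "(y has_real_derivative slope F \<eta> (y \<eta>)) (at \<eta> within {a..b})"
            by (rule DERIV_subset[OF dy sub]) (use \<eta> sub in blast)
          show "(Y \<xi> has_real_derivative slope F \<eta> (Y \<xi> \<eta>)) (at \<eta> within {a..b})"
            by (rule DERIV_subset[OF dY[OF \<xi>(3,2)] sub']) (use \<eta> sub' in blast)
          have "\<bar>y \<eta>\<bar> \<le> \<rho> / 2" "\<bar>Y \<xi> \<eta>\<bar> \<le> \<rho> / 2"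
            using by1[of \<eta>] bY[OF \<xi>(3,2), of \<eta>] \<eta> sub sub' by blast+
          moreover have "\<bar>\<eta>\<bar> \<le> \<rho>" using \<eta> \<xi>(3) R\<rho> R by (auto simp: a_def b_def)
          ultimately show "\<bar>slope F \<eta> (y \<eta>) - slope F \<eta> (Y \<xi> \<eta>)\<bar> \<le> L * \<bar>y \<eta> - Y \<xi> \<eta>\<bar>"
            using \<rho> by (intro L) auto
        qed (use L0 eq p q ab in auto)
      qed
      show ?thesis using *[of p q] *[of q p] pq by blast
    qed
    have zero_iff: "y \<xi> = 0 \<longleftrightarrow> y 0 = \<kappa> * on_real \<sigma> \<xi> ^ (2 * k)"
      if \<xi>: "\<xi> \<in> {-2*x..x}" "\<xi> \<noteq> 0" for \<xi>
    proof -
      have "\<bar>\<xi>\<bar> \<le> 2 * x" using \<xi> x by auto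
      then have \<xi>r: "\<bar>\<xi>\<bar> < r0" "\<bar>\<xi>\<bar> < R" using x r r0 by auto
      show ?thesis
        using compare[OF \<xi> \<xi>r(2), of \<xi> 0] Yx[OF \<xi>r(2)] Y\<sigma>[OF \<xi>r(1)] by simp
    qed
    have y\<psi>: "y \<psi> = 0"
      using zero_iff[of \<psi>] \<psi> \<psi>0 \<psi>x x y0 by auto
    have ynz: "y \<xi> \<noteq> 0" if \<xi>: "\<xi> \<in> {\<psi><..<x}" for \<xi>
    proof (cases "\<xi> = 0")
      case True
      then show ?thesis using y0 \<sigma>x \<kappa> by simp
    next
      case False
      have \<xi>r: "\<bar>\<xi>\<bar> < r0" using \<xi> \<psi>r(1) sx(2) by auto
      have lt: "on_real \<sigma> \<psi> < on_real \<sigma> \<xi>" "on_real \<sigma> \<xi> < on_real \<sigma> x"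
        using real_germ_less_iff[OF germ \<psi>r(1) \<xi>r] real_germ_less_iff[OF germ \<xi>r sx(2)] \<xi> by auto
      then have "\<bar>on_real \<sigma> \<xi>\<bar> < \<bar>on_real \<sigma> x\<bar>" using \<psi>(2) by auto
      then have "\<bar>on_real \<sigma> \<xi>\<bar> ^ (2 * k) < \<bar>on_real \<sigma> x\<bar> ^ (2 * k)" using k by (intro power_strict_mono) auto
      then have "on_real \<sigma> \<xi> ^ (2 * k) \<noteq> on_real \<sigma> x ^ (2 * k)" by (simp add: power_even_abs)
      then show ?thesis using zero_iff[of \<xi>] \<xi> \<psi>x False y0 \<kappa> by auto
    qed
    have dyp: "(y has_real_derivative slope F \<xi> (y \<xi>)) (at \<xi> within {\<psi>..x})" if "\<xi> \<in> {\<psi>..x}" for \<xi>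
      by (rule DERIV_subset[OF dy \<psi>x]) (use that \<psi>x in auto)
    have byp: "\<bar>y \<xi>\<bar> < \<rho>" if "\<xi> \<in> {\<psi>..x}" for \<xi>
      using by1[of \<xi>] that \<psi>x \<rho> by force
    have dF: "d * fst (F (u, v)) < 0" if "\<bar>u\<bar> \<le> \<rho>" "\<bar>v\<bar> \<le> \<rho>" for u v
      using pos[OF that] dP by (auto simp: zero_less_mult_iff mult_less_0_iff)
    have xs: "x < \<rho>" "- \<rho> < \<psi>" "\<psi> < x" using x rR \<psi>r(3) \<psi>0 by auto
    note on = half_arc_on_graph[OF arc \<alpha>0 d cont L0 dF L xs dyp byp _ y\<psi> ynz]
    have yx: "y x = 0" using Yx[OF sx(3)] by (simp add: y_def)
    have end\<psi>: "fst (\<alpha> l) = \<psi>" and bds: "\<And>u. u \<in> {0..l} \<Longrightarrow> fst (\<alpha> u) \<in> {\<psi>..x} \<and> snd (\<alpha> u) = y (fst (\<alpha> u))"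
      using on yx by blast+
    have "\<bar>fst (\<alpha> u)\<bar> \<le> 2 * x \<and> \<bar>snd (\<alpha> u)\<bar> \<le> (3 * M) * x" if "u \<in> {0..l}" for u
      using bds[OF that] by2[of "fst (\<alpha> u)"] \<psi>(1) \<psi>x x by auto
    then show ?thesis using dP end\<psi> \<psi> \<psi>0 x by auto
  qed
  show ?thesis
  proof (rule that[of \<sigma> r "3 * M"])
    show "real_germ \<sigma> r" by (rule real_germ_mono[OF germ]) (use r in auto)
    show "fst (F (0, 0)) * fst (F (x, y)) > 0" if "\<bar>x\<bar> < r" "\<bar>y\<bar> < r" for x y
      using pos[of x y] that rR r by (auto simp: P_def)
  qed (use M0 sQ main in \<open>auto simp: P_def\<close>)
qed

section \<open>Half-returns of the flow as arcs, their continuity and their duration\<close>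

text \<open>The time \<open>t\<close> may be negative; its sign and size are both absorbed into the
  speed factor, as \<open>solution_dependence\<close> requires.\<close>

lemma solution_rescale:
  assumes "solution_on F \<gamma> (closed_segment 0 t)" "s \<in> {0..1}"
  shows "((\<lambda>s. \<gamma> (t * s)) has_vector_derivative t *\<^sub>R F (\<gamma> (t * s))) (at s within {0..1})"
proof -
  have img: "(\<lambda>s. t * s) ` {0..1} \<subseteq> closed_segment 0 t"
    by (auto simp: closed_segment_def mult.commute)
  then have "t * s \<in> closed_segment 0 t" using assms(2) by blast
  then have "(\<gamma> has_vector_derivative F (\<gamma> (t * s))) (at (t * s) within closed_segment 0 t)"
    using assms(1) by (auto simp: solution_on_def)
  then have "(\<gamma> has_vector_derivative F (\<gamma> (t * s))) (at (t * s) within (\<lambda>s. t * s) ` {0..1})"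
    by (rule has_vector_derivative_within_subset[OF _ img])
  moreover have "((\<lambda>s. t * s) has_vector_derivative t) (at s within {0..1})"
    by (auto intro!: derivative_eq_intros simp flip: has_real_derivative_iff_has_vector_derivative)
  ultimately show ?thesis
    using vector_diff_chain_within[of "\<lambda>s. t * s" t s "{0..1}" \<gamma>] by (simp add: o_def)
qed

text \<open>Uniqueness of solutions is what makes the definite description in \<open>flow\<close>
  denote; the value depends neither on the witness nor on the longer interval on which it
  lives.\<close>

lemma flow_eq_solution:
  assumes F: "locally_lipschitz F" and \<gamma>: "solution_on F \<gamma> (closed_segment 0 t)" "\<gamma> 0 = p"
    and u: "u \<in> closed_segment 0 t"
  shows "flow F u p = \<gamma> u"
proof -
  have "closed_segment 0 u \<subseteq> closed_segment 0 t"
    using u by (simp add: subset_closed_segment)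
  then have \<gamma>u: "solution_on F \<gamma> (closed_segment 0 u)"
    using \<gamma>(1) unfolding solution_on_def by (meson has_vector_derivative_within_subset subsetD)
  show ?thesis unfolding flow_def
  proof (rule the_equality)
    show "\<exists>\<gamma>'. \<gamma>' 0 = p \<and> solution_on F \<gamma>' (closed_segment 0 u) \<and> \<gamma>' u = \<gamma> u"
      using \<gamma>u \<gamma>(2) by blast
    fix q assume "\<exists>\<gamma>'. \<gamma>' 0 = p \<and> solution_on F \<gamma>' (closed_segment 0 u) \<and> \<gamma>' u = q"
    then obtain \<gamma>' where \<gamma>': "\<gamma>' 0 = p" "solution_on F \<gamma>' (closed_segment 0 u)" "\<gamma>' u = q" by blast
    have "(\<lambda>s. \<gamma>' (u * s)) 1 = (\<lambda>s. \<gamma> (u * s)) 1"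
      by (rule solution_unique[OF F solution_rescale[OF \<gamma>'(2)] solution_rescale[OF \<gamma>u]])
         (use \<gamma>(2) \<gamma>'(1) in auto)
    then show "q = \<gamma> u" using \<gamma>'(3) by simp
  qed
qed

lemma half_return_solution:
  assumes F: "locally_lipschitz F" and t: "half_return_time s F x t"
  obtains \<gamma> where "solution_on F \<gamma> (closed_segment 0 t)" "\<gamma> 0 = (x, 0)" "snd (\<gamma> t) = 0"
    "fst (\<gamma> t) = fst (flow F t (x, 0))" "\<And>u. u \<in> open_segment 0 t \<Longrightarrow> s * snd (\<gamma> u) > 0"
proof -
  obtain \<gamma> where \<gamma>: "solution_on F \<gamma> (closed_segment 0 t)" "\<gamma> 0 = (x, 0)"
    using t by (auto simp: half_return_time_def flow_dom_def)
  have "flow F u (x, 0) = \<gamma> u" if "u \<in> closed_segment 0 t" for u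
    by (rule flow_eq_solution[OF F \<gamma> that])
  then show ?thesis
    using t \<gamma> by (intro that[of \<gamma>]) (auto simp: half_return_time_def open_segment_def)
qed

text \<open>Multiplying time by \<open>sgn t\<close> removes the distinction between positive and
  negative return times from what follows.\<close>

lemma half_return_arc:
  assumes F: "locally_lipschitz F" and t: "half_return_time s F x t" "t \<noteq> 0"
  obtains \<alpha> where "half_arc s (\<lambda>p. sgn t *\<^sub>R F p) \<bar>t\<bar> \<alpha>" "\<alpha> 0 = (x, 0)" "\<alpha> \<bar>t\<bar> = (fst (flow F t (x, 0)), 0)"
proof -
  obtain \<gamma> where \<gamma>: "solution_on F \<gamma> (closed_segment 0 t)" "\<gamma> 0 = (x, 0)" "snd (\<gamma> t) = 0"
    "fst (\<gamma> t) = fst (flow F t (x, 0))" and pos: "\<And>u. u \<in> open_segment 0 t \<Longrightarrow> s * snd (\<gamma> u) > 0"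
    using half_return_solution[OF F t(1)] by metis
  define \<alpha> where "\<alpha> u = \<gamma> (sgn t * u)" for u
  have tt: "sgn t * \<bar>t\<bar> = t" by (simp add: sgn_mult_abs)
  have cs: "(\<lambda>u. sgn t * u) ` {0..\<bar>t\<bar>} \<subseteq> closed_segment 0 t"
    using t(2) by (cases "t > 0") (auto simp: closed_segment_eq_real_ivl)
  have "solution_on (\<lambda>p. sgn t *\<^sub>R F p) \<alpha> {0..\<bar>t\<bar>}"
    unfolding solution_on_def
  proof
    fix u assume u: "u \<in> {0..\<bar>t\<bar>}"
    then have "sgn t * u \<in> closed_segment 0 t" using cs by blast
    then have "(\<gamma> has_vector_derivative F (\<gamma> (sgn t * u))) (at (sgn t * u) within closed_segment 0 t)"
      using \<gamma>(1) by (auto simp: solution_on_def)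
    then have "(\<gamma> has_vector_derivative F (\<gamma> (sgn t * u))) (at (sgn t * u) within (\<lambda>u. sgn t * u) ` {0..\<bar>t\<bar>})"
      by (rule has_vector_derivative_within_subset[OF _ cs])
    moreover have "((\<lambda>u. sgn t * u) has_vector_derivative sgn t) (at u within {0..\<bar>t\<bar>})"
      by (auto intro!: derivative_eq_intros simp flip: has_real_derivative_iff_has_vector_derivative)
    ultimately show "(\<alpha> has_vector_derivative sgn t *\<^sub>R F (\<alpha> u)) (at u within {0..\<bar>t\<bar>})"
      using vector_diff_chain_within[of "\<lambda>u. sgn t * u" "sgn t" u "{0..\<bar>t\<bar>}" \<gamma>]
      by (simp add: o_def \<alpha>_def[abs_def])
  qed
  moreover have "s * snd (\<alpha> u) > 0" if "u \<in> {0<..<\<bar>t\<bar>}" for u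
    unfolding \<alpha>_def using t(2) that by (intro pos, cases "t > 0") (auto simp: open_segment_eq_real_ivl)
  ultimately have "half_arc s (\<lambda>p. sgn t *\<^sub>R F p) \<bar>t\<bar> \<alpha>"
    using t(2) \<gamma> tt by (auto simp: half_arc_def \<alpha>_def)
  then show ?thesis
    using \<gamma> tt by (intro that[of \<alpha>]) (auto simp: \<alpha>_def prod_eq_iff)
qed

text \<open>After rescaling to unit time the return time becomes a speed factor, so
  \<open>solution_dependence\<close> covers the change of initial point and of duration together.
  The purpose is to know that the difference of the two return maps keeps one sign on the whole
  interval.\<close>

lemma half_return_map_continuous:
  assumes F: "locally_lipschitz F" and \<tau>: "continuous_on {0<..<x\<^sub>0} \<tau>"
    and half: "\<And>x. x \<in> {0<..<x\<^sub>0} \<Longrightarrow> half_return_time s F x (\<tau> x)"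
  shows "continuous_on {0<..<x\<^sub>0} (half_return_map F \<tau>)"
  unfolding continuous_on_iff
proof (intro ballI allI impI)
  fix x and \<epsilon> :: real assume x: "x \<in> {0<..<x\<^sub>0}" and \<epsilon>: "\<epsilon> > 0"
  obtain \<gamma> where \<gamma>: "solution_on F \<gamma> (closed_segment 0 (\<tau> x))" "\<gamma> 0 = (x, 0)"
    "fst (\<gamma> (\<tau> x)) = fst (flow F (\<tau> x) (x, 0))"
    using half_return_solution[OF F half[OF x]] by metis
  obtain \<eta> where \<eta>: "\<eta> > 0" and
    dep: "\<And>\<beta> b t. (\<And>t. t \<in> {0..1} \<Longrightarrow> (\<beta> has_vector_derivative b *\<^sub>R F (\<beta> t)) (at t within {0..1})) \<Longrightarrow>
       \<bar>b - \<tau> x\<bar> < \<eta> \<Longrightarrow> dist (\<beta> 0) (\<gamma> (\<tau> x * 0)) < \<eta> \<Longrightarrow> t \<in> {0..1} \<Longrightarrow> dist (\<beta> t) (\<gamma> (\<tau> x * t)) < \<epsilon>"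
    using solution_dependence[OF F solution_rescale[OF \<gamma>(1)] \<epsilon>] by blast
  obtain d where d: "d > 0" "\<And>x'. x' \<in> {0<..<x\<^sub>0} \<Longrightarrow> dist x' x < d \<Longrightarrow> dist (\<tau> x') (\<tau> x) < \<eta>"
    using \<tau> x \<eta> unfolding continuous_on_iff by blast
  show "\<exists>d>0. \<forall>x'\<in>{0<..<x\<^sub>0}. dist x' x < d \<longrightarrow> dist (half_return_map F \<tau> x') (half_return_map F \<tau> x) < \<epsilon>"
  proof (intro exI[of _ "min d \<eta>"] conjI ballI impI)
    fix x' assume x': "x' \<in> {0<..<x\<^sub>0}" "dist x' x < min d \<eta>"
    obtain \<beta> where \<beta>: "solution_on F \<beta> (closed_segment 0 (\<tau> x'))" "\<beta> 0 = (x', 0)"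
      "fst (\<beta> (\<tau> x')) = fst (flow F (\<tau> x') (x', 0))"
      using half_return_solution[OF F half[OF x'(1)]] by metis
    have "dist ((\<lambda>t. \<beta> (\<tau> x' * t)) 1) (\<gamma> (\<tau> x * 1)) < \<epsilon>"
      by (rule dep[OF solution_rescale[OF \<beta>(1)]])
         (use d(2)[OF x'(1)] x' \<beta>(2) \<gamma>(2) in \<open>auto simp: dist_real_def dist_Pair_Pair\<close>)
    then show "dist (half_return_map F \<tau> x') (half_return_map F \<tau> x) < \<epsilon>"
      using dist_fst_le[of "\<beta> (\<tau> x')" "\<gamma> (\<tau> x)"] \<beta>(3) \<gamma>(3) by (simp add: half_return_map_def)
  qed (use d \<eta> in auto)
qed

text \<open>The quotient of germ value and argument tends to 1 both along \<open>x\<close> and along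
  \<open>\<phi> x\<close>, and the two germ values are opposite.\<close>

lemma real_germ_reflection_asymp:
  assumes \<sigma>: "real_germ \<sigma> r" and \<phi>: "\<And>x. 0 < x \<Longrightarrow> x < r \<Longrightarrow>
    \<phi> x < 0 \<and> - (2 * x) \<le> \<phi> x \<and> on_real \<sigma> (\<phi> x) = - on_real \<sigma> x"
  shows "((\<lambda>x. \<phi> x / x) \<longlongrightarrow> -1) (at_right 0)"
proof -
  have r: "r > 0" using \<sigma> by (simp add: real_germ_def)
  have ev: "\<forall>\<^sub>F x in at_right 0. x \<in> {0<..<r/2}" using r by (intro eventually_at_right_real) auto
  have "(\<phi> \<longlongrightarrow> 0) (at_right 0)"
  proof (rule Lim_null_comparison)
    show "\<forall>\<^sub>F x in at_right 0. norm (\<phi> x) \<le> 2 * x" using ev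
    proof eventually_elim
      case (elim x)
      then show ?case using \<phi>[of x] r by auto
    qed
    show "((\<lambda>x::real. 2 * x) \<longlongrightarrow> 0) (at_right 0)" by (auto intro!: tendsto_eq_intros)
  qed
  moreover have "\<forall>\<^sub>F x in at_right 0. \<phi> x \<noteq> 0" using ev
  proof eventually_elim
    case (elim x)
    then show ?case using \<phi>[of x] r by auto
  qed
  ultimately have "filterlim \<phi> (at 0) (at_right 0)" by (auto simp: filterlim_at)
  from filterlim_compose[OF real_germ_asymp[OF \<sigma>] this]
  have 1: "((\<lambda>x. on_real \<sigma> (\<phi> x) / \<phi> x) \<longlongrightarrow> 1) (at_right 0)" .
  have 2: "((\<lambda>x. on_real \<sigma> x / x) \<longlongrightarrow> 1) (at_right 0)"
    using real_germ_asymp[OF \<sigma>] by (rule filterlim_mono) (auto simp: at_within_le_at)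
  have "((\<lambda>x. - (on_real \<sigma> x / x) / (on_real \<sigma> (\<phi> x) / \<phi> x)) \<longlongrightarrow> - 1 / 1) (at_right 0)"
    by (intro tendsto_intros 1 2) auto
  then have "((\<lambda>x. - (on_real \<sigma> x / x) / (on_real \<sigma> (\<phi> x) / \<phi> x)) \<longlongrightarrow> - 1) (at_right 0)" by simp
  then show ?thesis
  proof (rule Lim_transform_eventually)
    show "\<forall>\<^sub>F x in at_right 0. - (on_real \<sigma> x / x) / (on_real \<sigma> (\<phi> x) / \<phi> x) = \<phi> x / x"
      using ev
    proof eventually_elim
      case (elim x)
      have "on_real \<sigma> x \<noteq> 0" using real_germ_bounds(2)[OF \<sigma>, of x] elim r by auto
      then show ?case using \<phi>[of x] elim r by (auto simp: field_simps)
    qed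
  qed
qed

text \<open>By the mean value theorem the horizontal displacement divided by the duration is, up to
  the time direction, the first component of the field at some point of the arc, and the whole arc
  lies at a distance of order \<open>x\<close> from the origin.\<close>

lemma half_arc_mean_speed:
  assumes cont: "continuous_on UNIV F" and \<epsilon>: "\<epsilon> > 0"
  obtains \<eta> where "\<eta> > 0" "\<And>x d l \<alpha>. 0 < x \<Longrightarrow> x < \<eta> \<Longrightarrow> d \<in> {-1, 1} \<Longrightarrow> half_arc s (\<lambda>p. d *\<^sub>R F p) l \<alpha> \<Longrightarrow>
      \<alpha> 0 = (x, 0) \<Longrightarrow> (\<forall>u\<in>{0..l}. \<bar>fst (\<alpha> u)\<bar> \<le> 2 * x \<and> \<bar>snd (\<alpha> u)\<bar> \<le> K * x) \<Longrightarrow>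
      \<bar>d * (fst (\<alpha> l) - x) / l - fst (F (0, 0))\<bar> < \<epsilon>"
proof -
  have "continuous_on UNIV (\<lambda>p. fst (F p))" by (intro continuous_intros cont)
  then obtain \<delta> where \<delta>: "\<delta> > 0" "\<And>p. dist p (0, 0) < \<delta> \<Longrightarrow> dist (fst (F p)) (fst (F (0, 0))) < \<epsilon>"
    using \<epsilon> unfolding continuous_on_iff by (metis UNIV_I)
  define \<eta> where "\<eta> = \<delta> / (3 + \<bar>K\<bar>)"
  show ?thesis
  proof (rule that[of \<eta>])
    show "\<eta> > 0" using \<delta> by (simp add: \<eta>_def add_pos_nonneg)
    fix x d l \<alpha> assume x: "0 < x" "x < \<eta>" and d: "d \<in> {-1, 1::real}" and arc: "half_arc s (\<lambda>p. d *\<^sub>R F p) l \<alpha>"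
      and \<alpha>0: "\<alpha> 0 = (x, 0)" and b: "\<forall>u\<in>{0..l}. \<bar>fst (\<alpha> u)\<bar> \<le> 2 * x \<and> \<bar>snd (\<alpha> u)\<bar> \<le> K * x"
    have l: "l > 0" using arc by (simp add: half_arc_def)
    have "\<exists>u\<in>{0<..<l}. fst (\<alpha> l) - fst (\<alpha> 0) = d * fst (F (\<alpha> u)) * (l - 0)"
      by (rule mvt_simple[OF l]) (use half_arc_components(1)[OF arc] in \<open>auto simp: has_field_derivative_def\<close>)
    then obtain u where u: "u \<in> {0<..<l}" "fst (\<alpha> l) - x = d * fst (F (\<alpha> u)) * l" using \<alpha>0 by auto
    have "d * (fst (\<alpha> l) - x) / l = fst (F (\<alpha> u))" unfolding u(2) using d l by auto
    moreover have "dist (\<alpha> u) (0, 0) < \<delta>"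
    proof -
      have "dist (\<alpha> u) (0, 0) \<le> \<bar>fst (\<alpha> u)\<bar> + \<bar>snd (\<alpha> u)\<bar>"
        using sqrt_sum_squares_le_sum_abs[of "fst (\<alpha> u)" "snd (\<alpha> u)"] by (simp add: dist_prod_def)
      also have "\<dots> \<le> 2 * x + K * x" using b u by (intro add_mono) auto
      also have "\<dots> \<le> (3 + \<bar>K\<bar>) * x" using x mult_right_mono[OF abs_ge_self[of K], of x]
        unfolding distrib_right by linarith
      also have "\<dots> < \<delta>" using x(2) by (simp add: \<eta>_def pos_less_divide_eq mult.commute add_pos_nonneg)
      finally show ?thesis .
    qed
    ultimately show "\<bar>d * (fst (\<alpha> l) - x) / l - fst (F (0, 0))\<bar> < \<epsilon>"
      using \<delta>(2) by (simp add: dist_real_def)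
  qed
qed

text \<open>Direction of time and reflection come from \<open>half_return_local\<close>. The
  duration is, up to sign, the displacement \<open>\<phi> x - x\<close>, asymptotic to
  \<open>- 2 * x\<close>, divided by a mean speed that tends to the first component at the
  origin.\<close>

lemma half_return_germ:
  assumes F: "analytic_vfield F" and contact: "invisible_contact s k F" and k: "k \<ge> 1" and s: "s \<in> {-1, 1}"
    and x0: "x\<^sub>0 > 0" and half: "\<And>x. x \<in> {0<..<x\<^sub>0} \<Longrightarrow> half_return_time s F x (\<tau> x) \<and> \<tau> x \<noteq> 0"
  obtains r \<sigma> K A where "real_germ \<sigma> r" "r \<le> x\<^sub>0" "K \<ge> 0"
    "\<And>x. 0 < \<bar>x\<bar> \<Longrightarrow> \<bar>x\<bar> < r \<Longrightarrow> s * fst (F (0, 0)) * (snd (F (x, 0)) * x) < 0"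
    "\<And>x y. \<bar>x\<bar> < r \<Longrightarrow> \<bar>y\<bar> < r \<Longrightarrow> fst (F (0, 0)) * fst (F (x, y)) > 0"
    "\<And>x. 0 < x \<Longrightarrow> x < r \<Longrightarrow> sgn (\<tau> x) = - sgn (fst (F (0, 0)))"
    "\<And>x. 0 < x \<Longrightarrow> x < r \<Longrightarrow> half_arc s (\<lambda>p. - sgn (fst (F (0, 0))) *\<^sub>R F p) \<bar>\<tau> x\<bar> (A x)"
    "\<And>x. 0 < x \<Longrightarrow> x < r \<Longrightarrow> A x 0 = (x, 0) \<and> A x \<bar>\<tau> x\<bar> = (half_return_map F \<tau> x, 0)"
    "\<And>x. 0 < x \<Longrightarrow> x < r \<Longrightarrow> half_return_map F \<tau> x < 0 \<and> - (2 * x) \<le> half_return_map F \<tau> x \<and>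
        on_real \<sigma> (half_return_map F \<tau> x) = - on_real \<sigma> x"
    "\<And>x u. 0 < x \<Longrightarrow> x < r \<Longrightarrow> u \<in> {0..\<bar>\<tau> x\<bar>} \<Longrightarrow> \<bar>fst (A x u)\<bar> \<le> 2 * x \<and> \<bar>snd (A x u)\<bar> \<le> K * x"
    "((\<lambda>x. \<bar>\<tau> x\<bar> / x) \<longlongrightarrow> 2 / \<bar>fst (F (0, 0))\<bar>) (at_right 0)"
proof -
  have lip: "locally_lipschitz F" by (rule analytic_vfield_lipschitz[OF F])
  define P where "P = fst (F (0, 0))"
  have P0: "P \<noteq> 0" using contact by (simp add: invisible_contact_def P_def)
  obtain r1 \<sigma> K where germ1: "real_germ \<sigma> r1" and K: "K \<ge> 0" and
    sQ: "\<And>x. 0 < \<bar>x\<bar> \<Longrightarrow> \<bar>x\<bar> < r1 \<Longrightarrow> s * P * (snd (F (x, 0)) * x) < 0" and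
    pos: "\<And>x y. \<bar>x\<bar> < r1 \<Longrightarrow> \<bar>y\<bar> < r1 \<Longrightarrow> P * fst (F (x, y)) > 0" and
    loc: "\<And>x d l \<alpha>. 0 < x \<Longrightarrow> x < r1 \<Longrightarrow> d \<in> {-1, 1} \<Longrightarrow> half_arc s (\<lambda>p. d *\<^sub>R F p) l \<alpha> \<Longrightarrow> \<alpha> 0 = (x, 0) \<Longrightarrow>
       d * P < 0 \<and> fst (\<alpha> l) < 0 \<and> - (2 * x) \<le> fst (\<alpha> l) \<and> on_real \<sigma> (fst (\<alpha> l)) = - on_real \<sigma> x \<and>
       (\<forall>u\<in>{0..l}. \<bar>fst (\<alpha> u)\<bar> \<le> 2 * x \<and> \<bar>snd (\<alpha> u)\<bar> \<le> K * x)"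
    by (rule half_return_local[OF F contact k s, folded P_def]) (rule that)
  define r where "r = min r1 x\<^sub>0"
  have r: "r > 0" "r \<le> r1" "r \<le> x\<^sub>0" using germ1 x0 by (auto simp: r_def real_germ_def)
  define \<phi> where "\<phi> = half_return_map F \<tau>"
  have "\<exists>\<alpha>. half_arc s (\<lambda>p. sgn (\<tau> x) *\<^sub>R F p) \<bar>\<tau> x\<bar> \<alpha> \<and> \<alpha> 0 = (x, 0) \<and> \<alpha> \<bar>\<tau> x\<bar> = (\<phi> x, 0)" if "0 < x" "x < r" for x
  proof -
    have "half_return_time s F x (\<tau> x)" "\<tau> x \<noteq> 0" using half[of x] that r by auto
    from half_return_arc[OF lip this] show ?thesis unfolding \<phi>_def half_return_map_def by metis
  qed
  then obtain A where A: "\<And>x. 0 < x \<Longrightarrow> x < r \<Longrightarrow> half_arc s (\<lambda>p. sgn (\<tau> x) *\<^sub>R F p) \<bar>\<tau> x\<bar> (A x)"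
    "\<And>x. 0 < x \<Longrightarrow> x < r \<Longrightarrow> A x 0 = (x, 0) \<and> A x \<bar>\<tau> x\<bar> = (\<phi> x, 0)"
    by metis
  have d: "sgn (\<tau> x) \<in> {-1, 1}" if "0 < x" "x < r" for x
    using half[of x] that r by (auto simp: sgn_if)
  have main: "sgn (\<tau> x) * P < 0" "\<phi> x < 0 \<and> - (2 * x) \<le> \<phi> x \<and> on_real \<sigma> (\<phi> x) = - on_real \<sigma> x"
    "\<forall>u\<in>{0..\<bar>\<tau> x\<bar>}. \<bar>fst (A x u)\<bar> \<le> 2 * x \<and> \<bar>snd (A x u)\<bar> \<le> K * x"
    if x: "0 < x" "x < r" for x
    using loc[OF x(1) _ d[OF x] A(1)[OF x]] A(2)[OF x] x r by auto
  have sgn\<tau>: "sgn (\<tau> x) = - sgn P" if "0 < x" "x < r" for x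
    using main(1)[OF that] by (auto simp: sgn_if mult_less_0_iff split: if_splits)
  have germ: "real_germ \<sigma> r" using real_germ_mono[OF germ1] r by auto
  have ev: "\<forall>\<^sub>F x in at_right 0. x \<in> {0<..<e}" if "e > 0" for e :: real
    using that by (intro eventually_at_right_real) auto
  have "((\<lambda>x. - sgn P * (\<phi> x - x) / \<bar>\<tau> x\<bar>) \<longlongrightarrow> P) (at_right 0)"
  proof (rule tendstoI)
    fix \<epsilon> :: real assume \<epsilon>: "\<epsilon> > 0"
    obtain \<eta> where \<eta>: "\<eta> > 0" and speed: "\<And>x d l \<alpha>. 0 < x \<Longrightarrow> x < \<eta> \<Longrightarrow> d \<in> {-1, 1} \<Longrightarrow> half_arc s (\<lambda>p. d *\<^sub>R F p) l \<alpha> \<Longrightarrow>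
      \<alpha> 0 = (x, 0) \<Longrightarrow> (\<forall>u\<in>{0..l}. \<bar>fst (\<alpha> u)\<bar> \<le> 2 * x \<and> \<bar>snd (\<alpha> u)\<bar> \<le> K * x) \<Longrightarrow>
      \<bar>d * (fst (\<alpha> l) - x) / l - fst (F (0, 0))\<bar> < \<epsilon>"
      using half_arc_mean_speed[OF locally_lipschitz_continuous[OF lip] \<epsilon>] by blast
    show "\<forall>\<^sub>F x in at_right 0. dist (- sgn P * (\<phi> x - x) / \<bar>\<tau> x\<bar>) P < \<epsilon>"
      using ev[OF r(1)] ev[OF \<eta>]
    proof eventually_elim
      case (elim x)
      then have x: "0 < x" "x < r" by auto
      have "\<bar>sgn (\<tau> x) * (fst (A x \<bar>\<tau> x\<bar>) - x) / \<bar>\<tau> x\<bar> - fst (F (0, 0))\<bar> < \<epsilon>"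
        by (rule speed[OF x(1) _ d[OF x] A(1)[OF x] _ main(3)[OF x]]) (use elim A(2)[OF x] in auto)
      then show ?case using A(2)[OF x] by (simp add: sgn\<tau>[OF x] dist_real_def P_def)
    qed
  qed
  moreover have "((\<lambda>x. \<phi> x / x) \<longlongrightarrow> -1) (at_right 0)"
    by (rule real_germ_reflection_asymp[OF germ main(2)])
  ultimately have "((\<lambda>x. - sgn P * (\<phi> x / x - 1) / (- sgn P * (\<phi> x - x) / \<bar>\<tau> x\<bar>)) \<longlongrightarrow> - sgn P * (-1 - 1) / P) (at_right 0)"
    using P0 by (intro tendsto_intros)
  moreover have "- sgn P * (-1 - 1) / P = 2 / \<bar>P\<bar>" using P0 by (simp add: sgn_if)
  ultimately have "((\<lambda>x. - sgn P * (\<phi> x / x - 1) / (- sgn P * (\<phi> x - x) / \<bar>\<tau> x\<bar>)) \<longlongrightarrow> 2 / \<bar>P\<bar>) (at_right 0)" by simp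
  then have lim: "((\<lambda>x. \<bar>\<tau> x\<bar> / x) \<longlongrightarrow> 2 / \<bar>P\<bar>) (at_right 0)"
  proof (rule Lim_transform_eventually)
    show "\<forall>\<^sub>F x in at_right 0. - sgn P * (\<phi> x / x - 1) / (- sgn P * (\<phi> x - x) / \<bar>\<tau> x\<bar>) = \<bar>\<tau> x\<bar> / x"
      using ev[OF r(1)]
    proof eventually_elim
      case (elim x)
      then have x: "0 < x" "x < r" by auto
      have "\<phi> x - x \<noteq> 0" "sgn P \<noteq> 0" using main(2)[OF x] x P0 by (auto simp: sgn_zero_iff)
      moreover have "\<phi> x / x - 1 = (\<phi> x - x) / x" using x by (simp add: diff_divide_distrib)
      ultimately show ?case using x by simp
    qed
  qed
  show ?thesis
  proof (rule that[of \<sigma> r K A])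
    show "half_arc s (\<lambda>p. - sgn (fst (F (0, 0))) *\<^sub>R F p) \<bar>\<tau> x\<bar> (A x)" if "0 < x" "x < r" for x
      using A(1)[OF that] unfolding sgn\<tau>[OF that] P_def .
    show "s * fst (F (0, 0)) * (snd (F (x, 0)) * x) < 0" if "0 < \<bar>x\<bar>" "\<bar>x\<bar> < r" for x
      using sQ[of x] that r by (simp add: P_def)
    show "fst (F (0, 0)) * fst (F (x, y)) > 0" if "\<bar>x\<bar> < r" "\<bar>y\<bar> < r" for x y
      using pos[of x y] that r by (simp add: P_def)
    show "((\<lambda>x. \<bar>\<tau> x\<bar> / x) \<longlongrightarrow> 2 / \<bar>fst (F (0, 0))\<bar>) (at_right 0)" using lim by (simp add: P_def)
    show "sgn (\<tau> x) = - sgn (fst (F (0, 0)))" if "0 < x" "x < r" for x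
      using sgn\<tau>[OF that] by (simp add: P_def)
  qed (use germ r K A(2) main \<phi>_def in blast)+
qed

section \<open>The displacement function\<close>

lemma real_germ_complex_diff:
  assumes \<sigma>: "real_germ \<sigma> r" and zw: "z \<in> ball 0 r" "w \<in> ball 0 r"
  shows "norm ((\<sigma> z - \<sigma> w) - (z - w)) \<le> 1 / 4 * norm (z - w)"
proof -
  have hol: "\<sigma> holomorphic_on ball 0 r" using \<sigma> by (simp add: real_germ_def)
  have "norm ((\<sigma> z - z) - (\<sigma> w - w)) \<le> 1 / 4 * norm (z - w)"
  proof (rule field_differentiable_bound[of "ball 0 r" "\<lambda>z. \<sigma> z - z" "\<lambda>z. deriv \<sigma> z - 1"])
    fix u :: complex assume u: "u \<in> ball 0 r"
    have "(\<sigma> has_field_derivative deriv \<sigma> u) (at u within ball 0 r)"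
      using holomorphic_derivI[OF hol open_ball u] .
    then show "((\<lambda>z. \<sigma> z - z) has_field_derivative deriv \<sigma> u - 1) (at u within ball 0 r)"
      by (auto intro!: derivative_eq_intros)
    show "norm (deriv \<sigma> u - 1) \<le> 1 / 4" using \<sigma> u by (auto simp: real_germ_def)
  qed (use zw in auto)
  then show ?thesis by (simp add: algebra_simps)
qed

text \<open>On the complex disc \<open>\<sigma>\<close> is injective because its difference from the
  identity is \<open>1 / 4\<close>-Lipschitz, so it has a holomorphic inverse. The inverse is real
  at small reals because \<open>real_germ_solve\<close> provides real preimages.\<close>

lemma real_germ_inverse:
  assumes \<sigma>: "real_germ \<sigma> r"
  obtains s S where "real_germ S s" "s \<le> r / 2"
    "\<And>x. \<bar>x\<bar> < r \<Longrightarrow> \<bar>on_real \<sigma> x\<bar> < s \<Longrightarrow> on_real S (on_real \<sigma> x) = x"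
    "\<And>y. \<bar>y\<bar> < s \<Longrightarrow> on_real \<sigma> (on_real S y) = y"
proof -
  have r: "r > 0" and hol: "\<sigma> holomorphic_on ball 0 r" and \<sigma>0: "\<sigma> 0 = 0" and d\<sigma>: "deriv \<sigma> 0 = 1"
    using \<sigma> by (auto simp: real_germ_def)
  have inj: "inj_on \<sigma> (ball 0 r)"
  proof (rule inj_onI)
    fix z w assume zw: "z \<in> ball 0 r" "w \<in> ball 0 r" "\<sigma> z = \<sigma> w"
    have "norm ((\<sigma> z - \<sigma> w) - (z - w)) \<le> 1 / 4 * norm (z - w)"
      by (rule real_germ_complex_diff[OF \<sigma> zw(1,2)])
    then have "norm (w - z) \<le> 1 / 4 * norm (z - w)" using zw(3) by simp
    then show "z = w" by (simp add: norm_minus_commute)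
  qed
  obtain g where g: "g holomorphic_on (\<sigma> ` ball 0 r)"
    and dg: "\<And>z. z \<in> ball 0 r \<Longrightarrow> deriv \<sigma> z * deriv g (\<sigma> z) = 1"
    and gf: "\<And>z. z \<in> ball 0 r \<Longrightarrow> g (\<sigma> z) = z"
    using holomorphic_has_inverse[OF hol open_ball inj] by blast
  have "open (\<sigma> ` ball 0 r)" by (rule open_mapping_thm3[OF hol open_ball inj])
  moreover have "0 \<in> \<sigma> ` ball 0 r" using \<sigma>0 r by (metis centre_in_ball imageI)
  ultimately obtain e where e: "e > 0" "ball 0 e \<subseteq> \<sigma> ` ball 0 r"
    using open_contains_ball by blast
  define t where "t = min e (r / 2)"
  have t: "t > 0" "t \<le> e" "t \<le> r / 2" using e r by (auto simp: t_def)
  have ex: "\<exists>x. \<bar>x\<bar> < r \<and> on_real \<sigma> x = y" if "\<bar>y\<bar> < t" for y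
  proof -
    have "\<bar>y\<bar> < r / 2" using that t by simp
    then obtain x where "\<bar>x\<bar> \<le> 2 * \<bar>y\<bar>" "on_real \<sigma> x = y"
      using real_germ_solve[OF \<sigma>, of y y] by auto
    then show ?thesis using \<open>\<bar>y\<bar> < r / 2\<close> by (intro exI[of _ x]) auto
  qed
  have g\<sigma>: "g (of_real (on_real \<sigma> x)) = of_real x" if "\<bar>x\<bar> < r" for x
    using gf[of "of_real x"] real_germ_of_real[OF \<sigma> that] that by simp
  have greal: "g (of_real y) \<in> \<real>" if y: "\<bar>y\<bar> < t" for y
    using ex[OF y] g\<sigma> by (metis Reals_of_real)
  have holg: "g holomorphic_on ball 0 t" using e t by (intro holomorphic_on_subset[OF g]) auto
  have g0: "g 0 = 0" using gf[of 0] r \<sigma>0 by simp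
  have dg0: "deriv g 0 = 1" using dg[of 0] r \<sigma>0 d\<sigma> by simp
  obtain s where s: "0 < s" "s \<le> t" "real_germ g s"
    using real_germ_shrink[OF holg t(1) g0 dg0 greal] by blast
  show ?thesis
  proof (rule that[OF s(3)])
    show "s \<le> r / 2" using s t by simp
    show *: "on_real g (on_real \<sigma> x) = x" if "\<bar>x\<bar> < r" "\<bar>on_real \<sigma> x\<bar> < s" for x
      using g\<sigma>[OF that(1)] by (simp add: on_real_def[of g])
    show "on_real \<sigma> (on_real g y) = y" if "\<bar>y\<bar> < s" for y
      using ex[of y] * that s by auto
  qed
qed

text \<open>Write \<open>G z = z ^ N * g z\<close> with \<open>g 0 \<noteq> 0\<close>. For odd
  \<open>N\<close> the evenness of \<open>G\<close> would make \<open>g\<close> odd along the real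
  axis, hence \<open>g 0 = - g 0\<close>. The asymptotics of the derivative, from the same
  factorisation, serve a monotonicity estimate.\<close>

lemma even_holomorphic_order:
  assumes r: "r > 0" and G: "G holomorphic_on ball 0 r" and even: "\<And>z. z \<in> ball 0 r \<Longrightarrow> G (- z) = G z"
    and real: "\<And>x. \<bar>x\<bar> < r \<Longrightarrow> G (of_real x) \<in> \<real>" and G0: "G 0 = 0"
    and nz: "\<And>x. 0 < x \<Longrightarrow> x < r \<Longrightarrow> G (of_real x) \<noteq> 0"
  obtains n a where "n \<ge> (1::nat)" "a \<noteq> 0"
    "((\<lambda>x. on_real G x / x ^ (2 * n)) \<longlongrightarrow> a) (at 0)"
    "((\<lambda>x. on_real (deriv G) x / x ^ (2 * n - 1)) \<longlongrightarrow> 2 * real n * a) (at 0)"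
proof -
  have ev: "\<forall>\<^sub>F x in at (0::real). x \<noteq> 0 \<and> \<bar>x\<bar> < e" if "e > 0" for e
    unfolding eventually_at using that by (intro exI[of _ e]) auto
  have of_real_at: "filterlim (of_real :: real \<Rightarrow> complex) (at 0) (at 0)"
    by (rule filterlim_atI) (auto intro!: tendsto_eq_intros simp: eventually_at_filter)
  have nc: "\<not> G constant_on ball 0 r"
  proof
    assume "G constant_on ball 0 r"
    then have "G (of_real (r / 2)) = G 0" using r by (auto simp: constant_on_def)
    then show False using nz[of "r / 2"] G0 r by simp
  qed
  obtain g s N where N: "0 < N" and s: "0 < s" "ball (0::complex) s \<subseteq> ball 0 r" and g: "g holomorphic_on ball 0 s"
    and Gg: "\<And>w. w \<in> ball 0 s \<Longrightarrow> G w = (w - 0) ^ N * g w" and gnz: "\<And>w. w \<in> ball 0 s \<Longrightarrow> g w \<noteq> 0"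
    by (rule holomorphic_factor_zero_nonconstant[OF G open_ball connected_ball centre_in_ball[THEN iffD2, OF r] G0 nc]) (rule that)
  have sr: "s \<le> r" using s by (simp add: ball_subset_ball_iff)
  have along: "((\<lambda>x. f (of_real x)) \<longlongrightarrow> f 0) (at (0::real))" if "f holomorphic_on ball 0 s" for f :: "complex \<Rightarrow> complex"
  proof -
    have "isCont f 0"
      using that s by (metis at_within_open centre_in_ball continuous_on_eq_continuous_within holomorphic_on_imp_continuous_on open_ball)
    then show ?thesis using filterlim_compose[OF _ of_real_at] by (auto simp: isCont_def)
  qed
  have Gx: "G (of_real x) / of_real x ^ N = g (of_real x)" if "x \<noteq> 0" "\<bar>x\<bar> < s" for x
    using Gg[of "of_real x"] that by simp
  have "even N"
  proof (rule ccontr)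
    assume odd: "\<not> even N"
    have "((\<lambda>x. - g (of_real x)) \<longlongrightarrow> - g 0) (at (0::real))" by (intro tendsto_intros along g)
    moreover have "((\<lambda>x. - g (of_real x)) \<longlongrightarrow> g 0) (at (0::real))"
    proof (rule Lim_transform_eventually)
      have "(\<lambda>z. g (- z)) holomorphic_on ball 0 s"
        by (rule holomorphic_on_compose_gen[OF _ g, of uminus, unfolded o_def]) (auto intro!: holomorphic_intros)
      from along[OF this] show "((\<lambda>x. g (- of_real x)) \<longlongrightarrow> g 0) (at (0::real))" by simp
      show "\<forall>\<^sub>F x in at (0::real). g (- of_real x) = - g (of_real x)"
        using ev[OF s(1)]
      proof eventually_elim
        case (elim x)
        have "g (- of_real x) = G (- of_real x) / (- of_real x) ^ N" using Gx[of "- x"] elim by simp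
        also have "\<dots> = - (G (of_real x) / of_real x ^ N)" using even[of "of_real x"] elim sr odd by simp
        also have "\<dots> = - g (of_real x)" using Gx[of x] elim by simp
        finally show ?case .
      qed
    qed
    ultimately have "- g 0 = g 0" using LIM_unique by blast
    then show False using gnz[of 0] s by simp
  qed
  then obtain n where n: "N = 2 * n" by (auto elim: evenE)
  have n1: "n \<ge> 1" using N n by simp
  define a where "a = Re (g 0)"
  have lim1: "((\<lambda>x. G (of_real x) / of_real x ^ N) \<longlongrightarrow> g 0) (at (0::real))"
    by (rule Lim_transform_eventually[OF along[OF g]]) (use ev[OF s(1)] Gx in \<open>auto elim!: eventually_mono\<close>)
  have Re_div: "Re (z / of_real x ^ m) = Re z / x ^ m" for z x m
    by (metis Re_divide_of_real of_real_power)
  have 1: "((\<lambda>x. on_real G x / x ^ (2 * n)) \<longlongrightarrow> a) (at 0)"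
    using tendsto_Re[OF lim1] by (simp add: on_real_def a_def Re_div n)
  have "((\<lambda>x. Im (G (of_real x) / of_real x ^ N)) \<longlongrightarrow> Im (g 0)) (at 0)" by (rule tendsto_Im[OF lim1])
  moreover have "((\<lambda>x. Im (G (of_real x) / of_real x ^ N)) \<longlongrightarrow> 0) (at 0)"
  proof (rule Lim_transform_eventually[OF tendsto_const])
    show "\<forall>\<^sub>F x in at 0. 0 = Im (G (of_real x) / of_real x ^ N)"
      using ev[OF r]
    proof eventually_elim
      case (elim x)
      have "G (of_real x) / of_real x ^ N \<in> \<real>" using real[of x] elim by (intro Reals_divide Reals_power) auto
      then show ?case by (simp add: complex_is_Real_iff)
    qed
  qed
  ultimately have "Im (g 0) = 0" using LIM_unique by blast
  then have ga: "g 0 = of_real a" by (simp add: a_def complex_eq_iff)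
  then have a0: "a \<noteq> 0" using gnz[of 0] s by auto
  have dG: "deriv G z = of_nat N * z ^ (N - 1) * g z + z ^ N * deriv g z" if z: "z \<in> ball 0 s" for z
  proof -
    have "(g has_field_derivative deriv g z) (at z)" by (rule holomorphic_derivI[OF g open_ball z])
    then have "((\<lambda>z. z ^ N * g z) has_field_derivative of_nat N * z ^ (N - 1) * g z + z ^ N * deriv g z) (at z)"
      by (auto intro!: derivative_eq_intros)
    then have "(G has_field_derivative of_nat N * z ^ (N - 1) * g z + z ^ N * deriv g z) (at z)"
      by (rule DERIV_cong_ev[THEN iffD1, rotated -1, OF _ refl _ refl])
         (use z Gg eventually_nhds_in_open[OF open_ball z] in \<open>auto elim!: eventually_mono\<close>)
    then show ?thesis by (rule DERIV_imp_deriv)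
  qed
  have "((\<lambda>x. of_nat N * g (of_real x) + of_real x * deriv g (of_real x)) \<longlongrightarrow> of_nat N * g 0 + 0 * deriv g 0) (at (0::real))"
    by (intro tendsto_intros along g holomorphic_deriv open_ball) (auto intro!: tendsto_eq_intros)
  then have "((\<lambda>x. deriv G (of_real x) / of_real x ^ (N - 1)) \<longlongrightarrow> of_nat N * g 0 + 0 * deriv g 0) (at (0::real))"
  proof (rule Lim_transform_eventually)
    show "\<forall>\<^sub>F x in at (0::real). of_nat N * g (of_real x) + of_real x * deriv g (of_real x) = deriv G (of_real x) / of_real x ^ (N - 1)"
      using ev[OF s(1)]
    proof eventually_elim
      case (elim x)
      have "complex_of_real x ^ N = of_real x ^ (N - 1) * of_real x" using N by (cases N) auto
      then show ?case using dG[of "of_real x"] elim by (simp add: field_simps)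
    qed
  qed
  from tendsto_Re[OF this] have 2: "((\<lambda>x. on_real (deriv G) x / x ^ (2 * n - 1)) \<longlongrightarrow> 2 * real n * a) (at 0)"
    by (simp add: on_real_def Re_div n ga)
  show ?thesis by (rule that[OF n1 a0 1 2])
qed

text \<open>The first bound uses that \<open>deriv \<sigma>\<close> is close to 1 near 0: a shift by
  \<open>b\<close> lowers the value by nearly \<open>b\<close>. The second is a mixed second
  difference, bounded through the Lipschitz constant of \<open>deriv \<sigma>\<close>; it controls
  how the effect of the shift varies with the point, which uniqueness needs.\<close>

lemma real_germ_shift:
  assumes \<sigma>: "real_germ \<sigma> r"
  obtains C where "C \<ge> 0"
    "\<And>x b \<rho>. \<bar>x\<bar> \<le> \<rho> \<Longrightarrow> \<bar>x - b\<bar> \<le> \<rho> \<Longrightarrow> \<rho> \<le> r / 2 \<Longrightarrow> \<bar>on_real \<sigma> (x - b) - on_real \<sigma> x + b\<bar> \<le> C * \<rho> * \<bar>b\<bar>"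
    "\<And>x x' b. \<bar>x\<bar> < r / 4 \<Longrightarrow> \<bar>x'\<bar> < r / 4 \<Longrightarrow> \<bar>b\<bar> < r / 4 \<Longrightarrow>
       \<bar>(on_real \<sigma> (x - b) - on_real \<sigma> x) - (on_real \<sigma> (x' - b) - on_real \<sigma> x')\<bar> \<le> C * \<bar>b\<bar> * \<bar>x - x'\<bar>"
proof -
  have r: "r > 0" and hol: "\<sigma> holomorphic_on ball 0 r" and d\<sigma>: "deriv \<sigma> 0 = 1"
    and bd: "\<And>z. z \<in> ball 0 r \<Longrightarrow> norm (deriv \<sigma> z - 1) \<le> 1 / 4"
    using \<sigma> by (auto simp: real_germ_def)
  \<comment> \<open>The constant \<open>4 * M / r\<close> of \<open>holomorphic_lipschitz\<close>,
    applied to \<open>deriv \<sigma>\<close> with the crude bound \<open>M = 2\<close>.\<close>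
  define C where "C = 4 * 2 / r"
  have C: "C \<ge> 0" using r by (simp add: C_def)
  have lipc: "norm (deriv \<sigma> z - deriv \<sigma> w) \<le> C * norm (z - w)" if "z \<in> cball 0 (r/2)" "w \<in> cball 0 (r/2)" for z w
    unfolding C_def
  proof (rule holomorphic_lipschitz[OF _ r _ that])
    show "deriv \<sigma> holomorphic_on ball 0 r" by (rule holomorphic_deriv[OF hol open_ball])
    fix u :: complex assume "u \<in> ball 0 r"
    then have "norm (deriv \<sigma> u - 1) \<le> 1 / 4" by (rule bd)
    then show "norm (deriv \<sigma> u) \<le> 2" using norm_triangle_ineq2[of "deriv \<sigma> u" 1] by simp
  qed
  have lip: "\<bar>on_real (deriv \<sigma>) x - on_real (deriv \<sigma>) y\<bar> \<le> C * \<bar>x - y\<bar>" if "\<bar>x\<bar> \<le> r / 2" "\<bar>y\<bar> \<le> r / 2" for x y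
  proof -
    have "\<bar>Re (deriv \<sigma> (of_real x) - deriv \<sigma> (of_real y))\<bar> \<le> norm (deriv \<sigma> (of_real x) - deriv \<sigma> (of_real y))"
      by (rule abs_Re_le_cmod)
    also have "\<dots> \<le> C * norm (complex_of_real x - of_real y)" using that by (intro lipc) auto
    also have "norm (complex_of_real x - of_real y) = \<bar>x - y\<bar>" by (simp flip: of_real_diff)
    finally show ?thesis by (simp add: on_real_def)
  qed
  show ?thesis
  proof (rule that[OF C])
    fix x b \<rho> assume x: "\<bar>x\<bar> \<le> \<rho>" "\<bar>x - b\<bar> \<le> \<rho>" "\<rho> \<le> r / 2"
    have "norm ((on_real \<sigma> (x - b) - (x - b)) - (on_real \<sigma> x - x)) \<le> (C * \<rho>) * norm ((x - b) - x)"
    proof (rule field_differentiable_bound[of "{-\<rho>..\<rho>}" "\<lambda>x. on_real \<sigma> x - x" "\<lambda>x. on_real (deriv \<sigma>) x - 1"])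
      fix z assume z: "z \<in> {-\<rho>..\<rho>}"
      have zr: "\<bar>z\<bar> < r" using z x r by auto
      show "((\<lambda>x. on_real \<sigma> x - x) has_real_derivative on_real (deriv \<sigma>) z - 1) (at z within {-\<rho>..\<rho>})"
        using real_germ_has_derivative[OF \<sigma> zr] by (auto intro!: derivative_eq_intros)
      have "\<bar>on_real (deriv \<sigma>) z - on_real (deriv \<sigma>) 0\<bar> \<le> C * \<bar>z - 0\<bar>" using z x r by (intro lip) auto
      also have "\<dots> \<le> C * \<rho>" using z C by (intro mult_left_mono) auto
      finally show "norm (on_real (deriv \<sigma>) z - 1) \<le> C * \<rho>" using d\<sigma> by (simp add: on_real_def)
    qed (use x in auto)
    then show "\<bar>on_real \<sigma> (x - b) - on_real \<sigma> x + b\<bar> \<le> C * \<rho> * \<bar>b\<bar>" by (simp add: algebra_simps)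
  next
    fix x x' b assume x: "\<bar>x\<bar> < r / 4" "\<bar>x'\<bar> < r / 4" "\<bar>b\<bar> < r / 4"
    have "norm ((on_real \<sigma> (x - b) - on_real \<sigma> x) - (on_real \<sigma> (x' - b) - on_real \<sigma> x')) \<le> (C * \<bar>b\<bar>) * norm (x - x')"
    proof (rule field_differentiable_bound[of "{-r/4<..<r/4}" "\<lambda>x. on_real \<sigma> (x - b) - on_real \<sigma> x"
          "\<lambda>x. on_real (deriv \<sigma>) (x - b) - on_real (deriv \<sigma>) x"])
      fix z assume z: "z \<in> {-r/4<..<r/4}"
      have "\<bar>z\<bar> < r / 4" "\<bar>z - b\<bar> \<le> \<bar>z\<bar> + \<bar>b\<bar>" using z by auto
      then have zr: "\<bar>z\<bar> < r" "\<bar>z - b\<bar> < r" "\<bar>z\<bar> \<le> r / 2" "\<bar>z - b\<bar> \<le> r / 2" using x(3) r by linarith+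
      have "((\<lambda>x. on_real \<sigma> (x - b)) has_real_derivative on_real (deriv \<sigma>) (z - b) * 1) (at z)"
        by (rule DERIV_chain2[where f = "on_real \<sigma>" and g = "\<lambda>x. x - b", OF real_germ_has_derivative[OF \<sigma> zr(2)]])
           (auto intro!: derivative_eq_intros)
      then have "((\<lambda>x. on_real \<sigma> (x - b) - on_real \<sigma> x) has_real_derivative on_real (deriv \<sigma>) (z - b) * 1 - on_real (deriv \<sigma>) z) (at z)"
        by (intro DERIV_diff real_germ_has_derivative[OF \<sigma> zr(1)])
      then show "((\<lambda>x. on_real \<sigma> (x - b) - on_real \<sigma> x) has_real_derivative on_real (deriv \<sigma>) (z - b) - on_real (deriv \<sigma>) z)
          (at z within {-r/4<..<r/4})" by (simp add: has_field_derivative_at_within)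
      show "norm (on_real (deriv \<sigma>) (z - b) - on_real (deriv \<sigma>) z) \<le> C * \<bar>b\<bar>"
        using lip[OF zr(4,3)] by simp
    qed (use x in auto)
    then show "\<bar>(on_real \<sigma> (x - b) - on_real \<sigma> x) - (on_real \<sigma> (x' - b) - on_real \<sigma> x')\<bar> \<le> C * \<bar>b\<bar> * \<bar>x - x'\<bar>"
      by simp
  qed
qed

text \<open>With \<open>v = S p\<close> and \<open>u = S (- p)\<close>, where \<open>S\<close> inverts \<open>\<sigma>2\<close>, the unperturbed displacement is an
  even analytic function of \<open>p\<close>; this is why its order \<open>2 * n\<close> is even. The perturbation contributes
  \<open>- 2 * b\<close> to leading order.\<close>

lemma displacement:
  assumes g1: "real_germ \<sigma>1 r" and g2: "real_germ \<sigma>2 r" and \<mu>: "\<mu> \<in> {-1, 1}"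
    and nz: "\<And>v u. 0 < v \<Longrightarrow> v < r \<Longrightarrow> - r < u \<Longrightarrow> u < 0 \<Longrightarrow> on_real \<sigma>2 u = - on_real \<sigma>2 v \<Longrightarrow>
      \<mu> * (on_real \<sigma>1 v + on_real \<sigma>1 u) > 0"
  obtains \<epsilon> n \<xi> where "\<epsilon> > 0" "n \<ge> (1::nat)" "\<xi> > 0"
    "\<And>e. e > 0 \<Longrightarrow> \<exists>\<eta>>0. \<forall>b. 0 < \<mu> * b \<and> \<mu> * b < \<eta> \<longrightarrow> (\<exists>v u. 0 < v \<and> v < e \<and> - e < u \<and> u < 0 \<and>
       on_real \<sigma>2 u = - on_real \<sigma>2 v \<and> on_real \<sigma>1 (v - b) + on_real \<sigma>1 (u - b) = 0)"
    "\<And>b v u v' u'. \<bar>b\<bar> < \<epsilon> \<Longrightarrow> 0 < v \<Longrightarrow> v < \<epsilon> \<Longrightarrow> - \<epsilon> < u \<Longrightarrow> u < 0 \<Longrightarrow> on_real \<sigma>2 u = - on_real \<sigma>2 v \<Longrightarrow>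
       on_real \<sigma>1 (v - b) + on_real \<sigma>1 (u - b) = 0 \<Longrightarrow> 0 < v' \<Longrightarrow> v' < \<epsilon> \<Longrightarrow> - \<epsilon> < u' \<Longrightarrow> u' < 0 \<Longrightarrow>
       on_real \<sigma>2 u' = - on_real \<sigma>2 v' \<Longrightarrow> on_real \<sigma>1 (v' - b) + on_real \<sigma>1 (u' - b) = 0 \<Longrightarrow> v = v'"
    "\<And>(F::real filter) v u. ((\<lambda>b. b) \<longlongrightarrow> 0) F \<Longrightarrow> (v \<longlongrightarrow> 0) F \<Longrightarrow> (u \<longlongrightarrow> 0) F \<Longrightarrow>
       (\<forall>\<^sub>F b in F. 0 < \<mu> * b \<and> 0 < v b \<and> u b < 0 \<and> on_real \<sigma>2 (u b) = - on_real \<sigma>2 (v b) \<and>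
         on_real \<sigma>1 (v b - b) + on_real \<sigma>1 (u b - b) = 0) \<Longrightarrow>
       ((\<lambda>b. v b ^ (2 * n) / \<bar>b\<bar>) \<longlongrightarrow> \<xi>) F"
proof -
  have r: "r > 0" using g1 by (simp add: real_germ_def)
  obtain s S where S: "real_germ S s" and sr: "s \<le> r / 2"
    and S\<sigma>: "\<And>x. \<bar>x\<bar> < r \<Longrightarrow> \<bar>on_real \<sigma>2 x\<bar> < s \<Longrightarrow> on_real S (on_real \<sigma>2 x) = x"
    and \<sigma>S: "\<And>y. \<bar>y\<bar> < s \<Longrightarrow> on_real \<sigma>2 (on_real S y) = y"
    by (rule real_germ_inverse[OF g2]) (rule that)
  have s: "s > 0" using S by (simp add: real_germ_def)
  define T where "T = on_real S"
  define s1 where "s1 = on_real \<sigma>1"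
  define s2 where "s2 = on_real \<sigma>2"
  have T_bound: "\<bar>T p\<bar> \<le> 5 / 4 * \<bar>p\<bar>" if "\<bar>p\<bar> < s" for p
    unfolding T_def by (rule real_germ_bounds(1)[OF S that])
  have T_pos: "T p > 0" if "0 < p" "p < s" for p
    using real_germ_less_iff[OF S, of 0 p] real_germ_0[OF S] that by (simp add: T_def)
  have T_neg: "T (- p) < 0" if "0 < p" "p < s" for p
    using real_germ_less_iff[OF S, of "- p" 0] real_germ_0[OF S] that by (simp add: T_def)
  have s2T: "s2 (T p) = p" if "\<bar>p\<bar> < s" for p using \<sigma>S[OF that] by (simp add: s2_def T_def)
  have Sball: "S z \<in> ball 0 r" if "z \<in> ball 0 s" for z
  proof -
    have "norm (S z - z) \<le> 1 / 4 * norm z"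
      using real_germ_complex_diff[OF S that, of 0] s S by (simp add: real_germ_def)
    then have "norm (S z) \<le> 5 / 4 * norm z" using norm_triangle_ineq2[of "S z" z] by simp
    then show ?thesis using that sr s by simp
  qed
  define G where "G z = \<sigma>1 (S z) + \<sigma>1 (S (- z))" for z
  have hol: "(\<lambda>z. \<sigma>1 (S z)) holomorphic_on ball 0 s"
    by (rule holomorphic_on_compose_gen[unfolded o_def, of S _ \<sigma>1 "ball 0 r"])
       (use S g1 Sball in \<open>auto simp: real_germ_def\<close>)
  have hol': "(\<lambda>z. \<sigma>1 (S (- z))) holomorphic_on ball 0 s"
    by (rule holomorphic_on_compose_gen[OF _ hol, of uminus, unfolded o_def]) (auto intro!: holomorphic_intros)
  have holG: "G holomorphic_on ball 0 s" unfolding G_def by (intro holomorphic_intros hol hol')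
  define g0 where "g0 p = s1 (T p) + s1 (T (- p))" for p
  have GR: "G (of_real p) = of_real (g0 p)" if p: "\<bar>p\<bar> < s" for p
  proof -
    have "\<bar>T q\<bar> < r" if "\<bar>q\<bar> < s" for q using T_bound[OF that] that sr s by linarith
    then have *: "\<sigma>1 (S (of_real q)) = of_real (s1 (T q))" if "\<bar>q\<bar> < s" for q
      using real_germ_of_real[OF S that] real_germ_of_real[OF g1, of "T q"] that by (simp add: s1_def T_def)
    show ?thesis using *[of p] *[of "- p"] p by (simp add: G_def g0_def)
  qed
  have g0G: "on_real G p = g0 p" if "\<bar>p\<bar> < s" for p using GR[OF that] by (simp add: on_real_def)
  have \<mu>g0: "\<mu> * g0 p > 0" if p: "0 < p" "p < s" for p
  proof -
    have "\<bar>T p\<bar> < r" "\<bar>T (- p)\<bar> < r" using T_bound[of p] T_bound[of "- p"] p sr s by auto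
    then show ?thesis unfolding g0_def s1_def
      using T_pos[OF p] T_neg[OF p] s2T[of p] s2T[of "- p"] p by (intro nz) (auto simp: s2_def)
  qed
  obtain n a where n: "n \<ge> (1::nat)" and a: "a \<noteq> 0"
    and lim: "((\<lambda>x. on_real G x / x ^ (2 * n)) \<longlongrightarrow> a) (at 0)"
    and lim': "((\<lambda>x. on_real (deriv G) x / x ^ (2 * n - 1)) \<longlongrightarrow> 2 * real n * a) (at 0)"
  proof (rule even_holomorphic_order[OF s holG])
    show "G (- z) = G z" for z by (simp add: G_def add.commute)
    show "G (of_real x) \<in> \<real>" if "\<bar>x\<bar> < s" for x using GR[OF that] by simp
    show "G 0 = 0" using GR[of 0] s g1 S by (simp add: g0_def s1_def T_def real_germ_0)
    show "G (of_real x) \<noteq> 0" if "0 < x" "x < s" for x using GR[of x] \<mu>g0[OF that] that by auto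
  qed (rule that)
  have dg0: "(g0 has_real_derivative on_real (deriv G) p) (at p)" if p: "\<bar>p\<bar> < s" for p
  proof -
    have "(on_real G has_real_derivative on_real (deriv G) p) (at p)"
      by (rule on_real_has_derivative[OF holG p])
    then show ?thesis
    proof (rule has_field_derivative_transform_within_open[of _ _ _ "{-s<..<s}"])
      show "p \<in> {-s<..<s}" using p by auto
      show "on_real G x = g0 x" if "x \<in> {-s<..<s}" for x using that by (intro g0G) auto
    qed simp
  qed
  have ev_right: "\<forall>\<^sub>F p in at_right 0. p \<in> {0<..<e}" if "e > 0" for e :: real
    using that by (intro eventually_at_right_real) auto
  have \<mu>a: "\<mu> * a = \<bar>a\<bar>"
  proof -
    have "((\<lambda>x. \<mu> * (on_real G x / x ^ (2 * n))) \<longlongrightarrow> \<mu> * a) (at_right 0)"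
      by (intro tendsto_intros filterlim_mono[OF lim order_refl at_within_le_at])
    moreover have "\<forall>\<^sub>F x in at_right 0. \<mu> * (on_real G x / x ^ (2 * n)) \<ge> 0"
      using ev_right[OF s]
    proof eventually_elim
      case (elim x)
      then have "\<mu> * g0 x > 0" "x > 0" "\<bar>x\<bar> < s" using \<mu>g0 by auto
      then show ?case using g0G[of x] by (simp add: less_imp_le)
    qed
    ultimately have "\<mu> * a \<ge> 0" by (rule tendsto_lowerbound) simp
    then show ?thesis using \<mu> by auto
  qed
  obtain p1 where p1: "p1 > 0" and
    up: "\<And>p. 0 < p \<Longrightarrow> p < p1 \<Longrightarrow> \<bar>on_real G p / p ^ (2 * n) - a\<bar> < \<bar>a\<bar> / 2" and
    dn: "\<And>p. 0 < p \<Longrightarrow> p < p1 \<Longrightarrow> \<bar>on_real (deriv G) p / p ^ (2 * n - 1) - 2 * real n * a\<bar> < real n * \<bar>a\<bar>"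
  proof -
    have "\<forall>\<^sub>F x in at 0. dist (on_real G x / x ^ (2 * n)) a < \<bar>a\<bar> / 2"
      by (rule tendstoD[OF lim]) (use a in auto)
    then obtain d1 where d1: "d1 > 0" "\<And>x. x \<noteq> 0 \<Longrightarrow> dist x 0 < d1 \<Longrightarrow> dist (on_real G x / x ^ (2 * n)) a < \<bar>a\<bar> / 2"
      unfolding eventually_at by blast
    have "\<forall>\<^sub>F x in at 0. dist (on_real (deriv G) x / x ^ (2 * n - 1)) (2 * real n * a) < real n * \<bar>a\<bar>"
      by (rule tendstoD[OF lim']) (use a n in auto)
    then obtain d2 where d2: "d2 > 0" "\<And>x. x \<noteq> 0 \<Longrightarrow> dist x 0 < d2 \<Longrightarrow>
        dist (on_real (deriv G) x / x ^ (2 * n - 1)) (2 * real n * a) < real n * \<bar>a\<bar>"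
      unfolding eventually_at by blast
    show ?thesis
    proof (rule that[of "min d1 d2"])
      show "min d1 d2 > 0" using d1 d2 by simp
      fix p assume "0 < p" "p < min d1 d2"
      then show "\<bar>on_real G p / p ^ (2 * n) - a\<bar> < \<bar>a\<bar> / 2"
        "\<bar>on_real (deriv G) p / p ^ (2 * n - 1) - 2 * real n * a\<bar> < real n * \<bar>a\<bar>"
        using d1(2)[of p] d2(2)[of p] by (auto simp: dist_real_def)
    qed
  qed
  obtain C where C: "C \<ge> 0" and
    shift: "\<And>x b \<rho>. \<bar>x\<bar> \<le> \<rho> \<Longrightarrow> \<bar>x - b\<bar> \<le> \<rho> \<Longrightarrow> \<rho> \<le> r / 2 \<Longrightarrow> \<bar>s1 (x - b) - s1 x + b\<bar> \<le> C * \<rho> * \<bar>b\<bar>" and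
    shift_lip: "\<And>x x' b. \<bar>x\<bar> < r / 4 \<Longrightarrow> \<bar>x'\<bar> < r / 4 \<Longrightarrow> \<bar>b\<bar> < r / 4 \<Longrightarrow>
       \<bar>(s1 (x - b) - s1 x) - (s1 (x' - b) - s1 x')\<bar> \<le> C * \<bar>b\<bar> * \<bar>x - x'\<bar>"
    by (rule real_germ_shift[OF g1, folded s1_def]) (rule that)
  \<comment> \<open>The bound \<open>C * p0 \<le> 1 / 10\<close> from the last entry serves twice:
    it keeps the shift error below \<open>\<bar>b\<bar> / 2\<close> in \<open>E1'\<close>, and it
    makes \<open>5 / 2 * C * p0\<close> less than 1 in \<open>no_two\<close>.\<close>
  define p0 where "p0 = Min {s, r / 8, p1, 1 / (10 * (C + 1))}"
  have p0: "p0 > 0" "p0 \<le> s" "p0 \<le> r / 8" "p0 \<le> p1" and p0C: "p0 \<le> 1 / (10 * (C + 1))"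
    using s r p1 C by (auto simp: p0_def)
  have Cp0: "C * p0 \<le> 1 / 10"
  proof -
    have "p0 * (10 * (C + 1)) \<le> 1" using p0C C by (simp add: pos_le_divide_eq)
    then show ?thesis using p0(1) by (simp add: algebra_simps)
  qed
  define \<Delta> where "\<Delta> p b = s1 (T p - b) + s1 (T (- p) - b)" for p b
  \<comment> \<open>Each of the two summands is shifted by \<open>b\<close>, whence
    \<open>2 * b\<close>; \<open>\<rho>\<close> bounds \<open>T p\<close>, \<open>T (- p)\<close>
    and their shifts simultaneously.\<close>
  have E1: "\<bar>\<Delta> p b - g0 p + 2 * b\<bar> \<le> 2 * C * (5 / 4 * \<bar>p\<bar> + \<bar>b\<bar>) * \<bar>b\<bar>" if "\<bar>p\<bar> < p0" "\<bar>b\<bar> < p0" for p b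
  proof -
    define \<rho> where "\<rho> = 5 / 4 * \<bar>p\<bar> + \<bar>b\<bar>"
    have "\<bar>T p\<bar> \<le> 5 / 4 * \<bar>p\<bar>" "\<bar>T (- p)\<bar> \<le> 5 / 4 * \<bar>p\<bar>" using T_bound[of p] T_bound[of "- p"] that p0 by auto
    moreover have "\<rho> \<le> r / 2" using that p0 r by (simp add: \<rho>_def)
    ultimately have "\<bar>s1 (T p - b) - s1 (T p) + b\<bar> \<le> C * \<rho> * \<bar>b\<bar>" "\<bar>s1 (T (- p) - b) - s1 (T (- p)) + b\<bar> \<le> C * \<rho> * \<bar>b\<bar>"
      by (intro shift; simp add: \<rho>_def)+
    then have "\<bar>\<Delta> p b - g0 p + 2 * b\<bar> \<le> C * \<rho> * \<bar>b\<bar> + C * \<rho> * \<bar>b\<bar>"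
      unfolding \<Delta>_def g0_def by linarith
    then show ?thesis by (simp add: \<rho>_def mult_ac)
  qed
  have E1': "\<bar>\<Delta> p b - g0 p + 2 * b\<bar> \<le> 1 / 2 * \<bar>b\<bar>" if "\<bar>p\<bar> < p0" "\<bar>b\<bar> < p0" for p b
  proof -
    have "C * (5 / 4 * \<bar>p\<bar> + \<bar>b\<bar>) \<le> C * (5 / 4 * p0 + p0)"
      using that C by (intro mult_left_mono add_mono) auto
    also have "\<dots> \<le> 9 / 4 * (1 / 10)" using Cp0 by simp
    finally have "2 * C * (5 / 4 * \<bar>p\<bar> + \<bar>b\<bar>) \<le> 1 / 2" by simp
    then have "2 * C * (5 / 4 * \<bar>p\<bar> + \<bar>b\<bar>) * \<bar>b\<bar> \<le> 1 / 2 * \<bar>b\<bar>" by (rule mult_right_mono) simp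
    then show ?thesis using E1[OF that] by linarith
  qed
  \<comment> \<open>The part of the displacement due to \<open>b\<close> is Lipschitz in
    \<open>p\<close> with a constant proportional to \<open>\<bar>b\<bar>\<close>; the factor
    \<open>5 / 2\<close> is twice the Lipschitz constant \<open>5 / 4\<close> of
    \<open>T\<close>.\<close>
  have E2: "\<bar>(\<Delta> p b - g0 p) - (\<Delta> q b - g0 q)\<bar> \<le> 5 / 2 * C * \<bar>b\<bar> * \<bar>p - q\<bar>"
    if "\<bar>p\<bar> < p0" "\<bar>q\<bar> < p0" "\<bar>b\<bar> < p0" for p q b
  proof -
    have Tr: "\<bar>T x\<bar> < r / 4" if "\<bar>x\<bar> < p0" for x using T_bound[of x] that p0 r by auto
    have lipT: "\<bar>T x - T y\<bar> \<le> 5 / 4 * \<bar>x - y\<bar>" if "\<bar>x\<bar> < p0" "\<bar>y\<bar> < p0" for x y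
    proof -
      have xs: "\<bar>x\<bar> < s" "\<bar>y\<bar> < s" using that p0 by auto
      show ?thesis
        using real_germ_diff[OF S xs] abs_triangle_ineq2[of "on_real S x - on_real S y" "x - y"]
        unfolding T_def by simp
    qed
    define A where "A = (s1 (T p - b) - s1 (T p)) - (s1 (T q - b) - s1 (T q))"
    define B where "B = (s1 (T (- p) - b) - s1 (T (- p))) - (s1 (T (- q) - b) - s1 (T (- q)))"
    have 1: "\<bar>A\<bar> \<le> C * \<bar>b\<bar> * (5 / 4 * \<bar>p - q\<bar>)" unfolding A_def
      by (rule order_trans[OF shift_lip mult_left_mono[OF lipT]]) (use that p0 r C Tr in auto)
    have "\<bar>B\<bar> \<le> C * \<bar>b\<bar> * (5 / 4 * \<bar>- p - - q\<bar>)" unfolding B_def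
      by (rule order_trans[OF shift_lip mult_left_mono[OF lipT]]) (use that p0 r C Tr in auto)
    moreover have "\<bar>- p - - q\<bar> = \<bar>p - q\<bar>" by simp
    ultimately have 2: "\<bar>B\<bar> \<le> C * \<bar>b\<bar> * (5 / 4 * \<bar>p - q\<bar>)" by simp
    have "(\<Delta> p b - g0 p) - (\<Delta> q b - g0 q) = A + B" by (simp add: \<Delta>_def g0_def A_def B_def)
    then have "\<bar>(\<Delta> p b - g0 p) - (\<Delta> q b - g0 q)\<bar> \<le> C * \<bar>b\<bar> * (5 / 4 * \<bar>p - q\<bar>) + C * \<bar>b\<bar> * (5 / 4 * \<bar>p - q\<bar>)"
      using 1 2 abs_triangle_ineq[of A B] by linarith
    then show ?thesis by simp
  qed
  have g0_up: "\<bar>g0 p\<bar> \<le> 3 / 2 * \<bar>a\<bar> * p ^ (2 * n)" if "0 < p" "p < p0" for p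
  proof -
    have "\<bar>g0 p / p ^ (2 * n) - a\<bar> < \<bar>a\<bar> / 2" using up[of p] g0G[of p] that p0 by auto
    then have "\<bar>g0 p / p ^ (2 * n)\<bar> \<le> 3 / 2 * \<bar>a\<bar>" by linarith
    then show ?thesis using that by (simp add: abs_divide pos_divide_le_eq)
  qed
  \<comment> \<open>By the choice of \<open>p1\<close> the scaled derivative keeps at least half of
    its limit \<open>2 * n * a\<close>, which leaves the factor
    \<open>n * \<bar>a\<bar>\<close>.\<close>
  have g0_mono: "\<mu> * (g0 q - g0 p) \<ge> real n * \<bar>a\<bar> * p ^ (2 * n - 1) * (q - p)" if pq: "0 < p" "p < q" "q < p0" for p q
  proof -
    have "\<exists>z. p < z \<and> z < q \<and> g0 q - g0 p = (q - p) * on_real (deriv G) z"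
      by (rule MVT2) (use pq p0 in \<open>auto intro!: dg0\<close>)
    then obtain z where z: "p < z" "z < q" "g0 q - g0 p = (q - p) * on_real (deriv G) z" by blast
    have "\<bar>on_real (deriv G) z / z ^ (2 * n - 1) - 2 * real n * a\<bar> < real n * \<bar>a\<bar>"
      using z pq p0 by (intro dn) auto
    then have "\<bar>\<mu> * (on_real (deriv G) z / z ^ (2 * n - 1) - 2 * real n * a)\<bar> < real n * \<bar>a\<bar>"
      using \<mu> by (auto simp: abs_mult)
    then have "\<bar>\<mu> * (on_real (deriv G) z / z ^ (2 * n - 1)) - 2 * (real n * (\<mu> * a))\<bar> < real n * \<bar>a\<bar>"
      by (simp add: right_diff_distrib mult_ac)
    then have "\<mu> * (on_real (deriv G) z / z ^ (2 * n - 1)) \<ge> real n * \<bar>a\<bar>"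
      unfolding \<mu>a by linarith
    then have "\<mu> * on_real (deriv G) z \<ge> real n * \<bar>a\<bar> * z ^ (2 * n - 1)"
      using z pq by (simp add: pos_le_divide_eq)
    moreover have "real n * \<bar>a\<bar> * p ^ (2 * n - 1) \<le> real n * \<bar>a\<bar> * z ^ (2 * n - 1)"
      using z pq by (intro mult_left_mono power_mono) auto
    ultimately have "real n * \<bar>a\<bar> * p ^ (2 * n - 1) * (q - p) \<le> \<mu> * on_real (deriv G) z * (q - p)"
      using pq by (intro mult_right_mono) auto
    then show ?thesis using z(3) by (simp add: mult_ac)
  qed
  \<comment> \<open>At a zero
    \<open>2 * \<bar>b\<bar> \<le> \<bar>g0 p\<bar> + \<bar>b\<bar> / 2\<close>, so \<open>b\<close>
    is at most of order \<open>p ^ (2 * n)\<close>. This is what makes the perturbation weak enough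
    in \<open>no_two\<close>.\<close>
  have b_le: "\<bar>b\<bar> \<le> \<bar>a\<bar> * p ^ (2 * n)" if "0 < p" "p < p0" "\<bar>b\<bar> < p0" "\<Delta> p b = 0" for p b
    using E1'[of p b] g0_up[of p] that by (simp add: abs_if split: if_splits)
  \<comment> \<open>Between two zeros the unperturbed part grows at least by order
    \<open>p ^ (2 * n - 1) * (q - p)\<close>, whereas the perturbation can compensate only order
    \<open>\<bar>b\<bar> * (q - p)\<close>, which is smaller by one power of
    \<open>p\<close>.\<close>
  have no_two: False if pq: "0 < p" "p < q" "q < p0" and b: "\<bar>b\<bar> < p0" and z: "\<Delta> p b = 0" "\<Delta> q b = 0" for p q b
  proof -
    have "real n * \<bar>a\<bar> * p ^ (2 * n - 1) * (q - p) \<le> \<bar>g0 q - g0 p\<bar>"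
      using g0_mono[OF pq] \<mu> by auto
    also have "\<dots> \<le> 5 / 2 * C * \<bar>b\<bar> * (q - p)"
      using E2[of p q b] pq b z by (simp add: abs_minus_commute)
    also have "\<dots> \<le> 5 / 2 * C * (\<bar>a\<bar> * p ^ (2 * n)) * (q - p)"
      using b_le[OF pq(1) _ b z(1)] pq C by (intro mult_right_mono mult_left_mono) auto
    also have "p ^ (2 * n) = p * p ^ (2 * n - 1)" using n by (cases n) auto
    finally have "real n * (\<bar>a\<bar> * p ^ (2 * n - 1) * (q - p)) \<le> 5 / 2 * C * p * (\<bar>a\<bar> * p ^ (2 * n - 1) * (q - p))"
      by (simp add: mult_ac)
    moreover have "\<bar>a\<bar> * p ^ (2 * n - 1) * (q - p) > 0" using a pq by simp
    ultimately have "real n \<le> 5 / 2 * C * p" by (rule mult_right_le_imp_le)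
    also have "\<dots> \<le> 5 / 2 * (C * p0)" using pq C by (simp add: mult_left_mono)
    also have "\<dots> < 1" using Cp0 by simp
    finally show False using n by simp
  qed
  have contT: "continuous_on {-p0<..<p0} T"
    unfolding T_def using p0 by (intro real_germ_continuous[OF S]) auto
  \<comment> \<open>Every small pair of points exchanged by the reflection of
    \<open>\<sigma>2\<close> has the form \<open>(T p, T (- p))\<close>; this turns statements on
    pairs into statements on \<open>p\<close>.\<close>
  have inv_T: "0 < s2 v \<and> s2 v < p0 \<and> T (s2 v) = v \<and> T (- s2 v) = u"
    if "0 < v" "v < p0 / 2" "- (p0 / 2) < u" "u < 0" "s2 u = - s2 v" for v u
  proof -
    have vu: "\<bar>v\<bar> < r" "\<bar>u\<bar> < r" using that p0 r by auto
    have "0 < s2 v" using real_germ_less_iff[OF g2, of 0 v] real_germ_0[OF g2] that vu r by (simp add: s2_def)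
    moreover have "s2 v < p0"
      using real_germ_bounds(1)[OF g2 vu(1)] that by (simp add: s2_def)
    ultimately show ?thesis
      using S\<sigma>[OF vu(1)] S\<sigma>[OF vu(2)] that p0 by (simp add: s2_def T_def)
  qed
  show ?thesis
  proof (rule that[of "p0 / 2" n "2 / \<bar>a\<bar>"])
    show "2 / \<bar>a\<bar> > 0" using a by simp
    fix e :: real assume e: "e > 0"
    define q where "q = min (e / 2) (p0 / 2)"
    have q: "0 < q" "q < p0" "q \<le> e / 2" using e p0 by (auto simp: q_def)
    have \<mu>q: "\<mu> * g0 q > 0" using \<mu>g0[of q] q p0 by auto
    \<comment> \<open>\<open>3 * \<bar>b\<bar> < \<mu> * g0 q\<close> beats the at most
      \<open>5 / 2 * \<bar>b\<bar>\<close> by which \<open>b\<close> can lower the displacement at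
      \<open>q\<close>; at \<open>p = 0\<close> the sign is opposite, by monotonicity of
      \<open>\<sigma>1\<close>.\<close>
    define \<eta> where "\<eta> = min (p0 / 2) (\<mu> * g0 q / 3)"
    show "\<exists>\<eta>>0. \<forall>b. 0 < \<mu> * b \<and> \<mu> * b < \<eta> \<longrightarrow> (\<exists>v u. 0 < v \<and> v < e \<and> - e < u \<and> u < 0 \<and>
       on_real \<sigma>2 u = - on_real \<sigma>2 v \<and> on_real \<sigma>1 (v - b) + on_real \<sigma>1 (u - b) = 0)"
    proof (rule exI[of _ \<eta>], intro conjI allI impI)
      show "\<eta> > 0" using p0 \<mu>q by (simp add: \<eta>_def)
      fix b assume b: "0 < \<mu> * b \<and> \<mu> * b < \<eta>"
      then have bb: "\<bar>b\<bar> = \<mu> * b" "\<bar>b\<bar> < p0" "3 * \<bar>b\<bar> < \<mu> * g0 q" using \<mu> p0 by (auto simp: \<eta>_def)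
      have br: "\<bar>b\<bar> < r" using bb p0 r by auto
      have T0: "T 0 = 0" using real_germ_0[OF S] by (simp add: T_def)
      have "\<mu> * \<Delta> 0 b < 0"
      proof -
        have "on_real \<sigma>1 (- b) < on_real \<sigma>1 0 \<longleftrightarrow> - b < 0" "on_real \<sigma>1 0 < on_real \<sigma>1 (- b) \<longleftrightarrow> 0 < - b"
          by (intro real_germ_less_iff[OF g1]; use br r in simp)+
        then show ?thesis using b \<mu> real_germ_0[OF g1] by (auto simp: \<Delta>_def T0 s1_def)
      qed
      moreover have "\<mu> * \<Delta> q b > 0"
      proof -
        have "\<bar>\<Delta> q b - g0 q + 2 * b\<bar> \<le> 1 / 2 * \<bar>b\<bar>" using q bb by (intro E1') auto
        then have "\<bar>\<mu> * (\<Delta> q b - g0 q + 2 * b)\<bar> \<le> 1 / 2 * \<bar>b\<bar>" using \<mu> by (auto simp: abs_mult)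
        then have "\<bar>\<mu> * \<Delta> q b - \<mu> * g0 q + 2 * (\<mu> * b)\<bar> \<le> 1 / 2 * \<bar>b\<bar>"
          by (simp add: algebra_simps)
        then show ?thesis using bb by linarith
      qed
      moreover have "continuous_on {0..q} (\<lambda>p. \<mu> * \<Delta> p b)"
        unfolding \<Delta>_def s1_def
      proof (intro continuous_intros)
        have im: "\<bar>T x - b\<bar> < r" if "\<bar>x\<bar> < p0" for x using T_bound[of x] that p0 bb r by auto
        have c1: "continuous_on {-r<..<r} (on_real \<sigma>1)" by (rule real_germ_continuous[OF g1]) auto
        have im': "T x - b \<in> {-r<..<r}" if "\<bar>x\<bar> < p0" for x
          using im[OF that] by (auto simp: abs_less_iff)
        have ct: "continuous_on {0..q} T" by (rule continuous_on_subset[OF contT]) (use q in auto)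
        show "continuous_on {0..q} (\<lambda>p. on_real \<sigma>1 (T p - b))"
          by (rule continuous_on_compose2[OF c1]) (use q in \<open>auto intro!: continuous_intros ct im'\<close>)
        have ct': "continuous_on {0..q} (\<lambda>p. T (- p))"
          by (rule continuous_on_compose2[OF contT]) (use q in \<open>auto intro!: continuous_intros\<close>)
        show "continuous_on {0..q} (\<lambda>p. on_real \<sigma>1 (T (- p) - b))"
        proof (rule continuous_on_compose2[OF c1])
          show "continuous_on {0..q} (\<lambda>p. T (- p) - b)" by (intro continuous_intros ct')
          show "(\<lambda>p. T (- p) - b) ` {0..q} \<subseteq> {-r<..<r}"
          proof (rule image_subsetI)
            fix x assume "x \<in> {0..q}"
            then show "T (- x) - b \<in> {-r<..<r}" by (intro im') (use q in auto)
          qed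
        qed
      qed
      ultimately have "\<exists>p. 0 \<le> p \<and> p \<le> q \<and> \<mu> * \<Delta> p b = 0" using q by (intro IVT') auto
      then obtain p where p: "0 \<le> p" "p \<le> q" "\<mu> * \<Delta> p b = 0" by blast
      have "p \<noteq> 0" using p \<open>\<mu> * \<Delta> 0 b < 0\<close> by auto
      then have p': "0 < p" "p < s" "\<bar>p\<bar> < s" "\<bar>- p\<bar> < s" using p q p0 by auto
      have "\<Delta> p b = 0" using p(3) \<mu> by auto
      then show "\<exists>v u. 0 < v \<and> v < e \<and> - e < u \<and> u < 0 \<and>
         on_real \<sigma>2 u = - on_real \<sigma>2 v \<and> on_real \<sigma>1 (v - b) + on_real \<sigma>1 (u - b) = 0"
        using T_pos[OF p'(1,2)] T_neg[OF p'(1,2)] T_bound[OF p'(3)] T_bound[OF p'(4)] s2T[OF p'(3)] s2T[OF p'(4)] p q e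
        by (intro exI[of _ "T p"] exI[of _ "T (- p)"]) (simp add: \<Delta>_def s1_def s2_def)
    qed
  next
    fix b v u v' u'
    assume b: "\<bar>b\<bar> < p0 / 2" and v: "0 < v" "v < p0 / 2" "- (p0 / 2) < u" "u < 0" "on_real \<sigma>2 u = - on_real \<sigma>2 v"
      "on_real \<sigma>1 (v - b) + on_real \<sigma>1 (u - b) = 0"
      and v': "0 < v'" "v' < p0 / 2" "- (p0 / 2) < u'" "u' < 0" "on_real \<sigma>2 u' = - on_real \<sigma>2 v'"
      "on_real \<sigma>1 (v' - b) + on_real \<sigma>1 (u' - b) = 0"
    note B = inv_T[OF v(1-4), folded s2_def] inv_T[OF v'(1-4), folded s2_def]
    have p: "0 < s2 v" "s2 v < p0" "T (s2 v) = v" "T (- s2 v) = u" using B(1) v(5) by (auto simp: s2_def)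
    have p': "0 < s2 v'" "s2 v' < p0" "T (s2 v') = v'" "T (- s2 v') = u'" using B(2) v'(5) by (auto simp: s2_def)
    have "\<Delta> (s2 v) b = 0" "\<Delta> (s2 v') b = 0" using v(6) v'(6) p p' by (auto simp: \<Delta>_def s1_def)
    moreover have "\<bar>b\<bar> < p0" using b p0 by simp
    ultimately have "s2 v = s2 v'"
      using no_two[of "s2 v" "s2 v'" b] no_two[of "s2 v'" "s2 v" b] p p' by (metis linorder_less_linear)
    then show "v = v'" using p p' by metis
  next
    fix F :: "real filter" and v u :: "real \<Rightarrow> real"
    assume b0: "((\<lambda>b. b) \<longlongrightarrow> 0) F" and v0: "(v \<longlongrightarrow> 0) F" and u0: "(u \<longlongrightarrow> 0) F"
      and ev: "\<forall>\<^sub>F b in F. 0 < \<mu> * b \<and> 0 < v b \<and> u b < 0 \<and> on_real \<sigma>2 (u b) = - on_real \<sigma>2 (v b) \<and>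
         on_real \<sigma>1 (v b - b) + on_real \<sigma>1 (u b - b) = 0"
    have small: "\<forall>\<^sub>F b in F. \<bar>f b\<bar> < e" if "(f \<longlongrightarrow> 0) F" "e > 0" for f :: "real \<Rightarrow> real" and e
      using tendstoD[OF that] by (simp add: dist_real_def)
    have "p0 / 2 > 0" using p0 by simp
    note sm = small[OF b0 this] small[OF v0 this] small[OF u0 this]
    define p where "p b = s2 (v b)" for b
    have evp: "\<forall>\<^sub>F b in F. 0 < \<mu> * b \<and> \<bar>b\<bar> < p0 \<and> 0 < v b \<and> 0 < p b \<and> p b < p0 \<and> p b \<le> 5 / 4 * v b \<and> \<Delta> (p b) b = 0"
      using ev sm
    proof eventually_elim
      case (elim b)
      have "0 < p b \<and> p b < p0 \<and> T (p b) = v b \<and> T (- p b) = u b"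
        unfolding p_def by (rule inv_T) (use elim in \<open>auto simp: s2_def\<close>)
      moreover have "\<bar>p b\<bar> \<le> 5 / 4 * \<bar>v b\<bar>" unfolding p_def s2_def
        by (rule real_germ_bounds(1)[OF g2]) (use elim p0 r in auto)
      ultimately show ?case using elim by (auto simp: \<Delta>_def s1_def)
    qed
    have pl: "(p \<longlongrightarrow> 0) F"
    proof (rule Lim_null_comparison)
      show "\<forall>\<^sub>F b in F. norm (p b) \<le> 5 / 4 * v b" using evp by eventually_elim auto
      show "((\<lambda>b. 5 / 4 * v b) \<longlongrightarrow> 0) F" using tendsto_mult_left[OF v0, of "5/4"] by simp
    qed
    have pat: "filterlim p (at 0) F" using pl evp by (auto simp: filterlim_at elim!: eventually_mono)
    have vat: "filterlim v (at 0) F" using v0 evp by (auto simp: filterlim_at elim!: eventually_mono)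
    have l1: "((\<lambda>b. p b / v b) \<longlongrightarrow> 1) F"
      using filterlim_compose[OF real_germ_asymp[OF g2] vat] by (simp add: p_def s2_def)
    have l2: "((\<lambda>b. on_real G (p b) / p b ^ (2 * n)) \<longlongrightarrow> a) F"
      by (rule filterlim_compose[OF lim pat])
    have l3: "((\<lambda>b. g0 (p b) / b - 2) \<longlongrightarrow> 0) F"
    proof (rule Lim_null_comparison)
      show "\<forall>\<^sub>F b in F. norm (g0 (p b) / b - 2) \<le> 2 * C * (5 / 4 * \<bar>p b\<bar> + \<bar>b\<bar>)"
        using evp
      proof eventually_elim
        case (elim b)
        then have b: "b \<noteq> 0" by auto
        have "\<bar>0 - g0 (p b) + 2 * b\<bar> \<le> 2 * C * (5 / 4 * \<bar>p b\<bar> + \<bar>b\<bar>) * \<bar>b\<bar>"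
          using E1[of "p b" b] elim by auto
        moreover have "\<bar>0 - g0 (p b) + 2 * b\<bar> = \<bar>g0 (p b) / b - 2\<bar> * \<bar>b\<bar>"
          using b by (simp add: left_diff_distrib flip: abs_mult)
        ultimately show ?case using b by simp
      qed
      have "((\<lambda>b. 2 * C * (5 / 4 * \<bar>p b\<bar> + \<bar>b\<bar>)) \<longlongrightarrow> 2 * C * (5 / 4 * \<bar>0\<bar> + \<bar>0\<bar>)) F"
        by (intro tendsto_intros pl b0)
      then show "((\<lambda>b. 2 * C * (5 / 4 * \<bar>p b\<bar> + \<bar>b\<bar>)) \<longlongrightarrow> 0) F" by simp
    qed
    have "((\<lambda>b. (g0 (p b) / b - 2) + 2) \<longlongrightarrow> 0 + 2) F" by (intro tendsto_intros l3)
    then have l4: "((\<lambda>b. g0 (p b) / b) \<longlongrightarrow> 2) F" by simp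
    \<comment> \<open>\<open>v ^ (2 * n) / \<bar>b\<bar>\<close> is the product of
      \<open>g0 p / \<bar>b\<bar>\<close>, of \<open>p ^ (2 * n) / g0 p\<close> and of
      \<open>(v / p) ^ (2 * n)\<close>, with limits \<open>2 * \<mu>\<close>, \<open>1 / a\<close>
      and 1.\<close>
    have "((\<lambda>b. \<mu> * (g0 (p b) / b) / (on_real G (p b) / p b ^ (2 * n)) / (p b / v b) ^ (2 * n)) \<longlongrightarrow> \<mu> * 2 / a / 1 ^ (2 * n)) F"
      using a by (intro tendsto_intros l1 l2 l4) auto
    moreover have "\<mu> * 2 / a / 1 ^ (2 * n) = 2 / \<bar>a\<bar>"
      using \<mu>a \<mu> a by (auto simp: abs_if)
    ultimately have "((\<lambda>b. \<mu> * (g0 (p b) / b) / (on_real G (p b) / p b ^ (2 * n)) / (p b / v b) ^ (2 * n)) \<longlongrightarrow> 2 / \<bar>a\<bar>) F"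
      by simp
    then show "((\<lambda>b. v b ^ (2 * n) / \<bar>b\<bar>) \<longlongrightarrow> 2 / \<bar>a\<bar>) F"
    proof (rule Lim_transform_eventually)
      show "\<forall>\<^sub>F b in F. \<mu> * (g0 (p b) / b) / (on_real G (p b) / p b ^ (2 * n)) / (p b / v b) ^ (2 * n) = v b ^ (2 * n) / \<bar>b\<bar>"
        using evp
      proof eventually_elim
        case (elim b)
        have G: "on_real G (p b) = g0 (p b)" using elim p0 by (intro g0G) auto
        have "g0 (p b) \<noteq> 0" using \<mu>g0[of "p b"] elim p0 by auto
        moreover have "\<mu> / b = 1 / \<bar>b\<bar>" using elim \<mu> by (auto simp: abs_if)
        then have "\<mu> * (g0 (p b) / b) = g0 (p b) / \<bar>b\<bar>"
          by (metis mult.commute mult.right_neutral times_divide_eq_left times_divide_eq_right)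
        ultimately show ?case using elim by (simp add: G power_divide)
      qed
    qed
  qed (use p0 n in auto)
qed

section \<open>Crossing trajectories\<close>

lemma crossing_trajectoryD:
  assumes "crossing_trajectory Fp Fm \<gamma>"
  shows "snd (\<gamma> t) > 0 \<Longrightarrow> (\<gamma> has_vector_derivative Fp (\<gamma> t)) (at t)"
    and "snd (\<gamma> t) < 0 \<Longrightarrow> (\<gamma> has_vector_derivative Fm (\<gamma> t)) (at t)"
    and "snd (\<gamma> t) = 0 \<Longrightarrow>
        snd (Fp (\<gamma> t)) > 0 \<and> snd (Fm (\<gamma> t)) > 0 \<and>
          (\<gamma> has_vector_derivative Fm (\<gamma> t)) (at_left t) \<and>
          (\<gamma> has_vector_derivative Fp (\<gamma> t)) (at_right t) \<or>
        snd (Fp (\<gamma> t)) < 0 \<and> snd (Fm (\<gamma> t)) < 0 \<and>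
          (\<gamma> has_vector_derivative Fp (\<gamma> t)) (at_left t) \<and>
          (\<gamma> has_vector_derivative Fm (\<gamma> t)) (at_right t)"
proof -
  note D = assms[unfolded crossing_trajectory_def, THEN spec, of t]
  show "snd (\<gamma> t) > 0 \<Longrightarrow> (\<gamma> has_vector_derivative Fp (\<gamma> t)) (at t)"
    by (rule D[THEN conjunct1, THEN mp])
  show "snd (\<gamma> t) < 0 \<Longrightarrow> (\<gamma> has_vector_derivative Fm (\<gamma> t)) (at t)"
    by (rule D[THEN conjunct2, THEN conjunct1, THEN mp])
  show "snd (\<gamma> t) = 0 \<Longrightarrow>
        snd (Fp (\<gamma> t)) > 0 \<and> snd (Fm (\<gamma> t)) > 0 \<and>
          (\<gamma> has_vector_derivative Fm (\<gamma> t)) (at_left t) \<and>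
          (\<gamma> has_vector_derivative Fp (\<gamma> t)) (at_right t) \<or>
        snd (Fp (\<gamma> t)) < 0 \<and> snd (Fm (\<gamma> t)) < 0 \<and>
          (\<gamma> has_vector_derivative Fp (\<gamma> t)) (at_left t) \<and>
          (\<gamma> has_vector_derivative Fm (\<gamma> t)) (at_right t)"
    by (rule D[THEN conjunct2, THEN conjunct2, THEN mp])
qed

lemma crossing_trajectory_continuous:
  assumes "crossing_trajectory Fp Fm \<gamma>"
  shows "continuous_on UNIV \<gamma>"
proof (intro continuous_at_imp_continuous_on ballI)
  fix t
  consider "snd (\<gamma> t) > 0" | "snd (\<gamma> t) < 0" | "snd (\<gamma> t) = 0" by linarith
  then show "continuous (at t) \<gamma>"
  proof cases
    case 3
    then show ?thesis
      using crossing_trajectoryD(3)[OF assms, of t]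
      by (auto simp: continuous_at_split intro: has_vector_derivative_continuous)
  qed (use crossing_trajectoryD(1,2)[OF assms] in \<open>blast intro: has_vector_derivative_continuous\<close>)+
qed

text \<open>\<open>d\<close> is a direction of time and \<open>s\<close> a half plane. At a crossing
  point a single field governs the times in direction \<open>d\<close>, and the sign of
  \<open>d * s * snd (F (\<gamma> t))\<close> tells that it is \<open>F\<close>.\<close>

lemma crossing_trajectory_directional:
  fixes s d :: real
  assumes \<gamma>: "crossing_trajectory Fp Fm \<gamma>" and d: "d \<in> {-1, 1}" and s: "s \<in> {-1, 1}"
    and F: "F = (if s = 1 then Fp else Fm)"
  shows "s * snd (\<gamma> (t + d * u)) > 0 \<Longrightarrow>
      ((\<lambda>u. \<gamma> (t + d * u)) has_vector_derivative d *\<^sub>R F (\<gamma> (t + d * u))) (at u within S)"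
    and "snd (\<gamma> t) = 0 \<Longrightarrow> d * s * snd (F (\<gamma> t)) > 0 \<Longrightarrow>
      ((\<lambda>u. \<gamma> (t + d * u)) has_vector_derivative d *\<^sub>R F (\<gamma> t)) (at 0 within {0..})"
proof -
  have lin: "((\<lambda>u. t + d * u) has_vector_derivative d) (at u within S)" for u S
    by (auto intro!: derivative_eq_intros simp flip: has_real_derivative_iff_has_vector_derivative)
  {
    assume "s * snd (\<gamma> (t + d * u)) > 0"
    then have "(\<gamma> has_vector_derivative F (\<gamma> (t + d * u))) (at (t + d * u))"
      using crossing_trajectoryD(1,2)[OF \<gamma>, of "t + d * u"] s F by auto
    then have "(\<gamma> has_vector_derivative F (\<gamma> (t + d * u))) (at (t + d * u) within (\<lambda>u. t + d * u) ` S)"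
      by (rule has_vector_derivative_at_within)
    from vector_diff_chain_within[OF lin this]
    show "((\<lambda>u. \<gamma> (t + d * u)) has_vector_derivative d *\<^sub>R F (\<gamma> (t + d * u))) (at u within S)"
      by (simp add: o_def)
  next
    assume z: "snd (\<gamma> t) = 0" and pos: "d * s * snd (F (\<gamma> t)) > 0"
    have "snd (Fp (\<gamma> t)) > 0 \<and> snd (Fm (\<gamma> t)) > 0 \<and>
          (\<gamma> has_vector_derivative Fm (\<gamma> t)) (at_left t) \<and>
          (\<gamma> has_vector_derivative Fp (\<gamma> t)) (at_right t) \<or>
        snd (Fp (\<gamma> t)) < 0 \<and> snd (Fm (\<gamma> t)) < 0 \<and>
          (\<gamma> has_vector_derivative Fp (\<gamma> t)) (at_left t) \<and>
          (\<gamma> has_vector_derivative Fm (\<gamma> t)) (at_right t)"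
      using crossing_trajectoryD(3)[OF \<gamma> z] .
    then have side: "(\<gamma> has_vector_derivative F (\<gamma> t)) (if d = 1 then at_right t else at_left t)"
      using s d pos F by (auto split: if_splits)
    have "(\<lambda>u. t + d * u) ` {0..} \<subseteq> (if d = 1 then {t..} else {..t})" using d by auto
    moreover have "(if d = 1 then at_right t else at_left t) = at t within (if d = 1 then {t..} else {..t})"
      by (simp add: at_within_Ici_at_right at_within_Iic_at_left)
    ultimately have "(\<gamma> has_vector_derivative F (\<gamma> t)) (at (t + d * 0) within (\<lambda>u. t + d * u) ` {0..})"
      using side by (simp add: has_vector_derivative_within_subset)
    from vector_diff_chain_within[OF lin this]
    show "((\<lambda>u. \<gamma> (t + d * u)) has_vector_derivative d *\<^sub>R F (\<gamma> t)) (at 0 within {0..})"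
      by (simp add: o_def)
  }
qed

lemma solution_on_unique:
  assumes F: "locally_lipschitz F" and \<alpha>: "solution_on (\<lambda>p. d *\<^sub>R F p) \<alpha> {0..c}"
    and \<beta>: "solution_on (\<lambda>p. d *\<^sub>R F p) \<beta> {0..c}" and eq: "\<alpha> 0 = \<beta> 0" and u: "u \<in> {0..c::real}"
  shows "\<alpha> u = \<beta> u"
proof (cases "c = 0")
  case False
  then have c: "c > 0" using u by auto
  then have seg: "closed_segment 0 c = {0..c}" by (simp add: closed_segment_eq_real_ivl)
  have res: "((\<lambda>s. \<eta> (c * s)) has_vector_derivative (c * d) *\<^sub>R F (\<eta> (c * s))) (at s within {0..1})"
    if "solution_on (\<lambda>p. d *\<^sub>R F p) \<eta> {0..c}" "s \<in> {0..1}" for \<eta> s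
  proof -
    have img: "(\<lambda>s. c * s) ` {0..1} \<subseteq> {0..c}" using c by (auto simp: mult_left_le)
    then have "c * s \<in> {0..c}" using that(2) by blast
    then have "(\<eta> has_vector_derivative d *\<^sub>R F (\<eta> (c * s))) (at (c * s) within {0..c})"
      using that(1) by (auto simp: solution_on_def)
    then have "(\<eta> has_vector_derivative d *\<^sub>R F (\<eta> (c * s))) (at (c * s) within (\<lambda>s. c * s) ` {0..1})"
      by (rule has_vector_derivative_within_subset[OF _ img])
    moreover have "((\<lambda>s. c * s) has_vector_derivative c) (at s within {0..1})"
      by (auto intro!: derivative_eq_intros simp flip: has_real_derivative_iff_has_vector_derivative)
    ultimately have "(\<eta> \<circ> (\<lambda>s. c * s) has_vector_derivative c *\<^sub>R (d *\<^sub>R F (\<eta> (c * s)))) (at s within {0..1})"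
      by (rule vector_diff_chain_within[rotated])
    then show ?thesis by (simp add: o_def)
  qed
  have "(\<lambda>s. \<alpha> (c * s)) (u / c) = (\<lambda>s. \<beta> (c * s)) (u / c)"
    by (rule solution_unique[OF F res[OF \<alpha>] res[OF \<beta>]]) (use eq c u in \<open>auto simp: divide_le_eq\<close>)
  then show ?thesis using c by simp
qed (use eq u in auto)

text \<open>The starting point is a crossing, so the normal component is nonzero there and the
  trajectory enters the half plane of the arc. While it stays inside, uniqueness applies; the arc
  itself excludes an earlier return, since it is strictly inside until time
  \<open>l\<close>.\<close>

lemma crossing_trajectory_follows_arc:
  fixes s d :: real
  assumes \<gamma>: "crossing_trajectory Fp Fm \<gamma>" and d: "d \<in> {-1, 1}" and s: "s \<in> {-1, 1}"
    and F: "F = (if s = 1 then Fp else Fm)" and lip: "locally_lipschitz F"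
    and arc: "half_arc s (\<lambda>p. d *\<^sub>R F p) l \<alpha>" and start: "\<gamma> t = \<alpha> 0" and u: "u \<in> {0..l}"
  shows "\<gamma> (t + d * u) = \<alpha> u"
proof -
  have l: "l > 0" and \<alpha>0: "snd (\<alpha> 0) = 0" and pos: "\<And>u. u \<in> {0<..<l} \<Longrightarrow> s * snd (\<alpha> u) > 0"
    and sol: "solution_on (\<lambda>p. d *\<^sub>R F p) \<alpha> {0..l}"
    using arc by (auto simp: half_arc_def)
  define \<beta> where "\<beta> u = \<gamma> (t + d * u)" for u
  have \<beta>0: "\<beta> 0 = \<alpha> 0" "snd (\<gamma> t) = 0" using start \<alpha>0 by (auto simp: \<beta>_def)
  have cont: "continuous_on S \<beta>" for S
    unfolding \<beta>_def
    by (rule continuous_on_compose2[OF crossing_trajectory_continuous[OF \<gamma>]]) (auto intro!: continuous_intros)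
  have "snd (F (\<gamma> t)) \<noteq> 0" using crossing_trajectoryD(3)[OF \<gamma> \<beta>0(2)] s F by auto
  moreover have "s * snd (d *\<^sub>R F (\<alpha> 0)) \<ge> 0" by (rule half_arc_start_derivative[OF arc])
  ultimately have up: "d * s * snd (F (\<gamma> t)) > 0" using s d start by (auto simp: less_le)
  have d\<beta>0: "(\<beta> has_vector_derivative d *\<^sub>R F (\<beta> 0)) (at 0 within {0..})"
    using crossing_trajectory_directional(2)[OF \<gamma> d s F \<beta>0(2) up] by (simp add: \<beta>_def[abs_def])
  from bounded_linear.has_vector_derivative[OF bounded_linear_snd this]
  have "((\<lambda>u. s * snd (\<beta> u)) has_real_derivative s * snd (d *\<^sub>R F (\<beta> 0))) (at 0 within {0..})"
    by (intro DERIV_cmult) (simp add: has_real_derivative_iff_has_vector_derivative)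
  moreover have "s * snd (d *\<^sub>R F (\<beta> 0)) > 0" using up by (simp add: \<beta>_def mult_ac)
  ultimately obtain e where e: "e > 0" "\<And>h. 0 < h \<Longrightarrow> 0 + h \<in> {0..} \<Longrightarrow> h < e \<Longrightarrow> s * snd (\<beta> 0) < s * snd (\<beta> (0 + h))"
    using has_real_derivative_pos_inc_right[of "\<lambda>u. s * snd (\<beta> u)" _ 0 "{0..}"] by blast
  have init: "s * snd (\<beta> h) > 0" if "0 < h" "h < e" for h
    using e(2)[of h] that \<beta>0 \<alpha>0 by simp
  have follow: "\<beta> u = \<alpha> u" if c: "c \<le> l" "\<And>u. u \<in> {0<..c} \<Longrightarrow> s * snd (\<beta> u) > 0" and u: "u \<in> {0..c}" for c u
  proof (rule solution_on_unique[OF lip _ _ _ u])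
    show "solution_on (\<lambda>p. d *\<^sub>R F p) \<alpha> {0..c}"
      unfolding solution_on_def
    proof
      fix w assume w: "w \<in> {0..c}"
      then have "(\<alpha> has_vector_derivative d *\<^sub>R F (\<alpha> w)) (at w within {0..l})"
        using sol c(1) by (auto simp: solution_on_def)
      then show "(\<alpha> has_vector_derivative d *\<^sub>R F (\<alpha> w)) (at w within {0..c})"
        by (rule has_vector_derivative_within_subset) (use c(1) in auto)
    qed
    show "solution_on (\<lambda>p. d *\<^sub>R F p) \<beta> {0..c}"
      unfolding solution_on_def
    proof
      fix w assume w: "w \<in> {0..c}"
      show "(\<beta> has_vector_derivative d *\<^sub>R F (\<beta> w)) (at w within {0..c})"
      proof (cases "w = 0")
        case True
        then show ?thesis using has_vector_derivative_within_subset[OF d\<beta>0, of "{0..c}"] by auto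
      next
        case False
        then have "s * snd (\<beta> w) > 0" using c(2)[of w] w by auto
        then show ?thesis
          using crossing_trajectory_directional(1)[OF \<gamma> d s F, of t w] by (simp add: \<beta>_def[abs_def])
      qed
    qed
  qed (rule \<beta>0)
  \<comment> \<open>Times before \<open>min (e / 2) l\<close> are cut off, since
    \<open>\<beta> 0\<close> lies on the line and time 0 would otherwise be the least
    element.\<close>
  define B where "B = {u \<in> {0..l}. min (e / 2) l \<le> u} \<inter> {u \<in> {0..l}. s * snd (\<beta> u) \<le> 0}"
  have "closed B" unfolding B_def
    by (intro closed_Int continuous_on_closed_Collect_le continuous_on_const continuous_intros cont closed_atLeastAtMost)
  moreover have "{0..l} \<inter> B = B" by (auto simp: B_def)
  ultimately have cB: "compact B" using compact_Int_closed[OF compact_Icc, of B 0 l] by simp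
  have notB: "s * snd (\<beta> u) > 0" if "0 < u" "u \<le> l" "u \<notin> B" for u
    using that init[of u] e(1) unfolding B_def by (cases "u < e / 2") auto
  have "\<beta> u = \<alpha> u"
  proof (cases "B = {}")
    case True
    then show ?thesis using notB u by (intro follow[of l]) auto
  next
    case False
    then obtain m where m: "m \<in> B" and mmin: "\<And>u. u \<in> B \<Longrightarrow> m \<le> u"
      using compact_attains_inf[OF cB] by auto
    have m0: "0 < m" "m \<le> l" using m e l by (auto simp: B_def)
    have lt: "\<beta> w = \<alpha> w" if "w \<in> {0..<m}" for w
    proof (rule follow[of w])
      fix x assume "x \<in> {0<..w}"
      then show "s * snd (\<beta> x) > 0" using that m0 mmin[of x] by (intro notB) auto
    qed (use that m0 in auto)
    have "continuous_on {0..m} (\<lambda>u. dist (\<beta> u) (\<alpha> u))"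
      using m0 by (intro continuous_intros cont continuous_on_subset[OF half_arc_continuous[OF arc]]) auto
    then have "closed {u \<in> {0..m}. dist (\<beta> u) (\<alpha> u) \<le> 0}"
      by (intro continuous_on_closed_Collect_le continuous_on_const closed_atLeastAtMost)
    then have "closure {0..<m} \<subseteq> {u \<in> {0..m}. dist (\<beta> u) (\<alpha> u) \<le> 0}"
      by (rule closure_minimal[rotated]) (use lt in auto)
    then have le: "\<beta> w = \<alpha> w" if "w \<in> {0..m}" for w using m0 that by auto
    have "m = l"
    proof (rule ccontr)
      assume "m \<noteq> l"
      then have "s * snd (\<alpha> m) > 0" using m0 by (intro pos) auto
      then show False using m le[of m] m0 by (auto simp: B_def)
    qed
    then show ?thesis using le u by auto
  qed
  then show ?thesis by (simp add: \<beta>_def)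
qed

section \<open>Reversing, gluing and tracing arcs\<close>

lemma half_arc_reverse:
  assumes "half_arc s G l \<alpha>"
  shows "half_arc s (\<lambda>p. - G p) l (\<lambda>u. \<alpha> (l - u))"
  unfolding half_arc_def solution_on_def
proof (intro conjI ballI)
  fix u assume u: "u \<in> {0..l}"
  have img: "(\<lambda>u. l - u) ` {0..l} \<subseteq> {0..l}" by auto
  have "l - u \<in> {0..l}" using u by auto
  then have "(\<alpha> has_vector_derivative G (\<alpha> (l - u))) (at (l - u) within {0..l})"
    using assms by (auto simp: half_arc_def solution_on_def)
  then have "(\<alpha> has_vector_derivative G (\<alpha> (l - u))) (at (l - u) within (\<lambda>u. l - u) ` {0..l})"
    by (rule has_vector_derivative_within_subset[OF _ img])
  moreover have "((\<lambda>u. l - u) has_vector_derivative - 1) (at u within {0..l})"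
    by (auto intro!: derivative_eq_intros simp flip: has_real_derivative_iff_has_vector_derivative)
  ultimately show "((\<lambda>u. \<alpha> (l - u)) has_vector_derivative - G (\<alpha> (l - u))) (at u within {0..l})"
    using vector_diff_chain_within[of "\<lambda>u. l - u" "-1" u "{0..l}" \<alpha>] by (simp add: o_def)
qed (use assms in \<open>auto simp: half_arc_def\<close>)

lemma half_arc_hshift:
  assumes "half_arc s (\<lambda>p. d *\<^sub>R F p) l \<alpha>"
  shows "half_arc s (\<lambda>p. d *\<^sub>R hshift b F p) l (\<lambda>u. \<alpha> u + (b, 0))"
proof -
  have "hshift b F (p + (b, 0)) = F p" for p by (cases p) (simp add: hshift_def)
  then show ?thesis
    using assms by (auto simp: half_arc_def solution_on_def intro!: derivative_eq_intros)
qed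

lemma periodic_shift:
  fixes \<gamma> :: "real \<Rightarrow> 'a"
  assumes "\<And>t. \<gamma> (t + T) = \<gamma> t"
  shows "\<gamma> (t + of_int k * T) = \<gamma> t"
proof (induction k rule: int_induct[where k = 0])
  case (step1 i)
  then show ?case using assms[of "t + of_int i * T"] by (simp add: algebra_simps)
next
  case (step2 i)
  then show ?case using assms[of "t + of_int (i - 1) * T"] by (simp add: algebra_simps)
qed simp

lemma reduce_mod_period:
  fixes T :: real
  assumes "T > 0"
  obtains k :: int where "t + of_int k * T \<in> {a..<a + T}"
proof
  let ?k = "- \<lfloor>(t - a) / T\<rfloor>"
  have "of_int \<lfloor>(t - a) / T\<rfloor> \<le> (t - a) / T" "(t - a) / T < of_int \<lfloor>(t - a) / T\<rfloor> + 1" by linarith+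
  then have "of_int \<lfloor>(t - a) / T\<rfloor> * T \<le> t - a" "t - a < (of_int \<lfloor>(t - a) / T\<rfloor> + 1) * T"
    by (simp_all only: pos_le_divide_eq[OF assms] pos_divide_less_eq[OF assms])
  then show "t + of_int ?k * T \<in> {a..<a + T}" by (auto simp: algebra_simps)
qed

lemma has_vector_derivative_shift:
  fixes \<gamma> :: "real \<Rightarrow> 'a::real_normed_vector"
  assumes per: "\<And>t. \<gamma> (t + c) = \<gamma> t"
  shows "(\<gamma> has_vector_derivative D) (at (t + c)) \<Longrightarrow> (\<gamma> has_vector_derivative D) (at t)"
    and "(\<gamma> has_vector_derivative D) (at_left (t + c)) \<Longrightarrow> (\<gamma> has_vector_derivative D) (at_left t)"
    and "(\<gamma> has_vector_derivative D) (at_right (t + c)) \<Longrightarrow> (\<gamma> has_vector_derivative D) (at_right t)"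
proof -
  have *: "(\<gamma> has_vector_derivative D) (at t within S)"
    if "(\<gamma> has_vector_derivative D) (at (t + c) within (\<lambda>t. t + c) ` S)" for S
  proof -
    have "((\<lambda>t. t + c) has_vector_derivative 1) (at t within S)"
      by (auto intro!: derivative_eq_intros simp flip: has_real_derivative_iff_has_vector_derivative)
    from vector_diff_chain_within[OF this that] show ?thesis by (simp add: o_def per)
  qed
  have plus: "(\<lambda>t. t + c) = (+) c" by (simp add: fun_eq_iff add.commute)
  have img: "range (\<lambda>t. t + c) = UNIV" "(\<lambda>t. t + c) ` {..t} = {..t + c}" "(\<lambda>t. t + c) ` {t..} = {t + c..}"
    unfolding plus by (simp_all add: add.commute[of t c])
  show "(\<gamma> has_vector_derivative D) (at (t + c)) \<Longrightarrow> (\<gamma> has_vector_derivative D) (at t)"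
    using *[of UNIV] by (simp only: img)
  show "(\<gamma> has_vector_derivative D) (at_left (t + c)) \<Longrightarrow> (\<gamma> has_vector_derivative D) (at_left t)"
    using *[of "{..t}"] by (simp only: img at_within_Iic_at_left)
  show "(\<gamma> has_vector_derivative D) (at_right (t + c)) \<Longrightarrow> (\<gamma> has_vector_derivative D) (at_right t)"
    using *[of "{t..}"] by (simp only: img at_within_Ici_at_right)
qed

lemma has_vector_derivative_reflect:
  fixes \<gamma> :: "real \<Rightarrow> 'a::real_normed_vector"
  shows "(\<gamma> has_vector_derivative D) (at (- t)) \<Longrightarrow> ((\<lambda>t. \<gamma> (- t)) has_vector_derivative - D) (at t)"
    and "(\<gamma> has_vector_derivative D) (at_right (- t)) \<Longrightarrow> ((\<lambda>t. \<gamma> (- t)) has_vector_derivative - D) (at_left t)"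
    and "(\<gamma> has_vector_derivative D) (at_left (- t)) \<Longrightarrow> ((\<lambda>t. \<gamma> (- t)) has_vector_derivative - D) (at_right t)"
proof -
  have *: "((\<lambda>t. \<gamma> (- t)) has_vector_derivative - D) (at t within S)"
    if "(\<gamma> has_vector_derivative D) (at (- t) within uminus ` S)" for S
  proof -
    have "(uminus has_vector_derivative - 1) (at t within S)"
      by (auto intro!: derivative_eq_intros simp flip: has_real_derivative_iff_has_vector_derivative)
    from vector_diff_chain_within[OF this that] show ?thesis by (simp add: o_def)
  qed
  have img: "range (uminus :: real \<Rightarrow> real) = UNIV" "uminus ` {..t} = {- t..}" "uminus ` {t..} = {..- t}"
    by (auto simp: image_iff intro: exI[of _ "- _"] bexI[of _ "- _"])
  show "(\<gamma> has_vector_derivative D) (at (- t)) \<Longrightarrow> ((\<lambda>t. \<gamma> (- t)) has_vector_derivative - D) (at t)"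
    using *[of UNIV] by (simp only: img)
  show "(\<gamma> has_vector_derivative D) (at_right (- t)) \<Longrightarrow> ((\<lambda>t. \<gamma> (- t)) has_vector_derivative - D) (at_left t)"
    using *[of "{..t}"] by (simp only: img at_within_Iic_at_left at_within_Ici_at_right)
  show "(\<gamma> has_vector_derivative D) (at_left (- t)) \<Longrightarrow> ((\<lambda>t. \<gamma> (- t)) has_vector_derivative - D) (at_right t)"
    using *[of "{t..}"] by (simp only: img at_within_Iic_at_left at_within_Ici_at_right)
qed

lemma crossing_trajectory_reflect:
  assumes "crossing_trajectory (\<lambda>p. - Fp p) (\<lambda>p. - Fm p) \<gamma>"
  shows "crossing_trajectory Fp Fm (\<lambda>t. \<gamma> (- t))"
  unfolding crossing_trajectory_def
proof (intro allI conjI impI)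
  fix t
  note D = crossing_trajectoryD[OF assms, of "- t"]
  show "((\<lambda>t. \<gamma> (- t)) has_vector_derivative Fp (\<gamma> (- t))) (at t)" if "snd (\<gamma> (- t)) > 0"
    using has_vector_derivative_reflect(1)[OF D(1)[OF that]] by simp
  show "((\<lambda>t. \<gamma> (- t)) has_vector_derivative Fm (\<gamma> (- t))) (at t)" if "snd (\<gamma> (- t)) < 0"
    using has_vector_derivative_reflect(1)[OF D(2)[OF that]] by simp
  assume z: "snd (\<gamma> (- t)) = 0"
  show "snd (Fp (\<gamma> (- t))) > 0 \<and> snd (Fm (\<gamma> (- t))) > 0 \<and>
          ((\<lambda>t. \<gamma> (- t)) has_vector_derivative Fm (\<gamma> (- t))) (at_left t) \<and>
          ((\<lambda>t. \<gamma> (- t)) has_vector_derivative Fp (\<gamma> (- t))) (at_right t) \<or>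
        snd (Fp (\<gamma> (- t))) < 0 \<and> snd (Fm (\<gamma> (- t))) < 0 \<and>
          ((\<lambda>t. \<gamma> (- t)) has_vector_derivative Fp (\<gamma> (- t))) (at_left t) \<and>
          ((\<lambda>t. \<gamma> (- t)) has_vector_derivative Fm (\<gamma> (- t))) (at_right t)"
    using D(3)[OF z]
  proof (elim disjE conjE)
    assume *: "snd (- Fp (\<gamma> (- t))) > 0" "snd (- Fm (\<gamma> (- t))) > 0"
      "(\<gamma> has_vector_derivative - Fm (\<gamma> (- t))) (at_left (- t))"
      "(\<gamma> has_vector_derivative - Fp (\<gamma> (- t))) (at_right (- t))"
    show ?thesis
      using has_vector_derivative_reflect(3)[OF *(3)] has_vector_derivative_reflect(2)[OF *(4)] *(1,2) by simp
  next
    assume *: "snd (- Fp (\<gamma> (- t))) < 0" "snd (- Fm (\<gamma> (- t))) < 0"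
      "(\<gamma> has_vector_derivative - Fp (\<gamma> (- t))) (at_left (- t))"
      "(\<gamma> has_vector_derivative - Fm (\<gamma> (- t))) (at_right (- t))"
    show ?thesis
      using has_vector_derivative_reflect(3)[OF *(3)] has_vector_derivative_reflect(2)[OF *(4)] *(1,2) by simp
  qed
qed

text \<open>Both arcs start at \<open>(v, 0)\<close>, so time 0 is placed there: the upper arc is
  traversed backwards over \<open>{-lp..0}\<close>, the lower one forwards over
  \<open>{0..lm}\<close>, and the two ends meet at \<open>(u, 0)\<close> after periodic
  continuation.\<close>

lemma glue_arcs:
  assumes up: "half_arc 1 (\<lambda>p. - Fp p) lp \<alpha>p" and low: "half_arc (-1) Fm lm \<alpha>m"
    and v: "\<alpha>p 0 = (v, 0)" "\<alpha>m 0 = (v, 0)" and u: "\<alpha>p lp = (u, 0)" "\<alpha>m lm = (u, 0)" and uv: "u \<noteq> v"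
    and cv: "snd (Fp (v, 0)) < 0" "snd (Fm (v, 0)) < 0" and cu: "snd (Fp (u, 0)) > 0" "snd (Fm (u, 0)) > 0"
  obtains \<gamma> where "periodic_trajectory Fp Fm \<gamma> (lp + lm)" "\<gamma> 0 = (v, 0)"
    "\<And>t. t \<in> {-lp..0} \<Longrightarrow> snd (\<gamma> t) \<ge> 0" "\<And>t. t \<in> {0..lm} \<Longrightarrow> snd (\<gamma> t) \<le> 0"
proof -
  have lp: "lp > 0" and lm: "lm > 0" using up low by (auto simp: half_arc_def)
  define T where "T = lp + lm"
  have T: "T > 0" using lp lm by (simp add: T_def)
  define \<gamma>0 where "\<gamma>0 w = (if w \<ge> 0 then \<alpha>m w else \<alpha>p (- w))" for w
  \<comment> \<open>The floor moves \<open>t\<close> into \<open>{-lp..<lm}\<close>; the value at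
    \<open>lm\<close> is therefore that at \<open>- lp\<close>, which agrees with the end of the
    lower arc because both arcs end at \<open>(u, 0)\<close>.\<close>
  define \<gamma> where "\<gamma> t = \<gamma>0 (t - of_int \<lfloor>(t + lp) / T\<rfloor> * T)" for t
  have per: "\<gamma> (t + T) = \<gamma> t" for t
  proof -
    have "(t + T + lp) / T = (t + lp) / T + 1" using T by (simp add: field_simps)
    then have "\<lfloor>(t + T + lp) / T\<rfloor> = \<lfloor>(t + lp) / T\<rfloor> + 1" by simp
    then show ?thesis by (simp add: \<gamma>_def algebra_simps)
  qed
  have base: "\<gamma> t = \<gamma>0 t" if "t \<in> {-lp..<lm}" for t
  proof -
    have "0 \<le> (t + lp) / T" "(t + lp) / T < 1" using that T by (auto simp: T_def)
    then have "\<lfloor>(t + lp) / T\<rfloor> = 0" by linarith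
    then show ?thesis by (simp add: \<gamma>_def)
  qed
  have \<gamma>m: "\<gamma> t = \<alpha>m t" if "t \<in> {0..lm}" for t
  proof (cases "t = lm")
    case True
    have "\<gamma> lm = \<gamma> (- lp)" using per[of "- lp"] by (simp add: T_def)
    also have "\<dots> = \<alpha>p lp" using base[of "- lp"] lp lm by (simp add: \<gamma>0_def)
    finally show ?thesis using True u by simp
  qed (use that base[of t] lp in \<open>auto simp: \<gamma>0_def\<close>)
  have \<gamma>p: "\<gamma> t = \<alpha>p (- t)" if "t \<in> {-lp..0}" for t
    using that base[of t] lm v by (cases "t = 0") (auto simp: \<gamma>0_def)
  have \<gamma>ends: "\<gamma> 0 = (v, 0)" "\<gamma> lm = (u, 0)" "\<gamma> (- lp) = (u, 0)"
    using \<gamma>m[of 0] \<gamma>m[of lm] \<gamma>p[of "- lp"] lp lm u v by auto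
  have spos: "snd (\<gamma> t) > 0" if "t \<in> {-lp<..<0}" for t
    using \<gamma>p[of t] that up by (auto simp: half_arc_def)
  have sneg: "snd (\<gamma> t) < 0" if "t \<in> {0<..<lm}" for t
    using \<gamma>m[of t] that low by (auto simp: half_arc_def)
  have dm: "(\<gamma> has_vector_derivative Fm (\<gamma> t)) (at t within {0..lm})" if t: "t \<in> {0..lm}" for t
  proof -
    have "(\<alpha>m has_vector_derivative Fm (\<alpha>m t)) (at t within {0..lm})"
      using low t by (auto simp: half_arc_def solution_on_def)
    then show ?thesis unfolding \<gamma>m[OF t, symmetric]
      by (rule has_vector_derivative_transform[OF t, rotated]) (simp add: \<gamma>m)
  qed
  have dp: "(\<gamma> has_vector_derivative Fp (\<gamma> t)) (at t within {-lp..0})" if t: "t \<in> {-lp..0}" for t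
  proof -
    have img: "uminus ` {-lp..0} = {0..lp}" by (auto simp: image_iff intro: bexI[of _ "- _"])
    have "(\<alpha>p has_vector_derivative - Fp (\<alpha>p (- t))) (at (- t) within uminus ` {-lp..0})"
      using up t by (auto simp: half_arc_def solution_on_def img)
    moreover have "(uminus has_vector_derivative - 1) (at t within {-lp..0})"
      by (auto intro!: derivative_eq_intros simp flip: has_real_derivative_iff_has_vector_derivative)
    ultimately have "(\<alpha>p \<circ> uminus has_vector_derivative (- 1) *\<^sub>R (- Fp (\<alpha>p (- t)))) (at t within {-lp..0})"
      by (rule vector_diff_chain_within[rotated])
    then have "((\<lambda>t. \<alpha>p (- t)) has_vector_derivative Fp (\<gamma> t)) (at t within {-lp..0})"
      by (simp add: o_def \<gamma>p[OF t])
    then show ?thesis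
      by (rule has_vector_derivative_transform[OF t, rotated]) (simp add: \<gamma>p)
  qed
  define Cr where "Cr t \<longleftrightarrow>
     (snd (\<gamma> t) > 0 \<longrightarrow> (\<gamma> has_vector_derivative Fp (\<gamma> t)) (at t)) \<and>
     (snd (\<gamma> t) < 0 \<longrightarrow> (\<gamma> has_vector_derivative Fm (\<gamma> t)) (at t)) \<and>
     (snd (\<gamma> t) = 0 \<longrightarrow>
        snd (Fp (\<gamma> t)) > 0 \<and> snd (Fm (\<gamma> t)) > 0 \<and>
          (\<gamma> has_vector_derivative Fm (\<gamma> t)) (at_left t) \<and>
          (\<gamma> has_vector_derivative Fp (\<gamma> t)) (at_right t) \<or>
        snd (Fp (\<gamma> t)) < 0 \<and> snd (Fm (\<gamma> t)) < 0 \<and>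
          (\<gamma> has_vector_derivative Fp (\<gamma> t)) (at_left t) \<and>
          (\<gamma> has_vector_derivative Fm (\<gamma> t)) (at_right t))" for t
  have Cr0: "Cr t" if t: "t \<in> {-lp..<-lp + T}" for t
  proof -
    consider "t = -lp" | "t \<in> {-lp<..<0}" | "t = 0" | "t \<in> {0<..<lm}"
      using t unfolding T_def by fastforce
    then show ?thesis
    proof cases
      case 1
      \<comment> \<open>The left derivative at \<open>- lp\<close> is the one at \<open>lm\<close>,
        transported by one period.\<close>
      have "(\<gamma> has_vector_derivative Fm (\<gamma> lm)) (at_left lm)"
        using dm[of lm] lm by (simp add: at_within_Icc_at_left)
      then have "(\<gamma> has_vector_derivative Fm (\<gamma> lm)) (at_left (- lp + T))" by (simp add: T_def)
      then have "(\<gamma> has_vector_derivative Fm (\<gamma> lm)) (at_left (- lp))"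
        by (rule has_vector_derivative_shift(2)[of \<gamma> T, OF per])
      moreover have "(\<gamma> has_vector_derivative Fp (\<gamma> (- lp))) (at_right (- lp))"
        using dp[of "- lp"] lp by (simp add: at_within_Icc_at_right)
      ultimately show ?thesis using 1 cu by (simp add: Cr_def \<gamma>ends)
    next
      case 2
      then have "(\<gamma> has_vector_derivative Fp (\<gamma> t)) (at t)"
        using dp[of t] by (simp add: at_within_Icc_at)
      then show ?thesis using spos[OF 2] by (simp add: Cr_def)
    next
      case 3
      have "(\<gamma> has_vector_derivative Fp (\<gamma> 0)) (at_left 0)"
        using dp[of 0] lp by (simp add: at_within_Icc_at_left)
      moreover have "(\<gamma> has_vector_derivative Fm (\<gamma> 0)) (at_right 0)"
        using dm[of 0] lm by (simp add: at_within_Icc_at_right)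
      ultimately show ?thesis using 3 cv by (simp add: Cr_def \<gamma>ends)
    next
      case 4
      then have "(\<gamma> has_vector_derivative Fm (\<gamma> t)) (at t)"
        using dm[of t] by (simp add: at_within_Icc_at)
      then show ?thesis using sneg[OF 4] by (simp add: Cr_def)
    qed
  qed
  have "Cr t" for t
  proof -
    obtain k :: int where k: "t + of_int k * T \<in> {-lp..<-lp + T}"
      using reduce_mod_period[OF T] by blast
    have perk: "\<gamma> (t + of_int k * T) = \<gamma> t" for t by (rule periodic_shift[of \<gamma> T, OF per])
    note sh = has_vector_derivative_shift[of \<gamma> "of_int k * T", OF perk]
    from Cr0[OF k] show ?thesis unfolding Cr_def perk using sh by blast
  qed
  then have cross: "crossing_trajectory Fp Fm \<gamma>" by (simp add: crossing_trajectory_def Cr_def)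
  \<comment> \<open>Minimality of the period: \<open>(v, 0)\<close> is not revisited within one
    period, since the open arcs avoid the line and \<open>u \<noteq> v\<close>.\<close>
  have "\<gamma> (0 + S) \<noteq> \<gamma> 0" if S: "0 < S" "S < T" for S
  proof -
    consider "S < lm" | "S = lm" | "lm < S" by linarith
    then show ?thesis
    proof cases
      case 1
      then have "snd (\<gamma> S) < 0" using S by (intro sneg) auto
      then show ?thesis using \<gamma>ends by auto
    next
      case 3
      then have "snd (\<gamma> (S - T)) > 0" using S by (intro spos) (auto simp: T_def)
      then show ?thesis using per[of "S - T"] \<gamma>ends by auto
    qed (use \<gamma>ends uv in auto)
  qed
  then have "periodic_trajectory Fp Fm \<gamma> (lp + lm)"
    unfolding periodic_trajectory_def T_def[symmetric] using cross T per by blast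
  moreover have "snd (\<gamma> t) \<ge> 0" if "t \<in> {-lp..0}" for t
    using spos[of t] \<gamma>ends that by (cases "t = -lp \<or> t = 0") (auto simp: less_imp_le)
  moreover have "snd (\<gamma> t) \<le> 0" if "t \<in> {0..lm}" for t
    using sneg[of t] \<gamma>ends that by (cases "t = 0 \<or> t = lm") (auto simp: less_imp_le)
  ultimately show ?thesis using that \<gamma>ends(1) by blast
qed

text \<open>Following the lower arc and then the reversed upper arc leads from \<open>(v, 0)\<close>
  back to it. The period \<open>T\<close> may differ from the time \<open>lm + lp\<close> of one
  lap: it is used to move each time past the start in direction \<open>d\<close>, after which whole
  laps are removed.\<close>

lemma range_through_arcs:
  fixes d :: real
  assumes \<gamma>: "crossing_trajectory Fp Fm \<gamma>" and per: "\<And>t. \<gamma> (t + T) = \<gamma> t" and T: "T > 0"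
    and lip: "locally_lipschitz Fp" "locally_lipschitz Fm" and d: "d \<in> {-1, 1}"
    and up: "half_arc 1 (\<lambda>p. (- d) *\<^sub>R Fp p) lp \<alpha>p" and low: "half_arc (-1) (\<lambda>p. d *\<^sub>R Fm p) lm \<alpha>m"
    and v: "\<alpha>p 0 = (v, 0)" "\<alpha>m 0 = (v, 0)" and u: "\<alpha>p lp = (u, 0)" "\<alpha>m lm = (u, 0)"
    and start: "\<gamma> t0 = (v, 0)"
  shows "range \<gamma> = \<alpha>m ` {0..lm} \<union> \<alpha>p ` {0..lp}"
proof -
  have lp: "lp > 0" and lm: "lm > 0" using up low by (auto simp: half_arc_def)
  have d': "- d \<in> {-1, 1}" using d by auto
  have fm: "\<gamma> (t + d * w) = \<alpha>m w" if "\<gamma> t = (v, 0)" "w \<in> {0..lm}" for t w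
    by (rule crossing_trajectory_follows_arc[OF \<gamma> d _ _ lip(2) low _ that(2)]) (use that v in auto)
  have fp: "\<gamma> (t + (- d) * w) = \<alpha>p w" if "\<gamma> t = (v, 0)" "w \<in> {0..lp}" for t w
    by (rule crossing_trajectory_follows_arc[OF \<gamma> d' _ _ lip(1) up _ that(2)]) (use that v in auto)
  have up': "half_arc 1 (\<lambda>p. d *\<^sub>R Fp p) lp (\<lambda>w. \<alpha>p (lp - w))"
    using half_arc_reverse[OF up] by simp
  have fr: "\<gamma> (t + d * w) = \<alpha>p (lp - w)" if "\<gamma> t = (u, 0)" "w \<in> {0..lp}" for t w
    by (rule crossing_trajectory_follows_arc[OF \<gamma> d _ _ lip(1) up' _ that(2)]) (use that u in auto)
  let ?C = "\<alpha>m ` {0..lm} \<union> \<alpha>p ` {0..lp}"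
  define S where "S = lm + lp"
  have S: "S > 0" using lp lm by (simp add: S_def)
  have around: "\<gamma> (t + d * w) \<in> ?C" "w = S \<Longrightarrow> \<gamma> (t + d * w) = (v, 0)"
    if t: "\<gamma> t = (v, 0)" and w: "w \<in> {0..S}" for t w
  proof -
    have mid: "\<gamma> (t + d * lm) = (u, 0)" using fm[OF t, of lm] u lm by auto
    have late: "\<gamma> (t + d * w) = \<alpha>p (lp - (w - lm))" if "lm \<le> w"
      using fr[OF mid, of "w - lm"] w that by (simp add: S_def algebra_simps)
    show "\<gamma> (t + d * w) \<in> ?C"
    proof (cases "w \<le> lm")
      case True
      then show ?thesis using fm[OF t, of w] w by auto
    next
      case False
      then show ?thesis using late w by (auto simp: S_def)
    qed
    show "\<gamma> (t + d * w) = (v, 0)" if "w = S" using late that lp v by (simp add: S_def)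
  qed
  have loop: "\<gamma> (t0 + d * (of_nat n * S)) = (v, 0)" for n
  proof (induction n)
    case (Suc n)
    have "\<gamma> (t0 + d * (of_nat n * S) + d * S) = (v, 0)" using around(2)[OF Suc] S by auto
    then show ?case by (simp add: algebra_simps)
  qed (use start in simp)
  have "\<gamma> t \<in> ?C" for t
  proof -
    obtain k :: int where k: "d * (t - t0) + of_int k * T \<in> {0..<0 + T}"
      using reduce_mod_period[OF T] by blast
    define w where "w = d * (t - t0) + of_int k * T"
    have w0: "w \<ge> 0" using k by (simp add: w_def)
    have dd: "d * d = 1" using d by auto
    have "\<gamma> (t0 + d * w) = \<gamma> t"
    proof -
      have "d * w = (d * d) * (t - t0) + d * (of_int k * T)" by (simp add: w_def algebra_simps)
      then have "t0 + d * w = t + d * (of_int k * T)" unfolding dd by simp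
      moreover have "\<gamma> (t + d * (of_int k * T)) = \<gamma> t"
        using periodic_shift[of \<gamma> T t k, OF per] periodic_shift[of \<gamma> T t "- k", OF per] d by auto
      ultimately show ?thesis by simp
    qed
    moreover obtain j :: int where j: "w + of_int j * S \<in> {0..<0 + S}"
      using reduce_mod_period[OF S] by blast
    have "j \<le> 0"
    proof (rule ccontr)
      assume "\<not> j \<le> 0"
      then have "of_int j * S \<ge> 1 * S" using S by (intro mult_right_mono) auto
      then show False using j w0 by simp
    qed
    then obtain n where n: "j = - int n" by (metis nonpos_int_cases)
    have "\<gamma> (t0 + d * (of_nat n * S) + d * (w - of_nat n * S)) \<in> ?C"
      by (rule around(1)[OF loop]) (use j n in auto)
    ultimately show ?thesis by (simp add: algebra_simps)
  qed
  moreover have "\<alpha>m w \<in> range \<gamma>" if "w \<in> {0..lm}" for w using fm[OF start that] by (metis rangeI)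
  moreover have "\<alpha>p w \<in> range \<gamma>" if "w \<in> {0..lp}" for w using fp[OF start that] by (metis rangeI)
  ultimately show ?thesis by blast
qed

text \<open>The case \<open>d = 1\<close> is \<open>glue_arcs\<close>; for \<open>d = -1\<close> the
  arcs belong to the negated fields, and the glued trajectory is run backwards in time.\<close>

lemma periodic_from_arcs:
  fixes d :: real
  assumes lip: "locally_lipschitz Fp" "locally_lipschitz Fm" and d: "d \<in> {-1, 1}"
    and up: "half_arc 1 (\<lambda>p. (- d) *\<^sub>R Fp p) lp \<alpha>p" and low: "half_arc (-1) (\<lambda>p. d *\<^sub>R Fm p) lm \<alpha>m"
    and v: "\<alpha>p 0 = (v, 0)" "\<alpha>m 0 = (v, 0)" and u: "\<alpha>p lp = (u, 0)" "\<alpha>m lm = (u, 0)" and uv: "u \<noteq> v"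
    and cv: "d * snd (Fp (v, 0)) < 0" "d * snd (Fm (v, 0)) < 0" and cu: "d * snd (Fp (u, 0)) > 0" "d * snd (Fm (u, 0)) > 0"
  obtains \<gamma> a m where "periodic_trajectory Fp Fm \<gamma> (lp + lm)" "range \<gamma> = \<alpha>m ` {0..lm} \<union> \<alpha>p ` {0..lp}"
    "a < m" "m < a + (lp + lm)" "\<And>t. t \<in> {a..m} \<Longrightarrow> snd (\<gamma> t) \<ge> 0" "\<And>t. t \<in> {m..a + (lp + lm)} \<Longrightarrow> snd (\<gamma> t) \<le> 0"
proof -
  have l: "lp > 0" "lm > 0" using up low by (auto simp: half_arc_def)
  have rng: "range \<gamma> = \<alpha>m ` {0..lm} \<union> \<alpha>p ` {0..lp}" if "periodic_trajectory Fp Fm \<gamma> (lp + lm)" "\<gamma> 0 = (v, 0)" for \<gamma>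
    by (rule range_through_arcs[where T = "lp + lm" and \<gamma> = \<gamma>, OF _ _ _ lip d up low v u that(2)])
       (use that(1) in \<open>auto simp: periodic_trajectory_def\<close>)
  show ?thesis
  proof (cases "d = 1")
    case True
    obtain \<gamma> where \<gamma>: "periodic_trajectory Fp Fm \<gamma> (lp + lm)" "\<gamma> 0 = (v, 0)"
      "\<And>t. t \<in> {-lp..0} \<Longrightarrow> snd (\<gamma> t) \<ge> 0" "\<And>t. t \<in> {0..lm} \<Longrightarrow> snd (\<gamma> t) \<le> 0"
    proof (rule glue_arcs[where Fp = Fp and Fm = Fm, OF _ _ v u uv])
      show "half_arc 1 (\<lambda>p. - Fp p) lp \<alpha>p" "half_arc (- 1) Fm lm \<alpha>m" using up low True by simp_all
      show "snd (Fp (v, 0)) < 0" "snd (Fm (v, 0)) < 0" "0 < snd (Fp (u, 0))" "0 < snd (Fm (u, 0))"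
        using cv cu True by simp_all
    qed (rule that)
    show ?thesis by (rule that[of \<gamma> "- lp" 0, OF \<gamma>(1) rng[OF \<gamma>(1,2)]]) (use \<gamma> l in auto)
  next
    case False
    then have d1: "d = -1" using d by auto
    obtain \<gamma> where \<gamma>: "periodic_trajectory (\<lambda>p. - Fp p) (\<lambda>p. - Fm p) \<gamma> (lp + lm)" "\<gamma> 0 = (v, 0)"
      "\<And>t. t \<in> {-lp..0} \<Longrightarrow> snd (\<gamma> t) \<ge> 0" "\<And>t. t \<in> {0..lm} \<Longrightarrow> snd (\<gamma> t) \<le> 0"
    proof (rule glue_arcs[where Fp = "\<lambda>p. - Fp p" and Fm = "\<lambda>p. - Fm p", OF _ _ v u uv])
      show "half_arc 1 (\<lambda>p. - (- Fp p)) lp \<alpha>p" "half_arc (- 1) (\<lambda>p. - Fm p) lm \<alpha>m" using up low d1 by simp_all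
      show "snd (- Fp (v, 0)) < 0" "snd (- Fm (v, 0)) < 0" "0 < snd (- Fp (u, 0))" "0 < snd (- Fm (u, 0))"
        using cv cu d1 by simp_all
    qed (rule that)
    have per: "\<gamma> (t + (lp + lm)) = \<gamma> t" for t using \<gamma>(1) by (auto simp: periodic_trajectory_def)
    have per': "\<gamma> (- (t + (lp + lm))) = \<gamma> (- t)" for t
    proof -
      have eq: "- (t + (lp + lm)) + (lp + lm) = - t" by simp
      show ?thesis using per[of "- (t + (lp + lm))"] unfolding eq by (rule sym)
    qed
    have "periodic_trajectory Fp Fm (\<lambda>t. \<gamma> (- t)) (lp + lm)"
      unfolding periodic_trajectory_def
    proof (intro conjI allI impI)
      show "crossing_trajectory Fp Fm (\<lambda>t. \<gamma> (- t))"
        by (rule crossing_trajectory_reflect) (use \<gamma>(1) in \<open>auto simp: periodic_trajectory_def\<close>)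
      fix S assume "0 < S \<and> S < lp + lm"
      then obtain t where "\<gamma> (t + S) \<noteq> \<gamma> t" using \<gamma>(1) unfolding periodic_trajectory_def by blast
      then have "\<gamma> (- ((- t - S) + S)) \<noteq> \<gamma> (- (- t - S))" by (simp add: algebra_simps)
      then show "\<exists>t. \<gamma> (- (t + S)) \<noteq> \<gamma> (- t)" by blast
    qed (use l per' in auto)
    moreover have "snd (\<gamma> (- t)) \<le> 0" if "t \<in> {lp..0 + (lp + lm)}" for t
      using \<gamma>(4)[of "- t + (lp + lm)"] per[of "- t"] that by auto
    ultimately show ?thesis
      using that[of "\<lambda>t. \<gamma> (- t)" 0 lp] rng[of "\<lambda>t. \<gamma> (- t)"] \<gamma>(2,3) l by auto
  qed
qed

text \<open>A trajectory avoiding the line stays in one half plane by connectedness, and there its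
  first coordinate is strictly monotone, which excludes a period.\<close>

lemma periodic_trajectory_meets_line:
  assumes \<gamma>: "periodic_trajectory Fp Fm \<gamma> T"
    and Pp: "\<And>t. cp * fst (Fp (\<gamma> t)) > 0" and Pm: "\<And>t. cm * fst (Fm (\<gamma> t)) > 0"
  obtains t where "snd (\<gamma> t) = 0"
proof (rule ccontr)
  assume "\<not> thesis"
  then have nz: "snd (\<gamma> t) \<noteq> 0" for t using that by blast
  have cr: "crossing_trajectory Fp Fm \<gamma>" and T: "T > 0" and per: "\<gamma> (t + T) = \<gamma> t" for t
    using \<gamma> by (auto simp: periodic_trajectory_def)
  have "continuous_on UNIV (\<lambda>t. snd (\<gamma> t))"
    by (intro continuous_intros crossing_trajectory_continuous[OF cr])
  then have conn: "connected (range (\<lambda>t. snd (\<gamma> t)))" by (intro connected_continuous_image) auto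
  have mono: False if d: "\<And>t. (\<gamma> has_vector_derivative F (\<gamma> t)) (at t)" and c: "\<And>t. c * fst (F (\<gamma> t)) > 0" for F c
  proof -
    have der: "((\<lambda>t. c * fst (\<gamma> t)) has_real_derivative c * fst (F (\<gamma> t))) (at t)" for t
      using bounded_linear.has_vector_derivative[OF bounded_linear_fst d[of t]]
      by (intro DERIV_cmult) (simp add: has_real_derivative_iff_has_vector_derivative)
    have "c * fst (\<gamma> 0) < c * fst (\<gamma> T)"
      by (rule DERIV_pos_imp_increasing[OF T, where f = "\<lambda>t. c * fst (\<gamma> t)"]) (use der c in blast)
    then show False using per[of 0] by simp
  qed
  show False
  proof (cases "\<exists>t. snd (\<gamma> t) < 0")
    case True
    then obtain t where t: "snd (\<gamma> t) < 0" by blast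
    have "snd (\<gamma> t') < 0" for t'
    proof (rule ccontr)
      assume "\<not> snd (\<gamma> t') < 0"
      then have "0 \<in> {snd (\<gamma> t)..snd (\<gamma> t')}" using t by auto
      then have "0 \<in> range (\<lambda>t. snd (\<gamma> t))"
        using connected_contains_Icc[OF conn, of "snd (\<gamma> t)" "snd (\<gamma> t')"] by blast
      then show False using nz by (auto simp: image_iff)
    qed
    then show False using mono[of Fm cm] crossing_trajectoryD(2)[OF cr] Pm by blast
  next
    case False
    then have "snd (\<gamma> t) > 0" for t using nz[of t] by (meson linorder_neqE_linordered_idom)
    then show False using mono[of Fp cp] crossing_trajectoryD(1)[OF cr] Pp by blast
  qed
qed

section \<open>The perturbed fold-fold singularity\<close>

lemma half_arc_zero:
  assumes arc: "half_arc s G l \<alpha>" and t: "t \<in> {0..l}" "snd (\<alpha> t) = 0"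
  shows "t = 0 \<or> t = l"
proof (rule ccontr)
  assume "\<not> (t = 0 \<or> t = l)"
  then have "t \<in> {0<..<l}" using t(1) by auto
  then have "s * snd (\<alpha> t) > 0" using arc unfolding half_arc_def by blast
  then show False using t(2) by simp
qed

text \<open>Both orientations of the rotation are covered by \<open>d\<close>: from
  \<open>(x, 0)\<close> with \<open>x > 0\<close> the lower arc runs in time direction
  \<open>d\<close> and the upper arc in direction \<open>- d\<close>. The locale records what holds
  on a common interval of the two germs, with the flow replaced by arcs.\<close>

locale fold_fold =
  fixes Zp Zm :: vfield and lp lm \<phi>p \<phi>m :: "real \<Rightarrow> real" and \<sigma>p \<sigma>m :: "complex \<Rightarrow> complex"
    and Ap Am :: "real \<Rightarrow> real \<Rightarrow> real \<times> real" and Pp Pm r K d :: real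
  assumes lip_p: "locally_lipschitz Zp" and lip_m: "locally_lipschitz Zm"
    and germ_p: "real_germ \<sigma>p r" and germ_m: "real_germ \<sigma>m r"
    and K0: "K \<ge> 0" and d: "d \<in> {-1, 1}" and dPp: "d * Pp > 0" and dPm: "d * Pm < 0"
    and Zp0: "snd (Zp (0, 0)) = 0" and Zm0: "snd (Zm (0, 0)) = 0"
    and Qp: "\<And>x. 0 < \<bar>x\<bar> \<Longrightarrow> \<bar>x\<bar> < r \<Longrightarrow> Pp * (snd (Zp (x, 0)) * x) < 0"
    and Qm: "\<And>x. 0 < \<bar>x\<bar> \<Longrightarrow> \<bar>x\<bar> < r \<Longrightarrow> Pm * (snd (Zm (x, 0)) * x) > 0"
    and box_p: "\<And>x y. \<bar>x\<bar> < r \<Longrightarrow> \<bar>y\<bar> < r \<Longrightarrow> Pp * fst (Zp (x, y)) > 0"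
    and box_m: "\<And>x y. \<bar>x\<bar> < r \<Longrightarrow> \<bar>y\<bar> < r \<Longrightarrow> Pm * fst (Zm (x, y)) > 0"
    and arc_p: "\<And>x. 0 < x \<Longrightarrow> x < r \<Longrightarrow> half_arc 1 (\<lambda>p. (- d) *\<^sub>R Zp p) (lp x) (Ap x)"
    and arc_m: "\<And>x. 0 < x \<Longrightarrow> x < r \<Longrightarrow> half_arc (-1) (\<lambda>p. d *\<^sub>R Zm p) (lm x) (Am x)"
    and ends_p: "\<And>x. 0 < x \<Longrightarrow> x < r \<Longrightarrow> Ap x 0 = (x, 0) \<and> Ap x (lp x) = (\<phi>p x, 0)"
    and ends_m: "\<And>x. 0 < x \<Longrightarrow> x < r \<Longrightarrow> Am x 0 = (x, 0) \<and> Am x (lm x) = (\<phi>m x, 0)"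
    and refl_p: "\<And>x. 0 < x \<Longrightarrow> x < r \<Longrightarrow> \<phi>p x < 0 \<and> - (2 * x) \<le> \<phi>p x \<and> on_real \<sigma>p (\<phi>p x) = - on_real \<sigma>p x"
    and refl_m: "\<And>x. 0 < x \<Longrightarrow> x < r \<Longrightarrow> \<phi>m x < 0 \<and> - (2 * x) \<le> \<phi>m x \<and> on_real \<sigma>m (\<phi>m x) = - on_real \<sigma>m x"
    and bound_p: "\<And>x u. 0 < x \<Longrightarrow> x < r \<Longrightarrow> u \<in> {0..lp x} \<Longrightarrow> \<bar>fst (Ap x u)\<bar> \<le> 2 * x \<and> \<bar>snd (Ap x u)\<bar> \<le> K * x"
    and bound_m: "\<And>x u. 0 < x \<Longrightarrow> x < r \<Longrightarrow> u \<in> {0..lm x} \<Longrightarrow> \<bar>fst (Am x u)\<bar> \<le> 2 * x \<and> \<bar>snd (Am x u)\<bar> \<le> K * x"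
begin

abbreviation "sp \<equiv> on_real \<sigma>p"
abbreviation "sm \<equiv> on_real \<sigma>m"

definition fixed_pair :: "real \<Rightarrow> real \<Rightarrow> real \<Rightarrow> bool" where
  "fixed_pair b v u \<longleftrightarrow> 0 < v \<and> u < 0 \<and> sm u = - sm v \<and> sp (v - b) + sp (u - b) = 0"

definition cycle :: "real \<Rightarrow> real \<Rightarrow> (real \<times> real) set" where
  "cycle b v = Am v ` {0..lm v} \<union> (\<lambda>t. Ap (v - b) t + (b, 0)) ` {0..lp (v - b)}"

definition period :: "real \<Rightarrow> real \<Rightarrow> real" where
  "period b v = lp (v - b) + lm v"

lemma r_pos: "r > 0"
  using germ_p by (simp add: real_germ_def)

lemma sp_less_iff: "\<bar>x\<bar> < r \<Longrightarrow> \<bar>y\<bar> < r \<Longrightarrow> sp x < sp y \<longleftrightarrow> x < y"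
  and sm_less_iff: "\<bar>x\<bar> < r \<Longrightarrow> \<bar>y\<bar> < r \<Longrightarrow> sm x < sm y \<longleftrightarrow> x < y"
  by (rule real_germ_less_iff[OF germ_p] real_germ_less_iff[OF germ_m]; assumption)+

text \<open>The bound \<open>r / 2\<close> keeps the image, which is at least
  \<open>- 2 * x\<close>, inside the interval on which the germ is injective.\<close>

lemma reflection_eqI:
  "0 < x \<Longrightarrow> x < r / 2 \<Longrightarrow> \<bar>u\<bar> < r \<Longrightarrow> sp u = - sp x \<Longrightarrow> \<phi>p x = u"
  "0 < x \<Longrightarrow> x < r / 2 \<Longrightarrow> \<bar>u\<bar> < r \<Longrightarrow> sm u = - sm x \<Longrightarrow> \<phi>m x = u"
  using refl_p[of x] real_germ_eq_iff[OF germ_p, of "\<phi>p x" u] refl_m[of x] real_germ_eq_iff[OF germ_m, of "\<phi>m x" u]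
  by auto

text \<open>Allows an arc to be followed back from a crossing on the left: its abscissa is an image
  under either return map.\<close>

lemma reflection_surj:
  assumes "- r / 4 < u" "u < 0"
  shows "\<exists>x. 0 < x \<and> x < r / 2 \<and> \<phi>p x = u" "\<exists>x. 0 < x \<and> x < r / 2 \<and> \<phi>m x = u"
proof -
  have "\<exists>x. 0 < x \<and> x < r / 2 \<and> on_real \<sigma> u = - on_real \<sigma> x" if \<sigma>: "real_germ \<sigma> r" for \<sigma>
  proof -
    have ur: "\<bar>u\<bar> < r" "\<bar>u\<bar> < r / 2" using assms by auto
    obtain x where x: "\<bar>x\<bar> \<le> 2 * \<bar>u\<bar>" "on_real \<sigma> x = - on_real \<sigma> u"
      using real_germ_solve[OF \<sigma> ur(2), of "- on_real \<sigma> u"] real_germ_bounds(1)[OF \<sigma> ur(1)] by auto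
    have xr: "\<bar>x\<bar> < r" using x assms by auto
    have "on_real \<sigma> u < 0" using real_germ_less_iff[OF \<sigma> ur(1), of 0] real_germ_0[OF \<sigma>] assms r_pos by simp
    then have "0 < x" using real_germ_less_iff[OF \<sigma> _ xr, of 0] real_germ_0[OF \<sigma>] x r_pos by simp
    then show ?thesis using x assms by (intro exI[of _ x]) auto
  qed
  note solve = this
  have ur: "\<bar>u\<bar> < r" using assms by auto
  obtain x where x: "0 < x" "x < r / 2" "sp u = - sp x" using solve[OF germ_p] by blast
  show "\<exists>x. 0 < x \<and> x < r / 2 \<and> \<phi>p x = u" using reflection_eqI(1)[OF x(1,2) ur x(3)] x by blast
  obtain y where y: "0 < y" "y < r / 2" "sm u = - sm y" using solve[OF germ_m] by blast
  show "\<exists>x. 0 < x \<and> x < r / 2 \<and> \<phi>m x = u" using reflection_eqI(2)[OF y(1,2) ur y(3)] y by blast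
qed

text \<open>\<open>sp (v - b)\<close> and \<open>sp (u - b)\<close> are opposite, and the first is
  the larger one, so they lie on different sides of 0; hence \<open>b\<close> lies strictly between
  \<open>u\<close> and \<open>v\<close>, whatever its sign.\<close>

lemma fixed_pair_arcs:
  assumes "fixed_pair b v u" and v: "v < r / 8" and u: "- r / 8 < u" and b: "\<bar>b\<bar> < r / 8"
  shows "0 < v - b" "v - b < r / 4" "u - b < 0" "\<phi>m v = u" "\<phi>p (v - b) = u - b"
proof -
  have p: "0 < v" "u < 0" "sm u = - sm v" "sp (v - b) + sp (u - b) = 0"
    using assms(1) by (auto simp: fixed_pair_def)
  have "\<bar>v\<bar> < r / 8" "\<bar>u\<bar> < r / 8" using p u v by auto
  then have small: "\<bar>v - b\<bar> < r / 4" "\<bar>u - b\<bar> < r / 4"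
    using b abs_triangle_ineq4[of v b] abs_triangle_ineq4[of u b] by - linarith+
  then have sr: "\<bar>v - b\<bar> < r" "\<bar>u - b\<bar> < r" "\<bar>0\<bar> < r" using r_pos by auto
  have "sp (u - b) < sp (v - b)" using sp_less_iff[OF sr(2,1)] p by simp
  then have "sp 0 < sp (v - b)" "sp (u - b) < sp 0" using p real_germ_0[OF germ_p] by auto
  then show 1: "0 < v - b" "u - b < 0" using sp_less_iff[OF sr(3,1)] sp_less_iff[OF sr(2,3)] by auto
  show "v - b < r / 4" using small(1) by linarith
  show "\<phi>m v = u" by (rule reflection_eqI) (use p u v r_pos in auto)
  show "\<phi>p (v - b) = u - b" by (rule reflection_eqI) (use p 1 small sr r_pos in auto)
qed

lemma shifted_arc:
  assumes "0 < x" "x < r"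
  shows "half_arc 1 (\<lambda>p. (- d) *\<^sub>R hshift b Zp p) (lp x) (\<lambda>t. Ap x t + (b, 0))"
    and "(\<lambda>t. Ap x t + (b, 0)) 0 = (x + b, 0)" "(\<lambda>t. Ap x t + (b, 0)) (lp x) = (\<phi>p x + b, 0)"
  using half_arc_hshift[OF arc_p[OF assms], of b] ends_p[OF assms] by simp_all

lemma hshift_apply: "hshift b F (x, y) = F (x - b, y)"
  by (simp add: hshift_def)

lemma hshift_lipschitz: "locally_lipschitz (hshift b Zp)"
  unfolding locally_lipschitz_def
proof
  fix p :: "real \<times> real"
  define q where "q = p - (b, 0)"
  obtain e L where e: "e > 0" and L: "\<forall>x\<in>ball q e. \<forall>y\<in>ball q e. dist (Zp x) (Zp y) \<le> L * dist x y"
    using lip_p unfolding locally_lipschitz_def by blast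
  have sh: "hshift b Zp x = Zp (x - (b, 0))" for x by (cases x) (simp add: hshift_def)
  have "\<forall>x\<in>ball p e. \<forall>y\<in>ball p e. dist (hshift b Zp x) (hshift b Zp y) \<le> L * dist x y"
  proof (intro ballI)
    fix x y assume "x \<in> ball p e" "y \<in> ball p e"
    then have "x - (b, 0) \<in> ball q e" "y - (b, 0) \<in> ball q e" by (auto simp: q_def dist_norm)
    with L have "dist (Zp (x - (b, 0))) (Zp (y - (b, 0))) \<le> L * dist (x - (b, 0)) (y - (b, 0))" by blast
    then show "dist (hshift b Zp x) (hshift b Zp y) \<le> L * dist x y" by (simp add: sh dist_norm)
  qed
  then show "\<exists>r>0. \<exists>L. \<forall>x\<in>ball p r. \<forall>y\<in>ball p r. dist (hshift b Zp x) (hshift b Zp y) \<le> L * dist x y"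
    using e by blast
qed

lemma normal_signs:
  "0 < x \<Longrightarrow> x < r \<Longrightarrow> d * snd (Zp (x, 0)) < 0" "0 < x \<Longrightarrow> x < r \<Longrightarrow> d * snd (Zm (x, 0)) < 0"
  "x < 0 \<Longrightarrow> - r < x \<Longrightarrow> d * snd (Zp (x, 0)) > 0" "x < 0 \<Longrightarrow> - r < x \<Longrightarrow> d * snd (Zm (x, 0)) > 0"
  using Qp[of x] Qm[of x] d dPp dPm by (auto simp: zero_less_mult_iff mult_less_0_iff)

lemma cycle_exists:
  assumes p: "fixed_pair b v u" and v: "v < r / 8" and u: "- r / 8 < u" and b: "\<bar>b\<bar> < r / 8"
  obtains \<gamma> a m where "periodic_trajectory (hshift b Zp) Zm \<gamma> (period b v)" "range \<gamma> = cycle b v"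
    "a < m" "m < a + period b v" "\<And>t. t \<in> {a..m} \<Longrightarrow> snd (\<gamma> t) \<ge> 0" "\<And>t. t \<in> {m..a + period b v} \<Longrightarrow> snd (\<gamma> t) \<le> 0"
proof -
  note A = fixed_pair_arcs[OF assms]
  have vu: "0 < v" "u < 0" using p by (auto simp: fixed_pair_def)
  have vr: "v < r" "v - b < r" "- r < u" "- r < u - b" using v u b A r_pos by auto
  note S = shifted_arc[OF A(1) vr(2), of b]
  have e: "(\<lambda>t. Ap (v - b) t + (b, 0)) 0 = (v, 0)" "(\<lambda>t. Ap (v - b) t + (b, 0)) (lp (v - b)) = (u, 0)"
    using S(2,3) A(5) by simp_all
  have em: "Am v 0 = (v, 0)" "Am v (lm v) = (u, 0)" using ends_m[OF vu(1) vr(1)] A(4) by simp_all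
  have uv: "u \<noteq> v" using vu by simp
  have N: "d * snd (hshift b Zp (v, 0)) < 0" "d * snd (Zm (v, 0)) < 0"
    "d * snd (hshift b Zp (u, 0)) > 0" "d * snd (Zm (u, 0)) > 0"
    using normal_signs(1)[OF A(1) vr(2)] normal_signs(2)[OF vu(1) vr(1)]
      normal_signs(3)[OF A(3) vr(4)] normal_signs(4)[OF vu(2) vr(3)] by (simp_all add: hshift_apply)
  show ?thesis
    by (rule periodic_from_arcs[OF hshift_lipschitz lip_m d S(1) arc_m[OF vu(1) vr(1)] e(1) em(1) e(2) em(2) uv N])
       (rule that, simp_all add: period_def cycle_def)
qed

lemma cycle_crossings:
  assumes p: "fixed_pair b v u" and v: "v < r / 8" and u: "- r / 8 < u" and b: "\<bar>b\<bar> < r / 8"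
  shows "cycle_position (cycle b v) v"
proof -
  note A = fixed_pair_arcs[OF assms]
  have vu: "0 < v" "u < 0" using p by (auto simp: fixed_pair_def)
  have vr: "v < r" "v - b < r" using v u b A r_pos by auto
  note S = shifted_arc[OF A(1) vr(2), of b]
  note M = arc_m[OF vu(1) vr(1)]
  have "x = v" if x: "0 < x" "(x, 0) \<in> cycle b v" for x
    using x(2) unfolding cycle_def
  proof (elim UnE imageE)
    fix t assume t: "(x, 0) = Am v t" "t \<in> {0..lm v}"
    have "snd (Am v t) = 0" by (simp add: t(1)[symmetric])
    then have "t = 0 \<or> t = lm v" by (rule half_arc_zero[OF M t(2)])
    then show "x = v" using ends_m[OF vu(1) vr(1)] A(4) t(1) x vu by auto
  next
    fix t assume t: "(x, 0) = Ap (v - b) t + (b, 0)" "t \<in> {0..lp (v - b)}"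
    have "snd (Ap (v - b) t + (b, 0)) = 0" by (simp add: t(1)[symmetric])
    then have "t = 0 \<or> t = lp (v - b)" by (rule half_arc_zero[OF S(1) t(2)])
    then show "x = v" using S(2,3) A(5) t(1) x vu by auto
  qed
  moreover have "(v, 0) \<in> cycle b v"
    unfolding cycle_def using ends_m[OF vu(1) vr(1)] M by (intro UnI1 image_eqI[of _ _ 0]) (auto simp: half_arc_def)
  ultimately show ?thesis using vu by (auto simp: cycle_position_def)
qed

lemma cycle_bounds:
  assumes p: "fixed_pair b v u" and v: "v < r / 8" and u: "- r / 8 < u" and b: "\<bar>b\<bar> < r / 8"
    and q: "q \<in> cycle b v"
  shows "\<bar>fst q\<bar> \<le> 2 * v + 3 * \<bar>b\<bar> \<and> \<bar>snd q\<bar> \<le> K * (v + \<bar>b\<bar>)"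
proof -
  note A = fixed_pair_arcs[OF assms(1-4)]
  have vu: "0 < v" "u < 0" using p by (auto simp: fixed_pair_def)
  have vr: "v < r" "v - b < r" using v u b A r_pos by auto
  have K: "K * v \<le> K * (v + \<bar>b\<bar>)" "K * (v - b) \<le> K * (v + \<bar>b\<bar>)" using K0 by (intro mult_left_mono; simp)+
  show ?thesis
    using q unfolding cycle_def
  proof (elim UnE imageE)
    fix t assume t: "q = Am v t" "t \<in> {0..lm v}"
    then show ?thesis using bound_m[OF vu(1) vr(1) t(2)] K(1) by auto
  next
    fix t assume t: "q = Ap (v - b) t + (b, 0)" "t \<in> {0..lp (v - b)}"
    then show ?thesis using bound_p[OF A(1) vr(2) t(2)] K(2) by (auto simp: fst_add snd_add)
  qed
qed

text \<open>The largest abscissa \<open>v > 0\<close> at which a periodic trajectory meets \<open>y = 0\<close> is a fixed point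
  of the (monotone) return map: both the forward and the backward image of \<open>v\<close> are at most \<open>v\<close>.\<close>

lemma periodic_trajectory_fixed_pair:
  assumes \<gamma>: "periodic_trajectory (hshift b Zp) Zm \<gamma> T" and e: "e \<le> r / 8" and b: "\<bar>b\<bar> < e"
    and box: "\<And>t. \<bar>fst (\<gamma> t)\<bar> < e \<and> \<bar>snd (\<gamma> t)\<bar> < e"
  obtains v u where "fixed_pair b v u" "v < e" "- e < u" "range \<gamma> = cycle b v"
proof -
  have cr: "crossing_trajectory (hshift b Zp) Zm \<gamma>" and T: "T > 0" and per: "\<And>t. \<gamma> (t + T) = \<gamma> t"
    using \<gamma> by (auto simp: periodic_trajectory_def)
  have pairs: "\<gamma> t = (fst (\<gamma> t), snd (\<gamma> t))" for t by simp
  have small: "\<bar>fst (\<gamma> t)\<bar> < r / 8" "\<bar>fst (\<gamma> t) - b\<bar> < r / 4" "\<bar>snd (\<gamma> t)\<bar> < r / 8" for t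
    using box[THEN conjunct1, of t] box[THEN conjunct2, of t] e b abs_triangle_ineq4[of "fst (\<gamma> t)" b]
    by - linarith+
  have br: "\<bar>b\<bar> < r / 8" using b e by simp
  have d': "- d \<in> {-1, 1}" using d by auto
  define H where "H x \<longleftrightarrow> (x, 0) \<in> range \<gamma>" for x
  have H_bound: "\<bar>x\<bar> < e" if "H x" for x
    using that box unfolding H_def by (metis fst_conv imageE)
  \<comment> \<open>Strictly between 0 and \<open>b\<close> the normal components of the two fields
    have opposite signs, so such points are not crossings; at 0 and at \<open>b\<close> one of the
    components vanishes.\<close>
  have sides: "(x - b) * x > 0" if Hx: "H x" for x
  proof -
    obtain t where t: "\<gamma> t = (x, 0)" using Hx unfolding H_def by (metis imageE)
    have xs: "\<bar>x\<bar> < r" "\<bar>x - b\<bar> < r" using small[of t] t r_pos by auto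
    have C: "snd (Zp (x - b, 0)) * snd (Zm (x, 0)) > 0"
      using crossing_trajectoryD(3)[OF cr, of t] by (auto simp: t hshift_apply intro: mult_pos_pos mult_neg_neg)
    have dd: "(d * snd (Zp (x - b, 0))) * (d * snd (Zm (x, 0))) = snd (Zp (x - b, 0)) * snd (Zm (x, 0))"
      using d by auto
    have "x \<noteq> 0" "x - b \<noteq> 0" using C Zp0 Zm0 by auto
    then consider "(x - b) * x > 0" | "x > 0" "x - b < 0" | "x < 0" "x - b > 0"
      by (metis linorder_neqE_linordered_idom mult_neg_neg mult_pos_pos)
    then show ?thesis
    proof cases
      case 2
      then have "d * snd (Zp (x - b, 0)) > 0" "d * snd (Zm (x, 0)) < 0"
        using normal_signs(3)[of "x - b"] normal_signs(2)[of x] xs by simp_all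
      then show ?thesis using C mult_pos_neg[of "d * snd (Zp (x - b, 0))" "d * snd (Zm (x, 0))"] unfolding dd by simp
    next
      case 3
      then have "d * snd (Zp (x - b, 0)) < 0" "d * snd (Zm (x, 0)) > 0"
        using normal_signs(1)[of "x - b"] normal_signs(4)[of x] xs by simp_all
      then show ?thesis using C mult_neg_pos[of "d * snd (Zp (x - b, 0))" "d * snd (Zm (x, 0))"] unfolding dd by simp
    qed
  qed
  \<comment> \<open>From a crossing on the right the lower arc is followed in time direction
    \<open>d\<close> and the upper one in direction \<open>- d\<close>, so the crossing set is
    stable under both return maps.\<close>
  have right: "H (\<phi>m v)" "H (\<phi>p (v - b) + b)" if v: "H v" "v > 0" for v
  proof -
    obtain t where t: "\<gamma> t = (v, 0)" using v unfolding H_def by (metis imageE)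
    have vb: "v - b > 0" using sides[OF v(1)] v(2) by (simp add: zero_less_mult_iff)
    have "\<bar>v\<bar> < r / 8" "\<bar>v - b\<bar> < r / 4" using small[of t] t by auto
    then have vr: "v < r" "v - b < r" using r_pos by - linarith+
    note M = arc_m[OF v(2) vr(1)] and S = shifted_arc[OF vb vr(2), of b]
    have "\<gamma> (t + d * lm v) = Am v (lm v)"
      by (rule crossing_trajectory_follows_arc[OF cr d _ _ lip_m M])
         (use t ends_m[OF v(2) vr(1)] M in \<open>auto simp: half_arc_def\<close>)
    then show "H (\<phi>m v)" unfolding H_def using ends_m[OF v(2) vr(1)] by (metis rangeI)
    have "\<gamma> (t + (- d) * lp (v - b)) = Ap (v - b) (lp (v - b)) + (b, 0)"
      by (rule crossing_trajectory_follows_arc[OF cr d' _ _ hshift_lipschitz[of b] S(1)])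
         (use t S in \<open>auto simp: half_arc_def\<close>)
    then show "H (\<phi>p (v - b) + b)" unfolding H_def using S(3) by (metis rangeI)
  qed
  \<comment> \<open>The reversed lower arc leads from the left crossing back to the right one;
    \<open>left_p\<close> is the analogue for the upper arc.\<close>
  have left_m: "H x" if u: "H (\<phi>m x)" and x: "0 < x" "x < r / 2" for x
  proof -
    obtain t where t: "\<gamma> t = (\<phi>m x, 0)" using u unfolding H_def by (metis imageE)
    have xr: "x < r" using x by simp
    note M = arc_m[OF x(1) xr]
    have M': "half_arc (-1) (\<lambda>p. (- d) *\<^sub>R Zm p) (lm x) (\<lambda>w. Am x (lm x - w))"
      using half_arc_reverse[OF M] by simp
    have "\<gamma> (t + (- d) * lm x) = Am x (lm x - lm x)"
      by (rule crossing_trajectory_follows_arc[OF cr d' _ _ lip_m M'])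
         (use t ends_m[OF x(1) xr] M in \<open>auto simp: half_arc_def\<close>)
    then show "H x" unfolding H_def using ends_m[OF x(1) xr] by (metis diff_self rangeI)
  qed
  have left_p: "H (x + b)" if u: "H (\<phi>p x + b)" and x: "0 < x" "x < r / 2" for x
  proof -
    obtain t where t: "\<gamma> t = (\<phi>p x + b, 0)" using u unfolding H_def by (metis imageE)
    have xr: "x < r" using x by simp
    note S = shifted_arc[OF x(1) xr, of b]
    have S': "half_arc 1 (\<lambda>p. d *\<^sub>R hshift b Zp p) (lp x) (\<lambda>w. Ap x (lp x - w) + (b, 0))"
      using half_arc_reverse[OF S(1)] by simp
    have "\<gamma> (t + d * lp x) = Ap x (lp x - lp x) + (b, 0)"
      by (rule crossing_trajectory_follows_arc[OF cr d _ _ hshift_lipschitz[of b] S'])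
         (use t S in \<open>auto simp: half_arc_def\<close>)
    then show "H (x + b)" unfolding H_def using S(2) by (metis diff_self rangeI)
  qed
  obtain t0 where t0: "snd (\<gamma> t0) = 0"
  proof (rule periodic_trajectory_meets_line[OF \<gamma>, of Pp Pm])
    fix t
    have "\<bar>fst (\<gamma> t)\<bar> < r" "\<bar>fst (\<gamma> t) - b\<bar> < r" "\<bar>snd (\<gamma> t)\<bar> < r" using small[of t] r_pos by auto
    from box_p[OF this(2,3)] box_m[OF this(1,3)]
    show "Pp * fst (hshift b Zp (\<gamma> t)) > 0" "Pm * fst (Zm (\<gamma> t)) > 0"
      by (simp_all add: hshift_def case_prod_unfold)
  qed (rule that)
  have H0: "H (fst (\<gamma> t0))" unfolding H_def using t0 pairs[of t0] by (metis rangeI)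
  have "\<exists>v>0. H v"
  proof (cases "fst (\<gamma> t0) > 0")
    case False
    then have neg: "fst (\<gamma> t0) < 0" using sides[OF H0] by (cases "fst (\<gamma> t0) = 0") auto
    have "- r / 4 < fst (\<gamma> t0)" using small(1)[of t0] r_pos by auto
    then obtain x where x: "0 < x" "x < r / 2" "\<phi>m x = fst (\<gamma> t0)"
      using reflection_surj(2)[OF _ neg] by blast
    then show ?thesis using left_m[of x] H0 by auto
  qed (use H0 in blast)
  then obtain v0 where v0: "v0 > 0" "H v0" by blast
  have "range \<gamma> = \<gamma> ` {0..T}"
  proof
    show "range \<gamma> \<subseteq> \<gamma> ` {0..T}"
    proof
      fix q assume "q \<in> range \<gamma>"
      then obtain t where t: "q = \<gamma> t" by blast
      obtain k :: int where "t + of_int k * T \<in> {0..<0 + T}" using reduce_mod_period[OF T] by blast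
      moreover have "\<gamma> (t + of_int k * T) = \<gamma> t" by (rule periodic_shift[of \<gamma> T, OF per])
      ultimately show "q \<in> \<gamma> ` {0..T}" using t by (metis add_0 atLeastLessThan_iff atLeastAtMost_iff image_eqI less_imp_le)
    qed
  qed auto
  moreover have "compact (\<gamma> ` {0..T})"
    by (intro compact_continuous_image continuous_on_subset[OF crossing_trajectory_continuous[OF cr]]) auto
  ultimately have cpt: "compact (range \<gamma>)" by simp
  \<comment> \<open>The half line includes 0 to make the set compact; the maximum is positive
    because \<open>v0\<close> belongs to the set.\<close>
  define Kc where "Kc = range \<gamma> \<inter> {p. snd p = 0 \<and> 0 \<le> fst p}"
  have "closed {p :: real \<times> real. snd p = 0 \<and> 0 \<le> fst p}"
    by (intro closed_Collect_conj closed_Collect_eq closed_Collect_le continuous_intros)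
  then have "compact Kc" unfolding Kc_def by (rule compact_Int_closed[OF cpt])
  moreover have "(v0, 0) \<in> Kc" using v0 by (simp add: Kc_def H_def)
  ultimately obtain q where q: "q \<in> Kc" and qmax: "\<And>p. p \<in> Kc \<Longrightarrow> fst p \<le> fst q"
    using continuous_attains_sup[of Kc fst] continuous_on_fst[OF continuous_on_id] by (metis empty_iff)
  define v where "v = fst q"
  have Hv: "H v" using q unfolding Kc_def H_def v_def by (metis (mono_tags, lifting) IntE mem_Collect_eq prod.collapse)
  have vmax: "x \<le> v" if "H x" "x > 0" for x
    using qmax[of "(x, 0)"] that by (simp add: Kc_def H_def v_def)
  have vpos: "v > 0" using vmax[OF v0(2,1)] v0(1) by simp
  have vb: "v - b > 0" using sides[OF Hv] vpos by (simp add: zero_less_mult_iff)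
  have ve: "v < e" "v < r / 8" "v - b < r / 4" using H_bound[OF Hv] e b by auto
  have vr: "v < r" "v - b < r" using ve r_pos by auto
  define u1 where "u1 = \<phi>m v"
  define u2 where "u2 = \<phi>p (v - b) + b"
  have H1: "H u1" and H2: "H u2" using right[OF Hv vpos] by (auto simp: u1_def u2_def)
  have u1: "u1 < 0" "- e < u1" "sm u1 = - sm v"
    using refl_m[OF vpos vr(1)] H_bound[OF H1] by (auto simp: u1_def)
  have u2b: "u2 - b < 0" "sp (u2 - b) = - sp (v - b)"
    using refl_p[OF vb vr(2)] by (auto simp: u2_def)
  have u2: "u2 < 0" "- e < u2" using sides[OF H2] u2b H_bound[OF H2] by (auto simp: zero_less_mult_iff)
  have u1b: "u1 - b < 0" using sides[OF H1] u1 by (auto simp: zero_less_mult_iff)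
  have b1: "- r / 4 < u1 - b" "- r / 4 < u2" "\<bar>u1 - b\<bar> < r" "\<bar>u2 - b\<bar> < r" "\<bar>u1\<bar> < r" "\<bar>u2\<bar> < r"
    using u1 u2 u1b u2b e b r_pos by auto
  \<comment> \<open>Continuing from \<open>u1\<close> along the reversed upper arc reaches a
    crossing \<open>x + b\<close>, which cannot exceed the maximum \<open>v\<close>.\<close>
  have ge: "sp (v - b) + sp (u1 - b) \<ge> 0"
  proof -
    obtain x where x: "0 < x" "x < r / 2" "\<phi>p x = u1 - b" using reflection_surj(1)[OF b1(1) u1b] by blast
    have Hx: "H (x + b)" using left_p[OF _ x(1,2)] x(3) H1 by simp
    then have "x + b > 0" using sides[OF Hx] x by (auto simp: zero_less_mult_iff)
    then have "x + b \<le> v" using vmax Hx by blast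
    then have "sp x \<le> sp (v - b)"
      using sp_less_iff[of "v - b" x] x vb vr by (auto simp: not_less[symmetric])
    moreover have "sp (u1 - b) = - sp x" using refl_p[of x] x r_pos by auto
    ultimately show ?thesis by simp
  qed
  \<comment> \<open>The lower arc that ends at \<open>u2\<close> starts at a crossing
    \<open>x \<le> v\<close>; since the lower reflection reverses order, \<open>u1 \<le> u2\<close>,
    and \<open>u2\<close> is the upper image of \<open>v\<close>.\<close>
  have le: "sp (v - b) + sp (u1 - b) \<le> 0"
  proof -
    obtain x where x: "0 < x" "x < r / 2" "\<phi>m x = u2" using reflection_surj(2)[OF b1(2) u2(1)] by blast
    have Hx: "H x" using left_m[OF _ x(1,2)] x(3) H2 by simp
    then have "x \<le> v" using vmax x by blast
    then have "sm x \<le> sm v" using sm_less_iff[of v x] x vpos vr by (auto simp: not_less[symmetric])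
    moreover have "sm u2 = - sm x" using refl_m[of x] x r_pos by auto
    ultimately have "sm u1 \<le> sm u2" using u1 by simp
    then have "u1 \<le> u2" using sm_less_iff[OF b1(6,5)] by (auto simp: not_less[symmetric])
    then have "sp (u1 - b) \<le> sp (u2 - b)" using sp_less_iff[OF b1(4,3)] by (auto simp: not_less[symmetric])
    then show ?thesis using u2b by simp
  qed
  have fp: "fixed_pair b v u1" using vpos u1 ge le by (simp add: fixed_pair_def)
  obtain t where t: "\<gamma> t = (v, 0)" using Hv unfolding H_def by (metis imageE)
  have u1r: "- r / 8 < u1" using u1 e by simp
  note A = fixed_pair_arcs[OF fp ve(2) u1r br]
  note S = shifted_arc[OF vb vr(2), of b]
  have ee: "(\<lambda>t. Ap (v - b) t + (b, 0)) 0 = (v, 0)" "(\<lambda>t. Ap (v - b) t + (b, 0)) (lp (v - b)) = (u1, 0)"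
    using S(2,3) A(5) by simp_all
  have em: "Am v 0 = (v, 0)" "Am v (lm v) = (u1, 0)" using ends_m[OF vpos vr(1)] by (simp_all add: u1_def)
  have "range \<gamma> = cycle b v"
    unfolding cycle_def
    by (rule range_through_arcs[OF cr per T hshift_lipschitz lip_m d S(1) arc_m[OF vpos vr(1)] ee(1) em(1) ee(2) em(2) t])
  then show ?thesis by (rule that[OF fp ve(1) u1(2)])
qed

end

section \<open>Existence, uniqueness and asymptotics of the bifurcating cycle\<close>

context fold_fold
begin

text \<open>The position is governed by \<open>displacement\<close>. For the period it suffices that
  the shift \<open>b\<close> is negligible against \<open>X b\<close>, so that both arcs start at
  asymptotically the same distance from their contacts.\<close>

lemma unfolding_cycle_asymptotics:
  assumes \<mu>: "\<mu> \<in> {-1, 1}"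
    and \<phi>: "\<And>x. 0 < x \<Longrightarrow> x < r \<Longrightarrow> \<mu> * (\<phi>p x - \<phi>m x) < 0"
    and lim_p: "((\<lambda>x. lp x / x) \<longlongrightarrow> cp) (at_right 0)" and cp: "cp > 0"
    and lim_m: "((\<lambda>x. lm x / x) \<longlongrightarrow> cm) (at_right 0)" and cm: "cm > 0"
  shows "\<exists>C X T. unfolding_cycle Zp Zm \<mu> C T \<and>
           (\<forall>\<^sub>F b in unfolding_filter \<mu>. cycle_position (C b) (X b)) \<and>
           (\<exists>\<xi>\<^sub>0 T\<^sub>0 :: real. \<exists>n :: nat. \<xi>\<^sub>0 > 0 \<and> T\<^sub>0 > 0 \<and> n \<ge> 1 \<and>
              X \<sim>[unfolding_filter \<mu>] (\<lambda>b. \<xi>\<^sub>0 * \<bar>b\<bar> powr (1 / (2 * real n))) \<and>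
              T \<sim>[unfolding_filter \<mu>] (\<lambda>b. T\<^sub>0 * \<bar>b\<bar> powr (1 / (2 * real n))))"
proof -
  let ?F = "unfolding_filter \<mu>"
  have germs: "real_germ \<sigma>p (r / 2)" "real_germ \<sigma>m (r / 2)"
    using real_germ_mono[OF germ_p] real_germ_mono[OF germ_m] r_pos by auto
  \<comment> \<open>Since \<open>sp v = - sp (\<phi>p v)\<close>, the sign of
    \<open>sp v + sp u\<close> compares \<open>u\<close>, the lower image of \<open>v\<close>, with
    its upper image.\<close>
  have nz: "\<mu> * (sp v + sp u) > 0" if v: "0 < v" "v < r / 2" and u: "- (r / 2) < u" "u < 0" "sm u = - sm v" for v u
  proof -
    have vr: "v < r" using v r_pos by simp
    have "\<phi>m v = u" by (rule reflection_eqI(2)) (use v u r_pos in auto)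
    moreover have "\<bar>\<phi>p v\<bar> < r" "\<bar>u\<bar> < r" using refl_p[OF v(1) vr] v u by auto
    ultimately show ?thesis
      using sp_less_iff[of "\<phi>p v" u] sp_less_iff[of u "\<phi>p v"] refl_p[OF v(1) vr] \<phi>[OF v(1) vr] \<mu> by auto
  qed
  obtain \<epsilon> n \<xi> where \<epsilon>: "\<epsilon> > 0" and n: "n \<ge> (1::nat)" and \<xi>: "\<xi> > 0" and
    ex: "\<And>e. e > 0 \<Longrightarrow> \<exists>\<eta>>0. \<forall>b. 0 < \<mu> * b \<and> \<mu> * b < \<eta> \<longrightarrow> (\<exists>v u. 0 < v \<and> v < e \<and> - e < u \<and> u < 0 \<and>
       sm u = - sm v \<and> sp (v - b) + sp (u - b) = 0)" and
    uniq: "\<And>b v u v' u'. \<bar>b\<bar> < \<epsilon> \<Longrightarrow> 0 < v \<Longrightarrow> v < \<epsilon> \<Longrightarrow> - \<epsilon> < u \<Longrightarrow> u < 0 \<Longrightarrow> sm u = - sm v \<Longrightarrow>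
       sp (v - b) + sp (u - b) = 0 \<Longrightarrow> 0 < v' \<Longrightarrow> v' < \<epsilon> \<Longrightarrow> - \<epsilon> < u' \<Longrightarrow> u' < 0 \<Longrightarrow>
       sm u' = - sm v' \<Longrightarrow> sp (v' - b) + sp (u' - b) = 0 \<Longrightarrow> v = v'" and
    asym: "\<And>(F::real filter) v u. ((\<lambda>b. b) \<longlongrightarrow> 0) F \<Longrightarrow> (v \<longlongrightarrow> 0) F \<Longrightarrow> (u \<longlongrightarrow> 0) F \<Longrightarrow>
       (\<forall>\<^sub>F b in F. 0 < \<mu> * b \<and> 0 < v b \<and> u b < 0 \<and> sm (u b) = - sm (v b) \<and>
         sp (v b - b) + sp (u b - b) = 0) \<Longrightarrow>
       ((\<lambda>b. v b ^ (2 * n) / \<bar>b\<bar>) \<longlongrightarrow> \<xi>) F"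
    by (rule displacement[OF germs \<mu> nz]) (assumption | rule that)+
  define e where "e = min \<epsilon> (r / 8)"
  have e: "e > 0" "e \<le> \<epsilon>" "e \<le> r / 8" using \<epsilon> r_pos by (auto simp: e_def)
  have unique: "v = v'" if "fixed_pair b v u" "v < e" "- e < u" "fixed_pair b v' u'" "v' < e" "- e < u'" "\<bar>b\<bar> < e" for b v u v' u'
    using uniq[of b v u v' u'] that e unfolding fixed_pair_def by linarith
  have ev_b: "\<forall>\<^sub>F b in ?F. 0 < \<mu> * b \<and> \<mu> * b < \<delta> \<and> \<bar>b\<bar> < \<delta>" if \<delta>: "\<delta> > 0" for \<delta>
    unfolding eventually_at
  proof (rule exI[of _ \<delta>], intro conjI ballI impI)
    fix b assume b: "b \<in> {b. \<mu> * b > 0}" "b \<noteq> 0 \<and> dist b 0 < \<delta>"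
    then show "0 < \<mu> * b" "\<bar>b\<bar> < \<delta>" by auto
    then show "\<mu> * b < \<delta>" using \<mu> by auto
  qed (rule \<delta>)
  have ev_pair: "\<forall>\<^sub>F b in ?F. \<exists>v u. fixed_pair b v u \<and> v < \<delta> \<and> - \<delta> < u" if \<delta>: "\<delta> > 0" for \<delta>
  proof -
    obtain \<eta> where "\<eta> > 0" and \<eta>: "\<forall>b. 0 < \<mu> * b \<and> \<mu> * b < \<eta> \<longrightarrow> (\<exists>v u. 0 < v \<and> v < \<delta> \<and> - \<delta> < u \<and> u < 0 \<and>
       sm u = - sm v \<and> sp (v - b) + sp (u - b) = 0)" using ex[OF \<delta>] by blast
    show ?thesis using ev_b[OF \<open>\<eta> > 0\<close>]
    proof eventually_elim
      case (elim b)
      then show ?case using \<eta> unfolding fixed_pair_def by blast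
    qed
  qed
  \<comment> \<open>The choice is harmless: near 0 the abscissa is determined by
    \<open>unique\<close>, and values of \<open>b\<close> without a pair do not occur eventually in
    the filter.\<close>
  define X where "X b = (SOME v. \<exists>u. fixed_pair b v u \<and> v < e \<and> - e < u)" for b
  define U where "U b = (SOME u. fixed_pair b (X b) u \<and> X b < e \<and> - e < u)" for b
  have XU: "fixed_pair b (X b) (U b) \<and> X b < e \<and> - e < U b" if "\<exists>v u. fixed_pair b v u \<and> v < e \<and> - e < u" for b
  proof -
    have "\<exists>u. fixed_pair b (X b) u \<and> X b < e \<and> - e < u" unfolding X_def by (rule someI_ex[OF that])
    then show ?thesis unfolding U_def by (rule someI_ex)
  qed
  have ev: "\<forall>\<^sub>F b in ?F. fixed_pair b (X b) (U b) \<and> X b < e \<and> - e < U b \<and> \<bar>b\<bar> < e \<and> 0 < \<mu> * b"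
    using ev_pair[OF e(1)] ev_b[OF e(1)] by eventually_elim (use XU in blast)
  have b_lim: "((\<lambda>b. b) \<longlongrightarrow> 0) ?F" by (rule tendsto_ident_at)
  have ev_pos: "\<forall>\<^sub>F b in ?F. X b > 0" using ev by eventually_elim (simp add: fixed_pair_def)
  \<comment> \<open>Pairs exist in every smaller neighbourhood, and by uniqueness at the fixed scale
    \<open>e\<close> they have the chosen abscissa.\<close>
  have X_lim: "(X \<longlongrightarrow> 0) ?F"
  proof (rule tendstoI)
    fix \<delta> :: real assume \<delta>: "\<delta> > 0"
    then have "min \<delta> e > 0" using e by simp
    from ev_pair[OF this] ev show "\<forall>\<^sub>F b in ?F. dist (X b) 0 < \<delta>"
    proof eventually_elim
      case (elim b)
      then obtain v u where vu: "fixed_pair b v u" "v < min \<delta> e" "- min \<delta> e < u" by blast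
      then have "X b = v" using unique[of b "X b" "U b" v u] elim by auto
      then show ?case using vu elim by (simp add: fixed_pair_def)
    qed
  qed
  \<comment> \<open>\<open>5 / 3\<close> is the quotient of the germ constants \<open>5 / 4\<close>
    and \<open>3 / 4\<close>.\<close>
  have U_lim: "(U \<longlongrightarrow> 0) ?F"
  proof (rule Lim_null_comparison)
    show "\<forall>\<^sub>F b in ?F. norm (U b) \<le> 5 / 3 * X b" using ev
    proof eventually_elim
      case (elim b)
      then have XU: "0 < X b" "U b < 0" "sm (U b) = - sm (X b)" by (auto simp: fixed_pair_def)
      have "\<bar>U b\<bar> < r" "\<bar>X b\<bar> < r" using elim XU e r_pos by auto
      from real_germ_bounds(2)[OF germ_m this(1)] real_germ_bounds(1)[OF germ_m this(2)] XU
      show ?case by simp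
    qed
    show "((\<lambda>b. 5 / 3 * X b) \<longlongrightarrow> 0) ?F" using tendsto_mult_left[OF X_lim, of "5/3"] by simp
  qed
  have pw: "((\<lambda>b. X b ^ (2 * n) / \<bar>b\<bar>) \<longlongrightarrow> \<xi>) ?F"
    by (rule asym[OF b_lim X_lim U_lim]) (use ev in \<open>auto simp: fixed_pair_def elim!: eventually_mono\<close>)
  define C where "C b = cycle b (X b)" for b
  define T where "T b = period b (X b)" for b
  have ev_in: "\<forall>\<^sub>F b in ?F. \<forall>q\<in>C b. \<bar>fst q\<bar> < \<delta> \<and> \<bar>snd q\<bar> < \<delta>" if \<delta>: "\<delta> > 0" for \<delta>
  proof -
    have "((\<lambda>b. 2 * X b + 3 * \<bar>b\<bar>) \<longlongrightarrow> 2 * 0 + 3 * \<bar>0\<bar>) ?F" by (intro tendsto_intros X_lim b_lim)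
    then have 1: "\<forall>\<^sub>F b in ?F. 2 * X b + 3 * \<bar>b\<bar> < \<delta>" using order_tendstoD(2)[of _ 0 ?F \<delta>] \<delta> by simp
    have "((\<lambda>b. K * (X b + \<bar>b\<bar>)) \<longlongrightarrow> K * (0 + \<bar>0\<bar>)) ?F" by (intro tendsto_intros X_lim b_lim)
    then have 2: "\<forall>\<^sub>F b in ?F. K * (X b + \<bar>b\<bar>) < \<delta>" using order_tendstoD(2)[of _ 0 ?F \<delta>] \<delta> by simp
    show ?thesis using 1 2 ev
    proof eventually_elim
      case (elim b)
      show ?case
      proof
        fix q assume "q \<in> C b"
        then have "\<bar>fst q\<bar> \<le> 2 * X b + 3 * \<bar>b\<bar> \<and> \<bar>snd q\<bar> \<le> K * (X b + \<bar>b\<bar>)"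
          unfolding C_def by (intro cycle_bounds[of b "X b" "U b"]) (use elim e in auto)
        then show "\<bar>fst q\<bar> < \<delta> \<and> \<bar>snd q\<bar> < \<delta>" using elim by linarith
      qed
    qed
  qed
  \<comment> \<open>One neighbourhood serves both for the isolation of the cycle and for its
    uniqueness, because \<open>periodic_trajectory_fixed_pair\<close> covers periodic trajectories
    with any number of arcs.\<close>
  define V where "V = {p :: real \<times> real. \<bar>fst p\<bar> < e \<and> \<bar>snd p\<bar> < e}"
  have oV: "open V" unfolding V_def by (intro open_Collect_conj open_Collect_less continuous_intros)
  have V0: "(0, 0) \<in> V" using e by (simp add: V_def)
  have only: "range \<gamma> = C b" if \<gamma>: "periodic_trajectory (hshift b Zp) Zm \<gamma> T'" "range \<gamma> \<subseteq> V"
    and b: "fixed_pair b (X b) (U b) \<and> X b < e \<and> - e < U b \<and> \<bar>b\<bar> < e \<and> 0 < \<mu> * b" for \<gamma> T' b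
  proof -
    have bb: "\<bar>b\<bar> < e" using b by simp
    have box: "\<bar>fst (\<gamma> t)\<bar> < e \<and> \<bar>snd (\<gamma> t)\<bar> < e" for t using \<gamma>(2) by (auto simp: V_def)
    obtain v u where vu: "fixed_pair b v u" "v < e" "- e < u" "range \<gamma> = cycle b v"
      by (rule periodic_trajectory_fixed_pair[OF \<gamma>(1) e(3) bb box]) (rule that)
    have "v = X b" using unique[of b v u "X b" "U b"] vu b by blast
    then show ?thesis using vu(4) by (simp add: C_def)
  qed
  have limit: "crossing_limit_cycle (hshift b Zp) Zm (C b) (T b)"
    if b: "fixed_pair b (X b) (U b) \<and> X b < e \<and> - e < U b \<and> \<bar>b\<bar> < e \<and> 0 < \<mu> * b" and CV: "C b \<subseteq> V" for b
  proof -
    obtain \<gamma> a m where \<gamma>: "periodic_trajectory (hshift b Zp) Zm \<gamma> (T b)" "range \<gamma> = C b"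
      "a < m" "m < a + T b" "\<And>t. t \<in> {a..m} \<Longrightarrow> snd (\<gamma> t) \<ge> 0" "\<And>t. t \<in> {m..a + T b} \<Longrightarrow> snd (\<gamma> t) \<le> 0"
      unfolding T_def C_def
      by (rule cycle_exists[of b "X b" "U b"]) (use b e in \<open>auto intro: that\<close>)
    have "\<exists>\<gamma>. periodic_trajectory (hshift b Zp) Zm \<gamma> (T b) \<and> C b = range \<gamma> \<and>
        (\<exists>a m. a < m \<and> m < a + T b \<and> (\<forall>t\<in>{a..m}. snd (\<gamma> t) \<ge> 0) \<and> (\<forall>t\<in>{m..a + T b}. snd (\<gamma> t) \<le> 0))"
      by (rule exI[of _ \<gamma>]) (use \<gamma> in blast)
    moreover have "\<exists>U. open U \<and> C b \<subseteq> U \<and>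
        (\<forall>\<gamma>' T'. periodic_trajectory (hshift b Zp) Zm \<gamma>' T' \<and> range \<gamma>' \<subseteq> U \<longrightarrow> range \<gamma>' = C b)"
    proof (rule exI[of _ V], intro conjI allI impI)
      fix \<gamma>' T' assume "periodic_trajectory (hshift b Zp) Zm \<gamma>' T' \<and> range \<gamma>' \<subseteq> V"
      then show "range \<gamma>' = C b" using only[OF _ _ b, of \<gamma>' T'] by simp
    qed (use oV CV in auto)
    ultimately show ?thesis unfolding crossing_limit_cycle_def by blast
  qed
  have "unfolding_cycle Zp Zm \<mu> C T"
    unfolding unfolding_cycle_def
  proof (intro conjI allI impI)
    have "\<forall>\<^sub>F b in ?F. crossing_limit_cycle (hshift b Zp) Zm (C b) (T b) \<and> C b \<subseteq> V \<and>
           (\<forall>C' T'. crossing_limit_cycle (hshift b Zp) Zm C' T' \<and> C' \<subseteq> V \<longrightarrow> C' = C b)"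
      using ev ev_in[OF e(1)]
    proof eventually_elim
      case (elim b)
      have CV: "C b \<subseteq> V" using elim(2) by (auto simp: V_def)
      have "C' = C b" if C': "crossing_limit_cycle (hshift b Zp) Zm C' T'" "C' \<subseteq> V" for C' T'
      proof -
        obtain \<gamma> where \<gamma>: "periodic_trajectory (hshift b Zp) Zm \<gamma> T'" "C' = range \<gamma>"
          using C'(1) unfolding crossing_limit_cycle_def by blast
        have "range \<gamma> \<subseteq> V" using \<gamma>(2) C'(2) by simp
        from only[OF \<gamma>(1) this elim(1)] show ?thesis using \<gamma>(2) by simp
      qed
      then show ?case using limit[OF elim(1) CV] CV by blast
    qed
    then show "\<exists>V. open V \<and> (0, 0) \<in> V \<and>
        (\<forall>\<^sub>F b in ?F. crossing_limit_cycle (hshift b Zp) Zm (C b) (T b) \<and> C b \<subseteq> V \<and>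
           (\<forall>C' T'. crossing_limit_cycle (hshift b Zp) Zm C' T' \<and> C' \<subseteq> V \<longrightarrow> C' = C b))"
      using oV V0 by blast
  next
    fix W :: "(real \<times> real) set" assume W: "open W \<and> (0, 0) \<in> W"
    then obtain \<delta> where \<delta>: "\<delta> > 0" "ball (0, 0) \<delta> \<subseteq> W" using open_contains_ball by blast
    then have "\<delta> / 2 > 0" by simp
    from ev_in[OF this] show "\<forall>\<^sub>F b in ?F. C b \<subseteq> W"
    proof eventually_elim
      case (elim b)
      show ?case
      proof
        fix q assume "q \<in> C b"
        then have "\<bar>fst q\<bar> < \<delta> / 2" "\<bar>snd q\<bar> < \<delta> / 2" using elim by auto
        moreover have "dist (0, 0) q \<le> \<bar>fst q\<bar> + \<bar>snd q\<bar>"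
          using sqrt_sum_squares_le_sum_abs[of "fst q" "snd q"] by (simp add: dist_prod_def)
        ultimately have "dist (0, 0) q < \<delta>" by linarith
        then show "q \<in> W" using \<delta>(2) by auto
      qed
    qed
  qed
  moreover have "\<forall>\<^sub>F b in ?F. cycle_position (C b) (X b)"
    using ev
  proof eventually_elim
    case (elim b)
    then show ?case unfolding C_def by (intro cycle_crossings[of b "X b" "U b"]) (use e in auto)
  qed
  moreover have "\<exists>\<xi>\<^sub>0 T\<^sub>0 :: real. \<exists>n :: nat. \<xi>\<^sub>0 > 0 \<and> T\<^sub>0 > 0 \<and> n \<ge> 1 \<and>
              X \<sim>[?F] (\<lambda>b. \<xi>\<^sub>0 * \<bar>b\<bar> powr (1 / (2 * real n))) \<and>
              T \<sim>[?F] (\<lambda>b. T\<^sub>0 * \<bar>b\<bar> powr (1 / (2 * real n)))"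
  proof -
    define \<xi>0 where "\<xi>0 = \<xi> powr (1 / (2 * real n))"
    have \<xi>0: "\<xi>0 > 0" using \<xi> by (simp add: \<xi>0_def)
    have "((\<lambda>b. (X b ^ (2 * n) / \<bar>b\<bar>) powr (1 / (2 * real n))) \<longlongrightarrow> \<xi>0) ?F"
      unfolding \<xi>0_def by (intro tendsto_powr pw tendsto_const) (use \<xi> in auto)
    then have X0: "((\<lambda>b. X b / \<bar>b\<bar> powr (1 / (2 * real n))) \<longlongrightarrow> \<xi>0) ?F"
    proof (rule Lim_transform_eventually)
      show "\<forall>\<^sub>F b in ?F. (X b ^ (2 * n) / \<bar>b\<bar>) powr (1 / (2 * real n)) = X b / \<bar>b\<bar> powr (1 / (2 * real n))"
        using ev_pos
      proof eventually_elim
        case (elim b)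
        have "X b ^ (2 * n) = X b powr (2 * real n)" using elim by (simp flip: powr_realpow)
        then have "(X b ^ (2 * n)) powr (1 / (2 * real n)) = X b"
          using elim n by (simp add: powr_powr)
        then show ?case using elim by (simp add: powr_divide)
      qed
    qed
    have Xr: "filterlim X (at_right 0) ?F"
      using X_lim ev_pos by (auto simp: filterlim_at elim!: eventually_mono)
    \<comment> \<open>\<open>b\<close> is of order \<open>X b ^ (2 * n)\<close>, and
      \<open>2 * n > 1\<close>.\<close>
    have bX: "((\<lambda>b. b / X b) \<longlongrightarrow> 0) ?F"
    proof (rule Lim_null_comparison)
      show "\<forall>\<^sub>F b in ?F. norm (b / X b) \<le> X b ^ (2 * n - 1) / (X b ^ (2 * n) / \<bar>b\<bar>)"
        using ev_pos
      proof eventually_elim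
        case (elim b)
        have "X b ^ (2 * n) = X b * X b ^ (2 * n - 1)" using n by (cases n) auto
        then show ?case using elim by (simp add: field_simps)
      qed
      have "((\<lambda>b. X b ^ (2 * n - 1) / (X b ^ (2 * n) / \<bar>b\<bar>)) \<longlongrightarrow> 0 ^ (2 * n - 1) / \<xi>) ?F"
        using \<xi> by (intro tendsto_intros X_lim pw) auto
      then show "((\<lambda>b. X b ^ (2 * n - 1) / (X b ^ (2 * n) / \<bar>b\<bar>)) \<longlongrightarrow> 0) ?F"
        using n by (simp add: power_0_left)
    qed
    have "((\<lambda>b. X b - b) \<longlongrightarrow> 0 - 0) ?F" by (intro tendsto_intros X_lim b_lim)
    then have Xb_lim: "((\<lambda>b. X b - b) \<longlongrightarrow> 0) ?F" by simp
    have ev_Xb: "\<forall>\<^sub>F b in ?F. X b - b > 0" using ev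
    proof eventually_elim
      case (elim b)
      then show ?case by (intro fixed_pair_arcs(1)[of b "X b" "U b"]) (use e in auto)
    qed
    have Xbr: "filterlim (\<lambda>b. X b - b) (at_right 0) ?F"
      using Xb_lim ev_Xb by (auto simp: filterlim_at elim!: eventually_mono)
    have "((\<lambda>b. lp (X b - b) / (X b - b) * (1 - b / X b) + lm (X b) / X b) \<longlongrightarrow> cp * (1 - 0) + cm) ?F"
      by (intro tendsto_intros bX filterlim_compose[OF lim_p Xbr] filterlim_compose[OF lim_m Xr])
    then have TX: "((\<lambda>b. T b / X b) \<longlongrightarrow> cp * (1 - 0) + cm) ?F"
    proof (rule Lim_transform_eventually)
      show "\<forall>\<^sub>F b in ?F. lp (X b - b) / (X b - b) * (1 - b / X b) + lm (X b) / X b = T b / X b"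
        using ev_pos ev_Xb
      proof eventually_elim
        case (elim b)
        have "1 - b / X b = (X b - b) / X b" using elim by (simp add: diff_divide_distrib)
        then show ?case using elim by (simp add: T_def period_def add_divide_distrib)
      qed
    qed
    define T0 where "T0 = (cp + cm) * \<xi>0"
    have T0: "T0 > 0" using cp cm \<xi>0 by (simp add: T0_def)
    have "((\<lambda>b. (X b / \<bar>b\<bar> powr (1 / (2 * real n))) / \<xi>0) \<longlongrightarrow> \<xi>0 / \<xi>0) ?F"
      using \<xi>0 by (intro tendsto_intros X0) auto
    then have X_equiv: "X \<sim>[?F] (\<lambda>b. \<xi>0 * \<bar>b\<bar> powr (1 / (2 * real n)))"
      using \<xi>0 by (intro asymp_equivI') (simp add: divide_divide_eq_left mult.commute)
    have lim: "((\<lambda>b. (T b / X b) * (X b / \<bar>b\<bar> powr (1 / (2 * real n))) / T0) \<longlongrightarrow> (cp * (1 - 0) + cm) * \<xi>0 / T0) ?F"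
      using T0 by (intro tendsto_intros X0 TX) auto
    have "(cp * (1 - 0) + cm) * \<xi>0 / T0 = 1" using cp cm \<xi>0 by (simp add: T0_def)
    from lim[unfolded this] have "((\<lambda>b. T b / (T0 * \<bar>b\<bar> powr (1 / (2 * real n)))) \<longlongrightarrow> 1) ?F"
    proof (rule Lim_transform_eventually)
      show "\<forall>\<^sub>F b in ?F. (T b / X b) * (X b / \<bar>b\<bar> powr (1 / (2 * real n))) / T0 = T b / (T0 * \<bar>b\<bar> powr (1 / (2 * real n)))"
        using ev_pos by eventually_elim (simp add: divide_divide_eq_left mult.commute)
    qed
    then have "T \<sim>[?F] (\<lambda>b. T0 * \<bar>b\<bar> powr (1 / (2 * real n)))" by (rule asymp_equivI')
    with X_equiv show ?thesis using \<xi>0 T0 n by blast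
  qed
  ultimately show ?thesis by blast
qed

end

section \<open>From the hypotheses on the flow to the local picture\<close>

lemma invisible_contact_origin:
  assumes F: "analytic_vfield F" and c: "invisible_contact s k F" and k: "k \<ge> 1"
  shows "snd (F (0, 0)) = 0"
proof -
  obtain c where "fst (F (0, 0)) \<noteq> 0" "(\<lambda>x. snd (F (x, 0)) - c * x ^ (2 * k - 1)) \<in> O[at 0](\<lambda>x. x ^ (2 * k))"
    using c unfolding invisible_contact_def by blast
  from slope_asymptotics(2)[OF F this(1) k this(2)] this(1) show ?thesis by (simp add: slope_def)
qed

text \<open>Carries the sign from the point \<open>x\<^sub>1\<close>, where \<open>\<mu>\<close> is
  evaluated, to the points near 0, where the germs live.\<close>

lemma sgn_constant:
  fixes f :: "real \<Rightarrow> real"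
  assumes f: "continuous_on {a<..<b} f" and nz: "\<And>x. x \<in> {a<..<b} \<Longrightarrow> f x \<noteq> 0"
    and xy: "x \<in> {a<..<b}" "y \<in> {a<..<b}"
  shows "sgn (f x) = sgn (f y)"
proof (rule ccontr)
  assume ne: "sgn (f x) \<noteq> sgn (f y)"
  have "connected (f ` {a<..<b})" by (intro connected_continuous_image f connected_Ioo)
  then have *: "{f u..f v} \<subseteq> f ` {a<..<b}" if "u \<in> {a<..<b}" "v \<in> {a<..<b}" for u v
    using connected_contains_Icc that by blast
  have "0 \<in> {f x..f y} \<or> 0 \<in> {f y..f x}" using ne nz[OF xy(1)] nz[OF xy(2)] by (auto simp: sgn_if split: if_splits)
  then have "0 \<in> f ` {a<..<b}" using *[OF xy] *[OF xy(2,1)] by blast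
  then show False using nz by auto
qed

theorem proposition2:
  fixes Zp Zm :: vfield
    and x\<^sub>0 x\<^sub>1 \<mu> :: real
    and \<tau>p \<tau>m :: "real \<Rightarrow> real"
    and kp km :: nat
  assumes "analytic_vfield Zp" and "analytic_vfield Zm"
    and "hypothesis_H1 Zp Zm x\<^sub>0 \<tau>p \<tau>m"
    and "invisible_fold_fold kp km Zp Zm"
    and "x\<^sub>1 \<in> {0<..<x\<^sub>0}" and "\<mu> = mu_sign Zp Zm \<tau>p \<tau>m x\<^sub>1"
  shows "\<exists>C X T. unfolding_cycle Zp Zm \<mu> C T \<and>
           (\<forall>\<^sub>F b in unfolding_filter \<mu>. cycle_position (C b) (X b)) \<and>
           (\<exists>\<xi>\<^sub>0 T\<^sub>0 :: real. \<exists>n :: nat. \<xi>\<^sub>0 > 0 \<and> T\<^sub>0 > 0 \<and> n \<ge> 1 \<and>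
              X \<sim>[unfolding_filter \<mu>] (\<lambda>b. \<xi>\<^sub>0 * \<bar>b\<bar> powr (1 / (2 * real n))) \<and>
              T \<sim>[unfolding_filter \<mu>] (\<lambda>b. T\<^sub>0 * \<bar>b\<bar> powr (1 / (2 * real n))))"
proof -
  define \<phi>p where "\<phi>p = half_return_map Zp \<tau>p"
  define \<phi>m where "\<phi>m = half_return_map Zm \<tau>m"
  have x0: "x\<^sub>0 > 0" and \<tau>c: "continuous_on {0<..<x\<^sub>0} \<tau>p" "continuous_on {0<..<x\<^sub>0} \<tau>m"
    and half: "\<And>x. x \<in> {0<..<x\<^sub>0} \<Longrightarrow> half_return_time 1 Zp x (\<tau>p x)" "\<And>x. x \<in> {0<..<x\<^sub>0} \<Longrightarrow> half_return_time (-1) Zm x (\<tau>m x)"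
    and \<tau>\<tau>: "\<And>x. x \<in> {0<..<x\<^sub>0} \<Longrightarrow> \<tau>p x * \<tau>m x < 0"
    and \<phi>ne: "\<And>x. x \<in> {0<..<x\<^sub>0} \<Longrightarrow> \<phi>p x \<noteq> \<phi>m x"
    using assms(3) by (auto simp: hypothesis_H1_def \<phi>p_def \<phi>m_def)
  have cp: "invisible_contact 1 kp Zp" "kp \<ge> 1" and cm: "invisible_contact (-1) km Zm" "km \<ge> 1"
    using assms(4) by (auto simp: invisible_fold_fold_def)
  have lip: "locally_lipschitz Zp" "locally_lipschitz Zm"
    using assms(1,2) by (auto intro: analytic_vfield_lipschitz)
  define Pp where "Pp = fst (Zp (0, 0))"
  define Pm where "Pm = fst (Zm (0, 0))"
  have P0: "Pp \<noteq> 0" "Pm \<noteq> 0" using cp cm by (auto simp: invisible_contact_def Pp_def Pm_def)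
  have half': "half_return_time 1 Zp x (\<tau>p x) \<and> \<tau>p x \<noteq> 0" "half_return_time (-1) Zm x (\<tau>m x) \<and> \<tau>m x \<noteq> 0"
    if "x \<in> {0<..<x\<^sub>0}" for x using half[OF that] \<tau>\<tau>[OF that] by auto
  have s: "(1::real) \<in> {-1, 1}" "(-1::real) \<in> {-1, 1}" by auto
  obtain rp \<sigma>p Kp Ap where p: "real_germ \<sigma>p rp" "rp \<le> x\<^sub>0" "Kp \<ge> 0"
    "\<And>x. 0 < \<bar>x\<bar> \<Longrightarrow> \<bar>x\<bar> < rp \<Longrightarrow> 1 * Pp * (snd (Zp (x, 0)) * x) < 0"
    "\<And>x y. \<bar>x\<bar> < rp \<Longrightarrow> \<bar>y\<bar> < rp \<Longrightarrow> Pp * fst (Zp (x, y)) > 0"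
    "\<And>x. 0 < x \<Longrightarrow> x < rp \<Longrightarrow> sgn (\<tau>p x) = - sgn Pp"
    "\<And>x. 0 < x \<Longrightarrow> x < rp \<Longrightarrow> half_arc 1 (\<lambda>p. - sgn Pp *\<^sub>R Zp p) \<bar>\<tau>p x\<bar> (Ap x)"
    "\<And>x. 0 < x \<Longrightarrow> x < rp \<Longrightarrow> Ap x 0 = (x, 0) \<and> Ap x \<bar>\<tau>p x\<bar> = (\<phi>p x, 0)"
    "\<And>x. 0 < x \<Longrightarrow> x < rp \<Longrightarrow> \<phi>p x < 0 \<and> - (2 * x) \<le> \<phi>p x \<and> on_real \<sigma>p (\<phi>p x) = - on_real \<sigma>p x"
    "\<And>x u. 0 < x \<Longrightarrow> x < rp \<Longrightarrow> u \<in> {0..\<bar>\<tau>p x\<bar>} \<Longrightarrow> \<bar>fst (Ap x u)\<bar> \<le> 2 * x \<and> \<bar>snd (Ap x u)\<bar> \<le> Kp * x"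
    "((\<lambda>x. \<bar>\<tau>p x\<bar> / x) \<longlongrightarrow> 2 / \<bar>Pp\<bar>) (at_right 0)"
    by (rule half_return_germ[OF assms(1) cp s(1) x0 half'(1), folded Pp_def \<phi>p_def]) (assumption | rule that)+
  obtain rm \<sigma>m Km Am where m: "real_germ \<sigma>m rm" "rm \<le> x\<^sub>0" "Km \<ge> 0"
    "\<And>x. 0 < \<bar>x\<bar> \<Longrightarrow> \<bar>x\<bar> < rm \<Longrightarrow> -1 * Pm * (snd (Zm (x, 0)) * x) < 0"
    "\<And>x y. \<bar>x\<bar> < rm \<Longrightarrow> \<bar>y\<bar> < rm \<Longrightarrow> Pm * fst (Zm (x, y)) > 0"
    "\<And>x. 0 < x \<Longrightarrow> x < rm \<Longrightarrow> sgn (\<tau>m x) = - sgn Pm"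
    "\<And>x. 0 < x \<Longrightarrow> x < rm \<Longrightarrow> half_arc (-1) (\<lambda>p. - sgn Pm *\<^sub>R Zm p) \<bar>\<tau>m x\<bar> (Am x)"
    "\<And>x. 0 < x \<Longrightarrow> x < rm \<Longrightarrow> Am x 0 = (x, 0) \<and> Am x \<bar>\<tau>m x\<bar> = (\<phi>m x, 0)"
    "\<And>x. 0 < x \<Longrightarrow> x < rm \<Longrightarrow> \<phi>m x < 0 \<and> - (2 * x) \<le> \<phi>m x \<and> on_real \<sigma>m (\<phi>m x) = - on_real \<sigma>m x"
    "\<And>x u. 0 < x \<Longrightarrow> x < rm \<Longrightarrow> u \<in> {0..\<bar>\<tau>m x\<bar>} \<Longrightarrow> \<bar>fst (Am x u)\<bar> \<le> 2 * x \<and> \<bar>snd (Am x u)\<bar> \<le> Km * x"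
    "((\<lambda>x. \<bar>\<tau>m x\<bar> / x) \<longlongrightarrow> 2 / \<bar>Pm\<bar>) (at_right 0)"
    by (rule half_return_germ[OF assms(2) cm s(2) x0 half'(2), folded Pm_def \<phi>m_def]) (assumption | rule that)+
  define r where "r = min rp rm"
  define d where "d = sgn Pp"
  have r: "r > 0" "r \<le> rp" "r \<le> rm" "r \<le> x\<^sub>0" using p(1,2) m(1) by (auto simp: r_def real_germ_def)
  \<comment> \<open>The two return times have opposite signs, and each is opposite to the first
    component of its field at the origin; so these components are opposite to each other, and a
    single \<open>d\<close> serves both fields.\<close>
  have "sgn (\<tau>p (r / 2)) * sgn (\<tau>m (r / 2)) < 0"
    using \<tau>\<tau>[of "r / 2"] r by (simp flip: sgn_mult)
  then have "(- sgn Pp) * (- sgn Pm) < 0" using p(6)[of "r / 2"] m(6)[of "r / 2"] r by simp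
  then have dm: "d = - sgn Pm" unfolding d_def by (auto simp: sgn_if split: if_splits)
  define K where "K = max Kp Km"
  interpret fold_fold Zp Zm "\<lambda>x. \<bar>\<tau>p x\<bar>" "\<lambda>x. \<bar>\<tau>m x\<bar>" \<phi>p \<phi>m \<sigma>p \<sigma>m Ap Am Pp Pm r K d
  proof
    show "d \<in> {-1, 1}" using P0 by (simp add: d_def sgn_if)
    show "d * Pp > 0" using P0 by (simp add: d_def sgn_if)
    show "d * Pm < 0" using P0 by (simp add: dm sgn_if)
    show "snd (Zp (0, 0)) = 0" "snd (Zm (0, 0)) = 0"
      using invisible_contact_origin[OF assms(1) cp] invisible_contact_origin[OF assms(2) cm] .
    show "real_germ \<sigma>p r" "real_germ \<sigma>m r" using real_germ_mono[OF p(1)] real_germ_mono[OF m(1)] r by auto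
    show "K \<ge> 0" using p(3) by (simp add: K_def)
    fix x :: real
    show "Pp * (snd (Zp (x, 0)) * x) < 0" if "0 < \<bar>x\<bar>" "\<bar>x\<bar> < r" using p(4)[of x] that r by simp
    show "0 < Pm * (snd (Zm (x, 0)) * x)" if "0 < \<bar>x\<bar>" "\<bar>x\<bar> < r" using m(4)[of x] that r by simp
    show "0 < Pp * fst (Zp (x, y))" "0 < Pm * fst (Zm (x, y))" if "\<bar>x\<bar> < r" "\<bar>y\<bar> < r" for y
      using p(5)[of x y] m(5)[of x y] that r by auto
    assume x: "0 < x" "x < r"
    then have xp: "0 < x" "x < rp" and xm: "0 < x" "x < rm" using r by auto
    show "half_arc 1 (\<lambda>p. - d *\<^sub>R Zp p) \<bar>\<tau>p x\<bar> (Ap x)" unfolding d_def by (rule p(7)[OF xp])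
    show "half_arc (- 1) (\<lambda>p. d *\<^sub>R Zm p) \<bar>\<tau>m x\<bar> (Am x)" unfolding dm by (rule m(7)[OF xm])
    show "Ap x 0 = (x, 0) \<and> Ap x \<bar>\<tau>p x\<bar> = (\<phi>p x, 0)" by (rule p(8)[OF xp])
    show "Am x 0 = (x, 0) \<and> Am x \<bar>\<tau>m x\<bar> = (\<phi>m x, 0)" by (rule m(8)[OF xm])
    show "\<phi>p x < 0 \<and> - (2 * x) \<le> \<phi>p x \<and> on_real \<sigma>p (\<phi>p x) = - on_real \<sigma>p x" by (rule p(9)[OF xp])
    show "\<phi>m x < 0 \<and> - (2 * x) \<le> \<phi>m x \<and> on_real \<sigma>m (\<phi>m x) = - on_real \<sigma>m x" by (rule m(9)[OF xm])
    have "Kp * x \<le> K * x" "Km * x \<le> K * x" using x by (auto simp: K_def intro: mult_right_mono)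
    then show "\<bar>fst (Ap x u)\<bar> \<le> 2 * x \<and> \<bar>snd (Ap x u)\<bar> \<le> K * x" if "u \<in> {0..\<bar>\<tau>p x\<bar>}" for u
      using p(10)[OF xp that] by linarith
    show "\<bar>fst (Am x u)\<bar> \<le> 2 * x \<and> \<bar>snd (Am x u)\<bar> \<le> K * x" if "u \<in> {0..\<bar>\<tau>m x\<bar>}" for u
      using m(10)[OF xm that] \<open>Km * x \<le> K * x\<close> by linarith
  qed (use lip in auto)
  have "continuous_on {0<..<x\<^sub>0} \<phi>p" "continuous_on {0<..<x\<^sub>0} \<phi>m"
    unfolding \<phi>p_def \<phi>m_def
    using half_return_map_continuous[OF lip(1) \<tau>c(1) half(1)] half_return_map_continuous[OF lip(2) \<tau>c(2) half(2)] by auto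
  then have cont: "continuous_on {0<..<x\<^sub>0} (\<lambda>x. \<phi>p x - \<phi>m x)" by (intro continuous_intros)
  \<comment> \<open>The orientation sign enters \<open>mu_sign\<close> twice, and its square is
    1.\<close>
  have \<mu>: "\<mu> = - sgn (\<phi>p x\<^sub>1 - \<phi>m x\<^sub>1)"
    using assms(6) by (auto simp: mu_sign_def sigma_sign_def delta_sign_def \<phi>p_def \<phi>m_def sgn_mult)
  show ?thesis
  proof (rule unfolding_cycle_asymptotics[OF _ _ p(11) _ m(11)])
    show "\<mu> \<in> {-1, 1}" using \<phi>ne[OF assms(5)] by (auto simp: \<mu> sgn_if)
    show "2 / \<bar>Pp\<bar> > 0" "2 / \<bar>Pm\<bar> > 0" using P0 by simp_all
    fix x assume x: "0 < x" "x < r"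
    then have xI: "x \<in> {0<..<x\<^sub>0}" using r by auto
    have "\<mu> = - sgn (\<phi>p x - \<phi>m x)"
      unfolding \<mu> using sgn_constant[OF cont _ assms(5) xI] \<phi>ne by simp
    moreover have "\<phi>p x - \<phi>m x \<noteq> 0" using \<phi>ne[OF xI] by simp
    ultimately show "\<mu> * (\<phi>p x - \<phi>m x) < 0" by (auto simp: sgn_if)
  qed
qed

end
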